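(* Let $A$ be a basic $\mathbb{N}$-graded Gorenstein tiled order over $R=k[x]$ and $\Gamma=\Gamma_A$. (a) The following are equivalent: $\Gamma=0$; $A$ is hereditary; $A$ is conjugate to the tiled order of some size $n\ge1$ with exponent matrix $d(i,j)=1$ if $i>j$ and $d(i,j)=0$ if $i\le j$. (b) $\Gamma$ is isomorphic to $kA_1=k$ if and only if $A$ is conjugate to the tiled order of some even size $n\geq 2$ with exponent matrix given by $d(i,i)=0$ and, for $i\ne j$, $d(i,j)=1$ if $\lceil i/2\rceil\ge\lceil j/2\rceil$ and $d(i,j)=0$ otherwise (that is, $2\times 2$ diagonal blocks $\begin{bmatrix}0&1\\1&0\end{bmatrix}$, all entries above the diagonal blocks equal to $0$ and all entries below them equal to $1$). (c) $\Gamma$ is isomorphic to the path algebra $kA_2$ of the quiver $\bullet\to\bullet$ if and only if $A$ is conjugate to the tiled order of some size $n\ge2$ with exponent matrix given by $d(1,n)=2$; $d(i,j)=1$ if $i<j$ and $(i,j)\ne(1,n)$; $d(i,i)=0$; $d(i,i-1)=1$ for $2\le i\le n$; and $d(i,j)=0$ if $i\ge j+2$.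
   Context: Let $k$ be a field, $R=k[x]$, $K=k[x,x^{-1}]$, graded by $\deg x=1$. Modules are right modules. For a $\mathbb{Z}$-graded vector space $M$, $M(1)_n=M_{n+1}$ and $M_{\ge 0}=\bigoplus_{n\ge 0}M_n$. A tiled order (over $R$) of size $n\geq 1$ is an $R$-subalgebra $A=[Rx^{d(i,j)}]_{1\le i,j\le n}\subseteq \mathrm{M}_n(K)$ with integers $d(i,j)$ satisfying $d(i,i)=0$ and $d(i,l)+d(l,j)\ge d(i,j)$ for all $i,j,l$. The matrix $[d(i,j)]$ is its exponent matrix. $A$ is $\mathbb{Z}$-graded by $\mathrm{M}_n(K)_j=\mathrm{M}_n(k)x^j$; it is $\mathbb{N}$-graded iff all $d(i,j)\ge 0$, and basic iff $d(i,j)+d(j,i)>0$ for all $i\ne j$. Let $e_i$ be the diagonal matrix units and put $\mathbb{I}=\{1,\dots,n\}$. A basic tiled order is Gorenstein iff there is a (unique) bijection $\nu:\mathbb{I}\to\mathbb{I}$ (the Nakayama permutation) with $d(\nu i,j)+d(j,i)=d(\nu i,i)$ for all $i,j\in\mathbb{I}$. Put $p_i=1-d(\nu i,i)$. Two tiled orders of size $n$ with exponent matrices $d$, $d'$ are conjugate if they are conjugate by a product of a permutation matrix and a diagonal matrix $\mathrm{diag}(x^{l_1},\dots,x^{l_n})$, i.e. there are a permutation $\sigma$ and integers $l_i$ with $d'(\sigma i,\sigma j)=d(i,j)+l_i-l_j$ for all $i,j$. $\mathrm{CM}^{\mathbb{Z}}A$ is the Frobenius category of finitely generated graded $A$-modules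 that are projective over $R$, with degree-$0$ homomorphisms, and $\underline{\mathrm{CM}}^{\mathbb{Z}}A$ is its stable category (modulo maps factoring through graded projectives). For $A$ basic $\mathbb{N}$-graded Gorenstein put $V=[R\ \cdots\ R]\oplus\bigoplus_{i\in\mathbb{I}}\bigoplus_{j=1}^{-p_i}e_{\nu i}A(j)_{\ge 0}$ ($n$ entries in the row module $[R\ \cdots\ R]$; empty sums are zero) and $\Gamma_A=\mathrm{End}_{\underline{\mathrm{CM}}^{\mathbb{Z}}A}(V)$. *)

theory Defs
  imports
    "HOL-Library.Poly_Mapping"
    "HOL-Library.FuncSet"
    "HOL-Combinatorics.Permutations"
    "HOL-Algebra.QuotRing"
    "Jordan_Normal_Form.Matrix"
    "Graph_Theory.Arc_Walk"
begin

section \<open>Graded algebras and graded right modules\<close>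

text \<open>
  Algebras over a field are given by the record \<open>module\<close> of HOL-Algebra, which carries both a
  ring structure and a scalar multiplication. As for that record, the fields \<open>mult\<close> and \<open>one\<close>
  of a (right) module record have no meaning and are left undefined in the constructions below.
\<close>

record ('k, 'a) graded_algebra = "('k, 'a) module" +
  acomp :: "int \<Rightarrow> 'a set"

record ('a, 'm) rmod = "'m ring" +
  ract :: "'m \<Rightarrow> 'a \<Rightarrow> 'm"

record ('a, 'm) graded_rmod = "('a, 'm) rmod" +
  mcomp :: "int \<Rightarrow> 'm set"

locale right_module = ring A + M: abelian_group M
  for A :: "('a, 'c) ring_scheme" (structure) and M :: "('a, 'm, 'd) rmod_scheme" (structure) +
  assumes ract_closed: "\<lbrakk>m \<in> carrier M; a \<in> carrier A\<rbrakk> \<Longrightarrow> ract M m a \<in> carrier M"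
    and ract_add_left: "\<lbrakk>m \<in> carrier M; m' \<in> carrier M; a \<in> carrier A\<rbrakk> \<Longrightarrow>
          ract M (m \<oplus>\<^bsub>M\<^esub> m') a = ract M m a \<oplus>\<^bsub>M\<^esub> ract M m' a"
    and ract_add_right: "\<lbrakk>m \<in> carrier M; a \<in> carrier A; b \<in> carrier A\<rbrakk> \<Longrightarrow>
          ract M m (a \<oplus>\<^bsub>A\<^esub> b) = ract M m a \<oplus>\<^bsub>M\<^esub> ract M m b"
    and ract_mult: "\<lbrakk>m \<in> carrier M; a \<in> carrier A; b \<in> carrier A\<rbrakk> \<Longrightarrow>
          ract M m (a \<otimes>\<^bsub>A\<^esub> b) = ract M (ract M m a) b"
    and ract_one: "m \<in> carrier M \<Longrightarrow> ract M m \<one>\<^bsub>A\<^esub> = m"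

text \<open>
  The last assumption says that the module is the direct sum of its homogeneous components.
  Over an algebra \<open>A\<close> whose scalars lie in degree \<open>0\<close> these are automatically subspaces.
\<close>

locale graded_right_module = right_module A M
  for A :: "('k, 'a, 'c) graded_algebra_scheme" (structure)
    and M :: "('a, 'm, 'd) graded_rmod_scheme" (structure) +
  assumes mcomp_subgroup: "subgroup (mcomp M l) (add_monoid M)"
    and mcomp_act: "\<lbrakk>m \<in> mcomp M l; a \<in> acomp A j\<rbrakk> \<Longrightarrow> ract M m a \<in> mcomp M (l + j)"
    and mcomp_decomp: "m \<in> carrier M \<Longrightarrow>
          \<exists>!f. (\<forall>l. f l \<in> mcomp M l) \<and> finite {l. f l \<noteq> \<zero>\<^bsub>M\<^esub>} \<and>
               m = (\<Oplus>\<^bsub>M\<^esub>l\<in>{l. f l \<noteq> \<zero>\<^bsub>M\<^esub>}. f l)"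

definition rmod_hom ::
    "('a, 'c) ring_scheme \<Rightarrow> ('a, 'm, 'd) rmod_scheme \<Rightarrow> ('a, 'n, 'e) rmod_scheme \<Rightarrow> ('m \<Rightarrow> 'n) set"
  where "rmod_hom A M N = {f \<in> carrier M \<rightarrow>\<^sub>E carrier N.
    (\<forall>x\<in>carrier M. \<forall>y\<in>carrier M. f (x \<oplus>\<^bsub>M\<^esub> y) = f x \<oplus>\<^bsub>N\<^esub> f y) \<and>
    (\<forall>x\<in>carrier M. \<forall>a\<in>carrier A. f (ract M x a) = ract N (f x) a)}"

text \<open>Homomorphisms of degree \<open>0\<close>.\<close>

definition graded_hom ::
    "('a, 'c) ring_scheme \<Rightarrow> ('a, 'm, 'd) graded_rmod_scheme \<Rightarrow> ('a, 'n, 'e) graded_rmod_scheme \<Rightarrow>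
     ('m \<Rightarrow> 'n) set"
  where "graded_hom A M N = {f \<in> rmod_hom A M N. \<forall>l. f ` mcomp M l \<subseteq> mcomp N l}"

definition regular_rmod :: "('a, 'c) ring_scheme \<Rightarrow> ('a, 'a) rmod"
  where "regular_rmod A = \<lparr>carrier = carrier A, monoid.mult = undefined, one = undefined,
    zero = \<zero>\<^bsub>A\<^esub>, add = add A, ract = monoid.mult A\<rparr>"

definition graded_regular :: "('k, 'a, 'c) graded_algebra_scheme \<Rightarrow> ('a, 'a) graded_rmod"
  where "graded_regular A = \<lparr>carrier = carrier A, monoid.mult = undefined, one = undefined,
    zero = \<zero>\<^bsub>A\<^esub>, add = add A, ract = monoid.mult A, mcomp = acomp A\<rparr>"

text \<open>\<open>shift M j\<close> is \<open>M(j)\<close>.\<close>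

definition shift :: "('a, 'm) graded_rmod \<Rightarrow> int \<Rightarrow> ('a, 'm) graded_rmod"
  where "shift M j = M\<lparr>mcomp := \<lambda>l. mcomp M (l + j)\<rparr>"

definition trunc_nonneg :: "('a, 'm) graded_rmod \<Rightarrow> ('a, 'm) graded_rmod"
  where "trunc_nonneg M = M\<lparr>
    carrier := {m. \<exists>N. \<exists>f \<in> (\<Pi> l\<in>{0..N}. mcomp M l). m = (\<Oplus>\<^bsub>M\<^esub>l\<in>{0..N}. f l)},
    mcomp := \<lambda>l. if 0 \<le> l then mcomp M l else {\<zero>\<^bsub>M\<^esub>}\<rparr>"

text \<open>Direct sum over a finite index set.\<close>

definition graded_dsum :: "'i set \<Rightarrow> ('i \<Rightarrow> ('a, 'm) graded_rmod) \<Rightarrow> ('a, 'i \<Rightarrow> 'm) graded_rmod"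
  where "graded_dsum I F = \<lparr>carrier = (\<Pi>\<^sub>E i\<in>I. carrier (F i)),
    monoid.mult = undefined, one = undefined,
    zero = (\<lambda>i\<in>I. \<zero>\<^bsub>F i\<^esub>), add = (\<lambda>f g. \<lambda>i\<in>I. f i \<oplus>\<^bsub>F i\<^esub> g i),
    ract = (\<lambda>f a. \<lambda>i\<in>I. ract (F i) (f i) a),
    mcomp = (\<lambda>l. \<Pi>\<^sub>E i\<in>I. mcomp (F i) l)\<rparr>"

definition fin_gen :: "('a, 'c) ring_scheme \<Rightarrow> ('a, 'm, 'd) rmod_scheme \<Rightarrow> bool"
  where "fin_gen A M \<longleftrightarrow> (\<exists>S. finite S \<and> S \<subseteq> carrier M \<and>
    (\<forall>m\<in>carrier M. \<exists>c \<in> S \<rightarrow> carrier A. m = (\<Oplus>\<^bsub>M\<^esub>s\<in>S. ract M s (c s))))"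

definition free_rmod :: "('a, 'c) ring_scheme \<Rightarrow> 'i set \<Rightarrow> ('a, 'i \<Rightarrow> 'a) rmod"
  where "free_rmod A I = \<lparr>carrier = {f \<in> I \<rightarrow>\<^sub>E carrier A. finite {i \<in> I. f i \<noteq> \<zero>\<^bsub>A\<^esub>}},
    monoid.mult = undefined, one = undefined, zero = (\<lambda>i\<in>I. \<zero>\<^bsub>A\<^esub>),
    add = (\<lambda>f g. \<lambda>i\<in>I. f i \<oplus>\<^bsub>A\<^esub> g i), ract = (\<lambda>f a. \<lambda>i\<in>I. f i \<otimes>\<^bsub>A\<^esub> a)\<rparr>"

text \<open>
  A module is projective if it is a direct summand of a free module. A free module on a subset
  of \<open>M\<close> suffices, because \<open>M\<close> is a quotient of the free module on its own elements.
\<close>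

definition projective_rmod :: "('a, 'c) ring_scheme \<Rightarrow> ('a, 'm, 'd) rmod_scheme \<Rightarrow> bool"
  where "projective_rmod A M \<longleftrightarrow> right_module A M \<and>
    (\<exists>(I :: 'm set). \<exists>f \<in> rmod_hom A M (free_rmod A I). \<exists>g \<in> rmod_hom A (free_rmod A I) M.
       \<forall>m\<in>carrier M. g (f m) = m)"

text \<open>
  Finitely generated graded projective modules: direct summands, in the category of graded modules
  and degree \<open>0\<close> maps, of finite direct sums of shifts of \<open>A\<close>.
\<close>

definition graded_projective ::
    "('k, 'a, 'c) graded_algebra_scheme \<Rightarrow> ('a, 'm, 'd) graded_rmod_scheme \<Rightarrow> bool"
  where "graded_projective A P \<longleftrightarrow> graded_right_module A P \<and>
    (\<exists>(m :: nat) s. let F = graded_dsum {..<m} (\<lambda>i. shift (graded_regular A) (s i)) in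
       \<exists>f \<in> graded_hom A P F. \<exists>g \<in> graded_hom A F P. \<forall>p\<in>carrier P. g (f p) = p)"

definition opposite_ring :: "('a, 'c) ring_scheme \<Rightarrow> ('a, 'c) ring_scheme"
  where "opposite_ring A = A\<lparr>monoid.mult := \<lambda>a b. b \<otimes>\<^bsub>A\<^esub> a\<rparr>"

definition right_ideal :: "('a, 'c) ring_scheme \<Rightarrow> 'a set \<Rightarrow> bool"
  where "right_ideal A J \<longleftrightarrow> subgroup J (add_monoid A) \<and>
    (\<forall>x\<in>J. \<forall>a\<in>carrier A. x \<otimes>\<^bsub>A\<^esub> a \<in> J)"

definition right_hereditary :: "('a, 'c) ring_scheme \<Rightarrow> bool"
  where "right_hereditary A \<longleftrightarrow>
    (\<forall>J. right_ideal A J \<longrightarrow> projective_rmod A ((regular_rmod A)\<lparr>carrier := J\<rparr>))"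

definition hereditary :: "('a, 'c) ring_scheme \<Rightarrow> bool"
  where "hereditary A \<longleftrightarrow> right_hereditary A \<and> right_hereditary (opposite_ring A)"


section \<open>Quotients and isomorphisms of algebras, path algebras\<close>

definition quot_algebra :: "('k, 'e, 'c) module_scheme \<Rightarrow> 'e set \<Rightarrow> ('k, 'e set) module"
  where "quot_algebra E I = \<lparr>carrier = carrier (E Quot I), monoid.mult = monoid.mult (E Quot I),
    one = one (E Quot I), zero = zero (E Quot I), add = add (E Quot I),
    module.smult = (\<lambda>c X. \<Union>x\<in>X. I +>\<^bsub>E\<^esub> (c \<odot>\<^bsub>E\<^esub> x))\<rparr>"

definition algebra_iso :: "('k, 'a, 'c) module_scheme \<Rightarrow> ('k, 'b, 'd) module_scheme \<Rightarrow> bool"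
  where "algebra_iso A B \<longleftrightarrow>
    (\<exists>h \<in> ring_iso A B. \<forall>c. \<forall>a\<in>carrier A. h (c \<odot>\<^bsub>A\<^esub> a) = c \<odot>\<^bsub>B\<^esub> h a)"

text \<open>
  A path in a quiver is given by its start vertex and its list of arrows. The product of two basis
  paths is their concatenation, the left factor coming first, or zero.
\<close>

definition quiver_paths :: "('v, 'e) pre_digraph \<Rightarrow> ('v \<times> 'e list) set"
  where "quiver_paths Q = {(u, p). \<exists>v. pre_digraph.awalk Q u p v}"

definition path_algebra :: "('v, 'e) pre_digraph \<Rightarrow> ('k :: field, 'v \<times> 'e list \<Rightarrow> 'k) module"
  where "path_algebra Q = \<lparr>
    carrier = {f. finite {w. f w \<noteq> 0} \<and> {w. f w \<noteq> 0} \<subseteq> quiver_paths Q},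
    monoid.mult = (\<lambda>f g (u, p). \<Sum>i\<le>length p.
              f (u, take i p) * g (pre_digraph.awlast Q u (take i p), drop i p)),
    one = (\<lambda>(u, p). if u \<in> verts Q \<and> p = [] then 1 else 0),
    zero = (\<lambda>w. 0),
    add = (\<lambda>f g w. f w + g w),
    module.smult = (\<lambda>c f w. c * f w)\<rparr>"

text \<open>The linearly oriented quiver \<open>1 \<rightarrow> 2 \<rightarrow> \<cdots> \<rightarrow> m\<close> of type \<open>A\<^sub>m\<close>.\<close>

definition quiver_A :: "nat \<Rightarrow> (nat, nat) pre_digraph"
  where "quiver_A m = \<lparr>verts = {1..m}, arcs = {1..<m}, tail = id, head = Suc\<rparr>"


section \<open>Tiled orders\<close>

text \<open>
  \<open>K = k[x, x\<^sup>-\<^sup>1]\<close> is the group algebra of the integers, that is, finitely supported functions with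
  the convolution product; \<open>Poly_Mapping.single i c\<close> is \<open>c x\<^sup>i\<close>.
\<close>

type_synonym 'k laurent = "int \<Rightarrow>\<^sub>0 'k"

abbreviation lmonom :: "int \<Rightarrow> 'k :: field \<Rightarrow> 'k laurent"
  where "lmonom \<equiv> Poly_Mapping.single"

definition poly_part :: "'k :: field laurent set"
  where "poly_part = {f. Poly_Mapping.keys f \<subseteq> {0..}}"

definition poly_ring :: "'k :: field laurent ring"
  where "poly_ring = \<lparr>carrier = poly_part, monoid.mult = (*), one = 1, zero = 0, add = (+)\<rparr>"

definition homogeneous_mat :: "int \<Rightarrow> 'k :: field laurent mat \<Rightarrow> bool"
  where "homogeneous_mat l a \<longleftrightarrow> (\<forall>i<dim_row a. \<forall>j<dim_col a. \<exists>c. a $$ (i, j) = lmonom l c)"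

text \<open>
  Matrix indices start at \<open>0\<close>, so \<open>d i j\<close> is the exponent in row \<open>i + 1\<close> and column \<open>j + 1\<close> in the
  usual numbering. Only the values at indices below the size \<open>n\<close> are relevant.
\<close>

definition exponent_matrix :: "nat \<Rightarrow> (nat \<Rightarrow> nat \<Rightarrow> int) \<Rightarrow> bool"
  where "exponent_matrix n d \<longleftrightarrow> 1 \<le> n \<and> (\<forall>i<n. d i i = 0) \<and>
    (\<forall>i<n. \<forall>l<n. \<forall>j<n. d i l + d l j \<ge> d i j)"

definition tiled_order_carrier :: "nat \<Rightarrow> (nat \<Rightarrow> nat \<Rightarrow> int) \<Rightarrow> 'k :: field laurent mat set"
  where "tiled_order_carrier n d = {a \<in> carrier_mat n n.
    \<forall>i<n. \<forall>j<n. \<exists>r\<in>poly_part. a $$ (i, j) = r * lmonom (d i j) 1}"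

definition tiled_order ::
    "nat \<Rightarrow> (nat \<Rightarrow> nat \<Rightarrow> int) \<Rightarrow> ('k :: field, 'k laurent mat) graded_algebra"
  where "tiled_order n d = \<lparr>carrier = tiled_order_carrier n d,
    monoid.mult = (*), one = 1\<^sub>m n, zero = 0\<^sub>m n n, add = (+),
    module.smult = (\<lambda>c a. lmonom 0 c \<cdot>\<^sub>m a),
    acomp = (\<lambda>l. {a \<in> tiled_order_carrier n d. homogeneous_mat l a})\<rparr>"

definition N_graded :: "('k, 'a, 'c) graded_algebra_scheme \<Rightarrow> bool"
  where "N_graded A \<longleftrightarrow> (\<forall>l<0. acomp A l = {\<zero>\<^bsub>A\<^esub>})"

definition basic_order :: "nat \<Rightarrow> (nat \<Rightarrow> nat \<Rightarrow> int) \<Rightarrow> bool"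
  where "basic_order n d \<longleftrightarrow> (\<forall>i<n. \<forall>j<n. i \<noteq> j \<longrightarrow> d i j + d j i > 0)"

text \<open>\<open>permutes\<close> fixes the values outside the index set, so that the permutation is unique.\<close>

definition is_nakayama :: "nat \<Rightarrow> (nat \<Rightarrow> nat \<Rightarrow> int) \<Rightarrow> (nat \<Rightarrow> nat) \<Rightarrow> bool"
  where "is_nakayama n d \<nu> \<longleftrightarrow> \<nu> permutes {..<n} \<and>
    (\<forall>i<n. \<forall>j<n. d (\<nu> i) j + d j i = d (\<nu> i) i)"

definition gorenstein_order :: "nat \<Rightarrow> (nat \<Rightarrow> nat \<Rightarrow> int) \<Rightarrow> bool"
  where "gorenstein_order n d \<longleftrightarrow> (\<exists>\<nu>. is_nakayama n d \<nu>)"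

definition nakayama :: "nat \<Rightarrow> (nat \<Rightarrow> nat \<Rightarrow> int) \<Rightarrow> nat \<Rightarrow> nat"
  where "nakayama n d = (THE \<nu>. is_nakayama n d \<nu>)"

definition gor_param :: "nat \<Rightarrow> (nat \<Rightarrow> nat \<Rightarrow> int) \<Rightarrow> nat \<Rightarrow> int"
  where "gor_param n d i = 1 - d (nakayama n d i) i"

definition conjugate_orders ::
    "nat \<Rightarrow> (nat \<Rightarrow> nat \<Rightarrow> int) \<Rightarrow> nat \<Rightarrow> (nat \<Rightarrow> nat \<Rightarrow> int) \<Rightarrow> bool"
  where "conjugate_orders n d n' d' \<longleftrightarrow> n = n' \<and>
    (\<exists>\<sigma> (l :: nat \<Rightarrow> int). \<sigma> permutes {..<n} \<and>
      (\<forall>i<n. \<forall>j<n. d' (\<sigma> i) (\<sigma> j) = d i j + l i - l j))"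


section \<open>Graded Cohen-Macaulay modules and the algebra \<open>\<Gamma>\<^sub>A\<close>\<close>

text \<open>The \<open>R\<close>-module underlying a module over a tiled order of size \<open>n\<close>.\<close>

definition base_module ::
    "nat \<Rightarrow> ('k :: field laurent mat, 'm, 'd) rmod_scheme \<Rightarrow> ('k laurent, 'm) rmod"
  where "base_module n M = \<lparr>carrier = carrier M, monoid.mult = undefined, one = undefined,
    zero = \<zero>\<^bsub>M\<^esub>, add = add M, ract = (\<lambda>m r. ract M m (r \<cdot>\<^sub>m 1\<^sub>m n))\<rparr>"

definition graded_CM ::
    "nat \<Rightarrow> (nat \<Rightarrow> nat \<Rightarrow> int) \<Rightarrow> ('k :: field laurent mat, 'm, 'd) graded_rmod_scheme \<Rightarrow> bool"
  where "graded_CM n d M \<longleftrightarrow>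
    graded_right_module (tiled_order n d :: ('k, 'k laurent mat) graded_algebra) M \<and>
    fin_gen (tiled_order n d) M \<and> projective_rmod poly_ring (base_module n M)"

text \<open>
  Endomorphism algebra in the category of graded modules; a scalar \<open>c\<close> acts on a module
  through \<open>c \<cdot> 1 \<in> A\<close>.
\<close>

definition graded_End ::
    "('k, 'a, 'c) graded_algebra_scheme \<Rightarrow> ('a, 'm, 'd) graded_rmod_scheme \<Rightarrow> ('k, 'm \<Rightarrow> 'm) module"
  where "graded_End A M = \<lparr>carrier = graded_hom A M M, monoid.mult = compose (carrier M),
    one = (\<lambda>x\<in>carrier M. x), zero = (\<lambda>x\<in>carrier M. \<zero>\<^bsub>M\<^esub>),
    add = (\<lambda>f g. \<lambda>x\<in>carrier M. f x \<oplus>\<^bsub>M\<^esub> g x),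
    module.smult = (\<lambda>c f. \<lambda>x\<in>carrier M. ract M (f x) (c \<odot>\<^bsub>A\<^esub> \<one>\<^bsub>A\<^esub>))\<rparr>"

text \<open>
  The maps that factor through a graded projective object of the category. Fixing the element
  type of \<open>P\<close> is harmless: every finitely generated graded projective module is isomorphic to a
  submodule of a finite direct sum of shifts of \<open>A\<close>, whose elements have this type.
\<close>

definition projective_maps ::
    "nat \<Rightarrow> (nat \<Rightarrow> nat \<Rightarrow> int) \<Rightarrow> ('k :: field laurent mat, 'm) graded_rmod \<Rightarrow>
     ('k laurent mat, 'n) graded_rmod \<Rightarrow> ('m \<Rightarrow> 'n) set"
  where "projective_maps n d M N =
    (let A = tiled_order n d :: ('k, 'k laurent mat) graded_algebra in
     {f \<in> graded_hom A M N. \<exists>P :: ('k laurent mat, nat \<Rightarrow> 'k laurent mat) graded_rmod.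
        graded_CM n d P \<and> graded_projective A P \<and>
        (\<exists>g \<in> graded_hom A M P. \<exists>h \<in> graded_hom A P N. \<forall>x\<in>carrier M. f x = h (g x))})"

definition stable_End ::
    "nat \<Rightarrow> (nat \<Rightarrow> nat \<Rightarrow> int) \<Rightarrow> ('k :: field laurent mat, 'm) graded_rmod \<Rightarrow>
     ('k, ('m \<Rightarrow> 'm) set) module"
  where "stable_End n d M = quot_algebra (graded_End (tiled_order n d) M) (projective_maps n d M M)"

text \<open>
  A set \<open>S\<close> of \<open>r \<times> n\<close> matrices, viewed as a graded module over a tiled order of size \<open>n\<close> by matrix
  multiplication.
\<close>

definition mat_rmod ::
    "nat \<Rightarrow> nat \<Rightarrow> 'k :: field laurent mat set \<Rightarrow> ('k laurent mat, 'k laurent mat) graded_rmod"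
  where "mat_rmod r n S = \<lparr>carrier = S, monoid.mult = undefined, one = undefined,
    zero = 0\<^sub>m r n, add = (+), ract = (*), mcomp = (\<lambda>l. {a \<in> S. homogeneous_mat l a})\<rparr>"

text \<open>The row module \<open>[R \<cdots> R]\<close>.\<close>

definition row_module :: "nat \<Rightarrow> ('k :: field laurent mat, 'k laurent mat) graded_rmod"
  where "row_module n = mat_rmod 1 n {a \<in> carrier_mat 1 n. \<forall>j<n. a $$ (0, j) \<in> poly_part}"

definition mat_idem :: "nat \<Rightarrow> nat \<Rightarrow> 'k :: field laurent mat"
  where "mat_idem n i = mat n n (\<lambda>(r, c). if r = i \<and> c = i then 1 else 0)"

text \<open>The module \<open>e\<^sub>i A\<close>.\<close>

definition idem_module ::
    "nat \<Rightarrow> (nat \<Rightarrow> nat \<Rightarrow> int) \<Rightarrow> nat \<Rightarrow> ('k :: field laurent mat, 'k laurent mat) graded_rmod"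
  where "idem_module n d i = mat_rmod n n {mat_idem n i * a | a. a \<in> tiled_order_carrier n d}"

text \<open>
  The summands of \<open>V\<close> are indexed by \<open>None\<close> for the row module and by \<open>Some (i, j)\<close> for
  \<open>e\<^bsub>\<nu> i\<^esub> A(j)\<^bsub>\<ge> 0\<^esub>\<close> with \<open>1 \<le> j \<le> -p\<^sub>i\<close>.
\<close>

definition V_module ::
    "nat \<Rightarrow> (nat \<Rightarrow> nat \<Rightarrow> int) \<Rightarrow>
     ('k :: field laurent mat, (nat \<times> int) option \<Rightarrow> 'k laurent mat) graded_rmod"
  where "V_module n d =
    graded_dsum (insert None (Some ` (SIGMA i:{..<n}. {1..- gor_param n d i})))
      (\<lambda>s. case s of None \<Rightarrow> row_module n
         | Some (i, j) \<Rightarrow> trunc_nonneg (shift (idem_module n d (nakayama n d i)) j))"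

definition Gamma ::
    "nat \<Rightarrow> (nat \<Rightarrow> nat \<Rightarrow> int) \<Rightarrow>
     ('k :: field, (((nat \<times> int) option \<Rightarrow> 'k laurent mat) \<Rightarrow>
                    ((nat \<times> int) option \<Rightarrow> 'k laurent mat)) set) module"
  where "Gamma n d = stable_End n d (V_module n d)"


section \<open>The exponent matrices in the classification\<close>

definition exp_hereditary :: "nat \<Rightarrow> nat \<Rightarrow> int"
  where "exp_hereditary i j = (if i > j then 1 else 0)"

text \<open>With indices starting at \<open>0\<close>, the number of the \<open>2 \<times> 2\<close> diagonal block containing \<open>i\<close> is
  \<open>\<lceil>(i + 1) / 2\<rceil> = i div 2 + 1\<close>.\<close>

definition exp_A1 :: "nat \<Rightarrow> nat \<Rightarrow> int"
  where "exp_A1 i j = (if i = j then 0 else if i div 2 \<ge> j div 2 then 1 else 0)"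

definition exp_A2 :: "nat \<Rightarrow> nat \<Rightarrow> nat \<Rightarrow> int"
  where "exp_A2 n i j =
    (if i = 0 \<and> j = n - 1 then 2
     else if i < j then 1
     else if i = j then 0
     else if i = j + 1 then 1
     else 0)"

end

theory Submission
  imports Defs
begin

text \<open>
  The maps of degree \<open>0\<close> between graded lattices of rank one are scalars, so the endomorphism ring of
  \<open>V\<close>, which is a direct sum of such lattices, is a ring of matrices over \<open>k\<close> whose zero pattern is given
  by inclusions of lattices, and in the stable category one discards the entries with a projective
  lattice in between (\<open>hom_eq_lin\<close>, \<open>projective_maps_eq\<close>). Everything is thereby reduced to the
  exponent matrix.

  The key number is \<open>N = \<Sum>\<^sub>i d (\<nu> i) i - n + 1 = 1 - \<Sum>\<^sub>i p\<^sub>i\<close>. It counts the nonprojective summands of \<open>V\<close>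
  (\<open>card_V_nonproj\<close>). On the other hand, summing the Gorenstein identity shows that \<open>N\<close> is the average
  over \<open>i\<close> of \<open>\<Sum>\<^bsub>j \<noteq> i\<^esub> (d i j + d j i - 1)\<close>, the excess of \<open>i\<close> (\<open>sum_excess\<close>), so that it only depends on the conjugacy
  class. Small values of \<open>N\<close> are rigid: an index of excess \<open>0\<close> forces \<open>N \<le> 0\<close>, and one of excess \<open>1\<close> forces
  \<open>N \<le> 1\<close>. Hence for \<open>N \<le> 2\<close> every index has excess exactly \<open>N\<close>, and the order can be recovered.

  For \<open>N = 0\<close> the order is a chain, for \<open>N = 1\<close> a chain of incomparable pairs, and for \<open>N = 2\<close> the poset of graded
  indecomposable projectives is the ladder in which \<open>t \<le> u\<close> iff \<open>u = t\<close> or \<open>u \<ge> t + 2\<close>; these are the three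
  matrices of the theorem (\<open>nak_sum_hereditary\<close>, \<open>nak_sum_A1\<close>, \<open>nak_sum_A2\<close>). Conversely \<open>N\<close> is read off from
  the sum of the entries of these matrices. The filters of the ladder show that for \<open>N = 2\<close> the two
  nonprojective summands of \<open>V\<close> have stable maps in exactly one direction, so \<open>\<Gamma>\<close> is \<open>0\<close>, \<open>k\<close> or \<open>kA\<^sub>2\<close> for
  \<open>N = 0, 1, 2\<close>. For other values of \<open>N\<close> the number of orthogonal idempotents and noncommutativity exclude
  these algebras.

  Finally, \<open>A\<close> is hereditary iff all graded lattices of rank one are projective. If \<open>A\<close> is hereditary, a shift
  of such a lattice is a right ideal, and a splitting of it can be made homogeneous. Conversely, a right
  ideal is filtered by its rows; each row is a multiple of a graded lattice of rank one because
  \<open>k[x, x\<^sup>-\<^sup>1]\<close> is a principal ideal domain, so the filtration splits. Left ideals are treated by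
  transposition. For the conjugates of the hereditary matrix all lattices of rank one are projective,
  and this property in turn leaves no nonprojective summand in \<open>V\<close>.
\<close>

section \<open>Conjugation and the Nakayama permutation\<close>

lemma exponent_matrix_conj:
  assumes "exponent_matrix n d" 
  shows "exponent_matrix n (\<lambda>i j. d i j + l i - l j)"
  using assms unfolding exponent_matrix_def by (simp; smt (verit))

lemma is_nakayama_conj:
  assumes "is_nakayama n d \<nu>" 
  shows "is_nakayama n (\<lambda>i j. d i j + l i - l j) \<nu>"
  using assms unfolding is_nakayama_def by auto

text \<open>
  Lets an order be normalised by a diagonal matrix before a permutation is looked for.
\<close>

lemma conjugate_orders_shift:
  assumes "conjugate_orders n (\<lambda>i j. d i j + l i - l j) m e"
  shows "conjugate_orders n d m e"
proof -
  obtain \<sigma> l' where "m = n" "\<sigma> permutes {..<n}" "\<forall>i<n. \<forall>j<n. e (\<sigma> i) (\<sigma> j) = d i j + l i - l j + l' i - l' j"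
    using assms unfolding conjugate_orders_def by auto
  then show ?thesis unfolding conjugate_orders_def
    by (intro conjI exI[of _ \<sigma>] exI[of _ "\<lambda>i. l i + l' i"]) auto
qed

locale gorenstein_tiled =
  fixes n :: nat and d :: "nat \<Rightarrow> nat \<Rightarrow> int" and \<nu> :: "nat \<Rightarrow> nat"
  assumes exp: "exponent_matrix n d" and basic: "basic_order n d" and nak: "is_nakayama n d \<nu>"
begin

lemma n_pos: "n \<ge> 1" using exp by (simp add: exponent_matrix_def)
lemma d_diag [simp]: "i < n \<Longrightarrow> d i i = 0" using exp by (simp add: exponent_matrix_def)
lemma d_tri: "\<lbrakk>i < n; l < n; j < n\<rbrakk> \<Longrightarrow> d i j \<le> d i l + d l j"
  using exp by (simp add: exponent_matrix_def)
lemma d_sym_pos: "\<lbrakk>i < n; j < n; i \<noteq> j\<rbrakk> \<Longrightarrow> d i j + d j i \<ge> 1"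
  using basic by (force simp: basic_order_def)
lemma nu_permutes: "\<nu> permutes {..<n}" using nak by (simp add: is_nakayama_def)
lemma nu_less [simp]: "\<nu> i < n \<longleftrightarrow> i < n"
  using permutes_in_image[OF nu_permutes, of i] by simp
lemma nu_eq_iff [simp]: "\<nu> i = \<nu> j \<longleftrightarrow> i = j"
  using permutes_inj[OF nu_permutes] by (auto dest: injD)
lemma gor: "\<lbrakk>i < n; j < n\<rbrakk> \<Longrightarrow> d (\<nu> i) j + d j i = d (\<nu> i) i"
  using nak by (simp add: is_nakayama_def)
lemma nu_surj: assumes "m < n" obtains i where "i < n" "m = \<nu> i"
  using permutes_image[OF nu_permutes] assms by (metis imageE lessThan_iff)

text \<open>
  If \<open>\<nu>\<close> and \<open>\<mu>\<close> are Nakayama permutations, adding the two Gorenstein identities for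
  \<open>\<nu> i\<close> and \<open>\<mu> i\<close> gives \<open>d (\<nu> i) (\<mu> i) + d (\<mu> i) (\<nu> i) = 0\<close>, so they agree as the order is basic.
\<close>

lemma nakayama_eq: "nakayama n d = \<nu>"
  unfolding nakayama_def
proof (rule the_equality)
  show "is_nakayama n d \<nu>" by (rule nak)
next
  fix \<mu> assume mu: "is_nakayama n d \<mu>"
  then interpret M: gorenstein_tiled n d \<mu> using exp basic by unfold_locales
  show "\<mu> = \<nu>"
  proof
    fix i show "\<mu> i = \<nu> i"
    proof (cases "i < n")
      case True
      have "d (\<nu> i) (\<mu> i) + d (\<mu> i) i = d (\<nu> i) i" "d (\<mu> i) (\<nu> i) + d (\<nu> i) i = d (\<mu> i) i"
        using True gor M.gor by auto
      then have "d (\<nu> i) (\<mu> i) + d (\<mu> i) (\<nu> i) = 0" by linarith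
      then show ?thesis using d_sym_pos[of "\<nu> i" "\<mu> i"] True by force
    next
      case False
      then show ?thesis using nu_permutes M.nu_permutes by (simp add: permutes_def)
    qed
  qed
qed

text \<open>
  This is \<open>\<Sum>\<^sub>i (1 - p\<^sub>i)\<close>. By \<open>card_V_nonproj\<close> below, \<open>nak_sum - n + 1\<close> is the number of nonprojective
  summands of \<open>V\<close>; the whole classification is governed by this number.
\<close>

definition nak_sum :: int where "nak_sum = (\<Sum>i<n. d (\<nu> i) i)"

text \<open>
  The number of incomparable elements of an element in column \<open>i\<close> of the poset of graded points
  introduced below (lemma \<open>card_incomparable\<close>).
\<close>

definition excess :: "nat \<Rightarrow> int"
  where "excess i = (\<Sum>j\<in>{..<n} - {i}. d i j + d j i - 1)"

text \<open>
  Sum the Gorenstein identity over all pairs of indices; \<open>\<nu>\<close> permutes the rows.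
\<close>

lemma two_sum_d: "2 * (\<Sum>i<n. \<Sum>j<n. d i j) = int n * nak_sum"
proof -
  have "int n * nak_sum = (\<Sum>i<n. \<Sum>j<n. d (\<nu> i) j + d j i)"
    unfolding nak_sum_def sum_distrib_left by (rule sum.cong) (auto simp: gor)
  also have "\<dots> = (\<Sum>i<n. \<Sum>j<n. d (\<nu> i) j) + (\<Sum>i<n. \<Sum>j<n. d j i)"
    by (simp add: sum.distrib)
  also have "(\<Sum>i<n. \<Sum>j<n. d (\<nu> i) j) = (\<Sum>i<n. \<Sum>j<n. d i j)"
    using sum.permute[OF nu_permutes, of "\<lambda>i. \<Sum>j<n. d i j"] by (simp add: comp_def)
  also have "(\<Sum>i<n. \<Sum>j<n. d j i) = (\<Sum>i<n. \<Sum>j<n. d i j)" by (rule sum.swap)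
  finally show ?thesis by simp
qed

lemma excess_term_nonneg: "\<lbrakk>i < n; j \<in> {..<n} - {i}\<rbrakk> \<Longrightarrow> 0 \<le> d i j + d j i - 1"
  using d_sym_pos[of i j] by force

lemma excess_nonneg: "i < n \<Longrightarrow> 0 \<le> excess i"
  unfolding excess_def by (rule sum_nonneg) (rule excess_term_nonneg)

text \<open>
  The average excess of an index is therefore the number of nonprojective summands of \<open>V\<close>.
\<close>

lemma sum_excess: "(\<Sum>i<n. excess i) = int n * (nak_sum - int n + 1)"
proof -
  have "excess i = (\<Sum>j<n. d i j) + (\<Sum>j<n. d j i) - (int n - 1)" if "i < n" for i
  proof -
    have "(\<Sum>j<n. d i j + d j i - 1) = (d i i + d i i - 1) + excess i"
      unfolding excess_def using that by (intro sum.remove) auto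
    then show ?thesis using that by (simp add: sum.distrib sum_subtractf)
  qed
  then have "(\<Sum>i<n. excess i) = (\<Sum>i<n. (\<Sum>j<n. d i j) + (\<Sum>j<n. d j i) - (int n - 1))"
    by (intro sum.cong) auto
  also have "\<dots> = 2 * (\<Sum>i<n. \<Sum>j<n. d i j) - int n * (int n - 1)"
    by (simp add: sum.distrib sum_subtractf sum.swap[of "\<lambda>i j. d j i"])
  finally show ?thesis by (simp add: two_sum_d algebra_simps)
qed

lemma nak_sum_conj:
  "gorenstein_tiled.nak_sum n (\<lambda>i j. d i j + l i - l j) \<nu> = nak_sum"
proof -
  interpret C: gorenstein_tiled n "\<lambda>i j. d i j + l i - l j" \<nu>
    using exponent_matrix_conj[OF exp, of l] is_nakayama_conj[OF nak, of l] basic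
    by unfold_locales (auto simp: basic_order_def)
  have "(\<Sum>i<n. l (\<nu> i)) = (\<Sum>i<n. l i)"
    using sum.permute[OF nu_permutes, of l] by (simp add: comp_def)
  then show ?thesis
    unfolding C.nak_sum_def nak_sum_def by (simp add: sum.distrib sum_subtractf)
qed

lemma conj_gorenstein: "gorenstein_tiled n (\<lambda>i j. d i j + l i - l j) \<nu>"
    using exponent_matrix_conj[OF exp, of l] is_nakayama_conj[OF nak, of l] basic
    by unfold_locales (auto simp: basic_order_def)

text \<open>
  Conjugation does not change the sum of all entries, so the Nakayama sum can be read off any
  conjugate matrix. This gives the implications from the explicit matrices to \<open>\<Gamma>\<close>.
\<close>

lemma nak_sum_of_conj:
  assumes "conjugate_orders n d m e"
  shows "2 * (\<Sum>i<n. \<Sum>j<n. e i j) = int n * nak_sum"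
proof -
  obtain \<sigma> l where s: "m = n" "\<sigma> permutes {..<n}"
    and e: "\<forall>i<n. \<forall>j<n. e (\<sigma> i) (\<sigma> j) = d i j + l i - l j"
    using assms unfolding conjugate_orders_def by auto
  have "(\<Sum>i<n. \<Sum>j<n. e i j) = (\<Sum>i<n. \<Sum>j<n. e (\<sigma> i) (\<sigma> j))"
  proof -
    have "(\<Sum>i<n. \<Sum>j<n. e i j) = (\<Sum>i<n. \<Sum>j<n. e (\<sigma> i) j)"
      using sum.permute[OF s(2), of "\<lambda>i. \<Sum>j<n. e i j"] by (simp only: comp_def)
    moreover have "(\<Sum>j<n. e (\<sigma> i) j) = (\<Sum>j<n. e (\<sigma> i) (\<sigma> j))" for i
      using sum.permute[OF s(2), of "e (\<sigma> i)"] by (simp only: comp_def)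
    ultimately show ?thesis by simp
  qed
  also have "\<dots> = (\<Sum>i<n. \<Sum>j<n. d i j + l i - l j)" using e by simp
  also have "\<dots> = (\<Sum>i<n. \<Sum>j<n. d i j)"
    by (simp add: sum.distrib sum_subtractf sum_distrib_left)
  finally show ?thesis by (simp add: two_sum_d)
qed

text \<open>
  Conjugate so that row \<open>p\<close> is zero. Then every entry is at most \<open>d i p + d p j \<le> 1\<close>, and the term of
  \<open>nak_sum\<close> that lies in row \<open>p\<close> vanishes.
\<close>

lemma excess_zero_imp_small:
  assumes p: "p < n" "excess p = 0" shows "nak_sum \<le> int n - 1"
proof -
  let ?l = "\<lambda>i. d p i"
  let ?e = "\<lambda>i j. d i j + ?l i - ?l j"
  interpret C: gorenstein_tiled n ?e \<nu> by (rule conj_gorenstein)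
  have s: "d p j + d j p = 1" if "j < n" "j \<noteq> p" for j
    using p that excess_term_nonneg[OF p(1)] unfolding excess_def
    by (subst (asm) sum_nonneg_eq_0_iff) auto
  have le: "?e i j \<le> 1" if "i < n" "j < n" for i j
    using s[of i] d_tri[of i p j] that p(1) by (cases "i = p") (auto intro: order.trans)
  obtain i0 where i0: "i0 < n" "p = \<nu> i0" using nu_surj p(1) by blast
  have "nak_sum = C.nak_sum" by (simp add: nak_sum_conj)
  also have "\<dots> = ?e (\<nu> i0) i0 + (\<Sum>i\<in>{..<n}-{i0}. ?e (\<nu> i) i)"
    unfolding C.nak_sum_def using i0 by (intro sum.remove) auto
  also have "?e (\<nu> i0) i0 = 0" using i0 p(1) by auto
  also have "(\<Sum>i\<in>{..<n}-{i0}. ?e (\<nu> i) i) \<le> (\<Sum>i\<in>{..<n}-{i0}. 1)"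
    by (rule sum_mono) (use le in auto)
  finally show ?thesis using i0 by simp
qed

end

section \<open>An index of excess one\<close>

text \<open>
  The normal form at an index \<open>p\<close> whose only excess comes from \<open>q\<close>. The point of column \<open>p\<close> and degree
  \<open>0\<close> lies below all points of degree at least \<open>0\<close> and above all points of negative degree in the
  columns other than \<open>p\<close> and \<open>q\<close>, and its only incomparable point is the one of column \<open>q\<close> and degree \<open>0\<close>;
  whatever lies above (below) the latter in these columns also lies above (below) the former.
\<close>

definition cut_form :: "nat \<Rightarrow> (nat \<Rightarrow> nat \<Rightarrow> int) \<Rightarrow> nat \<Rightarrow> nat \<Rightarrow> bool"
  where "cut_form n e p q \<longleftrightarrow> e p q = 1 \<and> e q p = 1 \<and>
    (\<forall>j<n. j \<noteq> q \<longrightarrow> e p j = 0) \<and> (\<forall>j<n. j \<noteq> p \<longrightarrow> e j p = 1) \<and>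
    (\<forall>j<n. j \<noteq> p \<and> j \<noteq> q \<longrightarrow> e q j \<ge> 0 \<and> e j q \<ge> 1)"

lemma ex_cut_form:
  assumes ex: "exponent_matrix n d" and p: "p < n" "q < n" "p \<noteq> q"
    and pq: "d p q + d q p = 2" and pj: "\<And>j. \<lbrakk>j < n; j \<noteq> p; j \<noteq> q\<rbrakk> \<Longrightarrow> d p j + d j p = 1"
  shows "\<exists>l. cut_form n (\<lambda>i j. d i j + l i - l j) p q"
proof
  define l where "l = (\<lambda>i. if i = q then d p q - 1 else d p i)"
  have tri: "\<And>i j m. \<lbrakk>i < n; j < n; m < n\<rbrakk> \<Longrightarrow> d i j \<le> d i m + d m j" and dg: "\<And>i. i < n \<Longrightarrow> d i i = 0"
    using ex by (auto simp: exponent_matrix_def)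
  have "d p q + l p - l q = 1" "d q p + l q - l p = 1" using p pq dg by (auto simp: l_def)
  moreover have "d p j + l p - l j = 0" if "j < n" "j \<noteq> q" for j using p that dg by (auto simp: l_def)
  moreover have "d j p + l j - l p = 1" if "j < n" "j \<noteq> p" for j using p that dg pj[of j] pq by (auto simp: l_def)
  moreover have "d q j + l q - l j \<ge> 0" if "j < n" "j \<noteq> p" "j \<noteq> q" for j
    using p that dg pj[of j] pq tri[of q p j] by (auto simp: l_def)
  moreover have "d j q + l j - l q \<ge> 1" if "j < n" "j \<noteq> p" "j \<noteq> q" for j
    using p that dg pj[of j] pq tri[of p q j] by (auto simp: l_def)
  ultimately show "cut_form n (\<lambda>i j. d i j + l i - l j) p q" unfolding cut_form_def by blast
qed

context gorenstein_tiled begin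

lemma excess_one_partner:
  assumes p: "p < n" "excess p = 1"
  obtains q where "q < n" "q \<noteq> p" "d p q + d q p = 2"
    "\<And>j. \<lbrakk>j < n; j \<noteq> p; j \<noteq> q\<rbrakk> \<Longrightarrow> d p j + d j p = 1"
proof -
  let ?f = "\<lambda>j. d p j + d j p - 1"
  have "\<exists>q\<in>{..<n}-{p}. ?f q \<noteq> 0"
    using p(2) unfolding excess_def by (metis (mono_tags, lifting) sum.neutral zero_neq_one)
  then obtain q where q: "q \<in> {..<n}-{p}" "?f q \<noteq> 0" by blast
  then have q1: "?f q \<ge> 1" using excess_term_nonneg[OF p(1) q(1)] by linarith
  have eq: "1 = ?f q + (\<Sum>j\<in>{..<n}-{p}-{q}. ?f j)"
    using p(2) q unfolding excess_def by (subst sum.remove[symmetric]) auto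
  have nn: "(\<Sum>j\<in>{..<n}-{p}-{q}. ?f j) \<ge> 0"
    by (rule sum_nonneg) (use excess_term_nonneg[OF p(1)] in auto)
  have z: "(\<Sum>j\<in>{..<n}-{p}-{q}. ?f j) = 0" using eq nn q1 by linarith
  then have "\<forall>j\<in>{..<n}-{p}-{q}. ?f j = 0"
    using excess_term_nonneg[OF p(1)] by (subst (asm) sum_nonneg_eq_0_iff) auto
  then show ?thesis using that[of q] q eq z by auto
qed

text \<open>
  In the normal form, entries outside column \<open>q\<close> are at most \<open>1\<close>. The Gorenstein identity forces
  \<open>\<nu> q = p\<close>, so column \<open>q\<close> also contributes at most \<open>1\<close> to \<open>nak_sum\<close>.
\<close>

lemma excess_one_imp_small:
  assumes p: "p < n" "excess p = 1" shows "nak_sum \<le> int n"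
proof -
  obtain q where q: "q < n" "q \<noteq> p" "d p q + d q p = 2"
    "\<And>j. \<lbrakk>j < n; j \<noteq> p; j \<noteq> q\<rbrakk> \<Longrightarrow> d p j + d j p = 1" using excess_one_partner[OF p] by blast
  from ex_cut_form[OF exp p(1) q(1) q(2)[symmetric] q(3,4)]
  obtain l where cf: "cut_form n (\<lambda>i j. d i j + l i - l j) p q" ..
  let ?e = "\<lambda>i j. d i j + l i - l j"
  interpret C: gorenstein_tiled n ?e \<nu> by (rule conj_gorenstein)
  have l: "?e p q = 1" "?e q p = 1" "\<And>j. \<lbrakk>j < n; j \<noteq> q\<rbrakk> \<Longrightarrow> ?e p j = 0"
    "\<And>j. \<lbrakk>j < n; j \<noteq> p\<rbrakk> \<Longrightarrow> ?e j p = 1" "\<And>j. \<lbrakk>j < n; j \<noteq> p; j \<noteq> q\<rbrakk> \<Longrightarrow> ?e q j \<ge> 0"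
    using cf unfolding cut_form_def by blast+
  have le: "?e i j \<le> 1" if "i < n" "j < n" "j \<noteq> q" for i j
  proof (cases "i = p")
    case True
    then show ?thesis using l(3)[OF that(2,3)] by simp
  next
    case False
    then show ?thesis using C.d_tri[OF that(1) p(1) that(2)] l(3)[OF that(2,3)] l(4)[OF that(1) False] by linarith
  qed
  have "\<nu> q = p"
  proof -
    obtain i where i: "i < n" "p = \<nu> i" using nu_surj p(1) by blast
    have g: "?e p q + ?e q i = ?e p i" using C.gor[of i q] i q by simp
    show ?thesis
    proof (rule ccontr)
      assume "\<nu> q \<noteq> p"
      then have "i \<noteq> q" using i by auto
      show False
      proof (cases "i = p")
        case True
        show False using g l(1,2) p(1) unfolding True by simp
      next
        case False
        then show False using g l(1) l(3)[OF i(1) \<open>i \<noteq> q\<close>] l(5)[OF i(1) False \<open>i \<noteq> q\<close>] by linarith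
      qed
    qed
  qed
  then have le': "?e (\<nu> i) i \<le> 1" if "i < n" for i 
  proof (cases "i = q")
    case True
    then show ?thesis using l(1) \<open>\<nu> q = p\<close> by simp
  next
    case False
    then show ?thesis using le[OF _ that False, of "\<nu> i"] that by simp
  qed
  have "nak_sum = C.nak_sum" by (simp add: nak_sum_conj)
  also have "\<dots> \<le> (\<Sum>i<n. 1)" unfolding C.nak_sum_def by (rule sum_mono) (use le' in auto)
  finally show ?thesis by simp
qed

end

section \<open>Orders without excess\<close>

lemma inj_self_map_permutes:
  fixes \<sigma> :: "nat \<Rightarrow> nat"
  assumes "inj_on \<sigma> {..<n}" "\<And>i. i < n \<Longrightarrow> \<sigma> i < n" "\<And>i. \<not> i < n \<Longrightarrow> \<sigma> i = i"
  shows "\<sigma> permutes {..<n}"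
proof (rule bij_imp_permutes)
  show "bij_betw \<sigma> {..<n} {..<n}"
    unfolding bij_betw_def using assms by (intro conjI endo_inj_surj) auto
qed (use assms in auto)

text \<open>
  The permutation sends an element to the number of its predecessors.
\<close>

lemma permutation_of_strict_total_order:
  fixes lt :: "nat \<Rightarrow> nat \<Rightarrow> bool"
  assumes irr: "\<And>i. i < n \<Longrightarrow> \<not> lt i i"
    and tr: "\<And>i j k. \<lbrakk>i < n; j < n; k < n; lt i j; lt j k\<rbrakk> \<Longrightarrow> lt i k"
    and tot: "\<And>i j. \<lbrakk>i < n; j < n; i \<noteq> j\<rbrakk> \<Longrightarrow> lt i j \<or> lt j i"
  shows "\<exists>\<sigma>. \<sigma> permutes {..<n} \<and> (\<forall>i<n. \<forall>j<n. \<sigma> i < \<sigma> j \<longleftrightarrow> lt i j)"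
proof -
  define \<sigma> where "\<sigma> i = (if i < n then card {k. k < n \<and> lt k i} else i)" for i
  have mono: "\<sigma> i < \<sigma> j" if "i < n" "j < n" "lt i j" for i j
  proof -
    have "{k. k < n \<and> lt k i} \<subset> {k. k < n \<and> lt k j}" using that irr[of i] tr by blast
    then show ?thesis using that by (simp add: \<sigma>_def psubset_card_mono)
  qed
  have iff: "\<sigma> i < \<sigma> j \<longleftrightarrow> lt i j" if "i < n" "j < n" for i j
    using mono[of i j] mono[of j i] tot[of i j] that by (metis less_asym less_irrefl)
  have "\<sigma> i < n" if "i < n" for i
  proof -
    have "{k. k < n \<and> lt k i} \<subset> {..<n}" using irr that by blast
    then have "card {k. k < n \<and> lt k i} < card {..<n}" by (rule psubset_card_mono[rotated]) simp
    then show ?thesis using that by (simp add: \<sigma>_def)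
  qed
  moreover have "inj_on \<sigma> {..<n}"
    by (rule inj_onI) (metis iff lessThan_iff less_irrefl tot)
  ultimately have "\<sigma> permutes {..<n}" by (intro inj_self_map_permutes) (auto simp: \<sigma>_def)
  then show ?thesis using iff by blast
qed

text \<open>
  Normalise row \<open>0\<close> to zero. All entries become \<open>0\<close> or \<open>1\<close>, and \<open>?e i j = 0\<close> is a total order;
  sorting the indices by it produces the hereditary matrix.
\<close>

lemma conjugate_hereditary:
  assumes ex: "exponent_matrix n d"
    and one: "\<And>i j. \<lbrakk>i < n; j < n; i \<noteq> j\<rbrakk> \<Longrightarrow> d i j + d j i = 1"
  shows "conjugate_orders n d n exp_hereditary"
proof (rule conjugate_orders_shift)
  let ?e = "\<lambda>i j. d i j + d 0 i - d 0 j"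
  have n: "0 < n" and tri: "\<And>i j m. \<lbrakk>i < n; j < n; m < n\<rbrakk> \<Longrightarrow> d i j \<le> d i m + d m j"
    and dg: "\<And>i. i < n \<Longrightarrow> d i i = 0" using ex by (auto simp: exponent_matrix_def)
  have zo: "?e i j = 0 \<or> ?e i j = 1" if "i < n" "j < n" for i j
  proof -
    have "d 0 j \<le> d 0 i + d i j" "d 0 i \<le> d 0 j + d j i" using tri n that by auto
    then show ?thesis using one[of i j] dg[of i] that by (cases "i = j") force+
  qed
  define lt where "lt i j \<longleftrightarrow> i \<noteq> j \<and> ?e i j = 0" for i j
  have lt_sym: "lt i j \<longleftrightarrow> i \<noteq> j \<and> ?e j i = 1" if "i < n" "j < n" for i j
    using one[of i j] that by (auto simp: lt_def)
  have tr: "lt i k" if "i < n" "j < n" "k < n" "lt i j" "lt j k" for i j k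
  proof -
    have "i \<noteq> k" using that lt_sym[of j k] by (auto simp: lt_def)
    moreover have "?e i k = 0" using that tri[of i k j] zo[of i k] by (auto simp: lt_def)
    ultimately show ?thesis by (simp add: lt_def)
  qed
  have tot: "lt i j \<or> lt j i" if "i < n" "j < n" "i \<noteq> j" for i j
    using lt_sym[of j i] zo[of i j] that by (auto simp: lt_def)
  have irr: "\<not> lt i i" if "i < n" for i by (simp add: lt_def)
  obtain \<sigma> where \<sigma>: "\<sigma> permutes {..<n}" "\<And>i j. \<lbrakk>i < n; j < n\<rbrakk> \<Longrightarrow> \<sigma> i < \<sigma> j \<longleftrightarrow> lt i j"
  proof -
    have "\<exists>\<sigma>. \<sigma> permutes {..<n} \<and> (\<forall>i<n. \<forall>j<n. \<sigma> i < \<sigma> j \<longleftrightarrow> lt i j)"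
      by (rule permutation_of_strict_total_order, fact irr, fact tr, fact tot)
    then show ?thesis using that by blast
  qed
  have "exp_hereditary (\<sigma> i) (\<sigma> j) = ?e i j" if "i < n" "j < n" for i j
    using \<sigma>(2)[of j i] lt_sym[of j i] zo[of i j] that dg[of i] by (auto simp: exp_hereditary_def)
  then show "conjugate_orders n ?e n exp_hereditary"
    unfolding conjugate_orders_def using \<sigma>(1) by (intro conjI exI[of _ \<sigma>] exI[of _ "\<lambda>_. 0"]) auto
qed

lemma (in gorenstein_tiled) nak_sum_hereditary:
  assumes "nak_sum = int n - 1" shows "conjugate_orders n d n exp_hereditary"
proof (rule conjugate_hereditary[OF exp])
  have "(\<Sum>i<n. excess i) = 0" using assms by (simp add: sum_excess)
  then have z: "excess i = 0" if "i < n" for i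
    using that excess_nonneg by (subst (asm) sum_nonneg_eq_0_iff) auto
  show "d i j + d j i = 1" if "i < n" "j < n" "i \<noteq> j" for i j
    using z[OF that(1)] that excess_term_nonneg[OF that(1)] unfolding excess_def
    by (subst (asm) sum_nonneg_eq_0_iff) auto
qed

section \<open>Orders with excess one\<close>

context gorenstein_tiled begin

text \<open>
  The excesses have average one, and none of them vanishes by \<open>excess_zero_imp_small\<close>.
\<close>

lemma excess_all_one:
  assumes T: "nak_sum = int n" and i: "i < n" shows "excess i = 1"
proof -
  have ge: "excess j \<ge> 1" if "j < n" for j
    using excess_nonneg[OF that] excess_zero_imp_small[OF that] T by linarith
  have "(\<Sum>j<n. excess j - 1) = 0" using T by (simp add: sum_subtractf sum_excess)
  then have "excess i - 1 = 0" using i by (subst (asm) sum_nonneg_eq_0_iff) (use ge in force)+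
  then show ?thesis by simp
qed

lemma ex_partner_involution:
  assumes T: "nak_sum = int n"
  obtains \<tau> where "\<And>i. i < n \<Longrightarrow> \<tau> i < n" "\<And>i. i < n \<Longrightarrow> \<tau> i \<noteq> i" "\<And>i. i < n \<Longrightarrow> \<tau> (\<tau> i) = i"
    "\<And>i. i < n \<Longrightarrow> d i (\<tau> i) + d (\<tau> i) i = 2"
    "\<And>i j. \<lbrakk>i < n; j < n; j \<noteq> i; j \<noteq> \<tau> i\<rbrakk> \<Longrightarrow> d i j + d j i = 1"
proof -
  have "\<exists>q. p < n \<longrightarrow> q < n \<and> q \<noteq> p \<and> d p q + d q p = 2 \<and> 
    (\<forall>j<n. j \<noteq> p \<and> j \<noteq> q \<longrightarrow> d p j + d j p = 1)" for p
    using excess_one_partner[of p] excess_all_one[OF T, of p] by metis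
  then obtain \<tau> where t: "\<And>p. p < n \<Longrightarrow> \<tau> p < n \<and> \<tau> p \<noteq> p \<and> d p (\<tau> p) + d (\<tau> p) p = 2 \<and> 
    (\<forall>j<n. j \<noteq> p \<and> j \<noteq> \<tau> p \<longrightarrow> d p j + d j p = 1)" by metis
  have "\<tau> (\<tau> i) = i" if "i < n" for i
  proof (rule ccontr)
    assume "\<tau> (\<tau> i) \<noteq> i"
    then have "d (\<tau> i) i + d i (\<tau> i) = 1" using t[OF that] t[of "\<tau> i"] that by metis
    then show False using t[OF that] by linarith
  qed
  then show ?thesis using that[of \<tau>] t by blast
qed

text \<open>
  Every index \<open>i\<close> has a unique partner \<open>\<tau> i\<close> with \<open>d i (\<tau> i) + d (\<tau> i) i = 2\<close>. After normalising at one pair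
  the matrix has entries \<open>0\<close> and \<open>1\<close>, and the relation \<open>d i j = 0\<close> is a total order of the pairs.
  An index is sent to twice the rank of its pair, plus one for the larger partner.
\<close>

lemma nak_sum_A1:
  assumes T: "nak_sum = int n" shows "even n \<and> n \<ge> 2 \<and> conjugate_orders n d n exp_A1"
proof -
  obtain \<tau> where t: "\<And>i. i < n \<Longrightarrow> \<tau> i < n" "\<And>i. i < n \<Longrightarrow> \<tau> i \<noteq> i" "\<And>i. i < n \<Longrightarrow> \<tau> (\<tau> i) = i"
    and two: "\<And>i. i < n \<Longrightarrow> d i (\<tau> i) + d (\<tau> i) i = 2"
    and one: "\<And>i j. \<lbrakk>i < n; j < n; j \<noteq> i; j \<noteq> \<tau> i\<rbrakk> \<Longrightarrow> d i j + d j i = 1"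
    using ex_partner_involution[OF T] by blast
  define q where "q = \<tau> 0"
  have n0: "0 < n" using n_pos by simp
  have q: "q < n" "q \<noteq> 0" using t n0 by (auto simp: q_def)
  from ex_cut_form[OF exp n0 q(1) q(2)[symmetric]] two[OF n0] one[OF n0]
  have "\<exists>l. cut_form n (\<lambda>i j. d i j + l i - l j) 0 q" unfolding q_def by blast
  then obtain l where cf: "cut_form n (\<lambda>i j. d i j + l i - l j) 0 q" ..
  define e where "e = (\<lambda>i j. d i j + l i - l j)"
  interpret C: gorenstein_tiled n e \<nu> unfolding e_def by (rule conj_gorenstein)
  have two: "e i (\<tau> i) + e (\<tau> i) i = 2" if "i < n" for i using two[OF that] by (simp add: e_def)
  have one: "e i j + e j i = 1" if "i < n" "j < n" "j \<noteq> i" "j \<noteq> \<tau> i" for i j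
    using one[OF that] by (simp add: e_def)
  have c: "e 0 q = 1" "e q 0 = 1" "\<And>j. \<lbrakk>j < n; j \<noteq> q\<rbrakk> \<Longrightarrow> e 0 j = 0" "\<And>j. \<lbrakk>j < n; j \<noteq> 0\<rbrakk> \<Longrightarrow> e j 0 = 1"
    "\<And>j. \<lbrakk>j < n; j \<noteq> 0; j \<noteq> q\<rbrakk> \<Longrightarrow> e q j \<ge> 0" "\<And>j. \<lbrakk>j < n; j \<noteq> 0; j \<noteq> q\<rbrakk> \<Longrightarrow> e j q \<ge> 1"
    using cf unfolding cut_form_def e_def[symmetric] by blast+
  have tq: "\<tau> q = 0" using t n0 by (simp add: q_def)
  have cq: "e j q = 1" "e q j = 0" if "j < n" "j \<noteq> 0" "j \<noteq> q" for j
    using c(5)[OF that] c(6)[OF that] one[of q j] q that tq by auto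
  have nonneg: "e i j \<ge> 0" if "i < n" "j < n" for i j
  proof (cases "i = 0 \<or> i = q \<or> i = j")
    case True
    then show ?thesis using c cq that by (metis C.d_diag le_less zero_le_one)
  next
    case False
    then have "e 0 j \<le> 0 + e i j" using C.d_tri[of 0 i j] c(3)[of i] that by simp
    moreover have "e 0 j \<ge> 0" using c that by (cases "j = q") auto
    ultimately show ?thesis by simp
  qed
  have le1: "e i j \<le> 1" if "i < n" "j < n" for i j
  proof (cases "j = q")
    case True
    then show ?thesis using c cq that q by (metis C.d_diag order_refl zero_le_one)
  next
    case False
    then have "e i j \<le> e i 0 + 0" using C.d_tri[of i 0 j] c(3)[of j] that n0 by simp
    moreover have "e i 0 \<le> 1" using c(4)[of i] that by (cases "i = 0") auto
    ultimately show ?thesis by simp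
  qed
  have zo: "e i j = 0 \<or> e i j = 1" if "i < n" "j < n" for i j
    using nonneg[OF that] le1[OF that] by linarith
  have etau: "e i (\<tau> i) = 1" "e (\<tau> i) i = 1" if "i < n" for i
    using two[OF that] le1[of i "\<tau> i"] le1[of "\<tau> i" i] t that by auto
  define lt where "lt i j \<longleftrightarrow> i \<noteq> j \<and> e i j = 0" for i j
  have lt_e: "e j i = 1" if "i < n" "j < n" "lt i j" for i j
    using that zo[of j i] C.d_sym_pos[of i j] by (auto simp: lt_def)
  have ltau: "\<not> lt i (\<tau> i)" "\<not> lt (\<tau> i) i" if "i < n" for i using etau[OF that] by (auto simp: lt_def)
  have tot: "i = j \<or> j = \<tau> i \<or> lt i j \<or> lt j i" if "i < n" "j < n" for i j
    using one[of i j] zo[of i j] that by (auto simp: lt_def)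
  have tr: "lt i k" if "i < n" "j < n" "k < n" "lt i j" "lt j k" for i j k
  proof -
    have "i \<noteq> k" using that lt_e[of j k] by (auto simp: lt_def)
    moreover have "e i k = 0" using that C.d_tri[of i j k] zo[of i k] by (auto simp: lt_def)
    ultimately show ?thesis by (simp add: lt_def)
  qed
  have asym: "\<not> lt j i" if "i < n" "j < n" "lt i j" for i j
    using lt_e[OF that] by (simp add: lt_def)
  have lt_tau1: "lt (\<tau> i) j" if "i < n" "j < n" "lt i j" for i j
    using tot[of "\<tau> i" j] tr[of i j "\<tau> i"] ltau t that by (metis lt_def)
  have lt_tau2: "lt i (\<tau> j)" if "i < n" "j < n" "lt i j" for i j
    using tot[of "\<tau> j" i] tr[of "\<tau> j" i j] ltau t that by (metis lt_def)
  (* One representative of each pair: the smaller partner. *)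
  define Rp where "Rp = {i. i < n \<and> i < \<tau> i}"
  have finR: "finite Rp" by (simp add: Rp_def)
  define rk where "rk i = card {k\<in>Rp. lt k i}" for i
  have rep: "\<exists>k\<in>Rp. k = i \<or> k = \<tau> i" if "i < n" for i
    using t that unfolding Rp_def by (cases "i < \<tau> i") (force simp: not_less le_less)+
  have rk_mono: "rk i < rk j" if "i < n" "j < n" "lt i j" for i j
  proof -
    obtain k where k: "k \<in> Rp" "k = i \<or> k = \<tau> i" using rep[OF \<open>i < n\<close>] by blast
    have "{k\<in>Rp. lt k i} \<subseteq> {k\<in>Rp. lt k j}" using tr[OF _ that(1,2) _ that(3)] by (auto simp: Rp_def)
    moreover have "lt k j" "\<not> lt k i"
      using k that(3) lt_tau1[OF that] ltau[OF that(1)] by (auto simp: lt_def)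
    ultimately have "{k\<in>Rp. lt k i} \<subset> {k\<in>Rp. lt k j}" using k by blast
    then show ?thesis unfolding rk_def using finR by (intro psubset_card_mono) auto
  qed
  have rk_tau: "rk (\<tau> i) = rk i" if "i < n" for i
  proof -
    have "lt k (\<tau> i) \<longleftrightarrow> lt k i" if "k < n" for k
      using lt_tau2[of k i] lt_tau2[of k "\<tau> i"] t[OF \<open>i < n\<close>] \<open>i < n\<close> that by metis
    then have "{k\<in>Rp. lt k (\<tau> i)} = {k\<in>Rp. lt k i}" unfolding Rp_def by auto
    then show ?thesis by (simp add: rk_def)
  qed
  have rk_iff: "rk i < rk j \<longleftrightarrow> lt i j" if "i < n" "j < n" for i j
    using tot[OF that] rk_mono[of i j] rk_mono[of j i] rk_tau that by (metis less_asym less_irrefl)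
  have nR: "n = 2 * card Rp"
  proof -
    have "{..<n} = Rp \<union> \<tau> ` Rp"
    proof
      show "{..<n} \<subseteq> Rp \<union> \<tau> ` Rp"
      proof
        fix i assume "i \<in> {..<n}"
        then have "i < n" by simp
        obtain k where k: "k \<in> Rp" "k = i \<or> k = \<tau> i" using rep[OF \<open>i < n\<close>] by blast
        then have "i = k \<or> i = \<tau> k" using t(3)[OF \<open>i < n\<close>] by auto
        then show "i \<in> Rp \<union> \<tau> ` Rp" using k(1) by blast
      qed
    qed (auto simp: Rp_def t)
    moreover have "Rp \<inter> \<tau> ` Rp = {}" by (auto simp: Rp_def t)
    moreover have "card (\<tau> ` Rp) = card Rp" by (rule card_image) (metis (no_types, lifting) Rp_def inj_onI mem_Collect_eq t(3))
    ultimately show ?thesis using card_Un_disjoint[of Rp "\<tau> ` Rp"] finR by (metis card_lessThan finite_imageI mult_2)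
  qed
  have rk_less: "rk i < card Rp" if "i < n" for i
  proof -
    obtain k where k: "k \<in> Rp" "k = i \<or> k = \<tau> i" using rep[OF \<open>i < n\<close>] by blast
    then have "\<not> lt k i" using ltau[OF that] by (auto simp: lt_def)
    then show ?thesis unfolding rk_def using k finR by (intro psubset_card_mono) auto
  qed
  define \<sigma> where "\<sigma> i = (if i < n then 2 * rk i + (if \<tau> i < i then 1 else 0) else i)" for i
  have div2: "\<sigma> i div 2 = rk i" if "i < n" for i using that by (simp add: \<sigma>_def)
  have \<sigma>_eq: "i = j" if "i < n" "j < n" "\<sigma> i = \<sigma> j" for i j
  proof -
    have "rk i = rk j" using that div2 by metis
    moreover from this have "\<tau> i < i \<longleftrightarrow> \<tau> j < j" using that by (auto simp: \<sigma>_def split: if_splits)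
    ultimately show ?thesis using tot[of i j] rk_iff t that
      by (metis less_asym less_irrefl linorder_neqE_nat)
  qed
  have "\<sigma> permutes {..<n}"
  proof (rule inj_self_map_permutes)
    show "inj_on \<sigma> {..<n}" using \<sigma>_eq by (auto intro: inj_onI)
    show "\<sigma> i < n" if "i < n" for i using rk_less[OF that] nR that by (auto simp: \<sigma>_def)
  qed (simp add: \<sigma>_def)
  moreover have "exp_A1 (\<sigma> i) (\<sigma> j) = e i j" if ij: "i < n" "j < n" for i j
  proof (cases "i = j")
    case False
    then have ne: "\<sigma> i \<noteq> \<sigma> j" using \<sigma>_eq ij by blast
    have "e i j = (if lt i j then 0 else 1)" using False zo[OF ij] by (auto simp: lt_def)
    then show ?thesis using ne rk_iff[OF ij] div2 ij by (auto simp: exp_A1_def)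
  qed (use ij in \<open>simp add: exp_A1_def\<close>)
  ultimately have "conjugate_orders n e n exp_A1"
    unfolding conjugate_orders_def by (intro conjI exI[of _ \<sigma>] exI[of _ "\<lambda>_. 0"]) auto
  then have "conjugate_orders n d n exp_A1" unfolding e_def by (rule conjugate_orders_shift)
  moreover have "even n \<and> n \<ge> 2" using nR n0 by (cases "card Rp") auto
  ultimately show ?thesis by blast
qed

end

lemma two_sum_less: "2 * (\<Sum>i<n. \<Sum>j<n. if j < i then 1 else 0 :: int) = int n * (int n - 1)"
proof (induction n)
  case (Suc n)
  have "(\<Sum>i<Suc n. \<Sum>j<Suc n. if j < i then 1 else 0 :: int) = (\<Sum>i<n. \<Sum>j<n. if j < i then 1 else 0) + int n"
    by (simp add: sum.distrib)
  then show ?case using Suc.IH by (simp add: algebra_simps)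
qed simp

text \<open>
  The matrix differs from the hereditary one by one extra entry \<open>1\<close> in every diagonal block.
\<close>

lemma sum_exp_A1:
  assumes "even n" shows "2 * (\<Sum>i<n. \<Sum>j<n. exp_A1 i j) = int n * int n"
proof -
  have e: "exp_A1 i j = (if j < i then 1 else 0) + (if even i \<and> j = Suc i then 1 else 0)" for i j
    unfolding exp_A1_def by (auto simp: div_le_mono elim!: oddE evenE)
  have "(\<Sum>i<n. \<Sum>j<n. if even i \<and> j = Suc i then 1 else 0 :: int) = (\<Sum>i<n. if even i then 1 else 0)"
    using assms by (intro sum.cong) (auto simp: sum.delta intro: Suc_lessI)
  also have "2 * \<dots> = int n"
  proof -
    have "2 * (\<Sum>i<2 * k. if even i then 1 else 0 :: int) = int (2 * k)" for k
      by (induction k) simp_all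
    then show ?thesis using assms by (elim evenE) simp
  qed
  finally show ?thesis using two_sum_less[of n] by (simp add: e sum.distrib algebra_simps)
qed

lemma sum_exp_A2:
  assumes "n \<ge> 2" shows "2 * (\<Sum>i<n. \<Sum>j<n. exp_A2 n i j) = int n * (int n + 1)"
proof -
  have e: "exp_A2 n i j = (if i < j then 1 else 0) + (if i = 0 \<and> j = n - 1 then 1 else 0)
      + (if i = Suc j then 1 else 0)" if "i < n" "j < n" for i j
    unfolding exp_A2_def using that assms by auto
  have "(\<Sum>i<n. \<Sum>j<n. exp_A2 n i j) = (\<Sum>i<n. \<Sum>j<n. (if i < j then 1 else 0) + 
      (if i = 0 \<and> j = n - 1 then 1 else 0) + (if i = Suc j then 1 else 0))"
    using e by (intro sum.cong refl) auto
  also have "\<dots> = (\<Sum>i<n. \<Sum>j<n. if i < j then 1 else 0) + 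
      (\<Sum>i<n. \<Sum>j<n. if i = 0 \<and> j = n - 1 then 1 else 0) + (\<Sum>i<n. \<Sum>j<n. if i = Suc j then 1 else 0)"
    by (simp add: sum.distrib)
  also have "(\<Sum>i<n. \<Sum>j<n. if i < j then 1 else 0 :: int) = (\<Sum>j<n. \<Sum>i<n. if i < j then 1 else 0)"
    by (rule sum.swap)
  also have "(\<Sum>i<n. \<Sum>j<n. if i = 0 \<and> j = n - 1 then 1 else 0 :: int) = (\<Sum>i<n. if i = 0 then 1 else 0)"
    using assms by (intro sum.cong refl) auto
  also have "\<dots> = 1" using assms by simp
  also have "(\<Sum>i<n. \<Sum>j<n. if i = Suc j then 1 else 0 :: int) = int n - 1"
  proof -
    have "(\<Sum>i<n. \<Sum>j<n. if i = Suc j then 1 else 0 :: int) = (\<Sum>j<n. \<Sum>i<n. if i = Suc j then 1 else 0)"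
      by (rule sum.swap)
    also have "\<dots> = (\<Sum>j<n. if Suc j < n then 1 else 0)" by (intro sum.cong refl) (simp add: sum.delta)
    also have "\<dots> = int n - 1"
    proof -
      obtain m where m: "n = Suc m" using assms by (metis Suc_le_D numeral_2_eq_2)
      show ?thesis unfolding m by (simp del: sum.If_cases)
    qed
    finally show ?thesis .
  qed
  finally show ?thesis using two_sum_less[of n] by (simp add: algebra_simps)
qed

section \<open>Posets in which filters are complements of ideals\<close>

text \<open>
  The conditions say that the complement of the principal filter of \<open>p\<close> is the principal ideal of
  \<open>\<phi> p\<close>, that every element is incomparable with exactly two others, and that intervals are finite.
  Such a poset is the integers with \<open>t \<le> u\<close> iff \<open>t = u\<close> or \<open>t + 2 \<le> u\<close>, a ladder whose neighbouring
  integers are incomparable, with \<open>\<phi> t = t + 1\<close>.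
\<close>

locale complementary_poset =
  fixes P :: "'p set" and le :: "'p \<Rightarrow> 'p \<Rightarrow> bool" and \<phi> \<psi> :: "'p \<Rightarrow> 'p"
  assumes refl: "p \<in> P \<Longrightarrow> le p p"
    and antisym: "\<lbrakk>p \<in> P; q \<in> P; le p q; le q p\<rbrakk> \<Longrightarrow> p = q"
    and trans: "\<lbrakk>p \<in> P; q \<in> P; r \<in> P; le p q; le q r\<rbrakk> \<Longrightarrow> le p r"
    and phi_in [simp]: "p \<in> P \<Longrightarrow> \<phi> p \<in> P" and psi_in [simp]: "p \<in> P \<Longrightarrow> \<psi> p \<in> P"
    and phi_psi [simp]: "p \<in> P \<Longrightarrow> \<phi> (\<psi> p) = p" and psi_phi [simp]: "p \<in> P \<Longrightarrow> \<psi> (\<phi> p) = p"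
    and compl: "\<lbrakk>p \<in> P; q \<in> P\<rbrakk> \<Longrightarrow> \<not> le p q \<longleftrightarrow> le q (\<phi> p)"
    and two_incomparable: "p \<in> P \<Longrightarrow> card {q \<in> P. \<not> le p q \<and> \<not> le q p} = 2"
    and finite_interval: "\<lbrakk>p \<in> P; q \<in> P\<rbrakk> \<Longrightarrow> finite {r \<in> P. le p r \<and> le r q}"
begin

abbreviation par :: "'p \<Rightarrow> 'p \<Rightarrow> bool" where "par p q \<equiv> \<not> le p q \<and> \<not> le q p"

lemma phi_mono: "\<lbrakk>p \<in> P; q \<in> P\<rbrakk> \<Longrightarrow> le (\<phi> p) (\<phi> q) \<longleftrightarrow> le p q"
  using compl[of p q] compl[of q "\<phi> p"] by auto

text \<open>
  An element \<open>q\<close> incomparable with \<open>p\<close> lies in the complement of the filter of \<open>p\<close>, hence below \<open>\<phi> p\<close>;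
  so \<open>\<phi> p \<le> p\<close> would give \<open>q \<le> p\<close>.
\<close>

lemma par_phi: assumes p: "p \<in> P" shows "par p (\<phi> p)"
proof -
  have "{q \<in> P. par p q} \<noteq> {}" using two_incomparable[OF p] by (metis card.empty zero_neq_numeral)
  then obtain q where q: "q \<in> P" "par p q" by blast
  then have "le q (\<phi> p)" using compl p by blast
  then have "\<not> le (\<phi> p) p" using trans[of q "\<phi> p" p] p q by auto
  moreover have "\<not> le p (\<phi> p)" using compl[of p "\<phi> p"] refl[of "\<phi> p"] p by simp
  ultimately show ?thesis by blast
qed

lemma par_psi: "p \<in> P \<Longrightarrow> par p (\<psi> p)"
  using par_phi[of "\<psi> p"] by simp

text \<open>
  If \<open>\<phi> p = \<psi> p\<close>, the second element \<open>q\<close> incomparable with \<open>p\<close> satisfies \<open>q \<le> \<phi> p\<close>, and dually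
  \<open>\<phi> p \<le> q\<close>.
\<close>

lemma phi_neq_psi: assumes p: "p \<in> P" shows "\<phi> p \<noteq> \<psi> p"
proof
  assume eq: "\<phi> p = \<psi> p"
  have "\<exists>q \<in> {q \<in> P. par p q}. q \<noteq> \<phi> p"
  proof (rule ccontr)
    assume "\<not> ?thesis"
    then have "{q \<in> P. par p q} \<subseteq> {\<phi> p}" by blast
    then have "card {q \<in> P. par p q} \<le> 1" by (metis card.empty card_insert_disjoint card_mono empty_iff finite.intros One_nat_def)
    then show False using two_incomparable[OF p] by simp
  qed
  then obtain q where q: "q \<in> P" "par p q" "q \<noteq> \<phi> p" by blast
  have "le q (\<phi> p)" using compl[of p q] p q by blast
  moreover have "le p (\<phi> q)" using compl[of q p] p q by blast
  then have "le (\<phi> p) q" using phi_mono[of "\<phi> p" q] eq p q by simp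
  ultimately show False using antisym[of q "\<phi> p"] p q by simp
qed

lemma par_iff: assumes p: "p \<in> P" and q: "q \<in> P" shows "par p q \<longleftrightarrow> q = \<phi> p \<or> q = \<psi> p"
proof -
  have fin: "finite {q \<in> P. par p q}" using two_incomparable[OF p] by (metis card.infinite zero_neq_numeral)
  have "{\<phi> p, \<psi> p} = {q \<in> P. par p q}"
    by (rule card_subset_eq[OF fin]) (use p par_phi[OF p] par_psi[OF p] phi_neq_psi[OF p] two_incomparable[OF p] in auto)
  then show ?thesis using q by blast
qed

lemma psi_le_phi: "p \<in> P \<Longrightarrow> le (\<psi> p) (\<phi> p)"
  using compl[of p "\<psi> p"] par_psi[of p] by simp

text \<open>
  The orbit of \<open>p\<close> under \<open>\<phi>\<close> with integer exponents; \<open>\<psi>\<close> is the inverse of \<open>\<phi>\<close>.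
\<close>

definition orb :: "'p \<Rightarrow> int \<Rightarrow> 'p"
  where "orb p t = (if 0 \<le> t then (\<phi> ^^ nat t) p else (\<psi> ^^ nat (- t)) p)"

context
  fixes p0 assumes p0: "p0 \<in> P"
begin

lemma orb_in [simp]: "orb p0 t \<in> P"
proof -
  have "(\<phi> ^^ m) p0 \<in> P" "(\<psi> ^^ m) p0 \<in> P" for m by (induction m) (auto simp: p0)
  then show ?thesis by (simp add: orb_def)
qed

lemma orb_0 [simp]: "orb p0 0 = p0" by (simp add: orb_def)

lemma phi_orb: "\<phi> (orb p0 t) = orb p0 (t + 1)"
proof (cases "0 \<le> t")
  case True
  then show ?thesis by (simp add: orb_def nat_add_distrib)
next
  case False
  then have e: "nat (- t) = Suc (nat (- (t + 1)))" by simp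
  have "(\<psi> ^^ m) p0 \<in> P" for m by (induction m) (auto simp: p0)
  then have "\<phi> (orb p0 t) = (\<psi> ^^ nat (- (t + 1))) p0" using False by (simp add: orb_def e)
  also have "\<dots> = orb p0 (t + 1)" using False by (cases "t = -1") (auto simp: orb_def)
  finally show ?thesis .
qed

lemma psi_orb: "\<psi> (orb p0 t) = orb p0 (t - 1)"
  using phi_orb[of "t - 1"] psi_phi[OF orb_in, of "t - 1"] by simp

lemma par_orb: "q \<in> P \<Longrightarrow> par (orb p0 t) q \<longleftrightarrow> q = orb p0 (t + 1) \<or> q = orb p0 (t - 1)"
  using par_iff[of "orb p0 t" q] phi_orb psi_orb by simp

lemma orb_neq2: "orb p0 t \<noteq> orb p0 (t + 2)"
  using phi_neq_psi[of "orb p0 (t + 1)"] phi_orb[of "t + 1"] psi_orb[of "t + 1"] by (simp add: add.commute)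

lemma orb_le2: "le (orb p0 t) (orb p0 (t + 2))"
  using psi_le_phi[of "orb p0 (t + 1)"] phi_orb[of "t + 1"] psi_orb[of "t + 1"] by (simp add: add.commute)

lemma orb_le3: "le (orb p0 t) (orb p0 (t + 3))"
proof (rule ccontr)
  assume n: "\<not> ?thesis"
  have a: "orb p0 (t + 3) \<noteq> orb p0 (t + 1)" using orb_neq2[of "t + 1"] by (simp add: add.commute)
  have b: "orb p0 (t + 3) \<noteq> orb p0 (t - 1)"
  proof
    assume e: "orb p0 (t + 3) = orb p0 (t - 1)"
    have "le (orb p0 (t - 1)) (orb p0 (t + 1))" "le (orb p0 (t + 1)) (orb p0 (t + 3))"
      using orb_le2[of "t - 1"] orb_le2[of "t + 1"] by (simp_all add: add.commute)
    then have "orb p0 (t - 1) = orb p0 (t + 1)" using e antisym orb_in by metis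
    then show False using orb_neq2[of "t - 1"] by (simp add: add.commute)
  qed
  have "le (orb p0 (t + 3)) (orb p0 t)" using n a b par_orb[of "orb p0 (t + 3)" t] by auto
  then have "le (orb p0 (t + 3)) (orb p0 (t + 2))" using orb_le2[of t] trans orb_in by blast
  then show False using par_orb[of "orb p0 (t + 3)" "t + 2"] by (simp add: add.commute)
qed

lemma orb_le_add: "le (orb p0 t) (orb p0 (t + 2 + int k))"
proof (induction k arbitrary: t rule: nat_less_induct)
  case (1 k)
  show ?case
  proof (cases "k < 2")
    case True
    then have "k = 0 \<or> k = 1" by auto
    then show ?thesis using orb_le2[of t] orb_le3[of t] by (auto simp: add.commute)
  next
    case False
    then have "k - 2 < k" by simp
    then have "le (orb p0 (t + 2)) (orb p0 (t + 2 + 2 + int (k - 2)))" using 1 by blast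
    moreover have "t + 2 + 2 + int (k - 2) = t + 2 + int k" using False by simp
    ultimately show ?thesis using orb_le2[of t] trans[OF orb_in orb_in orb_in] by metis
  qed
qed

lemma orb_le: "u \<ge> t + 2 \<Longrightarrow> le (orb p0 t) (orb p0 u)"
  using orb_le_add[of t "nat (u - t - 2)"] by simp

lemma orb_neq_less: assumes "t < u" shows "orb p0 t \<noteq> orb p0 u"
proof
  assume e: "orb p0 t = orb p0 u"
  consider "u = t + 1" | "u = t + 2" | "u \<ge> t + 3" using assms by linarith
  then show False
  proof cases
    case 1 then show ?thesis using e par_orb[of "orb p0 u" t] refl[of "orb p0 u"] by auto
  next
    case 2 then show ?thesis using e orb_neq2[of t] by simp
  next
    case 3
    then have "le (orb p0 (t + 1)) (orb p0 t)" using orb_le[of "t + 1" u] e by simp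
    then show ?thesis using par_orb[of "orb p0 (t + 1)" t] by auto
  qed
qed

lemma orb_eq_iff [simp]: "orb p0 t = orb p0 u \<longleftrightarrow> t = u"
  using orb_neq_less[of t u] orb_neq_less[of u t] by (metis linorder_neqE)

lemma orb_le_iff: "le (orb p0 t) (orb p0 u) \<longleftrightarrow> t = u \<or> u \<ge> t + 2"
proof
  assume le: "le (orb p0 t) (orb p0 u)"
  have "par (orb p0 t) (orb p0 u)" if "u = t + 1 \<or> u = t - 1"
    using par_orb[of "orb p0 u" t] that by auto
  moreover have "t = u" if "u \<le> t - 2"
    using orb_le[of u t] that antisym[OF orb_in orb_in le] by simp
  ultimately show "t = u \<or> u \<ge> t + 2" using le by linarith
qed (auto simp: orb_le refl)

text \<open>
  An element \<open>r\<close> outside the orbit is comparable with the whole orbit. By finiteness of intervals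
  it lies above some and not above all of the orbit, hence between some \<open>orb p0 t\<close> and
  \<open>orb p0 (t + 1)\<close>, which are incomparable.
\<close>

lemma orb_surj: assumes r: "r \<in> P" obtains t where "r = orb p0 t"
proof -
  have "\<exists>t. r = orb p0 t"
  proof (rule ccontr)
    assume "\<not> ?thesis"
    then have cmp: "le (orb p0 t) r \<or> le r (orb p0 t)" for t using par_orb[OF r, of t] by blast
    have "\<not> (\<forall>k. le (orb p0 (2 * int k)) r)"
    proof
      assume "\<forall>k. le (orb p0 (2 * int k)) r"
      moreover have "le p0 (orb p0 (2 * int k))" for k using orb_le_iff[of 0 "2 * int k"] by simp presburger
      ultimately have "range (\<lambda>k. orb p0 (2 * int k)) \<subseteq> {q \<in> P. le p0 q \<and> le q r}" by auto
      then have "finite (range (\<lambda>k. orb p0 (2 * int k)))" using finite_interval[OF p0 r] finite_subset by blast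
      moreover have "inj (\<lambda>k. orb p0 (2 * int k))" by (auto simp: inj_on_def)
      ultimately show False using range_inj_infinite by blast
    qed
    then obtain a where a: "\<not> le (orb p0 (2 * int a)) r" by blast
    have "\<not> (\<forall>k. le r (orb p0 (- 2 * int k)))"
    proof
      assume "\<forall>k. le r (orb p0 (- 2 * int k))"
      moreover have "le (orb p0 (- 2 * int k)) p0" for k using orb_le_iff[of "- 2 * int k" 0] by simp presburger
      ultimately have "range (\<lambda>k. orb p0 (- 2 * int k)) \<subseteq> {q \<in> P. le r q \<and> le q p0}" by auto
      then have "finite (range (\<lambda>k. orb p0 (- 2 * int k)))" using finite_interval[OF r p0] finite_subset by blast
      moreover have "inj (\<lambda>k. orb p0 (- 2 * int k))" by (auto simp: inj_on_def)
      ultimately show False using range_inj_infinite by blast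
    qed
    then obtain b where b: "le (orb p0 (- 2 * int b)) r" using cmp by blast
    have "le (orb p0 (- 2 * int b + int k)) r" for k
    proof (induction k)
      case (Suc k)
      let ?t = "- 2 * int b + int k"
      have "\<not> le r (orb p0 (?t + 1))"
      proof
        assume "le r (orb p0 (?t + 1))"
        then have "le (orb p0 ?t) (orb p0 (?t + 1))" using Suc trans[OF orb_in r orb_in] by blast
        then show False by (simp add: orb_le_iff)
      qed
      moreover have "?t + 1 = - 2 * int b + int (Suc k)" by simp
      ultimately show ?case using cmp[of "?t + 1"] by metis
    qed (use b in simp)
    from this[of "2 * a + 2 * b"] show False using a by simp
  qed
  then show ?thesis using that by blast
qed

end
end

section \<open>Orders with excess two\<close>

context gorenstein_tiled begin

lemma excess_all_two:
  assumes T: "nak_sum = int n + 1" and i: "i < n" shows "excess i = 2"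
proof -
  have ge: "excess j \<ge> 2" if "j < n" for j
    using excess_nonneg[OF that] excess_zero_imp_small[OF that] excess_one_imp_small[OF that] T by linarith
  have "(\<Sum>j<n. excess j - 2) = 0" using T by (simp add: sum_subtractf sum_excess)
  then have "excess i - 2 = 0" using i by (subst (asm) sum_nonneg_eq_0_iff) (use ge in force)+
  then show ?thesis by simp
qed

text \<open>
  A point \<open>(i, u)\<close> stands for the graded projective module generated in column \<open>i\<close> and degree \<open>u\<close>;
  \<open>ple\<close> is the reverse inclusion of these modules, and the filters bounded below are the graded
  lattices of rank one. The Gorenstein identity says that the complement of the filter of a point is
  the ideal of \<open>succ_pt\<close> of that point.
\<close>

definition points :: "(nat \<times> int) set" where "points = {..<n} \<times> UNIV"
definition ple :: "nat \<times> int \<Rightarrow> nat \<times> int \<Rightarrow> bool"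
  where "ple p q \<longleftrightarrow> d (fst p) (fst q) \<le> snd q - snd p"
definition succ_pt :: "nat \<times> int \<Rightarrow> nat \<times> int"
  where "succ_pt p = (let m = inv_into UNIV \<nu> (fst p) in (m, snd p + d (fst p) m - 1))"
definition pred_pt :: "nat \<times> int \<Rightarrow> nat \<times> int"
  where "pred_pt p = (\<nu> (fst p), snd p - d (\<nu> (fst p)) (fst p) + 1)"

lemma inv_nu [simp]: "\<nu> (inv_into UNIV \<nu> i) = i" "inv_into UNIV \<nu> (\<nu> i) = i"
  using permutes_inverses[OF nu_permutes] by auto
lemma inv_nu_less [simp]: "inv_into UNIV \<nu> i < n \<longleftrightarrow> i < n" using nu_less[of "inv_into UNIV \<nu> i"] by simp

lemma card_incomparable:
  assumes i: "i < n"
  shows "int (card {q \<in> points. \<not> ple (i, u) q \<and> \<not> ple q (i, u)}) = excess i"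
proof -
  have "{q \<in> points. \<not> ple (i, u) q \<and> \<not> ple q (i, u)} = (SIGMA j:{..<n}-{i}. {u - d j i<..<u + d i j})"
    using i by (auto simp: points_def ple_def)
  then have "int (card {q \<in> points. \<not> ple (i, u) q \<and> \<not> ple q (i, u)}) =
      (\<Sum>j\<in>{..<n}-{i}. int (card {u - d j i<..<u + d i j}))"
    by (simp add: card_SigmaI)
  also have "\<dots> = excess i"
    unfolding excess_def
  proof (intro sum.cong refl)
    fix j assume "j \<in> {..<n}-{i}"
    then show "int (card {u - d j i<..<u + d i j}) = d i j + d j i - 1"
      using excess_term_nonneg[OF i, of j] by simp
  qed
  finally show ?thesis .
qed

lemma complementary_poset_points:
  assumes T: "nak_sum = int n + 1"
  shows "complementary_poset points ple succ_pt pred_pt"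
proof
  fix p q r :: "nat \<times> int"
  show "p \<in> points \<Longrightarrow> ple p p" by (auto simp: ple_def points_def)
  show "\<lbrakk>p \<in> points; q \<in> points; ple p q; ple q p\<rbrakk> \<Longrightarrow> p = q"
    using d_sym_pos[of "fst p" "fst q"] by (cases p; cases q; cases "fst p = fst q") (auto simp: ple_def points_def)
  show "\<lbrakk>p \<in> points; q \<in> points; r \<in> points; ple p q; ple q r\<rbrakk> \<Longrightarrow> ple p r"
    using d_tri[of "fst p" "fst q" "fst r"] by (cases p; cases q; cases r) (auto simp: ple_def points_def)
  show "p \<in> points \<Longrightarrow> succ_pt p \<in> points" "p \<in> points \<Longrightarrow> pred_pt p \<in> points"
    by (auto simp: points_def succ_pt_def pred_pt_def Let_def)
  show "p \<in> points \<Longrightarrow> succ_pt (pred_pt p) = p" "p \<in> points \<Longrightarrow> pred_pt (succ_pt p) = p"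
    by (auto simp: succ_pt_def pred_pt_def Let_def)
  show "\<lbrakk>p \<in> points; q \<in> points\<rbrakk> \<Longrightarrow> \<not> ple p q \<longleftrightarrow> ple q (succ_pt p)"
    using gor[of "inv_into UNIV \<nu> (fst p)" "fst q"] by (cases p; cases q) (auto simp: ple_def points_def succ_pt_def Let_def)
  show "p \<in> points \<Longrightarrow> card {q \<in> points. \<not> ple p q \<and> \<not> ple q p} = 2"
    using card_incomparable[of "fst p" "snd p"] excess_all_two[OF T, of "fst p"] by (auto simp: points_def)
  show "finite {r \<in> points. ple p r \<and> ple r q}"
  proof (rule finite_subset)
    show "{r \<in> points. ple p r \<and> ple r q} \<subseteq> (SIGMA j:{..<n}. {snd p + d (fst p) j..snd q - d j (fst q)})"
      by (auto simp: points_def ple_def)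
  qed simp
qed

text \<open>
  The points are listed as \<open>(c t, w t)\<close> for integers \<open>t\<close>. Raising the degree by one is the translation
  by \<open>n\<close>, so that \<open>n\<close> consecutive points represent every column once.
\<close>

definition ladder :: "(int \<Rightarrow> nat) \<Rightarrow> (int \<Rightarrow> int) \<Rightarrow> bool"
  where "ladder c w \<longleftrightarrow> (\<forall>t. c t < n) \<and> (\<forall>i<n. \<forall>u. \<exists>t. c t = i \<and> w t = u) \<and>
    (\<forall>t u. d (c t) (c u) \<le> w u - w t \<longleftrightarrow> t = u \<or> u \<ge> t + 2) \<and>
    (\<forall>t z. c (t + int n * z) = c t \<and> w (t + int n * z) = w t + z) \<and>
    bij_betw (\<lambda>t. c (int t)) {..<n} {..<n}"

lemma ex_ladder:
  assumes T: "nak_sum = int n + 1"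
  shows "\<exists>c w. ladder c w"
proof -
  interpret L: complementary_poset points ple succ_pt pred_pt by (rule complementary_poset_points[OF T])
  define p0 :: "nat \<times> int" where "p0 = (0, 0)"
  have p0: "p0 \<in> points" using n_pos by (simp add: p0_def points_def)
  define c where "c t = fst (L.orb p0 t)" for t
  define w where "w t = snd (L.orb p0 t)" for t
  have c: "c t < n" for t using L.orb_in[OF p0, of t] by (auto simp: c_def points_def)
  have surj: "\<exists>t. c t = i \<and> w t = u" if "i < n" for i u
    using L.orb_surj[OF p0, of "(i, u)"] that by (metis c_def w_def fst_conv snd_conv points_def SigmaI lessThan_iff UNIV_I)
  have le: "d (c t) (c u) \<le> w u - w t \<longleftrightarrow> t = u \<or> u \<ge> t + 2" for t u
    using L.orb_le_iff[OF p0, of t u] by (simp add: c_def w_def ple_def)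
  have eq: "t = u" if "c t = c u" "w t = w u" for t u
    using L.orb_eq_iff[OF p0, of t u] that by (simp add: c_def w_def prod_eq_iff)
  define X :: "int \<Rightarrow> nat \<times> int \<Rightarrow> nat \<times> int" where "X z p = (fst p, snd p + z)" for z p
  obtain m where m: "c m = c 0" "w m = w 0 + 1" using surj[OF c, of 0 "w 0 + 1"] by blast
  (* The degree shift commutes with the successor, so on the orbit it is a translation by some m. *)
  have step: "c (t + 1 + m) = c (t + 1) \<and> w (t + 1 + m) = w (t + 1) + 1 \<longleftrightarrow>
              c (t + m) = c t \<and> w (t + m) = w t + 1" for t
  proof -
    have a: "succ_pt (L.orb p0 (t + m)) = L.orb p0 (t + 1 + m)" "succ_pt (L.orb p0 t) = L.orb p0 (t + 1)"
      using L.phi_orb[OF p0] by (simp_all add: ac_simps)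
    have X: "L.orb p0 (t + m) = X 1 (L.orb p0 t) \<longleftrightarrow> succ_pt (L.orb p0 (t + m)) = succ_pt (X 1 (L.orb p0 t))"
    proof
      assume "succ_pt (L.orb p0 (t + m)) = succ_pt (X 1 (L.orb p0 t))"
      moreover have "X 1 (L.orb p0 t) \<in> points" using L.orb_in[OF p0, of t] by (auto simp: X_def points_def)
      ultimately show "L.orb p0 (t + m) = X 1 (L.orb p0 t)" using L.psi_phi L.orb_in[OF p0] by metis
    qed simp
    have "succ_pt (X 1 (L.orb p0 t)) = X 1 (succ_pt (L.orb p0 t))" by (simp add: X_def succ_pt_def Let_def)
    then show ?thesis using X a by (simp add: X_def c_def w_def prod_eq_iff)
  qed
  have per: "c (t + m) = c t \<and> w (t + m) = w t + 1" for t
  proof (induction t rule: int_induct[of _ 0])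
    case base then show ?case using m by simp
  next
    case (step1 i) then show ?case using step[of i] by simp
  next
    case (step2 i) then show ?case using step[of "i - 1"] by simp
  qed
  have m2: "m \<ge> 2" using le[of 0 m] m c d_diag[OF c, of 0] by (auto)
  have per': "c (t + m * int z) = c t \<and> w (t + m * int z) = w t + int z" for t z
  proof (induction z)
    case (Suc z) then show ?case using per[of "t + m * int z"] by (simp add: algebra_simps)
  qed simp
  have per'': "c (t + m * z) = c t \<and> w (t + m * z) = w t + z" for t z
    using per'[of t "nat z"] per'[of "t + m * z" "nat (- z)"] by (cases "z \<ge> 0") auto
  have bij: "bij_betw (\<lambda>t. c (int t)) {..<nat m} {..<n}"
    unfolding bij_betw_def
  proof
    show "inj_on (\<lambda>t. c (int t)) {..<nat m}"
    proof (rule inj_onI)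
      fix s t assume st: "s \<in> {..<nat m}" "t \<in> {..<nat m}" "c (int s) = c (int t)"
      have "int t = int s + m * (w (int t) - w (int s))"
      proof (rule eq)
        show "c (int t) = c (int s + m * (w (int t) - w (int s)))" using per'' st(3) by simp
        show "w (int t) = w (int s + m * (w (int t) - w (int s)))" using per'' by simp
      qed
      then have "int t mod m = int s mod m" by (metis mod_mult_self2)
      then show "s = t" using st by simp
    qed
    show "(\<lambda>t. c (int t)) ` {..<nat m} = {..<n}"
    proof
      show "(\<lambda>t. c (int t)) ` {..<nat m} \<subseteq> {..<n}" using c by auto
      show "{..<n} \<subseteq> (\<lambda>t. c (int t)) ` {..<nat m}"
      proof
        fix i assume "i \<in> {..<n}"
        then obtain t where t: "c t = i" using surj[of i 0] by auto
        have "c (t mod m) = i" using per''[of "t mod m" "t div m"] t by simp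
        moreover have "0 \<le> t mod m" "t mod m < m" using m2 by auto
        ultimately show "i \<in> (\<lambda>t. c (int t)) ` {..<nat m}"
          by (intro image_eqI[of _ _ "nat (t mod m)"]) auto
      qed
    qed
  qed
  then have "nat m = n" using bij_betw_same_card by fastforce
  then have mn: "m = int n" using m2 by simp
  have "ladder c w" unfolding ladder_def using c surj le per'' bij unfolding mn nat_int by blast
  then show ?thesis by blast
qed

text \<open>
  For columns listed in ladder order, \<open>d (c s) (c t) + w s - w t\<close> is the least \<open>v\<close> such that
  \<open>t + n v = s\<close> or \<open>t + n v \<ge> s + 2\<close>. Listing them in the opposite order gives the matrix \<open>exp_A2\<close>.
\<close>

lemma nak_sum_A2:
  assumes T: "nak_sum = int n + 1"
  shows "n \<ge> 2 \<and> conjugate_orders n d n (exp_A2 n)"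
proof -
  obtain c w where "ladder c w" using ex_ladder[OF T] by blast
  then have c: "\<And>t. c t < n" and le: "\<And>t u. d (c t) (c u) \<le> w u - w t \<longleftrightarrow> t = u \<or> u \<ge> t + 2"
      and per: "\<And>t z. c (t + int n * z) = c t \<and> w (t + int n * z) = w t + z"
      and bij: "bij_betw (\<lambda>t. c (int t)) {..<n} {..<n}"
    unfolding ladder_def by blast+
  have n2: "n \<ge> 2"
  proof (rule ccontr)
    assume "\<not> n \<ge> 2"
    then have "n = 1" using n_pos by simp
    moreover from this have "\<nu> 0 = 0" using nu_less[of 0] by simp
    ultimately have "nak_sum = 0" unfolding nak_sum_def by simp
    then show False using T by simp
  qed
  define g where "g = (\<lambda>t. c (int t))"
  define h where "h = inv_into {..<n} g"
  have g: "g t < n" for t using c by (simp add: g_def)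
  have gh: "g (h i) = i" "h i < n" if "i < n" for i
    using that bij f_inv_into_f[of i g "{..<n}"] inv_into_into[of i g "{..<n}"]
    unfolding h_def g_def[symmetric] bij_betw_def by auto
  define \<sigma> where "\<sigma> i = (if i < n then n - 1 - h i else i)" for i
  have sig: "\<sigma> i < n" "h i = n - 1 - \<sigma> i" if "i < n" for i using gh[OF that] that by (auto simp: \<sigma>_def)
  have "inj_on \<sigma> {..<n}"
  proof (rule inj_onI)
    fix i j assume ij: "i \<in> {..<n}" "j \<in> {..<n}" "\<sigma> i = \<sigma> j"
    then have ij: "i < n" "j < n" "\<sigma> i = \<sigma> j" by auto
    have "h i = h j" by (metis sig(2)[OF ij(1)] sig(2)[OF ij(2)] ij(3))
    then show "i = j" by (metis gh(1)[OF ij(1)] gh(1)[OF ij(2)])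
  qed
  then have perm: "\<sigma> permutes {..<n}" by (intro inj_self_map_permutes) (use sig(1) \<sigma>_def in auto)
  have val: "exp_A2 n i j = d (c s) (c t) + w s - w t"
    if ij: "i < n" "j < n" "s = int (n - 1 - i)" "t = int (n - 1 - j)" for i j s t
  proof -
    define x where "x = d (c s) (c t) + w s - w t"
    have E: "x \<le> v \<longleftrightarrow> s = t + int n * v \<or> t + int n * v \<ge> s + 2" for v
      using le[of s "t + int n * v"] per[of t v] by (auto simp: x_def)
    have s: "s = int n - 1 - int i" "t = int n - 1 - int j" using ij by auto
    have "x \<le> -1 \<longleftrightarrow> False" using E[of "-1"] s ij(1,2) by auto
    moreover have "x \<le> 0 \<longleftrightarrow> i = j \<or> i \<ge> j + 2" using E[of 0] s ij(1,2) by auto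
    moreover have "x \<le> 1 \<longleftrightarrow> \<not> (i = 0 \<and> j = n - 1)" using E[of 1] s ij(1,2) n2 by auto
    moreover have "x \<le> 2" using E[of 2] s ij(1,2) n2 by auto
    ultimately have "exp_A2 n i j = x" unfolding exp_A2_def using n2 by (auto split: if_splits)
    then show ?thesis by (simp add: x_def)
  qed
  have "exp_A2 n (\<sigma> i) (\<sigma> j) = d i j + w (int (h i)) - w (int (h j))" if "i < n" "j < n" for i j
  proof -
    have "exp_A2 n (\<sigma> i) (\<sigma> j) = d (c (int (h i))) (c (int (h j))) + w (int (h i)) - w (int (h j))"
    proof (rule val[OF sig(1)[OF that(1)] sig(1)[OF that(2)]])
      show "int (h i) = int (n - 1 - \<sigma> i)" "int (h j) = int (n - 1 - \<sigma> j)"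
        by (metis sig(2)[OF that(1)]) (metis sig(2)[OF that(2)])
    qed
    then show ?thesis using gh(1)[OF that(1)] gh(1)[OF that(2)] unfolding g_def by metis
  qed
  then show ?thesis using n2 perm unfolding conjugate_orders_def
    by (intro conjI exI[of _ \<sigma>] exI[of _ "\<lambda>i. w (int (h i))"]) auto
qed

end

section \<open>Graded lattices of rank one and the summands of V\<close>

text \<open>
  The vectors \<open>a\<close> for which the rows with entries in \<open>x\<^bsup>a l\<^esup> R\<close> form a module, that is, the graded lattices
  \<open>L(a)\<close> of rank one. There is a nonzero map \<open>L(a) \<rightarrow> L(b)\<close> of degree \<open>0\<close> iff \<open>a \<ge> b\<close>, and it is unique up to
  scalars.
\<close>

definition lattice_vec :: "nat \<Rightarrow> (nat \<Rightarrow> nat \<Rightarrow> int) \<Rightarrow> (nat \<Rightarrow> int) \<Rightarrow> bool"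
  where "lattice_vec n d a \<longleftrightarrow> (\<forall>i<n. \<forall>j<n. a j \<le> a i + d i j)"

text \<open>
  The map \<open>L(a) \<rightarrow> L(b)\<close> factors through a shift of \<open>e\<^sub>m A\<close>. Among the shifts that map to \<open>L(b)\<close> the one with
  exponents \<open>d m l + b m\<close> is the largest. For \<open>a = b\<close> the condition says that \<open>L(a)\<close> is projective.
\<close>

definition through_proj :: "nat \<Rightarrow> (nat \<Rightarrow> nat \<Rightarrow> int) \<Rightarrow> (nat \<Rightarrow> int) \<Rightarrow> (nat \<Rightarrow> int) \<Rightarrow> bool"
  where "through_proj n d a b \<longleftrightarrow> (\<exists>m<n. \<forall>l<n. d m l + b m \<le> a l)"

definition stable_hom :: "nat \<Rightarrow> (nat \<Rightarrow> nat \<Rightarrow> int) \<Rightarrow> (nat \<Rightarrow> int) \<Rightarrow> (nat \<Rightarrow> int) \<Rightarrow> bool"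
  where "stable_hom n d a b \<longleftrightarrow> (\<forall>l<n. b l \<le> a l) \<and> \<not> through_proj n d a b"

definition V_index :: "nat \<Rightarrow> (nat \<Rightarrow> nat \<Rightarrow> int) \<Rightarrow> (nat \<times> int) option set"
  where "V_index n d = insert None (Some ` (SIGMA i:{..<n}. {1..- gor_param n d i}))"

text \<open>
  The exponents of the summands of \<open>V\<close>, in the sense of \<open>lattice_vec\<close>.
\<close>

definition V_exp :: "nat \<Rightarrow> (nat \<Rightarrow> nat \<Rightarrow> int) \<Rightarrow> (nat \<times> int) option \<Rightarrow> nat \<Rightarrow> int"
  where "V_exp n d s l = (case s of None \<Rightarrow> 0 | Some (i, j) \<Rightarrow> max 0 (d (nakayama n d i) l - j))"

definition V_nonproj :: "nat \<Rightarrow> (nat \<Rightarrow> nat \<Rightarrow> int) \<Rightarrow> (nat \<times> int) option set"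
  where "V_nonproj n d = {s \<in> V_index n d. \<not> through_proj n d (V_exp n d s) (V_exp n d s)}"

lemma finite_V_index [simp]: "finite (V_index n d)" by (simp add: V_index_def)

lemma finite_V_nonproj [simp]: "finite (V_nonproj n d)" by (simp add: V_nonproj_def)

text \<open>
  A map that survives in the stable category does so together with all its factors.
\<close>

lemma stable_hom_middle:
  assumes "lattice_vec n d b" "stable_hom n d a c" "\<forall>l<n. b l \<le> a l" "\<forall>l<n. c l \<le> b l"
  shows "stable_hom n d a b" "stable_hom n d b c" "\<not> through_proj n d b b"
proof -
  have "\<not> through_proj n d x y" if "\<forall>l<n. x l \<le> a l" "\<forall>l<n. c l \<le> y l" for x y
  proof
    assume "through_proj n d x y"
    then obtain m where m: "m < n" "\<forall>l<n. d m l + y m \<le> x l" by (auto simp: through_proj_def)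
    then have "\<forall>l<n. d m l + c m \<le> a l" using that by (smt (verit))
    then show False using m(1) assms(2) by (auto simp: stable_hom_def through_proj_def)
  qed
  then show "stable_hom n d a b" "stable_hom n d b c" "\<not> through_proj n d b b"
    using assms by (auto simp: stable_hom_def)
qed

locale N_gorenstein_tiled = gorenstein_tiled +
  assumes nonneg: "\<lbrakk>i < n; j < n\<rbrakk> \<Longrightarrow> 0 \<le> d i j"
begin

lemma V_index_None [simp]: "None \<in> V_index n d" by (simp add: V_index_def)

lemma V_index_Some: "Some (i, j) \<in> V_index n d \<longleftrightarrow> i < n \<and> 1 \<le> j \<and> j < d (\<nu> i) i"
  by (auto simp: V_index_def gor_param_def nakayama_eq)

lemma V_exp_None [simp]: "V_exp n d None l = 0" by (simp add: V_exp_def)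
lemma V_exp_Some [simp]: "V_exp n d (Some (i, j)) l = max 0 (d (\<nu> i) l - j)"
  by (simp add: V_exp_def nakayama_eq)

lemma lattice_V_exp: assumes "s \<in> V_index n d" shows "lattice_vec n d (V_exp n d s)"
proof (cases s)
  case None
  then show ?thesis using nonneg by (auto simp: lattice_vec_def)
next
  case (Some p)
  obtain i j where p: "p = (i, j)" by (cases p)
  have i: "i < n" using assms by (simp add: Some p V_index_Some)
  show ?thesis unfolding lattice_vec_def
  proof (intro allI impI)
    fix k l assume kl: "k < n" "l < n"
    show "V_exp n d s l \<le> V_exp n d s k + d k l"
      using d_tri[of "\<nu> i" k l] nonneg[OF kl] i kl unfolding Some p by simp
  qed
qed

text \<open>
  If the lattice were the shift of \<open>e\<^sub>m A\<close> by \<open>c\<close>, its value \<open>0\<close> at \<open>\<nu> i\<close> gives \<open>c = 0\<close>. Writing \<open>m = \<nu> k\<close>, the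
  Gorenstein identities for \<open>k\<close> and \<open>i\<close> yield \<open>d i k + d k i = 0\<close>, so \<open>k = i\<close>; but row \<open>\<nu> i\<close> and the
  lattice differ at column \<open>i\<close>.
\<close>

lemma Some_not_projective:
  assumes s: "Some (i, j) \<in> V_index n d"
  shows "\<not> through_proj n d (V_exp n d (Some (i, j))) (V_exp n d (Some (i, j)))"
proof
  let ?a = "V_exp n d (Some (i, j))"
  have i: "i < n" and j: "1 \<le> j" "j < d (\<nu> i) i" using s by (simp_all add: V_index_Some)
  assume "through_proj n d ?a ?a"
  then obtain m where m: "m < n" and ge: "\<And>l. l < n \<Longrightarrow> d m l + ?a m \<le> ?a l"
    by (auto simp: through_proj_def)
  have eq: "d m l + ?a m = ?a l" if "l < n" for l
    using ge[OF that] lattice_V_exp[OF s] m that unfolding lattice_vec_def by (simp only: order_class.order_eq_iff) (smt (verit))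
  have am: "?a m = 0" "d m (\<nu> i) = 0"
  proof -
    have "?a (\<nu> i) = 0" using i j by simp
    moreover have "?a m \<ge> 0" by simp
    moreover have "d m (\<nu> i) \<ge> 0" using nonneg m i by simp
    ultimately show "?a m = 0" "d m (\<nu> i) = 0" using eq[of "\<nu> i", unfolded nu_less, OF i] by linarith+
  qed
  have dm: "d m l = ?a l" if "l < n" for l using eq[OF that] am by linarith
  obtain k where k: "k < n" "m = \<nu> k" using nu_surj[OF m] by blast
  have 1: "d m i + d i k = d m k" using gor[of k i] k i by simp
  have 2: "d m i = d (\<nu> i) i - j" using dm[OF i] j by simp
  have 3: "d m k = d (\<nu> i) k - j"
    using dm[OF k(1)] 1 2 j nonneg[of i k] i k by (simp split: if_splits add: max_def)
  have "d (\<nu> i) k + d k i = d (\<nu> i) i" using gor[of i k] i k by simp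
  then have "d i k + d k i = 0" using 1 2 3 by linarith
  then have "i = k" using d_sym_pos[of i k] i k by fastforce
  then show False using 2 j k by simp
qed

text \<open>
  The row module is projective iff the matrix has a zero row.
\<close>

lemma None_projective_iff: 
  "through_proj n d (V_exp n d None) (V_exp n d None) \<longleftrightarrow> (\<exists>i<n. d (\<nu> i) i = 0)"
proof
  assume "through_proj n d (V_exp n d None) (V_exp n d None)"
  then obtain m where m: "m < n" "\<forall>l<n. d m l \<le> 0" by (auto simp: through_proj_def)
  then obtain i where "i < n" "m = \<nu> i" using nu_surj by blast
  then show "\<exists>i<n. d (\<nu> i) i = 0" using m nonneg[of m i] by (intro exI[of _ i]) force
next
  assume "\<exists>i<n. d (\<nu> i) i = 0"
  then obtain i where i: "i < n" "d (\<nu> i) i = 0" by blast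
  have "d (\<nu> i) l \<le> 0" if "l < n" for l using gor[OF i(1) that] nonneg[OF that i(1)] i(2) by linarith
  then show "through_proj n d (V_exp n d None) (V_exp n d None)"
    unfolding through_proj_def using i by (intro exI[of _ "\<nu> i"]) auto
qed

lemma zero_diag_unique:
  assumes "i < n" "k < n" "d (\<nu> i) i = 0" "d (\<nu> k) k = 0" shows "i = k"
proof -
  have "d (\<nu> i) (\<nu> k) \<le> 0" using gor[of i "\<nu> k"] nonneg[of "\<nu> k" i] assms by simp
  moreover have "d (\<nu> k) (\<nu> i) \<le> 0" using gor[of k "\<nu> i"] nonneg[of "\<nu> i" k] assms by simp
  ultimately show ?thesis using d_sym_pos[of "\<nu> i" "\<nu> k"] assms by fastforce
qed

text \<open>
  The truncated summands number \<open>\<Sum>\<^sub>i max 0 (d (\<nu> i) i - 1)\<close> and are not projective. At most one index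
  has \<open>d (\<nu> i) i = 0\<close>; its term is off by one exactly when the row module does not count.
\<close>

lemma card_V_nonproj: "int (card (V_nonproj n d)) = nak_sum - int n + 1"
proof -
  define S where "S = (SIGMA i:{..<n}. {1..d (\<nu> i) i - 1})"
  have S: "V_index n d = insert None (Some ` S)"
    by (auto simp: V_index_def S_def gor_param_def nakayama_eq)
  have finS: "finite S" by (simp add: S_def)
  have cardS: "int (card (Some ` S)) = (\<Sum>i<n. int (nat (d (\<nu> i) i - 1)))"
    by (subst card_image) (auto simp: S_def card_SigmaI)
  have nonS: "\<not> through_proj n d (V_exp n d s) (V_exp n d s)" if "s \<in> Some ` S" for s
    using that Some_not_projective S by (metis (no_types, lifting) imageE insertCI surj_pair)
  show ?thesis
  proof (cases "\<exists>i<n. d (\<nu> i) i = 0")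
    case True
    then obtain i where i: "i < n" "d (\<nu> i) i = 0" by blast
    have "V_nonproj n d = Some ` S"
      unfolding V_nonproj_def S using nonS None_projective_iff True by blast
    moreover have "(\<Sum>i<n. int (nat (d (\<nu> i) i - 1))) = int (nat (d (\<nu> i) i - 1)) + (\<Sum>k\<in>{..<n}-{i}. int (nat (d (\<nu> k) k - 1)))"
      using i by (intro sum.remove) auto
    moreover have "(\<Sum>k\<in>{..<n}-{i}. int (nat (d (\<nu> k) k - 1))) = (\<Sum>k\<in>{..<n}-{i}. d (\<nu> k) k - 1)"
    proof (intro sum.cong refl)
      fix k assume "k \<in> {..<n}-{i}"
      then show "int (nat (d (\<nu> k) k - 1)) = d (\<nu> k) k - 1"
        using zero_diag_unique[of k i] i nonneg[of "\<nu> k" k] by force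
    qed
    moreover have "nak_sum = d (\<nu> i) i + (\<Sum>k\<in>{..<n}-{i}. d (\<nu> k) k)"
      unfolding nak_sum_def using i by (intro sum.remove) auto
    ultimately show ?thesis using cardS i by (simp add: sum_subtractf)
  next
    case False
    have "V_nonproj n d = insert None (Some ` S)"
      unfolding V_nonproj_def S using nonS None_projective_iff False by blast
    moreover have "(\<Sum>i<n. int (nat (d (\<nu> i) i - 1))) = (\<Sum>i<n. d (\<nu> i) i - 1)"
    proof (intro sum.cong refl)
      fix k assume "k \<in> {..<n}"
      then show "int (nat (d (\<nu> k) k - 1)) = d (\<nu> k) k - 1"
        using False nonneg[of "\<nu> k" k] by force
    qed
    moreover have "None \<notin> Some ` S" "finite (Some ` S)" using finS by auto
    ultimately show ?thesis using cardS by (simp add: sum_subtractf nak_sum_def)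
  qed
qed

end

section \<open>The summands of V for excess two\<close>

locale ladder_order = N_gorenstein_tiled +
  fixes c :: "int \<Rightarrow> nat" and w :: "int \<Rightarrow> int"
  assumes ladder: "ladder c w"
begin

lemma c_less [simp]: "c t < n" using ladder by (simp add: ladder_def)
lemma pt: "i < n \<Longrightarrow> \<exists>t. c t = i \<and> w t = u" using ladder by (simp add: ladder_def)
lemma le_iff: "d (c t) (c u) \<le> w u - w t \<longleftrightarrow> t = u \<or> u \<ge> t + 2" using ladder by (simp add: ladder_def)
text \<open>
  A lattice of rank one as a filter of the ladder.
\<close>

definition filt :: "(nat \<Rightarrow> int) \<Rightarrow> int set" where "filt a = {t. a (c t) \<le> w t}"

lemma le_iff_filt: "(\<forall>l<n. b l \<le> a l) \<longleftrightarrow> filt a \<subseteq> filt b"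
proof
  assume "\<forall>l<n. b l \<le> a l"
  then show "filt a \<subseteq> filt b" unfolding filt_def by (smt (verit) Collect_mono c_less)
next
  assume s: "filt a \<subseteq> filt b"
  show "\<forall>l<n. b l \<le> a l"
  proof (intro allI impI)
    fix l assume "l < n"
    then obtain t where t: "c t = l" "w t = a l" using pt by blast
    then have "t \<in> filt a" by (simp add: filt_def)
    then have "t \<in> filt b" using s by blast
    then show "b l \<le> a l" using t by (simp add: filt_def)
  qed
qed

lemma through_proj_filt:
  "through_proj n d a b \<longleftrightarrow> (\<exists>t\<in>filt b. \<forall>u\<in>filt a. u = t \<or> u \<ge> t + 2)"
proof
  assume "through_proj n d a b"
  then obtain m where m: "m < n" "\<forall>l<n. d m l + b m \<le> a l" by (auto simp: through_proj_def)
  obtain t where t: "c t = m" "w t = b m" using pt m by blast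
  have "u = t \<or> u \<ge> t + 2" if "u \<in> filt a" for u
    using m(2)[rule_format, of "c u"] that le_iff[of t u] t by (auto simp: filt_def)
  then show "\<exists>t\<in>filt b. \<forall>u\<in>filt a. u = t \<or> u \<ge> t + 2" using t by (intro bexI[of _ t]) (auto simp: filt_def)
next
  assume "\<exists>t\<in>filt b. \<forall>u\<in>filt a. u = t \<or> u \<ge> t + 2"
  then obtain t where t: "b (c t) \<le> w t" "\<And>u. u \<in> filt a \<Longrightarrow> u = t \<or> u \<ge> t + 2" by (auto simp: filt_def)
  have "d (c t) l + b (c t) \<le> a l" if l: "l < n" for l
  proof -
    obtain u where u: "c u = l" "w u = a l" using pt l by blast
    then have "u = t \<or> u \<ge> t + 2" by (intro t) (simp add: filt_def)
    then show ?thesis using le_iff[of t u] u t(1) by auto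
  qed
  then show "through_proj n d a b" unfolding through_proj_def using c_less by blast
qed

lemma filt_up: assumes "lattice_vec n d a" "t \<in> filt a" "u \<ge> t + 2" shows "u \<in> filt a"
proof -
  have "a (c u) \<le> a (c t) + d (c t) (c u)" using assms(1) by (simp add: lattice_vec_def)
  then show ?thesis using le_iff[of t u] assms by (simp add: filt_def)
qed

lemma filt_has_least: assumes a: "lattice_vec n d a" obtains t where "t \<in> filt a" "\<And>u. u \<in> filt a \<Longrightarrow> t \<le> u"
proof -
  have n0: "0 < n" using n_pos by simp
  obtain t1 where t1: "c t1 = 0" "w t1 = a 0" using pt[OF n0] by blast
  obtain t0 where t0: "c t0 = 0" "w t0 = Min ((\<lambda>l. a l - d 0 l) ` {..<n})" using pt[OF n0] by blast
  have mem: "t1 \<in> filt a" using t1 by (simp add: filt_def)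
  have lb: "t0 \<le> u" if "u \<in> filt a" for u
  proof -
    have "w t0 \<le> a (c u) - d 0 (c u)" unfolding t0(2) by (rule Min_le) auto
    moreover have "a (c u) \<le> w u" using that by (simp add: filt_def)
    ultimately have "d (c t0) (c u) \<le> w u - w t0" unfolding t0(1) by linarith
    then show ?thesis using le_iff by auto
  qed
  define k where "k = (LEAST k. t0 + int k \<in> filt a)"
  have "t0 + int (nat (t1 - t0)) \<in> filt a" using mem lb[OF mem] by simp
  then have k: "t0 + int k \<in> filt a" unfolding k_def by (rule LeastI)
  have "t0 + int k \<le> u" if "u \<in> filt a" for u
  proof -
    have "t0 + int (nat (u - t0)) \<in> filt a" using that lb[OF that] by simp
    then have "k \<le> nat (u - t0)" unfolding k_def by (rule Least_le)
    then show ?thesis using lb[OF that] by linarith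
  qed
  then show ?thesis using that k by blast
qed

text \<open>
  Filters of the ladder with least element \<open>t\<close> are \<open>{t} \<union> {t + 2..}\<close>, which is principal, and \<open>{t..}\<close>.
\<close>

lemma filt_shape:
  assumes a: "lattice_vec n d a" and t: "t \<in> filt a" "\<And>u. u \<in> filt a \<Longrightarrow> t \<le> u"
  shows "through_proj n d a a \<longleftrightarrow> t + 1 \<notin> filt a"
    "\<not> through_proj n d a a \<Longrightarrow> filt a = {t..}"
proof -
  show i: "through_proj n d a a \<longleftrightarrow> t + 1 \<notin> filt a"
  proof
    assume "through_proj n d a a"
    then obtain s where s: "s \<in> filt a" "\<And>u. u \<in> filt a \<Longrightarrow> u = s \<or> u \<ge> s + 2"
      unfolding through_proj_filt by blast
    then have "s = t" using t(2)[OF s(1)] s(2)[OF t(1)] by linarith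
    then show "t + 1 \<notin> filt a" using s(2)[of "t + 1"] by auto
  next
    assume n: "t + 1 \<notin> filt a"
    have "u = t \<or> u \<ge> t + 2" if "u \<in> filt a" for u
    proof -
      have "u \<noteq> t + 1" using n that by blast
      then show ?thesis using t(2)[OF that] by linarith
    qed
    then show "through_proj n d a a" unfolding through_proj_filt using t(1) by blast
  qed
  assume "\<not> through_proj n d a a"
  then have t1: "t + 1 \<in> filt a" using i by blast
  show "filt a = {t..}"
  proof
    show "filt a \<subseteq> {t..}" using t by auto
    show "{t..} \<subseteq> filt a"
    proof
      fix u assume "u \<in> {t..}"
      then have "u = t \<or> u = t + 1 \<or> u \<ge> t + 2" by auto
      then show "u \<in> filt a" using t(1) t1 filt_up[OF a t(1)] by blast
    qed
  qed
qed

lemma stable_hom_adjacent: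
  assumes a: "filt a = {t + 1..}" and b: "filt b = {t..}"
  shows "stable_hom n d a b" "\<not> stable_hom n d b a"
proof -
  have "\<not> through_proj n d a b"
  proof
    assume "through_proj n d a b"
    then obtain s where s: "s \<in> filt b" "\<And>u. u \<in> filt a \<Longrightarrow> u = s \<or> u \<ge> s + 2"
      unfolding through_proj_filt by blast
    then have "t \<le> s" using b by auto
    then show False using s(2)[of "s + 1"] unfolding a by auto
  qed
  then show "stable_hom n d a b" unfolding stable_hom_def le_iff_filt a b by auto
  show "\<not> stable_hom n d b a" unfolding stable_hom_def le_iff_filt a b by auto
qed

text \<open>
  The truncated summand is the row module intersected with the principal filter of the point
  \<open>(\<nu> i, -j)\<close>. The bound on \<open>v\<close> holds since the intersection misses the point \<open>(i, 0)\<close>.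
\<close>

lemma filt_V_Some:
  assumes s: "Some (i, j) \<in> V_index n d" and m: "\<And>u. u \<in> filt (V_exp n d None) \<Longrightarrow> t \<le> u"
  obtains v where "c v = \<nu> i" "w v = - j" "v \<notin> filt (V_exp n d None)" "v \<ge> t - 1"
    "\<And>u. u \<in> filt (V_exp n d (Some (i, j))) \<longleftrightarrow> u \<in> filt (V_exp n d None) \<and> (u = v \<or> u \<ge> v + 2)"
proof -
  have i: "i < n" and j: "1 \<le> j" "j < d (\<nu> i) i" using s by (simp_all add: V_index_Some)
  obtain v where v: "c v = \<nu> i" "w v = - j" using pt[of "\<nu> i"] i by auto
  have mem: "u \<in> filt (V_exp n d (Some (i, j))) \<longleftrightarrow> u \<in> filt (V_exp n d None) \<and> (u = v \<or> u \<ge> v + 2)" for u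
    using le_iff[of v u] v by (auto simp: filt_def)
  have "v \<ge> t - 1"
  proof (rule ccontr)
    assume less: "\<not> v \<ge> t - 1"
    obtain u where u: "c u = i" "w u = 0" using pt i by blast
    then have uF: "u \<in> filt (V_exp n d None)" by (simp add: filt_def)
    then have "u \<ge> v + 2" using m[OF uF] less by linarith
    then have "u \<in> filt (V_exp n d (Some (i, j)))" using mem uF by blast
    then show False using u j by (simp add: filt_def)
  qed
  then show ?thesis using that[of v] v mem j by (auto simp: filt_def)
qed

end

text \<open>
  If the row module is not projective it is \<open>{t..}\<close>, and the other summand can only be \<open>{t + 1..}\<close>. If it is
  \<open>{t} \<union> {t + 2..}\<close>, the two truncated summands are its intersections with the filters of \<open>t - 1\<close> and
  \<open>t + 1\<close>, namely \<open>{t + 2..}\<close> and \<open>{t + 3..}\<close>. Two adjacent filters have stable maps in one direction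
  only.
\<close>

lemma (in N_gorenstein_tiled) V_nonproj_excess_two:
  assumes T: "nak_sum = int n + 1"
  shows "\<exists>s t. s \<noteq> t \<and> V_nonproj n d = {s, t} \<and> stable_hom n d (V_exp n d s) (V_exp n d t)
    \<and> \<not> stable_hom n d (V_exp n d t) (V_exp n d s)"
proof -
  obtain c w where "ladder c w" using ex_ladder[OF T] by blast
  then interpret ladder_order n d \<nu> c w by unfold_locales
  have card: "card (V_nonproj n d) = 2" using card_V_nonproj T by simp
  have lat: "lattice_vec n d (V_exp n d s)" if "s \<in> V_nonproj n d" for s
    using that lattice_V_exp by (simp add: V_nonproj_def)
  have np: "\<not> through_proj n d (V_exp n d s) (V_exp n d s)" if "s \<in> V_nonproj n d" for s
    using that by (simp add: V_nonproj_def)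
  let ?F = "filt (V_exp n d None)"
  obtain t where t: "t \<in> ?F" "\<And>u. u \<in> ?F \<Longrightarrow> t \<le> u"
    using filt_has_least[OF lattice_V_exp[OF V_index_None]] by blast
  note shape = filt_shape[OF lattice_V_exp[OF V_index_None] t]
  obtain s1 s2 where s: "V_nonproj n d = {s1, s2}" "s1 \<noteq> s2" using card by (auto simp: card_2_iff)
  have goal: ?thesis if "s \<in> V_nonproj n d" "s' \<in> V_nonproj n d" 
    "filt (V_exp n d s) = {k + 1..}" "filt (V_exp n d s') = {k..}" for s s' k
  proof -
    have "s \<noteq> s'" using that(3,4) by auto
    moreover from this have "V_nonproj n d = {s, s'}" using s that(1,2) by auto
    ultimately show ?thesis using stable_hom_adjacent[OF that(3,4)] by blast
  qed
  show ?thesis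
  proof (cases "None \<in> V_nonproj n d")
    case True
    then have F: "?F = {t..}" using shape np by blast
    obtain i j where ij: "Some (i, j) \<in> V_nonproj n d" using s True by (metis insertCI option.exhaust surj_pair)
    then have "Some (i, j) \<in> V_index n d" by (simp add: V_nonproj_def)
    then obtain v where v: "v \<notin> ?F" "v \<ge> t - 1"
      "\<And>u. u \<in> filt (V_exp n d (Some (i, j))) \<longleftrightarrow> u \<in> ?F \<and> (u = v \<or> u \<ge> v + 2)"
      using filt_V_Some[of i j t] t(2) by metis
    have "v = t - 1" using v(1,2) unfolding F atLeast_iff by linarith
    have "u \<in> filt (V_exp n d (Some (i, j))) \<longleftrightarrow> t + 1 \<le> u" for u
      using v(3)[of u] \<open>v = t - 1\<close> unfolding F atLeast_iff by linarith
    then have "filt (V_exp n d (Some (i, j))) = {t + 1..}" by (simp add: set_eq_iff)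
    then show ?thesis using goal[OF ij True] F by blast
  next
    case False
    then have "through_proj n d (V_exp n d None) (V_exp n d None)" by (simp add: V_nonproj_def)
    then have t1: "t + 1 \<notin> ?F" using shape by blast
    have F: "u \<in> ?F \<longleftrightarrow> u = t \<or> u \<ge> t + 2" for u
    proof
      assume u: "u \<in> ?F"
      then have "u \<noteq> t + 1" using t1 by blast
      then show "u = t \<or> u \<ge> t + 2" using t(2)[OF u] by linarith
    qed (use t(1) filt_up[OF lattice_V_exp[OF V_index_None] t(1)] in blast)
    have ex: "\<exists>i j v. s = Some (i, j) \<and> c v = \<nu> i \<and> w v = - j \<and> 
      (v = t - 1 \<and> filt (V_exp n d s) = {t + 2..} \<or> v = t + 1 \<and> filt (V_exp n d s) = {t + 3..})"
      if sN: "s \<in> V_nonproj n d" for s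
    proof -
      obtain i j where ij: "s = Some (i, j)" using sN False by (metis option.exhaust surj_pair)
      then have "Some (i, j) \<in> V_index n d" using sN by (simp add: V_nonproj_def)
      then obtain v where v: "c v = \<nu> i" "w v = - j" "v \<notin> ?F" "v \<ge> t - 1"
        "\<And>u. u \<in> filt (V_exp n d (Some (i, j))) \<longleftrightarrow> u \<in> ?F \<and> (u = v \<or> u \<ge> v + 2)"
        using filt_V_Some[of i j t] t(2) by metis
      have "v \<noteq> t" "\<not> v \<ge> t + 2" using v(3) F by blast+
      then have "v = t - 1 \<or> v = t + 1" using v(4) by linarith
      moreover have "filt (V_exp n d s) = {t + 2..}" if "v = t - 1"
      proof (rule Set.set_eqI)
        show "u \<in> filt (V_exp n d s) \<longleftrightarrow> u \<in> {t + 2..}" for u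
          using v(5)[of u] F[of u] that unfolding ij atLeast_iff by linarith
      qed
      moreover have "filt (V_exp n d s) = {t + 3..}" if "v = t + 1"
      proof (rule Set.set_eqI)
        show "u \<in> filt (V_exp n d s) \<longleftrightarrow> u \<in> {t + 3..}" for u
          using v(5)[of u] F[of u] that unfolding ij atLeast_iff by linarith
      qed
      ultimately show ?thesis using ij v(1,2) by blast
    qed
    obtain i1 j1 v1 where 1: "s1 = Some (i1, j1)" "c v1 = \<nu> i1" "w v1 = - j1"
      "v1 = t - 1 \<and> filt (V_exp n d s1) = {t + 2..} \<or> v1 = t + 1 \<and> filt (V_exp n d s1) = {t + 3..}"
      using ex[of s1] s by blast
    obtain i2 j2 v2 where 2: "s2 = Some (i2, j2)" "c v2 = \<nu> i2" "w v2 = - j2"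
      "v2 = t - 1 \<and> filt (V_exp n d s2) = {t + 2..} \<or> v2 = t + 1 \<and> filt (V_exp n d s2) = {t + 3..}"
      using ex[of s2] s by blast
    have "v1 \<noteq> v2" using 1(1-3) 2(1-3) s(2) by auto
    then have "filt (V_exp n d s1) = {t + 2 + 1..} \<and> filt (V_exp n d s2) = {t + 2..} \<or>
      filt (V_exp n d s2) = {t + 2 + 1..} \<and> filt (V_exp n d s1) = {t + 2..}" using 1(4) 2(4) by auto
    then show ?thesis using goal[of s1 s2 "t + 2"] goal[of s2 s1 "t + 2"] s(1) by blast
  qed
qed

section \<open>Exponent matrices with only projective lattices\<close>

definition all_projective :: "nat \<Rightarrow> (nat \<Rightarrow> nat \<Rightarrow> int) \<Rightarrow> bool"
  where "all_projective n d \<longleftrightarrow> (\<forall>a. lattice_vec n d a \<longrightarrow> through_proj n d a a)"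

text \<open>
  In the normal form, a lattice vector decreases along the indices by at most one in total, so it
  takes at most two neighbouring values; the first index with the smaller value gives the
  projective module.
\<close>

lemma all_projective_hereditary:
  assumes "exponent_matrix n d" "conjugate_orders n d n exp_hereditary"
  shows "all_projective n d"
  unfolding all_projective_def
proof (intro allI impI)
  fix a assume a: "lattice_vec n d a"
  obtain \<sigma> l where perm: "\<sigma> permutes {..<n}"
    and e: "\<And>i j. \<lbrakk>i < n; j < n\<rbrakk> \<Longrightarrow> exp_hereditary (\<sigma> i) (\<sigma> j) = d i j + l i - l j"
    using assms(2) unfolding conjugate_orders_def by blast
  have n0: "0 < n" using assms(1) by (simp add: exponent_matrix_def)
  let ?\<mu> = "inv_into UNIV \<sigma>"
  have inv [simp]: "\<sigma> (?\<mu> i) = i" "?\<mu> (\<sigma> i) = i" for i using permutes_inverses[OF perm] by auto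
  have less [simp]: "\<sigma> i < n \<longleftrightarrow> i < n" "?\<mu> i < n \<longleftrightarrow> i < n" for i
    using permutes_in_image[OF perm, of i] permutes_in_image[OF permutes_inv[OF perm], of i] by auto
  define b where "b i = a (?\<mu> i) - l (?\<mu> i)" for i
  have b: "b j \<le> b i + exp_hereditary i j" if "i < n" "j < n" for i j
    using a e[of "?\<mu> i" "?\<mu> j"] that by (simp add: lattice_vec_def b_def)
  define m where "m = (LEAST i. i < n \<and> b i = b (n - 1))"
  have m: "m < n \<and> b m = b (n - 1)" unfolding m_def by (rule LeastI[of _ "n - 1"]) (use n0 in auto)
  have H: "exp_hereditary m i + b m \<le> b i" if i: "i < n" for i
  proof (cases "i < m")
    case True
    then have "b i \<noteq> b (n - 1)" using not_less_Least[of i "\<lambda>i. i < n \<and> b i = b (n - 1)"] i by (auto simp: m_def)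
    moreover have "b (n - 1) \<le> b i" using b[of i "n - 1"] i by (auto simp: exp_hereditary_def split: if_splits)
    ultimately show ?thesis using m by (simp add: exp_hereditary_def)
  next
    case False
    then show ?thesis using b[of i "n - 1"] i m by (auto simp: exp_hereditary_def split: if_splits)
  qed
  have "d (?\<mu> m) k + a (?\<mu> m) \<le> a k" if "k < n" for k
    using H[of "\<sigma> k"] that m e[of "?\<mu> m" k] by (simp add: b_def)
  then show "through_proj n d a a" unfolding through_proj_def using m by (intro exI[of _ "?\<mu> m"]) auto
qed

text \<open>
  The transpose of the hereditary matrix is the hereditary matrix for the opposite order of the indices.
\<close>

lemma conjugate_hereditary_transpose:
  assumes "conjugate_orders n d n exp_hereditary"
  shows "conjugate_orders n (\<lambda>i j. d j i) n exp_hereditary"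
proof -
  obtain \<sigma> l where perm: "\<sigma> permutes {..<n}"
    and e: "\<forall>i<n. \<forall>j<n. exp_hereditary (\<sigma> i) (\<sigma> j) = d i j + l i - l j"
    using assms unfolding conjugate_orders_def by blast
  have less: "\<sigma> i < n" if "i < n" for i using permutes_in_image[OF perm, of i] that by simp
  define \<tau> where "\<tau> i = (if i < n then n - 1 - \<sigma> i else i)" for i
  have "\<tau> permutes {..<n}"
  proof (rule inj_self_map_permutes)
    show "inj_on \<tau> {..<n}"
    proof (rule inj_onI)
      fix i j assume ij: "i \<in> {..<n}" "j \<in> {..<n}" "\<tau> i = \<tau> j"
      then have "\<sigma> i = \<sigma> j" using less[of i] less[of j] by (auto simp: \<tau>_def)
      then show "i = j" using permutes_inj[OF perm] by (auto dest: injD)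
    qed
  qed (auto simp: \<tau>_def)
  moreover have "exp_hereditary (\<tau> i) (\<tau> j) = d j i + (- l i) - (- l j)" if "i < n" "j < n" for i j
  proof -
    have "exp_hereditary (\<tau> i) (\<tau> j) = exp_hereditary (\<sigma> j) (\<sigma> i)"
      using that less[of i] less[of j] by (auto simp: exp_hereditary_def \<tau>_def)
    then show ?thesis using e that by simp
  qed
  ultimately show ?thesis unfolding conjugate_orders_def
    by (intro conjI exI[of _ \<tau>] exI[of _ "\<lambda>i. - l i"]) auto
qed

lemma exponent_matrix_transpose:
  "exponent_matrix n d \<Longrightarrow> exponent_matrix n (\<lambda>i j. d j i)"
  unfolding exponent_matrix_def by (metis add.commute)

section \<open>Laurent polynomials\<close>

abbreviation lookup :: "'k :: field laurent \<Rightarrow> int \<Rightarrow> 'k"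
  where "lookup \<equiv> Poly_Mapping.lookup"

lemma lookup_lmonom_mult: "lookup (lmonom i c * f) j = c * lookup f (j - i)"
  for f :: "'k :: field laurent"
proof -
  have "(j = i + q) = (j - i = q)" for q by auto
  then show ?thesis by (simp add: lookup_mult lookup_single when_mult)
qed

text \<open>
  The set \<open>x\<^bsup>a\<^esup> R\<close> inside \<open>K\<close>.
\<close>

definition order_ge :: "int \<Rightarrow> 'k :: field laurent set"
  where "order_ge a = {f. \<forall>i. lookup f i \<noteq> 0 \<longrightarrow> a \<le> i}"

lemma order_geD: "\<lbrakk>f \<in> order_ge a; i < a\<rbrakk> \<Longrightarrow> lookup f i = 0"
  by (force simp: order_ge_def)

lemma order_ge_zero [simp]: "0 \<in> order_ge a" by (simp add: order_ge_def)

lemma order_ge_lmonom [simp]: "lmonom i c \<in> order_ge a \<longleftrightarrow> c = 0 \<or> a \<le> i"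
  by (auto simp: order_ge_def lookup_single when_def)

lemma order_ge_add: "\<lbrakk>f \<in> order_ge a; g \<in> order_ge a\<rbrakk> \<Longrightarrow> f + g \<in> order_ge a"
  unfolding order_ge_def lookup_add mem_Collect_eq by (metis add.right_neutral)

lemma order_ge_uminus: "f \<in> order_ge a \<Longrightarrow> - f \<in> order_ge a"
  by (simp add: order_ge_def)

lemma order_ge_sum: "(\<And>i. i \<in> I \<Longrightarrow> f i \<in> order_ge a) \<Longrightarrow> (\<Sum>i\<in>I. f i) \<in> order_ge a"
  by (induction I rule: infinite_finite_induct) (auto intro: order_ge_add)

lemma order_ge_mono: "\<lbrakk>f \<in> order_ge a; b \<le> a\<rbrakk> \<Longrightarrow> f \<in> order_ge b"
  by (force simp: order_ge_def)

lemma order_ge_mult: assumes "f \<in> order_ge a" "g \<in> order_ge b" shows "f * g \<in> order_ge (a + b)"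
proof -
  have "a + b \<le> k" if "k \<in> Poly_Mapping.keys (f * g)" for k
  proof -
    obtain i j where "i \<in> Poly_Mapping.keys f" "j \<in> Poly_Mapping.keys g" "k = i + j"
      using \<open>k \<in> _\<close> keys_mult[of f g] by blast
    then show ?thesis using assms by (force simp: order_ge_def in_keys_iff)
  qed
  then show ?thesis by (auto simp: order_ge_def in_keys_iff)
qed

lemma order_ge_mult_le: "\<lbrakk>f \<in> order_ge a; g \<in> order_ge b; c \<le> a + b\<rbrakk> \<Longrightarrow> f * g \<in> order_ge c"
  by (rule order_ge_mono[OF order_ge_mult])

lemma poly_part_eq: "poly_part = order_ge 0"
  by (force simp: poly_part_def order_ge_def in_keys_iff)

lemma lmonom_mult_iff: "lmonom i 1 * f \<in> order_ge a \<longleftrightarrow> f \<in> order_ge (a - i)"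
proof -
  have "(\<forall>j. lookup f (j - i) \<noteq> 0 \<longrightarrow> a \<le> j) \<longleftrightarrow> (\<forall>j. lookup f j \<noteq> 0 \<longrightarrow> a - i \<le> j)"
    by (metis add_diff_cancel_right' diff_le_eq diff_add_cancel)
  then show ?thesis by (simp add: order_ge_def lookup_lmonom_mult)
qed

lemma order_ge_iff_poly_part: "f \<in> order_ge a \<longleftrightarrow> (\<exists>r\<in>poly_part. f = r * lmonom a 1)"
proof
  assume f: "f \<in> order_ge a"
  then have "lmonom (- a) 1 * f \<in> poly_part" by (simp add: poly_part_eq lmonom_mult_iff)
  moreover have "f = (lmonom (- a) 1 * f) * lmonom a 1"
    by (simp add: mult.commute[of _ "lmonom a 1"] mult.assoc[symmetric] mult_single)
  ultimately show "\<exists>r\<in>poly_part. f = r * lmonom a 1" by blast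
qed (auto simp: poly_part_eq intro: order_ge_mult_le)

lemma lmonom_inverse [simp]: "lmonom i 1 * (lmonom (- i) 1 * f) = f" "lmonom (- i) 1 * (lmonom i 1 * f) = f"
  for f :: "'k :: field laurent"
  by (simp_all add: mult.assoc[symmetric] mult_single)

lemma lmonom_eq_iff: "(\<exists>c. f = lmonom l c) \<longleftrightarrow> (\<forall>i. i \<noteq> l \<longrightarrow> lookup f i = 0)"
proof
  assume "\<forall>i. i \<noteq> l \<longrightarrow> lookup f i = 0"
  then have "f = lmonom l (lookup f l)" by (intro poly_mapping_eqI) (auto simp: lookup_single when_def)
  then show "\<exists>c. f = lmonom l c" by blast
qed (auto simp: lookup_single when_def)

section \<open>The ring of a tiled order\<close>

lemma tiled_carrier_iff:
  "a \<in> tiled_order_carrier n d \<longleftrightarrow> a \<in> carrier_mat n n \<and> (\<forall>i<n. \<forall>j<n. a $$ (i, j) \<in> order_ge (d i j))"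
  by (auto simp: tiled_order_carrier_def order_ge_iff_poly_part)

lemma mat_mult_index:
  "\<lbrakk>a \<in> carrier_mat r n; b \<in> carrier_mat n m; i < r; j < m\<rbrakk> \<Longrightarrow>
   (a * b) $$ (i, j) = (\<Sum>k<n. a $$ (i, k) * b $$ (k, j))"
  by (auto simp: scalar_prod_def lessThan_atLeast0 intro!: sum.cong)

lemma tiled_order_simps [simp]:
  "carrier (tiled_order n d) = tiled_order_carrier n d" "monoid.mult (tiled_order n d) = (*)"
  "one (tiled_order n d) = 1\<^sub>m n" "zero (tiled_order n d) = 0\<^sub>m n n" "add (tiled_order n d) = (+)"
  "acomp (tiled_order n d) l = {a \<in> tiled_order_carrier n d. homogeneous_mat l a}"
  "module.smult (tiled_order n d) c a = lmonom 0 c \<cdot>\<^sub>m a"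
  by (simp_all add: tiled_order_def)

lemma tiled_carrier_mat: "a \<in> tiled_order_carrier n d \<Longrightarrow> a \<in> carrier_mat n n"
  by (simp add: tiled_carrier_iff)

lemma tiled_mult_closed:
  assumes ex: "exponent_matrix n d" and a: "a \<in> tiled_order_carrier n d" and b: "b \<in> tiled_order_carrier n d"
  shows "a * b \<in> tiled_order_carrier n d"
  unfolding tiled_carrier_iff
proof (intro conjI allI impI)
  note am = tiled_carrier_mat[OF a] and bm = tiled_carrier_mat[OF b]
  show "a * b \<in> carrier_mat n n" using am bm by simp
  fix i j assume ij: "i < n" "j < n"
  have "a $$ (i, k) * b $$ (k, j) \<in> order_ge (d i j)" if "k < n" for k
    using a b ij that ex by (intro order_ge_mult_le[of _ "d i k" _ "d k j"]) (auto simp: tiled_carrier_iff exponent_matrix_def)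
  then show "(a * b) $$ (i, j) \<in> order_ge (d i j)"
    unfolding mat_mult_index[OF am bm ij] by (intro order_ge_sum) auto
qed

lemma tiled_one_closed: "exponent_matrix n d \<Longrightarrow> 1\<^sub>m n \<in> tiled_order_carrier n d"
  by (auto simp: tiled_carrier_iff exponent_matrix_def single_one[symmetric] simp del: single_one)

lemma tiled_add_closed:
  "\<lbrakk>a \<in> tiled_order_carrier n d; b \<in> tiled_order_carrier n d\<rbrakk> \<Longrightarrow> a + b \<in> tiled_order_carrier n d"
  by (auto simp: tiled_carrier_iff intro!: order_ge_add)

lemma tiled_uminus_closed: "a \<in> tiled_order_carrier n d \<Longrightarrow> - a \<in> tiled_order_carrier n d"
  by (auto simp: tiled_carrier_iff intro!: order_ge_uminus)

lemma tiled_smult_closed: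
  assumes "r \<in> order_ge 0" "a \<in> tiled_order_carrier n d" shows "r \<cdot>\<^sub>m a \<in> tiled_order_carrier n d"
  unfolding tiled_carrier_iff
proof (intro conjI allI impI)
  fix i j assume ij: "i < n" "j < n"
  have "r * a $$ (i, j) \<in> order_ge (d i j)"
    by (rule order_ge_mult_le[OF assms(1)]) (use assms(2) ij in \<open>auto simp: tiled_carrier_iff\<close>)
  then show "(r \<cdot>\<^sub>m a) $$ (i, j) \<in> order_ge (d i j)"
    using ij carrier_matD[OF tiled_carrier_mat[OF assms(2)]] by simp
qed (use assms in \<open>auto simp: tiled_carrier_iff\<close>)

lemma ring_tiled_order:
  assumes ex: "exponent_matrix n d"
  shows "ring (tiled_order n d :: ('k :: field, 'k laurent mat) graded_algebra)" (is "ring ?A")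
proof (rule ringI)
  have c: "x \<in> carrier_mat n n" if "x \<in> carrier ?A" for x using that by (simp add: tiled_carrier_iff)
  show "abelian_group ?A"
  proof (rule abelian_groupI)
    fix x y z assume x: "x \<in> carrier ?A" and y: "y \<in> carrier ?A" and z: "z \<in> carrier ?A"
    show "x \<oplus>\<^bsub>?A\<^esub> y \<in> carrier ?A" using x y by (simp add: tiled_add_closed)
    show "x \<oplus>\<^bsub>?A\<^esub> y \<oplus>\<^bsub>?A\<^esub> z = x \<oplus>\<^bsub>?A\<^esub> (y \<oplus>\<^bsub>?A\<^esub> z)"
      using assoc_add_mat[OF c[OF x] c[OF y] c[OF z]] by simp
    show "x \<oplus>\<^bsub>?A\<^esub> y = y \<oplus>\<^bsub>?A\<^esub> x" using comm_add_mat[OF c[OF x] c[OF y]] by simp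
    show "\<zero>\<^bsub>?A\<^esub> \<oplus>\<^bsub>?A\<^esub> x = x" using c[OF x] by simp
    have "- x \<oplus>\<^bsub>?A\<^esub> x = \<zero>\<^bsub>?A\<^esub>" using uminus_l_inv_mat[OF c[OF x]] by simp
    then show "\<exists>y\<in>carrier ?A. y \<oplus>\<^bsub>?A\<^esub> x = \<zero>\<^bsub>?A\<^esub>" using tiled_uminus_closed x by (metis tiled_order_simps(1))
  qed (simp add: tiled_carrier_iff)
  show "Group.monoid ?A"
  proof (rule monoidI)
    fix x y z assume x: "x \<in> carrier ?A" and y: "y \<in> carrier ?A" and z: "z \<in> carrier ?A"
    show "x \<otimes>\<^bsub>?A\<^esub> y \<in> carrier ?A" using x y tiled_mult_closed[OF ex] by simp
    show "x \<otimes>\<^bsub>?A\<^esub> y \<otimes>\<^bsub>?A\<^esub> z = x \<otimes>\<^bsub>?A\<^esub> (y \<otimes>\<^bsub>?A\<^esub> z)"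
      using assoc_mult_mat[OF c[OF x] c[OF y] c[OF z]] by simp
    show "\<one>\<^bsub>?A\<^esub> \<otimes>\<^bsub>?A\<^esub> x = x" "x \<otimes>\<^bsub>?A\<^esub> \<one>\<^bsub>?A\<^esub> = x" using c[OF x] by simp_all
  qed (simp add: tiled_one_closed[OF ex])
  fix x y z assume x: "x \<in> carrier ?A" and y: "y \<in> carrier ?A" and z: "z \<in> carrier ?A"
  show "(x \<oplus>\<^bsub>?A\<^esub> y) \<otimes>\<^bsub>?A\<^esub> z = x \<otimes>\<^bsub>?A\<^esub> z \<oplus>\<^bsub>?A\<^esub> y \<otimes>\<^bsub>?A\<^esub> z"
    using add_mult_distrib_mat[OF c[OF x] c[OF y] c[OF z]] by simp
  show "z \<otimes>\<^bsub>?A\<^esub> (x \<oplus>\<^bsub>?A\<^esub> y) = z \<otimes>\<^bsub>?A\<^esub> x \<oplus>\<^bsub>?A\<^esub> z \<otimes>\<^bsub>?A\<^esub> y"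
    using mult_add_distrib_mat[OF c[OF z] c[OF x] c[OF y]] by simp
qed

definition unit_mat :: "nat \<Rightarrow> 'k :: field laurent \<Rightarrow> nat \<Rightarrow> nat \<Rightarrow> 'k laurent mat"
  where "unit_mat n f i j = mat n n (\<lambda>(r, c). if r = i \<and> c = j then f else 0)"

lemma unit_mat_carrier [simp]: "unit_mat n f i j \<in> carrier_mat n n" by (simp add: unit_mat_def)

lemma unit_mat_index [simp]:
  "\<lbrakk>r < n; c < n\<rbrakk> \<Longrightarrow> unit_mat n f i j $$ (r, c) = (if r = i \<and> c = j then f else 0)"
  by (simp add: unit_mat_def)

lemma unit_mat_in_tiled: "f \<in> order_ge (d i j) \<Longrightarrow> unit_mat n f i j \<in> tiled_order_carrier n d"
  by (simp add: tiled_carrier_iff)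

lemma sum_unit_mat:
  assumes "i < n" "l < n"
  shows "(\<Sum>m<n. g m * unit_mat n f i j $$ (m, l)) = (if l = j then g i * f else 0)"
proof -
  have "(\<Sum>m<n. g m * unit_mat n f i j $$ (m, l)) = (\<Sum>m<n. if m = i then (if l = j then g i * f else 0) else 0)"
    using assms by (intro sum.cong) auto
  then show ?thesis using assms by simp
qed

section \<open>Modules with coordinates\<close>

text \<open>
  Modules that are, through the coordinates \<open>crd\<close>, a direct sum of lattices of rank one: row \<open>s \<in> S\<close>
  consists of the vectors over \<open>K\<close> with entries in \<open>x\<^bsup>a s l\<^esup> R\<close>, and \<open>A\<close> acts by matrix multiplication. Both \<open>V\<close>
  and the free modules have this form, with rather different element types, so that their
  homomorphisms are determined once for all.
\<close>

locale coord_module =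
  fixes n :: nat and d :: "nat \<Rightarrow> nat \<Rightarrow> int"
    and M :: "('k :: field laurent mat, 'm) graded_rmod"
    and S :: "'s set" and a :: "'s \<Rightarrow> nat \<Rightarrow> int" and crd :: "'m \<Rightarrow> 's \<Rightarrow> nat \<Rightarrow> 'k laurent"
  assumes exp: "exponent_matrix n d"
    and finS: "finite S"
    and lat: "s \<in> S \<Longrightarrow> lattice_vec n d (a s)"
    and crd_ge: "\<lbrakk>x \<in> carrier M; s \<in> S; l < n\<rbrakk> \<Longrightarrow> crd x s l \<in> order_ge (a s l)"
    and crd_eqI: "\<lbrakk>x \<in> carrier M; y \<in> carrier M; \<And>s l. \<lbrakk>s \<in> S; l < n\<rbrakk> \<Longrightarrow> crd x s l = crd y s l\<rbrakk> \<Longrightarrow> x = y"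
    and crd_surj: "(\<And>s l. \<lbrakk>s \<in> S; l < n\<rbrakk> \<Longrightarrow> f s l \<in> order_ge (a s l)) \<Longrightarrow>
          \<exists>x\<in>carrier M. \<forall>s\<in>S. \<forall>l<n. crd x s l = f s l"
    and zero_in: "\<zero>\<^bsub>M\<^esub> \<in> carrier M"
    and crd_zero: "\<lbrakk>s \<in> S; l < n\<rbrakk> \<Longrightarrow> crd \<zero>\<^bsub>M\<^esub> s l = 0"
    and add_in: "\<lbrakk>x \<in> carrier M; y \<in> carrier M\<rbrakk> \<Longrightarrow> x \<oplus>\<^bsub>M\<^esub> y \<in> carrier M"
    and crd_add: "\<lbrakk>x \<in> carrier M; y \<in> carrier M; s \<in> S; l < n\<rbrakk> \<Longrightarrow> crd (x \<oplus>\<^bsub>M\<^esub> y) s l = crd x s l + crd y s l"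
    and ract_in: "\<lbrakk>x \<in> carrier M; b \<in> tiled_order_carrier n d\<rbrakk> \<Longrightarrow> ract M x b \<in> carrier M"
    and crd_ract: "\<lbrakk>x \<in> carrier M; b \<in> tiled_order_carrier n d; s \<in> S; l < n\<rbrakk> \<Longrightarrow>
          crd (ract M x b) s l = (\<Sum>m<n. crd x s m * b $$ (m, l))"
    and mcomp_iff: "x \<in> mcomp M j \<longleftrightarrow> x \<in> carrier M \<and> (\<forall>s\<in>S. \<forall>m<n. \<exists>c. crd x s m = lmonom j c)"
begin

abbreviation (input) A :: "('k, 'k laurent mat) graded_algebra" where "A \<equiv> tiled_order n d"

definition mk :: "('s \<Rightarrow> nat \<Rightarrow> 'k laurent) \<Rightarrow> 'm"
  where "mk f = (SOME x. x \<in> carrier M \<and> (\<forall>s\<in>S. \<forall>l<n. crd x s l = f s l))"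

lemma n_pos: "0 < n" and d_diag [simp]: "i < n \<Longrightarrow> d i i = 0" using exp by (auto simp: exponent_matrix_def)

lemma mk:
  assumes "\<And>s l. \<lbrakk>s \<in> S; l < n\<rbrakk> \<Longrightarrow> f s l \<in> order_ge (a s l)"
  shows "mk f \<in> carrier M" "\<And>s l. \<lbrakk>s \<in> S; l < n\<rbrakk> \<Longrightarrow> crd (mk f) s l = f s l"
proof -
  have "\<exists>x. x \<in> carrier M \<and> (\<forall>s\<in>S. \<forall>l<n. crd x s l = f s l)" using crd_surj[of f] assms by blast
  then have "mk f \<in> carrier M \<and> (\<forall>s\<in>S. \<forall>l<n. crd (mk f) s l = f s l)" unfolding mk_def by (rule someI_ex)
  then show "mk f \<in> carrier M" "\<And>s l. \<lbrakk>s \<in> S; l < n\<rbrakk> \<Longrightarrow> crd (mk f) s l = f s l" by auto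
qed

lemma abelian_group_M: "abelian_group M"
proof (rule abelian_groupI)
  fix x y z assume x: "x \<in> carrier M" and y: "y \<in> carrier M" and z: "z \<in> carrier M"
  show "x \<oplus>\<^bsub>M\<^esub> y \<oplus>\<^bsub>M\<^esub> z = x \<oplus>\<^bsub>M\<^esub> (y \<oplus>\<^bsub>M\<^esub> z)"
    by (rule crd_eqI) (simp_all add: x y z add_in crd_add)
  show "x \<oplus>\<^bsub>M\<^esub> y = y \<oplus>\<^bsub>M\<^esub> x"
    by (rule crd_eqI) (simp_all add: x y add_in crd_add)
  show "\<zero>\<^bsub>M\<^esub> \<oplus>\<^bsub>M\<^esub> x = x"
    by (rule crd_eqI) (simp_all add: x zero_in add_in crd_add crd_zero)
  let ?y = "mk (\<lambda>s l. - crd x s l)"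
  have y: "?y \<in> carrier M" "\<And>s l. \<lbrakk>s \<in> S; l < n\<rbrakk> \<Longrightarrow> crd ?y s l = - crd x s l"
    using mk[of "\<lambda>s l. - crd x s l"] order_ge_uminus crd_ge[OF x] by blast+
  have "?y \<oplus>\<^bsub>M\<^esub> x = \<zero>\<^bsub>M\<^esub>"
    by (rule crd_eqI) (simp_all add: x y zero_in add_in crd_add crd_zero)
  then show "\<exists>y\<in>carrier M. y \<oplus>\<^bsub>M\<^esub> x = \<zero>\<^bsub>M\<^esub>" using y by blast
qed (auto simp: zero_in add_in)

lemma right_module_M: "right_module A M"
proof -
  interpret A: ring A by (rule ring_tiled_order[OF exp])
  interpret M: abelian_group M by (rule abelian_group_M)
  show ?thesis
  proof
    fix m m' b c
    assume m: "m \<in> carrier M"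
    show "ract M m \<one>\<^bsub>A\<^esub> = m"
    proof (rule crd_eqI)
      fix s l assume sl: "s \<in> S" "l < n"
      have "(\<Sum>k<n. crd m s k * 1\<^sub>m n $$ (k, l)) = (\<Sum>k<n. if k = l then crd m s k else 0)"
        using sl by (intro sum.cong) auto
      then show "crd (ract M m \<one>\<^bsub>A\<^esub>) s l = crd m s l" using sl m by (simp add: crd_ract tiled_one_closed[OF exp])
    qed (use m tiled_one_closed[OF exp] in \<open>auto intro: ract_in\<close>)
    assume "b \<in> carrier A"
    then have b: "b \<in> tiled_order_carrier n d" by simp
    show "ract M m b \<in> carrier M" using m b by (rule ract_in)
    show "ract M (m \<oplus>\<^bsub>M\<^esub> m') b = ract M m b \<oplus>\<^bsub>M\<^esub> ract M m' b" if m': "m' \<in> carrier M"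
      by (rule crd_eqI) (simp_all add: m m' b add_in crd_add ract_in crd_ract sum.distrib algebra_simps)
    assume "c \<in> carrier A"
    then have c: "c \<in> tiled_order_carrier n d" by simp
    show "ract M m (b \<oplus>\<^bsub>A\<^esub> c) = ract M m b \<oplus>\<^bsub>M\<^esub> ract M m c"
    proof (rule crd_eqI)
      fix s l assume sl: "s \<in> S" "l < n"
      have "(\<Sum>k<n. crd m s k * (b + c) $$ (k, l)) = (\<Sum>k<n. crd m s k * b $$ (k, l)) + (\<Sum>k<n. crd m s k * c $$ (k, l))"
        unfolding sum.distrib[symmetric] using sl tiled_carrier_mat[OF b] tiled_carrier_mat[OF c]
        by (intro sum.cong) (auto simp: algebra_simps)
      then show "crd (ract M m (b \<oplus>\<^bsub>A\<^esub> c)) s l = crd (ract M m b \<oplus>\<^bsub>M\<^esub> ract M m c) s l"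
        using sl m b c by (simp add: crd_ract crd_add ract_in tiled_add_closed)
    qed (use m b c in \<open>auto intro: ract_in add_in tiled_add_closed\<close>)
    show "ract M m (b \<otimes>\<^bsub>A\<^esub> c) = ract M (ract M m b) c"
    proof (rule crd_eqI)
      fix s l assume sl: "s \<in> S" "l < n"
      have "(\<Sum>k<n. crd m s k * (b * c) $$ (k, l)) = (\<Sum>k<n. \<Sum>j<n. crd m s k * b $$ (k, j) * c $$ (j, l))"
        using sl mat_mult_index[OF tiled_carrier_mat[OF b] tiled_carrier_mat[OF c]]
        by (intro sum.cong) (auto simp: sum_distrib_left mult.assoc)
      also have "\<dots> = (\<Sum>j<n. \<Sum>k<n. crd m s k * b $$ (k, j) * c $$ (j, l))" by (rule sum.swap)
      also have "\<dots> = (\<Sum>j<n. (\<Sum>k<n. crd m s k * b $$ (k, j)) * c $$ (j, l))" by (simp add: sum_distrib_right)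
      finally show "crd (ract M m (b \<otimes>\<^bsub>A\<^esub> c)) s l = crd (ract M (ract M m b) c) s l"
        using sl m b c by (simp add: crd_ract ract_in tiled_mult_closed[OF exp])
    qed (use m b c in \<open>auto intro: ract_in tiled_mult_closed[OF exp]\<close>)
  qed
qed

sublocale M: abelian_group M by (rule abelian_group_M)

lemma crd_finsum:
  assumes "finite I" "\<And>i. i \<in> I \<Longrightarrow> x i \<in> carrier M" "s \<in> S" "l < n"
  shows "crd (\<Oplus>\<^bsub>M\<^esub>i\<in>I. x i) s l = (\<Sum>i\<in>I. crd (x i) s l)"
  using assms(1,2)
proof (induction I rule: finite_induct)
  case (insert i I)
  then have "x \<in> I \<rightarrow> carrier M" "x i \<in> carrier M" by auto
  then have "(\<Oplus>\<^bsub>M\<^esub>i\<in>insert i I. x i) = x i \<oplus>\<^bsub>M\<^esub> (\<Oplus>\<^bsub>M\<^esub>i\<in>I. x i)" "(\<Oplus>\<^bsub>M\<^esub>i\<in>I. x i) \<in> carrier M"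
    using M.finsum_insert[OF insert(1,2)] M.finsum_closed by auto
  then show ?case using insert assms(3,4) by (simp add: crd_add)
qed (simp add: crd_zero assms)

text \<open>
  The homogeneous components are obtained by taking coefficients of all coordinates.
\<close>

lemma graded_right_module_M: "graded_right_module A M"
proof -
  interpret right_module A M by (rule right_module_M)
  show ?thesis
  proof (rule graded_right_module.intro[OF right_module_M], rule graded_right_module_axioms.intro)
    fix l j :: int and m :: 'm and b :: "'k laurent mat"
    show "subgroup (mcomp M l) (add_monoid M)"
    proof (rule M.add.subgroupI)
      show "mcomp M l \<subseteq> carrier M" using mcomp_iff[of _ l] by blast
      have "\<zero>\<^bsub>M\<^esub> \<in> mcomp M l" by (simp add: mcomp_iff zero_in crd_zero) (metis single_zero)
      then show "mcomp M l \<noteq> {}" by blast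
      fix x assume x: "x \<in> mcomp M l"
      then have xc: "x \<in> carrier M" by (auto simp: mcomp_iff)
      show "x \<oplus>\<^bsub>M\<^esub> y \<in> mcomp M l" if y: "y \<in> mcomp M l" for y
        using x y by (simp add: mcomp_iff add_in crd_add) (metis single_add)
      have "crd (\<ominus>\<^bsub>M\<^esub> x) s m = - crd x s m" if "s \<in> S" "m < n" for s m
      proof -
        have "crd (x \<oplus>\<^bsub>M\<^esub> \<ominus>\<^bsub>M\<^esub> x) s m = 0" using xc that M.r_neg crd_zero by simp
        then show ?thesis using that xc by (simp add: crd_add eq_neg_iff_add_eq_0 add.commute)
      qed
      then show "\<ominus>\<^bsub>M\<^esub> x \<in> mcomp M l" using x xc by (simp add: mcomp_iff) (metis single_uminus)
    qed
    show "ract M m b \<in> mcomp M (l + j)" if m: "m \<in> mcomp M l" and b: "b \<in> acomp A j"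
      unfolding mcomp_iff
    proof (intro conjI ballI allI impI)
      have mc: "m \<in> carrier M" and bc: "b \<in> tiled_order_carrier n d" and bh: "homogeneous_mat j b"
        using m b by (auto simp: mcomp_iff)
      show "ract M m b \<in> carrier M" using mc bc by (rule ract_in)
      fix s k assume sk: "s \<in> S" "k < n"
      have "lookup (crd m s i * b $$ (i, k)) t = 0" if "t \<noteq> l + j" "i < n" for t i
      proof -
        obtain c c' where "crd m s i = lmonom l c" "b $$ (i, k) = lmonom j c'"
          using m bh sk \<open>i < n\<close> tiled_carrier_mat[OF bc] unfolding mcomp_iff homogeneous_mat_def by (metis carrier_matD)
        then show ?thesis using that by (simp add: mult_single lookup_single when_def)
      qed
      then show "\<exists>c. crd (ract M m b) s k = lmonom (l + j) c"
        unfolding lmonom_eq_iff using mc bc sk by (simp add: crd_ract lookup_sum)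
    qed
    assume m: "m \<in> carrier M"
    let ?P = "\<lambda>f. (\<forall>l. f l \<in> mcomp M l) \<and> finite {l. f l \<noteq> \<zero>\<^bsub>M\<^esub>} \<and> m = (\<Oplus>\<^bsub>M\<^esub>l\<in>{l. f l \<noteq> \<zero>\<^bsub>M\<^esub>}. f l)"
    define g where "g l = mk (\<lambda>s k. lmonom l (lookup (crd m s k) l))" for l
    have g: "g l \<in> carrier M" "\<And>s k. \<lbrakk>s \<in> S; k < n\<rbrakk> \<Longrightarrow> crd (g l) s k = lmonom l (lookup (crd m s k) l)" for l
      unfolding g_def by (rule mk; use crd_ge[OF m] in \<open>force dest: order_geD\<close>)+
    have sum_eq: "crd (\<Oplus>\<^bsub>M\<^esub>l\<in>I. f l) s k = (\<Sum>l\<in>I. lmonom l (lookup (crd (f l) s k) l))"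
      if "\<forall>l. f l \<in> mcomp M l" "finite I" "s \<in> S" "k < n" for f I s k
    proof -
      have "crd (\<Oplus>\<^bsub>M\<^esub>l\<in>I. f l) s k = (\<Sum>l\<in>I. crd (f l) s k)"
        using that by (intro crd_finsum) (auto simp: mcomp_iff)
      also have "\<dots> = (\<Sum>l\<in>I. lmonom l (lookup (crd (f l) s k) l))"
      proof (intro sum.cong refl)
        fix l
        obtain c where "crd (f l) s k = lmonom l c" using \<open>\<forall>l. f l \<in> mcomp M l\<close> \<open>s \<in> S\<close> \<open>k < n\<close> unfolding mcomp_iff by blast
        then show "crd (f l) s k = lmonom l (lookup (crd (f l) s k) l)" by simp
      qed
      finally show ?thesis .
    qed
    have gm: "\<forall>l. g l \<in> mcomp M l" using g by (auto simp: mcomp_iff)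
    define K where "K = (\<Union>s\<in>S. \<Union>k<n. Poly_Mapping.keys (crd m s k))"
    have finK: "finite K" using finS by (simp add: K_def)
    have sub: "{l. g l \<noteq> \<zero>\<^bsub>M\<^esub>} \<subseteq> K"
    proof
      fix l assume "l \<in> {l. g l \<noteq> \<zero>\<^bsub>M\<^esub>}"
      then have "\<exists>s\<in>S. \<exists>k<n. crd (g l) s k \<noteq> crd \<zero>\<^bsub>M\<^esub> s k" using crd_eqI[OF g(1) zero_in, of l] by blast
      then obtain s k where sk: "s \<in> S" "k < n" "crd (g l) s k \<noteq> 0" using crd_zero by auto
      then have "lookup (crd m s k) l \<noteq> 0" using g(2)[OF sk(1,2), of l] by auto
      then show "l \<in> K" using sk by (auto simp: K_def in_keys_iff)
    qed
    have "m = (\<Oplus>\<^bsub>M\<^esub>l\<in>{l. g l \<noteq> \<zero>\<^bsub>M\<^esub>}. g l)"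
    proof (rule crd_eqI[OF m])
      show "(\<Oplus>\<^bsub>M\<^esub>l\<in>{l. g l \<noteq> \<zero>\<^bsub>M\<^esub>}. g l) \<in> carrier M" using g by (intro M.finsum_closed) auto
      fix s k assume sk: "s \<in> S" "k < n"
      show "crd m s k = crd (\<Oplus>\<^bsub>M\<^esub>l\<in>{l. g l \<noteq> \<zero>\<^bsub>M\<^esub>}. g l) s k"
      proof (rule poly_mapping_eqI)
        fix t
        have fin: "finite {l. g l \<noteq> \<zero>\<^bsub>M\<^esub>}" using finite_subset[OF sub finK] .
        have "lookup (crd (\<Oplus>\<^bsub>M\<^esub>l\<in>{l. g l \<noteq> \<zero>\<^bsub>M\<^esub>}. g l) s k) t = 
            (\<Sum>l\<in>{l. g l \<noteq> \<zero>\<^bsub>M\<^esub>}. if l = t then lookup (crd m s k) t else 0)"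
          unfolding sum_eq[OF gm fin sk] lookup_sum
          by (intro sum.cong) (auto simp: g sk lookup_single when_def)
        also have "\<dots> = lookup (crd m s k) t"
        proof (cases "g t = \<zero>\<^bsub>M\<^esub>")
          case True
          then have "lmonom t (lookup (crd m s k) t) = 0" using g(2)[OF sk, of t] crd_zero[OF sk] by simp
          then have "lookup (crd m s k) t = 0" by (metis lookup_single_eq lookup_zero)
          then show ?thesis by (auto intro!: sum.neutral)
        qed (use fin in simp)
        finally show "lookup (crd m s k) t = lookup (crd (\<Oplus>\<^bsub>M\<^esub>l\<in>{l. g l \<noteq> \<zero>\<^bsub>M\<^esub>}. g l) s k) t" by simp
      qed
    qed
    then have Pg: "?P g" using gm finite_subset[OF sub finK] by blast
    show "\<exists>!f. ?P f"
    proof (rule ex1I[of ?P g])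
      show "?P g" by (rule Pg)
      fix f assume f: "?P f"
      show "f = g"
      proof
        fix l
        have fc: "f l \<in> carrier M" for l using f by (auto simp: mcomp_iff)
        show "f l = g l"
        proof (rule crd_eqI[OF fc g(1)])
          fix s k assume sk: "s \<in> S" "k < n"
          obtain c where c: "crd (f l) s k = lmonom l c" using f sk unfolding mcomp_iff by blast
          have "lookup (crd m s k) l = lookup (crd (\<Oplus>\<^bsub>M\<^esub>l\<in>{l. f l \<noteq> \<zero>\<^bsub>M\<^esub>}. f l) s k) l" using f by simp
          also have "\<dots> = (\<Sum>j\<in>{l. f l \<noteq> \<zero>\<^bsub>M\<^esub>}. if j = l then lookup (crd (f l) s k) l else 0)"
            using f sk by (subst sum_eq) (auto simp: lookup_sum lookup_single when_def intro!: sum.cong)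
          also have "\<dots> = c"
          proof (cases "f l = \<zero>\<^bsub>M\<^esub>")
            case True
            then have "lmonom l c = 0" using c crd_zero[OF sk] by simp
            then have "c = 0" by (metis lookup_single_eq lookup_zero)
            then show ?thesis using True f by simp
          qed (use f c in simp)
          finally show "crd (f l) s k = crd (g l) s k" using c g(2)[OF sk] by simp
        qed
      qed
    qed
  qed
qed

end

section \<open>Graded homomorphisms are scalar matrices\<close>

context coord_module begin

text \<open>
  The element \<open>x\<^sup>u\<close> in row \<open>s\<close> and column \<open>m\<close>.
\<close>

definition basis_el :: "'s \<Rightarrow> nat \<Rightarrow> int \<Rightarrow> 'm"
  where "basis_el s m u = mk (\<lambda>s' l. if s' = s \<and> l = m then lmonom u 1 else 0)"

lemma basis_el:
  assumes "a s m \<le> u"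
  shows "basis_el s m u \<in> carrier M"
    "\<lbrakk>s' \<in> S; l < n\<rbrakk> \<Longrightarrow> crd (basis_el s m u) s' l = (if s' = s \<and> l = m then lmonom u 1 else 0)"
  using mk[of "\<lambda>s' l. if s' = s \<and> l = m then lmonom u 1 else 0"] assms by (auto simp: basis_el_def)

lemma crd_ract_unit_mat:
  assumes "x \<in> carrier M" "f \<in> order_ge (d i j)" "i < n" "s \<in> S" "l < n"
  shows "crd (ract M x (unit_mat n f i j)) s l = (if l = j then crd x s i * f else 0)"
  unfolding crd_ract[OF assms(1) unit_mat_in_tiled[of _ d i j, OF assms(2)] assms(4,5)] sum_unit_mat[OF assms(3,5)] ..

lemma basis_el_ract:
  assumes u: "a s m \<le> u" and f: "lmonom p (1 :: 'k) \<in> order_ge (d m m')" and m: "m < n" "m' < n" and s: "s \<in> S"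
  shows "ract M (basis_el s m u) (unit_mat n (lmonom p 1) m m') = basis_el s m' (u + p)"
proof (rule crd_eqI)
  have "a s m' \<le> a s m + d m m'" using lat[OF s] m by (simp add: lattice_vec_def)
  then have up: "a s m' \<le> u + p" using u f by simp
  show "basis_el s m' (u + p) \<in> carrier M" using basis_el(1)[of s m'] up by blast
  show "ract M (basis_el s m u) (unit_mat n (lmonom p 1) m m') \<in> carrier M"
    by (intro ract_in basis_el unit_mat_in_tiled u f)
  fix t l assume "t \<in> S" "l < n"
  then show "crd (ract M (basis_el s m u) (unit_mat n (lmonom p 1) m m')) t l = crd (basis_el s m' (u + p)) t l"
    using m up u f by (subst crd_ract_unit_mat) (auto simp: basis_el mult_single)
qed

end

locale coord_pair = M: coord_module n d M S a crd + N: coord_module n d N S' a' crd'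
  for n :: nat and d :: "nat \<Rightarrow> nat \<Rightarrow> int"
    and M :: "('k :: field laurent mat, 'm) graded_rmod" and S :: "'s set" and a crd
    and N :: "('k laurent mat, 'n) graded_rmod" and S' :: "'t set" and a' crd'
begin

abbreviation (input) A :: "('k, 'k laurent mat) graded_algebra" where "A \<equiv> tiled_order n d"

text \<open>
  The matrices of scalars whose entries respect the inclusions between the rank one summands.
\<close>

definition admissible :: "('s \<Rightarrow> 't \<Rightarrow> 'k) \<Rightarrow> bool"
  where "admissible c \<longleftrightarrow> (\<forall>s\<in>S. \<forall>t\<in>S'. c s t \<noteq> 0 \<longrightarrow> (\<forall>l<n. a' t l \<le> a s l))"

definition lin :: "('s \<Rightarrow> 't \<Rightarrow> 'k) \<Rightarrow> 'm \<Rightarrow> 'n"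
  where "lin c = (\<lambda>x\<in>carrier M. N.mk (\<lambda>t l. \<Sum>s\<in>S. lmonom 0 (c s t) * crd x s l))"

definition coef :: "('m \<Rightarrow> 'n) \<Rightarrow> 's \<Rightarrow> 't \<Rightarrow> 'k"
  where "coef f s t = lookup (crd' (f (M.basis_el s 0 (a s 0))) t 0) (a s 0)"

lemma scalar_order_ge: "f \<in> order_ge b \<Longrightarrow> lmonom 0 c * f \<in> order_ge b"
  by (rule order_ge_mult_le[of _ 0 _ b]) auto

lemma lin:
  assumes c: "admissible c" and x: "x \<in> carrier M"
  shows "lin c x \<in> carrier N"
    "\<lbrakk>t \<in> S'; l < n\<rbrakk> \<Longrightarrow> crd' (lin c x) t l = (\<Sum>s\<in>S. lmonom 0 (c s t) * crd x s l)"
proof -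
  have ge: "(\<Sum>s\<in>S. lmonom 0 (c s t) * crd x s l) \<in> order_ge (a' t l)" if "t \<in> S'" "l < n" for t l
  proof (rule order_ge_sum)
    fix s assume s: "s \<in> S"
    show "lmonom 0 (c s t) * crd x s l \<in> order_ge (a' t l)"
    proof (cases "c s t = 0")
      case False
      then have "a' t l \<le> a s l" using c s that by (auto simp: admissible_def)
      then show ?thesis using order_ge_mono[OF M.crd_ge[OF x s that(2)]] scalar_order_ge by blast
    qed simp
  qed
  note N.mk[of "\<lambda>t l. \<Sum>s\<in>S. lmonom 0 (c s t) * crd x s l", OF ge]
  then show "lin c x \<in> carrier N"
    "\<lbrakk>t \<in> S'; l < n\<rbrakk> \<Longrightarrow> crd' (lin c x) t l = (\<Sum>s\<in>S. lmonom 0 (c s t) * crd x s l)"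
    using x by (auto simp: lin_def)
qed

lemma lin_extensional: "lin c \<in> extensional (carrier M)" by (simp add: lin_def)

lemma lin_graded_hom: assumes c: "admissible c" shows "lin c \<in> graded_hom A M N"
  unfolding graded_hom_def rmod_hom_def mem_Collect_eq
proof (intro conjI ballI allI)
  note L = lin[OF c]
  show "lin c \<in> carrier M \<rightarrow>\<^sub>E carrier N" using L(1) lin_extensional by (auto simp: PiE_def)
  fix x assume x: "x \<in> carrier M"
  show "lin c (x \<oplus>\<^bsub>M\<^esub> y) = lin c x \<oplus>\<^bsub>N\<^esub> lin c y" if y: "y \<in> carrier M" for y
    by (rule N.crd_eqI)
      (simp_all add: L x y M.add_in N.add_in M.crd_add N.crd_add sum.distrib algebra_simps)
  show "lin c (ract M x b) = ract N (lin c x) b" if b: "b \<in> carrier A" for b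
  proof (rule N.crd_eqI)
    have b: "b \<in> tiled_order_carrier n d" using b by simp
    show "lin c (ract M x b) \<in> carrier N" "ract N (lin c x) b \<in> carrier N"
      using L(1) x b by (auto intro: M.ract_in N.ract_in)
    fix t l assume tl: "t \<in> S'" "l < n"
    have "crd' (lin c (ract M x b)) t l = (\<Sum>s\<in>S. \<Sum>m<n. lmonom 0 (c s t) * crd x s m * b $$ (m, l))"
      using L(2)[OF M.ract_in[OF x b] tl] x b tl by (simp add: M.crd_ract sum_distrib_left mult.assoc)
    also have "\<dots> = (\<Sum>m<n. \<Sum>s\<in>S. lmonom 0 (c s t) * crd x s m * b $$ (m, l))" by (rule sum.swap)
    also have "\<dots> = crd' (ract N (lin c x) b) t l"
      using L x b tl by (simp add: N.crd_ract sum_distrib_right)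
    finally show "crd' (lin c (ract M x b)) t l = crd' (ract N (lin c x) b) t l" .
  qed
next
  fix j
  show "lin c ` mcomp M j \<subseteq> mcomp N j"
  proof
    fix y assume "y \<in> lin c ` mcomp M j"
    then obtain x where x: "x \<in> mcomp M j" "y = lin c x" by blast
    then have xc: "x \<in> carrier M" by (simp add: M.mcomp_iff)
    have "\<exists>e. crd' y t l = lmonom j e" if tl: "t \<in> S'" "l < n" for t l
      unfolding lmonom_eq_iff
    proof (intro allI impI)
      fix i assume i: "i \<noteq> j"
      have "lookup (crd x s l) i = 0" if "s \<in> S" for s
        using x(1) that tl i unfolding M.mcomp_iff lmonom_eq_iff by blast
      then show "lookup (crd' y t l) i = 0"
        unfolding x(2) lin(2)[OF c xc tl] lookup_sum by (simp add: lookup_lmonom_mult)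
    qed
    then show "y \<in> mcomp N j" using lin(1)[OF c xc] x by (simp add: N.mcomp_iff)
  qed
qed

context
  fixes f assumes f: "f \<in> graded_hom A M N"
begin

lemma hom_in: "x \<in> carrier M \<Longrightarrow> f x \<in> carrier N"
  and hom_ext: "f \<in> extensional (carrier M)"
  and hom_add: "\<lbrakk>x \<in> carrier M; y \<in> carrier M\<rbrakk> \<Longrightarrow> f (x \<oplus>\<^bsub>M\<^esub> y) = f x \<oplus>\<^bsub>N\<^esub> f y"
  and hom_ract: "\<lbrakk>x \<in> carrier M; b \<in> tiled_order_carrier n d\<rbrakk> \<Longrightarrow> f (ract M x b) = ract N (f x) b"
  using f by (auto simp: graded_hom_def rmod_hom_def PiE_def)

lemma hom_mcomp: "x \<in> mcomp M j \<Longrightarrow> f x \<in> mcomp N j"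
  using f unfolding graded_hom_def by blast

lemma crd_hom_zero: assumes "t \<in> S'" "l < n" shows "crd' (f \<zero>\<^bsub>M\<^esub>) t l = 0"
proof -
  have "crd' (f (\<zero>\<^bsub>M\<^esub> \<oplus>\<^bsub>M\<^esub> \<zero>\<^bsub>M\<^esub>)) t l = crd' (f \<zero>\<^bsub>M\<^esub>) t l + crd' (f \<zero>\<^bsub>M\<^esub>) t l"
    unfolding hom_add[OF M.zero_in M.zero_in]
    by (rule N.crd_add[OF hom_in[OF M.zero_in] hom_in[OF M.zero_in] assms])
  then show ?thesis by (simp only: M.M.l_zero[OF M.zero_in] add_cancel_right_right)
qed

lemma crd_hom_finsum:
  assumes "finite I" "\<And>i. i \<in> I \<Longrightarrow> x i \<in> carrier M" "t \<in> S'" "l < n"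
  shows "crd' (f (\<Oplus>\<^bsub>M\<^esub>i\<in>I. x i)) t l = (\<Sum>i\<in>I. crd' (f (x i)) t l)"
  using assms(1,2)
proof (induction I rule: finite_induct)
  case (insert i I)
  then have x: "x \<in> I \<rightarrow> carrier M" "x i \<in> carrier M" by auto
  then have "(\<Oplus>\<^bsub>M\<^esub>i\<in>insert i I. x i) = x i \<oplus>\<^bsub>M\<^esub> (\<Oplus>\<^bsub>M\<^esub>i\<in>I. x i)" "(\<Oplus>\<^bsub>M\<^esub>i\<in>I. x i) \<in> carrier M"
    using M.M.finsum_insert[OF insert(1,2)] M.M.finsum_closed by auto
  then show ?case using insert x assms(3,4) by (simp add: hom_add hom_in N.crd_add)
qed (simp add: crd_hom_zero assms)

lemma hom_basis_el:
  assumes s: "s \<in> S" and m: "m < n" and u: "a s m \<le> u" and t: "t \<in> S'" and l: "l < n"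
  shows "crd' (f (M.basis_el s m u)) t l = (if l = m then lmonom u (lookup (crd' (f (M.basis_el s m u)) t m) u) else 0)"
proof -
  note e = M.basis_el[of s m u, OF u]
  have "M.basis_el s m u \<in> mcomp M u" using e by (auto simp: M.mcomp_iff intro: exI[of _ 0])
  then obtain c where c: "crd' (f (M.basis_el s m u)) t m = lmonom u c"
    using hom_mcomp t m unfolding N.mcomp_iff by blast
  show ?thesis
  proof (cases "l = m")
    case False
    have z: "lmonom 0 1 \<in> order_ge (d m m)" using m by (simp del: single_one)
    have "ract M (M.basis_el s m u) (unit_mat n (lmonom 0 1) m m) = M.basis_el s m u"
      using M.basis_el_ract[OF u z m m s] by simp
    then have "f (M.basis_el s m u) = ract N (f (M.basis_el s m u)) (unit_mat n (lmonom 0 1) m m)"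
      using hom_ract[OF e(1) unit_mat_in_tiled[of _ d m m, OF z]] by simp
    then have "crd' (f (M.basis_el s m u)) t l = crd' (ract N (f (M.basis_el s m u)) (unit_mat n (lmonom 0 1) m m)) t l"
      by (rule arg_cong)
    also have "\<dots> = 0"
      unfolding N.crd_ract_unit_mat[OF hom_in[OF e(1)] z m t l] using False by simp
    finally show ?thesis using False by simp
  qed (use c in simp)
qed

text \<open>
  Multiply by the matrix unit \<open>x\<^sup>p e\<^bsub>m m'\<^esub>\<close>.
\<close>

lemma coef_shift:
  assumes s: "s \<in> S" and m: "m < n" "m' < n" and u: "a s m \<le> u" and t: "t \<in> S'" and p: "d m m' \<le> p"
  shows "lookup (crd' (f (M.basis_el s m' (u + p))) t m') (u + p) = lookup (crd' (f (M.basis_el s m u)) t m) u"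
proof -
  have g: "lmonom p (1::'k) \<in> order_ge (d m m')" using p by simp
  have "f (M.basis_el s m' (u + p)) = ract N (f (M.basis_el s m u)) (unit_mat n (lmonom p 1) m m')"
    using M.basis_el_ract[OF u g m s] hom_ract[OF M.basis_el(1)[OF u] unit_mat_in_tiled[of _ d m m', OF g]] by simp
  then have "crd' (f (M.basis_el s m' (u + p))) t m' = crd' (f (M.basis_el s m u)) t m * lmonom p 1"
    using N.crd_ract_unit_mat[OF hom_in[OF M.basis_el(1)[OF u]] g m(1) t m(2)] by simp
  then show ?thesis by (simp add: mult.commute[of _ "lmonom p 1"] lookup_lmonom_mult)
qed

text \<open>
  The scalar by which \<open>f\<close> acts between two rows is the same in all columns and degrees, because any two
  basis elements of a row have a common multiple.
\<close>

lemma crd_hom_basis_el: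
  assumes s: "s \<in> S" and m: "m < n" and u: "a s m \<le> u" and t: "t \<in> S'" and l: "l < n"
  shows "crd' (f (M.basis_el s m u)) t l = (if l = m then lmonom u (coef f s t) else 0)"
proof -
  define U where "U = max (u + d m 0) (a s 0)"
  have n0: "0 < n" by (rule M.n_pos)
  have "lookup (crd' (f (M.basis_el s 0 (u + (U - u)))) t 0) (u + (U - u)) = lookup (crd' (f (M.basis_el s m u)) t m) u"
    by (rule coef_shift[OF s m n0 u t]) (simp add: U_def)
  moreover have "lookup (crd' (f (M.basis_el s 0 (a s 0 + (U - a s 0)))) t 0) (a s 0 + (U - a s 0)) = coef f s t"
    unfolding coef_def by (rule coef_shift[OF s n0 n0 _ t]) (use n0 in \<open>simp_all add: U_def\<close>)
  ultimately show ?thesis using hom_basis_el[OF assms] by simp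
qed

lemma coef_admissible: "admissible (coef f)"
  unfolding admissible_def
proof (intro ballI impI allI)
  fix s t l assume s: "s \<in> S" and t: "t \<in> S'" and c: "coef f s t \<noteq> 0" and l: "l < n"
  have "lmonom (a s l) (coef f s t) \<in> order_ge (a' t l)"
    using N.crd_ge[OF hom_in[OF M.basis_el(1)[OF order_refl]] t l] crd_hom_basis_el[OF s l order_refl t l] by (metis (full_types))
  then show "a' t l \<le> a s l" using c by simp
qed

text \<open>
  Every homomorphism of degree \<open>0\<close> is a matrix of scalars. Column \<open>l\<close> of an element is a combination of
  one basis element per row with coefficients in \<open>R\<close>, and \<open>f\<close> commutes with the matrix unit that
  projects to this column.
\<close>

lemma hom_eq_lin: "f = lin (coef f)"
proof
  fix x
  show "f x = lin (coef f) x"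
  proof (cases "x \<in> carrier M")
    case x: True
    show ?thesis
    proof (rule N.crd_eqI[OF hom_in[OF x] lin(1)[OF coef_admissible x]])
      fix t l assume t: "t \<in> S'" and l: "l < n"
      have z: "lmonom 0 1 \<in> order_ge (d l l)" using l by (simp del: single_one)
      define G where "G s = lmonom (- a s l) 1 * crd x s l" for s
      have G: "G s \<in> order_ge (d l l)" if "s \<in> S" for s
        using M.crd_ge[OF x that l] l by (simp add: G_def lmonom_mult_iff)
      define y where "y s = ract M (M.basis_el s l (a s l)) (unit_mat n (G s) l l)" for s
      have y: "y s \<in> carrier M" if "s \<in> S" for s
        unfolding y_def by (intro M.ract_in M.basis_el unit_mat_in_tiled G that order_refl)
      have eq: "ract M x (unit_mat n (lmonom 0 1) l l) = (\<Oplus>\<^bsub>M\<^esub>s\<in>S. y s)"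
      proof (rule M.crd_eqI)
        show "ract M x (unit_mat n (lmonom 0 1) l l) \<in> carrier M" by (intro M.ract_in x unit_mat_in_tiled z)
        show "(\<Oplus>\<^bsub>M\<^esub>s\<in>S. y s) \<in> carrier M" using y by (intro M.M.finsum_closed) auto
        fix s k assume s: "s \<in> S" and k: "k < n"
        have "crd (\<Oplus>\<^bsub>M\<^esub>s\<in>S. y s) s k = (\<Sum>s'\<in>S. crd (y s') s k)" by (rule M.crd_finsum[OF M.finS y s k])
        also have "\<dots> = (\<Sum>s'\<in>S. if s' = s then (if k = l then lmonom (a s l) 1 * G s else 0) else 0)"
        proof (intro sum.cong refl)
          fix s' assume s': "s' \<in> S"
          show "crd (y s') s k = (if s' = s then (if k = l then lmonom (a s l) 1 * G s else 0) else 0)"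
            unfolding y_def M.crd_ract_unit_mat[OF M.basis_el(1)[OF order_refl] G[OF s'] l s k]
            using M.basis_el(2)[OF order_refl s l, of s' l] by auto
        qed
        also have "\<dots> = (if k = l then crd x s l else 0)" using M.finS s by (simp add: G_def)
        finally show "crd (ract M x (unit_mat n (lmonom 0 1) l l)) s k = crd (\<Oplus>\<^bsub>M\<^esub>s\<in>S. y s) s k"
          unfolding M.crd_ract_unit_mat[OF x z l s k] by simp
      qed
      have "crd' (f x) t l = crd' (ract N (f x) (unit_mat n (lmonom 0 1) l l)) t l"
        unfolding N.crd_ract_unit_mat[OF hom_in[OF x] z l t l] by simp
      also have "\<dots> = crd' (f (\<Oplus>\<^bsub>M\<^esub>s\<in>S. y s)) t l"
        using hom_ract[OF x unit_mat_in_tiled[of _ d l l, OF z]] eq by simp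
      also have "\<dots> = (\<Sum>s\<in>S. crd' (f (y s)) t l)" by (rule crd_hom_finsum[OF M.finS y t l])
      also have "\<dots> = (\<Sum>s\<in>S. lmonom 0 (coef f s t) * crd x s l)"
      proof (intro sum.cong refl)
        fix s assume s: "s \<in> S"
        have "crd' (f (y s)) t l = lmonom (a s l) (coef f s t) * G s"
          using hom_ract[OF M.basis_el(1)[OF order_refl] unit_mat_in_tiled[of _ d l l, OF G[OF s]]]
            N.crd_ract_unit_mat[OF hom_in[OF M.basis_el(1)[OF order_refl]] G[OF s] l t l]
            crd_hom_basis_el[OF s l order_refl t l] by (simp add: y_def)
        also have "\<dots> = lmonom 0 (coef f s t) * (lmonom (a s l) 1 * G s)"
          by (simp add: mult.assoc[symmetric] mult_single)
        finally show "crd' (f (y s)) t l = lmonom 0 (coef f s t) * crd x s l" by (simp add: G_def)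
      qed
      finally show "crd' (f x) t l = crd' (lin (coef f) x) t l" using lin(2)[OF coef_admissible x t l] by simp
    qed
  next
    case False
    then show ?thesis using hom_ext lin_extensional by (simp add: extensional_def)
  qed
qed

end

lemma crd_hom:
  assumes "f \<in> graded_hom A M N" "x \<in> carrier M" "t \<in> S'" "l < n"
  shows "crd' (f x) t l = (\<Sum>s\<in>S. lmonom 0 (coef f s t) * crd x s l)"
  using lin(2)[OF coef_admissible[OF assms(1)] assms(2-4)] hom_eq_lin[OF assms(1)] by simp

lemma coef_lin: assumes c: "admissible c" and s: "s \<in> S" and t: "t \<in> S'" shows "coef (lin c) s t = c s t"
proof -
  have "crd' (lin c (M.basis_el s 0 (a s 0))) t 0 = (\<Sum>s'\<in>S. lmonom 0 (c s' t) * crd (M.basis_el s 0 (a s 0)) s' 0)"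
    by (rule lin(2)[OF c M.basis_el(1)[OF order_refl] t M.n_pos])
  also have "\<dots> = (\<Sum>s'\<in>S. if s' = s then lmonom (a s 0) (c s t) else 0)"
    by (intro sum.cong) (auto simp: M.basis_el[OF order_refl] M.n_pos mult_single)
  finally show ?thesis using s M.finS by (simp add: coef_def)
qed

lemma lin_cong: "(\<And>s t. \<lbrakk>s \<in> S; t \<in> S'\<rbrakk> \<Longrightarrow> c s t = c' s t) \<Longrightarrow> admissible c \<Longrightarrow> lin c = lin c'"
proof
  fix x assume eq: "\<And>s t. \<lbrakk>s \<in> S; t \<in> S'\<rbrakk> \<Longrightarrow> c s t = c' s t" and c: "admissible c"
  have c': "admissible c'" using eq c by (simp add: admissible_def)
  show "lin c x = lin c' x"
  proof (cases "x \<in> carrier M")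
    case x: True
    show ?thesis
      by (rule N.crd_eqI[OF lin(1)[OF c x] lin(1)[OF c' x]]) (simp add: lin(2)[OF c x] lin(2)[OF c' x] eq)
  qed (simp add: lin_def)
qed

lemma hom_eqI:
  assumes "f \<in> graded_hom A M N" "g \<in> graded_hom A M N"
    "\<And>s t. \<lbrakk>s \<in> S; t \<in> S'\<rbrakk> \<Longrightarrow> coef f s t = coef g s t"
  shows "f = g"
  using lin_cong[of "coef f" "coef g", OF assms(3) coef_admissible[OF assms(1)]]
    hom_eq_lin[OF assms(1)] hom_eq_lin[OF assms(2)] by metis

end

lemma coef_comp:
  assumes "coord_pair n d L S1 a1 crd1 M S2 a2 crd2" "coord_pair n d M S2 a2 crd2 N S3 a3 crd3"
    "coord_pair n d L S1 a1 crd1 N S3 a3 crd3"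
    and f: "f \<in> graded_hom (tiled_order n d) L M" and g: "g \<in> graded_hom (tiled_order n d) M N"
    and h: "\<And>x. x \<in> carrier L \<Longrightarrow> h x = g (f x)" and s: "s \<in> S1" and t: "t \<in> S3"
  shows "coord_pair.coef n L S1 a1 crd1 crd3 h s t
    = (\<Sum>u\<in>S2. coord_pair.coef n L S1 a1 crd1 crd2 f s u * coord_pair.coef n M S2 a2 crd2 crd3 g u t)"
proof -
  interpret LM: coord_pair n d L S1 a1 crd1 M S2 a2 crd2 by fact
  interpret MN: coord_pair n d M S2 a2 crd2 N S3 a3 crd3 by fact
  interpret LN: coord_pair n d L S1 a1 crd1 N S3 a3 crd3 by fact
  let ?e = "LM.M.basis_el s 0 (a1 s 0)"
  have e: "?e \<in> carrier L" by (rule LM.M.basis_el) simp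
  have "LN.coef h s t = lookup (crd3 (g (f ?e)) t 0) (a1 s 0)" using h[OF e] by (simp add: LN.coef_def)
  also have "\<dots> = (\<Sum>u\<in>S2. lookup (lmonom 0 (MN.coef g u t) * crd2 (f ?e) u 0) (a1 s 0))"
    using MN.crd_hom[OF g LM.hom_in[OF f e] t LM.M.n_pos] by (simp add: lookup_sum)
  also have "\<dots> = (\<Sum>u\<in>S2. LM.coef f s u * MN.coef g u t)"
    by (intro sum.cong refl) (simp add: lookup_lmonom_mult LM.crd_hom_basis_el[OF f s LM.M.n_pos order_refl _ LM.M.n_pos] mult.commute)
  finally show ?thesis .
qed

section \<open>The endomorphism ring\<close>

locale coord_end = E: coord_pair n d M S a crd M S a crd
  for n :: nat and d :: "nat \<Rightarrow> nat \<Rightarrow> int"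
    and M :: "('k :: field laurent mat, 'm) graded_rmod" and S :: "'s set" and a crd
begin

abbreviation (input) A :: "('k, 'k laurent mat) graded_algebra" where "A \<equiv> tiled_order n d"
abbreviation End :: "('k, 'm \<Rightarrow> 'm) module" where "End \<equiv> graded_End A M"
abbreviation coef where "coef \<equiv> E.coef"

lemma End_simps:
  "carrier End = graded_hom A M M" "monoid.mult End = compose (carrier M)"
  "one End = (\<lambda>x\<in>carrier M. x)" "zero End = (\<lambda>x\<in>carrier M. \<zero>\<^bsub>M\<^esub>)"
  "add End = (\<lambda>f g. \<lambda>x\<in>carrier M. f x \<oplus>\<^bsub>M\<^esub> g x)"
  "module.smult End = (\<lambda>c f. \<lambda>x\<in>carrier M. ract M (f x) (lmonom 0 c \<cdot>\<^sub>m 1\<^sub>m n))"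
  by (simp_all add: graded_End_def)

text \<open>
  Used to compute the operations of the endomorphism ring on matrices of scalars.
\<close>

lemma endo_eq_lin:
  assumes c: "E.admissible c" and F: "F \<in> extensional (carrier M)"
    and Fc: "\<And>x. x \<in> carrier M \<Longrightarrow> F x \<in> carrier M"
    and eq: "\<And>x t l. \<lbrakk>x \<in> carrier M; t \<in> S; l < n\<rbrakk> \<Longrightarrow> crd (F x) t l = (\<Sum>s\<in>S. lmonom 0 (c s t) * crd x s l)"
  shows "F \<in> carrier End" "\<lbrakk>s \<in> S; t \<in> S\<rbrakk> \<Longrightarrow> coef F s t = c s t"
proof -
  have "F = E.lin c"
  proof
    fix x show "F x = E.lin c x"
    proof (cases "x \<in> carrier M")
      case x: True
      show ?thesis by (rule E.M.crd_eqI[OF Fc[OF x] E.lin(1)[OF c x]]) (simp add: eq[OF x] E.lin(2)[OF c x])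
    qed (use F E.lin_extensional[of c] in \<open>simp add: extensional_def\<close>)
  qed
  then show "F \<in> carrier End" "\<lbrakk>s \<in> S; t \<in> S\<rbrakk> \<Longrightarrow> coef F s t = c s t"
    using E.lin_graded_hom[OF c] E.coef_lin[OF c] by (simp_all add: End_simps)
qed

context
  fixes f g assumes f: "f \<in> carrier End" and g: "g \<in> carrier End"
begin

lemma f': "f \<in> graded_hom A M M" and g': "g \<in> graded_hom A M M" using f g by (simp_all add: End_simps)

lemma End_add: "f \<oplus>\<^bsub>End\<^esub> g \<in> carrier End"
    "\<lbrakk>s \<in> S; t \<in> S\<rbrakk> \<Longrightarrow> coef (f \<oplus>\<^bsub>End\<^esub> g) s t = coef f s t + coef g s t"
proof -
  have adm: "E.admissible (\<lambda>s t. coef f s t + coef g s t)"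
    using E.coef_admissible[OF f'] E.coef_admissible[OF g'] unfolding E.admissible_def
    by (metis add.right_neutral)
  note 1 = endo_eq_lin[OF adm, of "f \<oplus>\<^bsub>End\<^esub> g"]
  have "f \<oplus>\<^bsub>End\<^esub> g \<in> extensional (carrier M)" by (simp add: End_simps)
  moreover have "(f \<oplus>\<^bsub>End\<^esub> g) x \<in> carrier M" if "x \<in> carrier M" for x
    using that E.hom_in[OF f'] E.hom_in[OF g'] by (simp add: End_simps E.M.add_in)
  moreover have "crd ((f \<oplus>\<^bsub>End\<^esub> g) x) t l = (\<Sum>s\<in>S. lmonom 0 (coef f s t + coef g s t) * crd x s l)"
    if "x \<in> carrier M" "t \<in> S" "l < n" for x t l
    using that E.hom_in[OF f'] E.hom_in[OF g'] E.crd_hom[OF f'] E.crd_hom[OF g']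
    by (simp add: End_simps E.M.crd_add single_add distrib_right sum.distrib)
  ultimately show "f \<oplus>\<^bsub>End\<^esub> g \<in> carrier End"
    "\<lbrakk>s \<in> S; t \<in> S\<rbrakk> \<Longrightarrow> coef (f \<oplus>\<^bsub>End\<^esub> g) s t = coef f s t + coef g s t" using 1 by blast+
qed

lemma End_mult: "f \<otimes>\<^bsub>End\<^esub> g \<in> carrier End"
    "\<lbrakk>s \<in> S; t \<in> S\<rbrakk> \<Longrightarrow> coef (f \<otimes>\<^bsub>End\<^esub> g) s t = (\<Sum>u\<in>S. coef g s u * coef f u t)"
proof -
  have adm: "E.admissible (\<lambda>s t. \<Sum>u\<in>S. coef g s u * coef f u t)"
    unfolding E.admissible_def
  proof (intro ballI impI allI)
    fix s t l assume s: "s \<in> S" and t: "t \<in> S" and ne: "(\<Sum>u\<in>S. coef g s u * coef f u t) \<noteq> 0" and l: "l < n"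
    obtain u where u: "u \<in> S" "coef g s u * coef f u t \<noteq> 0" using sum.not_neutral_contains_not_neutral[OF ne] by blast
    then have "a t l \<le> a u l" "a u l \<le> a s l"
      using E.coef_admissible[OF f'] E.coef_admissible[OF g'] s t l unfolding E.admissible_def by force+
    then show "a t l \<le> a s l" by simp
  qed
  note 1 = endo_eq_lin[OF adm, of "f \<otimes>\<^bsub>End\<^esub> g"]
  have "f \<otimes>\<^bsub>End\<^esub> g \<in> extensional (carrier M)" by (simp add: End_simps compose_def)
  moreover have "(f \<otimes>\<^bsub>End\<^esub> g) x \<in> carrier M" if "x \<in> carrier M" for x
    using that E.hom_in[OF f'] E.hom_in[OF g'] by (simp add: End_simps compose_def)
  moreover have "crd ((f \<otimes>\<^bsub>End\<^esub> g) x) t l = (\<Sum>s\<in>S. lmonom 0 (\<Sum>u\<in>S. coef g s u * coef f u t) * crd x s l)"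
    if x: "x \<in> carrier M" and t: "t \<in> S" and l: "l < n" for x t l
  proof -
    have sing: "lmonom 0 (\<Sum>u\<in>S. c u) = (\<Sum>u\<in>S. lmonom 0 (c u :: 'k))" for c
      by (induction S rule: infinite_finite_induct) (auto simp: single_add)
    have "crd ((f \<otimes>\<^bsub>End\<^esub> g) x) t l = (\<Sum>u\<in>S. lmonom 0 (coef f u t) * (\<Sum>s\<in>S. lmonom 0 (coef g s u) * crd x s l))"
      using x E.crd_hom[OF f' E.hom_in[OF g' x] t l] E.crd_hom[OF g' x _ l] by (simp add: End_simps compose_def)
    also have "\<dots> = (\<Sum>u\<in>S. \<Sum>s\<in>S. lmonom 0 (coef g s u * coef f u t) * crd x s l)"
      by (simp add: sum_distrib_left mult.assoc[symmetric] mult_single mult.commute[of "coef f _ _"])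
    also have "\<dots> = (\<Sum>s\<in>S. \<Sum>u\<in>S. lmonom 0 (coef g s u * coef f u t) * crd x s l)" by (rule sum.swap)
    finally show ?thesis by (simp add: sing sum_distrib_right)
  qed
  ultimately show "f \<otimes>\<^bsub>End\<^esub> g \<in> carrier End"
    "\<lbrakk>s \<in> S; t \<in> S\<rbrakk> \<Longrightarrow> coef (f \<otimes>\<^bsub>End\<^esub> g) s t = (\<Sum>u\<in>S. coef g s u * coef f u t)" using 1 by blast+
qed

end

lemma End_smult:
  assumes f: "f \<in> carrier End"
  shows "c \<odot>\<^bsub>End\<^esub> f \<in> carrier End"
    "\<lbrakk>s \<in> S; t \<in> S\<rbrakk> \<Longrightarrow> coef (c \<odot>\<^bsub>End\<^esub> f) s t = c * coef f s t"
proof -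
  have f': "f \<in> graded_hom A M M" using f by (simp add: End_simps)
  have adm: "E.admissible (\<lambda>s t. c * coef f s t)"
    using E.coef_admissible[OF f'] unfolding E.admissible_def by (metis mult_zero_right)
  have b: "lmonom 0 c \<cdot>\<^sub>m 1\<^sub>m n \<in> tiled_order_carrier n d"
    by (intro tiled_smult_closed tiled_one_closed E.M.exp) simp
  note 1 = endo_eq_lin[OF adm, of "c \<odot>\<^bsub>End\<^esub> f"]
  have "c \<odot>\<^bsub>End\<^esub> f \<in> extensional (carrier M)" by (simp add: End_simps)
  moreover have "(c \<odot>\<^bsub>End\<^esub> f) x \<in> carrier M" if "x \<in> carrier M" for x
    using that E.hom_in[OF f'] b by (simp add: End_simps E.M.ract_in)
  moreover have "crd ((c \<odot>\<^bsub>End\<^esub> f) x) t l = (\<Sum>s\<in>S. lmonom 0 (c * coef f s t) * crd x s l)"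
    if x: "x \<in> carrier M" and t: "t \<in> S" and l: "l < n" for x t l
  proof -
    have "(\<Sum>m<n. crd (f x) t m * (lmonom 0 c \<cdot>\<^sub>m 1\<^sub>m n) $$ (m, l)) = (\<Sum>m<n. if m = l then crd (f x) t m * lmonom 0 c else 0)"
      using l by (intro sum.cong) auto
    then have "crd ((c \<odot>\<^bsub>End\<^esub> f) x) t l = lmonom 0 c * crd (f x) t l"
      using x l E.M.crd_ract[OF E.hom_in[OF f' x] b t l] by (simp add: End_simps mult.commute)
    then show ?thesis using E.crd_hom[OF f' x t l]
      by (simp add: sum_distrib_left mult.assoc[symmetric] mult_single)
  qed
  ultimately show "c \<odot>\<^bsub>End\<^esub> f \<in> carrier End"
    "\<lbrakk>s \<in> S; t \<in> S\<rbrakk> \<Longrightarrow> coef (c \<odot>\<^bsub>End\<^esub> f) s t = c * coef f s t" using 1 by blast+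
qed

lemma End_zero: "\<zero>\<^bsub>End\<^esub> \<in> carrier End" "\<lbrakk>s \<in> S; t \<in> S\<rbrakk> \<Longrightarrow> coef \<zero>\<^bsub>End\<^esub> s t = 0"
proof -
  have adm: "E.admissible (\<lambda>s t. 0)" by (simp add: E.admissible_def)
  note 1 = endo_eq_lin[OF adm, of "\<zero>\<^bsub>End\<^esub>"]
  show "\<zero>\<^bsub>End\<^esub> \<in> carrier End" "\<lbrakk>s \<in> S; t \<in> S\<rbrakk> \<Longrightarrow> coef \<zero>\<^bsub>End\<^esub> s t = 0"
    by (rule 1; simp add: End_simps E.M.zero_in E.M.crd_zero)+
qed

lemma End_one: "\<one>\<^bsub>End\<^esub> \<in> carrier End" "\<lbrakk>s \<in> S; t \<in> S\<rbrakk> \<Longrightarrow> coef \<one>\<^bsub>End\<^esub> s t = (if s = t then 1 else 0)"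
proof -
  have adm: "E.admissible (\<lambda>s t. if s = t then 1 else 0)" by (auto simp: E.admissible_def)
  have eq: "crd x t l = (\<Sum>s\<in>S. lmonom 0 (if s = t then 1 else 0) * crd x s l)" if "t \<in> S" for x t l
  proof -
    have "(\<Sum>s\<in>S. lmonom 0 (if s = t then 1 else 0) * crd x s l) = (\<Sum>s\<in>S. if s = t then crd x s l else 0)"
      by (intro sum.cong) auto
    then show ?thesis using that E.M.finS by simp
  qed
  note 1 = endo_eq_lin[OF adm, of "\<one>\<^bsub>End\<^esub>"]
  show "\<one>\<^bsub>End\<^esub> \<in> carrier End" "\<lbrakk>s \<in> S; t \<in> S\<rbrakk> \<Longrightarrow> coef \<one>\<^bsub>End\<^esub> s t = (if s = t then 1 else 0)"
    by (rule 1; (simp add: End_simps; fail)?; simp only: End_simps restrict_apply' eq)+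
qed

lemma End_eqI: "\<lbrakk>f \<in> carrier End; g \<in> carrier End; \<And>s t. \<lbrakk>s \<in> S; t \<in> S\<rbrakk> \<Longrightarrow> coef f s t = coef g s t\<rbrakk> \<Longrightarrow> f = g"
  by (rule E.hom_eqI) (simp_all add: End_simps)

lemma End_lin: "E.admissible c \<Longrightarrow> E.lin c \<in> carrier End"
  by (simp add: End_simps E.lin_graded_hom)

lemma coef_nonzero_le: "\<lbrakk>f \<in> carrier End; s \<in> S; t \<in> S; coef f s t \<noteq> 0\<rbrakk> \<Longrightarrow> \<forall>l<n. a t l \<le> a s l"
  using E.coef_admissible[of f] unfolding E.admissible_def End_simps by blast

text \<open>
  All axioms are checked on matrices of scalars.
\<close>

lemma ring_End: "ring End"
proof (rule ringI)
  show "abelian_group End"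
  proof (rule abelian_groupI)
    fix x y z assume x: "x \<in> carrier End" and y: "y \<in> carrier End" and z: "z \<in> carrier End"
    show "x \<oplus>\<^bsub>End\<^esub> y \<in> carrier End" by (rule End_add(1)[OF x y])
    show "x \<oplus>\<^bsub>End\<^esub> y \<oplus>\<^bsub>End\<^esub> z = x \<oplus>\<^bsub>End\<^esub> (y \<oplus>\<^bsub>End\<^esub> z)"
      by (rule End_eqI) (simp_all only: End_add x y z add.assoc)
    show "x \<oplus>\<^bsub>End\<^esub> y = y \<oplus>\<^bsub>End\<^esub> x"
      by (rule End_eqI) (simp_all only: End_add x y add.commute)
    show "\<zero>\<^bsub>End\<^esub> \<oplus>\<^bsub>End\<^esub> x = x"
      by (rule End_eqI) (simp_all only: End_add End_zero x add_0)
    have m: "(- 1) \<odot>\<^bsub>End\<^esub> x \<in> carrier End" by (rule End_smult(1)[OF x])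
    have "(- 1) \<odot>\<^bsub>End\<^esub> x \<oplus>\<^bsub>End\<^esub> x = \<zero>\<^bsub>End\<^esub>"
      by (rule End_eqI[OF End_add(1)[OF m x] End_zero(1)]) (simp add: End_add(2)[OF m x] End_zero End_smult[OF x])
    then show "\<exists>y\<in>carrier End. y \<oplus>\<^bsub>End\<^esub> x = \<zero>\<^bsub>End\<^esub>" using m by blast
  qed (rule End_zero)
  show "Group.monoid End"
  proof (rule monoidI)
    fix x y z assume x: "x \<in> carrier End" and y: "y \<in> carrier End" and z: "z \<in> carrier End"
    show "x \<otimes>\<^bsub>End\<^esub> y \<in> carrier End" by (rule End_mult(1)[OF x y])
    show "x \<otimes>\<^bsub>End\<^esub> y \<otimes>\<^bsub>End\<^esub> z = x \<otimes>\<^bsub>End\<^esub> (y \<otimes>\<^bsub>End\<^esub> z)"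
    proof (rule End_eqI)
      fix s t assume st: "s \<in> S" "t \<in> S"
      have "coef (x \<otimes>\<^bsub>End\<^esub> y \<otimes>\<^bsub>End\<^esub> z) s t = (\<Sum>u\<in>S. \<Sum>v\<in>S. coef z s u * coef y u v * coef x v t)"
        using st by (simp add: End_mult x y z sum_distrib_left mult.assoc)
      also have "\<dots> = (\<Sum>v\<in>S. \<Sum>u\<in>S. coef z s u * coef y u v * coef x v t)" by (rule sum.swap)
      also have "\<dots> = coef (x \<otimes>\<^bsub>End\<^esub> (y \<otimes>\<^bsub>End\<^esub> z)) s t"
        using st by (simp add: End_mult x y z sum_distrib_right)
      finally show "coef (x \<otimes>\<^bsub>End\<^esub> y \<otimes>\<^bsub>End\<^esub> z) s t = coef (x \<otimes>\<^bsub>End\<^esub> (y \<otimes>\<^bsub>End\<^esub> z)) s t" .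
    qed (simp_all only: End_mult x y z)
    have d1: "(\<Sum>u\<in>S. g u * (if u = t then 1 else 0)) = g t" "(\<Sum>u\<in>S. (if t = u then 1 else 0) * g u) = g t"
      if "t \<in> S" for g :: "'s \<Rightarrow> 'k" and t
    proof -
      have "(\<Sum>u\<in>S. g u * (if u = t then 1 else 0)) = (\<Sum>u\<in>S. if u = t then g u else 0)"
        "(\<Sum>u\<in>S. (if t = u then 1 else 0) * g u) = (\<Sum>u\<in>S. if u = t then g u else 0)" by (auto intro!: sum.cong)
      then show "(\<Sum>u\<in>S. g u * (if u = t then 1 else 0)) = g t" "(\<Sum>u\<in>S. (if t = u then 1 else 0) * g u) = g t"
        using that E.M.finS by simp_all
    qed
    have e: "(\<Sum>u\<in>S. coef x s u * coef \<one>\<^bsub>End\<^esub> u t) = coef x s t" "(\<Sum>u\<in>S. coef \<one>\<^bsub>End\<^esub> s u * coef x u t) = coef x s t"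
      if "s \<in> S" "t \<in> S" for s t
      using d1(1)[OF that(2), of "coef x s"] d1(2)[OF that(1), of "\<lambda>u. coef x u t"] that
      by (simp_all add: End_one(2) cong: sum.cong)
    show "\<one>\<^bsub>End\<^esub> \<otimes>\<^bsub>End\<^esub> x = x" 
      by (rule End_eqI[OF End_mult(1)[OF End_one(1) x] x]) (simp only: End_mult(2)[OF End_one(1) x] e)
    show "x \<otimes>\<^bsub>End\<^esub> \<one>\<^bsub>End\<^esub> = x"
      by (rule End_eqI[OF End_mult(1)[OF x End_one(1)] x]) (simp only: End_mult(2)[OF x End_one(1)] e)
  qed (rule End_one)
  fix x y z assume x: "x \<in> carrier End" and y: "y \<in> carrier End" and z: "z \<in> carrier End"
  show "(x \<oplus>\<^bsub>End\<^esub> y) \<otimes>\<^bsub>End\<^esub> z = x \<otimes>\<^bsub>End\<^esub> z \<oplus>\<^bsub>End\<^esub> y \<otimes>\<^bsub>End\<^esub> z"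
    by (rule End_eqI) (simp_all add: End_mult End_add x y z distrib_left sum.distrib)
  show "z \<otimes>\<^bsub>End\<^esub> (x \<oplus>\<^bsub>End\<^esub> y) = z \<otimes>\<^bsub>End\<^esub> x \<oplus>\<^bsub>End\<^esub> z \<otimes>\<^bsub>End\<^esub> y"
    by (rule End_eqI) (simp_all add: End_mult End_add x y z distrib_right sum.distrib)
qed

section \<open>The ideal of maps without stable part\<close>

text \<open>
  The endomorphisms without entries that survive in the stable category. They turn out to be the maps
  that factor through projectives (lemma \<open>projective_maps_eq\<close>).
\<close>

definition unstable :: "('m \<Rightarrow> 'm) set"
  where "unstable = {f \<in> carrier End. \<forall>s\<in>S. \<forall>t\<in>S. stable_hom n d (a s) (a t) \<longrightarrow> coef f s t = 0}"

lemma stable_term: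
  assumes f: "f \<in> carrier End" and g: "g \<in> carrier End" and stu: "s \<in> S" "t \<in> S" "u \<in> S"
    and st: "stable_hom n d (a s) (a t)" and ne: "coef g s u * coef f u t \<noteq> 0"
  shows "stable_hom n d (a s) (a u)" "stable_hom n d (a u) (a t)" "\<not> through_proj n d (a u) (a u)"
proof -
  have "coef g s u \<noteq> 0" "coef f u t \<noteq> 0" using ne by auto
  then have "\<forall>l<n. a u l \<le> a s l" "\<forall>l<n. a t l \<le> a u l" using coef_nonzero_le f g stu by blast+
  from stable_hom_middle[OF E.M.lat[OF stu(3)] st this]
  show "stable_hom n d (a s) (a u)" "stable_hom n d (a u) (a t)" "\<not> through_proj n d (a u) (a u)" .
qed

lemma ideal_unstable: "ideal unstable End"
proof -
  interpret R: ring End by (rule ring_End)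
  have sub: "unstable \<subseteq> carrier End" by (auto simp: unstable_def)
  show ?thesis
  proof (rule idealI[OF ring_End])
    show "subgroup unstable (add_monoid End)"
    proof (rule R.add.subgroupI)
      show "unstable \<noteq> {}" using End_zero by (auto simp: unstable_def)
      fix f assume f: "f \<in> unstable"
      then have fc: "f \<in> carrier End" using sub by blast
      have nf: "\<ominus>\<^bsub>End\<^esub> f \<in> carrier End" using fc by simp
      have "coef (\<ominus>\<^bsub>End\<^esub> f) s t = 0" if "s \<in> S" "t \<in> S" "stable_hom n d (a s) (a t)" for s t
      proof -
        have "coef (f \<oplus>\<^bsub>End\<^esub> \<ominus>\<^bsub>End\<^esub> f) s t = 0" using fc that End_zero(2) R.r_neg by simp
        then show ?thesis using End_add(2)[OF fc nf that(1,2)] f that by (auto simp: unstable_def)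
      qed
      then show "\<ominus>\<^bsub>End\<^esub> f \<in> unstable" using nf by (simp add: unstable_def)
      show "f \<oplus>\<^bsub>End\<^esub> g \<in> unstable" if g: "g \<in> unstable" for g
        using f g by (auto simp: unstable_def End_add)
    qed (use sub in auto)
    fix f g assume f: "f \<in> unstable" and g: "g \<in> carrier End"
    then have fc: "f \<in> carrier End" using sub by blast
    have z: "coef f s t = 0" if "s \<in> S" "t \<in> S" "stable_hom n d (a s) (a t)" for s t
      using f that by (simp add: unstable_def)
    have "(\<Sum>u\<in>S. coef f s u * coef g u t) = 0" if st: "s \<in> S" "t \<in> S" "stable_hom n d (a s) (a t)" for s t
    proof (rule sum.neutral, rule ballI)
      fix u assume "u \<in> S"
      then show "coef f s u * coef g u t = 0" using stable_term(1)[OF g fc st(1,2) _ st(3)] z st by force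
    qed
    then show "g \<otimes>\<^bsub>End\<^esub> f \<in> unstable" using End_mult[OF g fc] by (simp add: unstable_def)
    have "(\<Sum>u\<in>S. coef g s u * coef f u t) = 0" if st: "s \<in> S" "t \<in> S" "stable_hom n d (a s) (a t)" for s t
    proof (rule sum.neutral, rule ballI)
      fix u assume "u \<in> S"
      then show "coef g s u * coef f u t = 0" using stable_term(2)[OF fc g st(1,2) _ st(3)] z st by force
    qed
    then show "f \<otimes>\<^bsub>End\<^esub> g \<in> unstable" using End_mult[OF fc g] by (simp add: unstable_def)
  qed
qed

end

section \<open>Isomorphisms from quotient algebras\<close>

text \<open>
  The isomorphism theorem for rings, together with the scalar multiplication of the quotient.
\<close>

lemma algebra_iso_quot:
  fixes E :: "('k, 'e, 'c) module_scheme" and B :: "('k, 'b, 'd) module_scheme"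
  assumes E: "ring E" and B: "ring B" and h: "h \<in> Ring.ring_hom E B" and surj: "h ` carrier E = carrier B"
    and ker: "I = {x \<in> carrier E. h x = \<zero>\<^bsub>B\<^esub>}"
    and sc: "\<And>c x. x \<in> carrier E \<Longrightarrow> c \<odot>\<^bsub>E\<^esub> x \<in> carrier E"
    and sh: "\<And>c x. x \<in> carrier E \<Longrightarrow> h (c \<odot>\<^bsub>E\<^esub> x) = c \<odot>\<^bsub>B\<^esub> h x"
  shows "algebra_iso (quot_algebra E I) B"
proof -
  interpret h: ring_hom_ring E B h using E B h by (rule ring_hom_ringI2)
  have I: "I = a_kernel E B h" unfolding ker a_kernel_def' ..
  let ?H = "\<lambda>X. the_elem (h ` X)"
  have iso: "?H \<in> ring_iso (E Quot I) B" unfolding I by (rule h.FactRing_iso_set[OF surj])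
  have "carrier (quot_algebra E I) = carrier (E Quot I)" "monoid.mult (quot_algebra E I) = monoid.mult (E Quot I)"
    "add (quot_algebra E I) = add (E Quot I)" "one (quot_algebra E I) = one (E Quot I)"
    by (simp_all add: quot_algebra_def)
  then have "ring_iso (quot_algebra E I) B = ring_iso (E Quot I) B"
    unfolding ring_iso_def Ring.ring_hom_def by (simp only:)
  with iso have "?H \<in> ring_iso (quot_algebra E I) B" by simp
  moreover have "?H (c \<odot>\<^bsub>quot_algebra E I\<^esub> X) = c \<odot>\<^bsub>B\<^esub> ?H X" if X: "X \<in> carrier (quot_algebra E I)" for c X
  proof -
    obtain x where x: "x \<in> carrier E" "X = I +>\<^bsub>E\<^esub> x"
      using X by (auto simp: quot_algebra_def FactRing_def A_RCOSETS_def')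
    have in_coset: "y \<in> carrier E \<and> h y = h z" if "y \<in> I +>\<^bsub>E\<^esub> z" "z \<in> carrier E" for y z
    proof -
      obtain i where i: "i \<in> I" "y = i \<oplus>\<^bsub>E\<^esub> z" using \<open>y \<in> I +>\<^bsub>E\<^esub> z\<close> unfolding a_r_coset_def' by blast
      then have "i \<in> carrier E" "h i = \<zero>\<^bsub>B\<^esub>" unfolding ker by blast+
      then show ?thesis using i(2) \<open>z \<in> carrier E\<close> by simp
    qed
    have self: "z \<in> I +>\<^bsub>E\<^esub> z" if "z \<in> carrier E" for z
    proof -
      have "\<zero>\<^bsub>E\<^esub> \<in> I" unfolding ker by simp
      moreover have "z = \<zero>\<^bsub>E\<^esub> \<oplus>\<^bsub>E\<^esub> z" using that by simp
      ultimately show ?thesis unfolding a_r_coset_def' by blast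
    qed
    have coset: "h ` (I +>\<^bsub>E\<^esub> y) = {h y}" if "y \<in> carrier E" for y
      using in_coset[OF _ that] self[OF that] by blast
    have mem: "x \<in> X" using self[OF x(1)] unfolding x(2) .
    have Xc: "y \<in> carrier E \<and> h y = h x" if "y \<in> X" for y
      using in_coset[OF _ x(1)] that unfolding x(2) by blast
    have "h ` (c \<odot>\<^bsub>quot_algebra E I\<^esub> X) = (\<Union>y\<in>X. h ` (I +>\<^bsub>E\<^esub> (c \<odot>\<^bsub>E\<^esub> y)))"
      by (simp add: quot_algebra_def image_UN)
    also have "\<dots> = (\<Union>y\<in>X. {c \<odot>\<^bsub>B\<^esub> h x})"
    proof (intro SUP_cong refl)
      fix y assume "y \<in> X"
      then have y: "y \<in> carrier E" "h y = h x" using Xc by blast+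
      show "h ` (I +>\<^bsub>E\<^esub> (c \<odot>\<^bsub>E\<^esub> y)) = {c \<odot>\<^bsub>B\<^esub> h x}"
        unfolding coset[OF sc[OF y(1)]] sh[OF y(1)] y(2) ..
    qed
    also have "\<dots> = {c \<odot>\<^bsub>B\<^esub> h x}" using mem by blast
    finally show ?thesis using coset[OF x(1)] x(2) by simp
  qed
  ultimately show ?thesis unfolding algebra_iso_def by (intro bexI[of _ ?H] allI ballI)
qed

section \<open>Shifts, truncations and direct sums of modules with coordinates\<close>

lemma coord_module_mat:
  fixes M :: "('k :: field laurent mat, 'k laurent mat) graded_rmod"
  assumes ex: "exponent_matrix n d" and S: "S \<subseteq> {..<r}" and lat: "\<And>i. i \<in> S \<Longrightarrow> lattice_vec n d (a i)"
    and car: "carrier M = {x \<in> carrier_mat r n. \<forall>i<r. \<forall>l<n.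
        (i \<in> S \<longrightarrow> x $$ (i, l) \<in> order_ge (a i l)) \<and> (i \<notin> S \<longrightarrow> x $$ (i, l) = 0)}"
    and ops: "zero M = 0\<^sub>m r n" "add M = (+)" "ract M = (*)"
      "mcomp M = (\<lambda>l. {x \<in> carrier M. homogeneous_mat l x})"
  shows "coord_module n d M S a (\<lambda>x i l. x $$ (i, l))"
proof
  have less: "i < r" if "i \<in> S" for i using S that by blast
  show "exponent_matrix n d" by (rule ex)
  show "finite S" using S finite_subset by blast
  fix x y :: "'k laurent mat" and s :: nat and l :: nat and f :: "nat \<Rightarrow> nat \<Rightarrow> 'k laurent"
    and b :: "'k laurent mat" and j :: int
  show "lattice_vec n d (a s)" if "s \<in> S" using lat that .
  show "x $$ (s, l) \<in> order_ge (a s l)" if "x \<in> carrier M" "s \<in> S" "l < n"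
    using that less unfolding car by blast
  show "x = y" if x: "x \<in> carrier M" and y: "y \<in> carrier M"
    and eq: "\<And>s l. \<lbrakk>s \<in> S; l < n\<rbrakk> \<Longrightarrow> x $$ (s, l) = y $$ (s, l)"
  proof (rule eq_matI)
    fix i l assume "i < dim_row y" "l < dim_col y"
    then have il: "i < r" "l < n" using y unfolding car by auto
    show "x $$ (i, l) = y $$ (i, l)"
    proof (cases "i \<in> S")
      case False
      then have "x $$ (i, l) = 0" "y $$ (i, l) = 0" using x y il unfolding car by blast+
      then show ?thesis by simp
    qed (use eq il in blast)
  qed (use x y in \<open>auto simp: car\<close>)
  show "\<exists>x\<in>carrier M. \<forall>s\<in>S. \<forall>l<n. x $$ (s, l) = f s l" if "\<And>s l. \<lbrakk>s \<in> S; l < n\<rbrakk> \<Longrightarrow> f s l \<in> order_ge (a s l)"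
    by (rule bexI[of _ "mat r n (\<lambda>(i, l). if i \<in> S then f i l else 0)"]) (use that less in \<open>auto simp: car\<close>)
  show "\<zero>\<^bsub>M\<^esub> \<in> carrier M" by (auto simp: car ops)
  show "\<zero>\<^bsub>M\<^esub> $$ (s, l) = 0" if "s \<in> S" "l < n" using that less by (simp add: ops)
  show "x \<oplus>\<^bsub>M\<^esub> y \<in> carrier M" if "x \<in> carrier M" "y \<in> carrier M"
    using that by (auto simp: car ops intro!: order_ge_add)
  show "(x \<oplus>\<^bsub>M\<^esub> y) $$ (s, l) = x $$ (s, l) + y $$ (s, l)" if "x \<in> carrier M" "y \<in> carrier M" "s \<in> S" "l < n"
    using that less by (auto simp: car ops)
  have ind: "(x * b) $$ (i, l) = (\<Sum>m<n. x $$ (i, m) * b $$ (m, l))"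
    if "x \<in> carrier M" "b \<in> tiled_order_carrier n d" "i < r" "l < n" for i l
    using that by (intro mat_mult_index) (auto simp: car tiled_carrier_iff)
  show "ract M x b $$ (s, l) = (\<Sum>m<n. x $$ (s, m) * b $$ (m, l))"
    if "x \<in> carrier M" "b \<in> tiled_order_carrier n d" "s \<in> S" "l < n"
    using ind that less by (simp add: ops)
  show "ract M x b \<in> carrier M" if x: "x \<in> carrier M" and b: "b \<in> tiled_order_carrier n d"
    unfolding car ops
  proof (intro CollectI conjI allI impI)
    show "x * b \<in> carrier_mat r n" using x b by (auto simp: car tiled_carrier_iff)
    fix i l assume il: "i < r" "l < n"
    show "(x * b) $$ (i, l) = 0" if "i \<notin> S"
      unfolding ind[OF x b il] by (rule sum.neutral) (use x that il in \<open>auto simp: car\<close>)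
    show "(x * b) $$ (i, l) \<in> order_ge (a i l)" if i: "i \<in> S"
      unfolding ind[OF x b il]
    proof (rule order_ge_sum)
      fix m assume "m \<in> {..<n}"
      then have m: "m < n" by simp
      show "x $$ (i, m) * b $$ (m, l) \<in> order_ge (a i l)"
      proof (rule order_ge_mult_le)
        show "x $$ (i, m) \<in> order_ge (a i m)" using x i il m by (simp add: car)
        show "b $$ (m, l) \<in> order_ge (d m l)" using b m il by (simp add: tiled_carrier_iff)
        show "a i l \<le> a i m + d m l" using lat[OF i] m il by (simp add: lattice_vec_def)
      qed
    qed
  qed
  show "x \<in> mcomp M j \<longleftrightarrow> x \<in> carrier M \<and> (\<forall>s\<in>S. \<forall>m<n. \<exists>c. x $$ (s, m) = lmonom j c)"
  proof -
    have "homogeneous_mat j x \<longleftrightarrow> (\<forall>s\<in>S. \<forall>m<n. \<exists>c. x $$ (s, m) = lmonom j c)" if x: "x \<in> carrier M"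
    proof -
      have "\<exists>c. x $$ (i, m) = lmonom j c" if "i < r" "m < n" "i \<notin> S" for i m
        using x that by (intro exI[of _ 0]) (simp add: car)
      moreover have "dim_row x = r" "dim_col x = n" using x by (auto simp: car)
      ultimately show ?thesis using less unfolding homogeneous_mat_def by metis
    qed
    then show ?thesis by (auto simp: ops)
  qed
qed

lemma (in coord_module) coord_module_shift:
  "coord_module n d (shift M k) S (\<lambda>s l. a s l - k) (\<lambda>x s l. lmonom (- k) 1 * crd x s l)"
proof
  let ?M = "shift M k"
  have ops: "carrier ?M = carrier M" "zero ?M = zero M" "add ?M = add M" "ract ?M = ract M"
    "mcomp ?M j = mcomp M (j + k)" for j by (simp_all add: shift_def)
  show "exponent_matrix n d" by (rule exp)
  show "finite S" by (rule finS)
  fix x y :: 'm and s :: 's and l :: nat and f :: "'s \<Rightarrow> nat \<Rightarrow> 'k laurent"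
    and b :: "'k laurent mat" and j :: int
  show "lattice_vec n d (\<lambda>l. a s l - k)" if "s \<in> S" using lat[OF that] by (simp add: lattice_vec_def)
  show "lmonom (- k) 1 * crd x s l \<in> order_ge (a s l - k)" if "x \<in> carrier ?M" "s \<in> S" "l < n"
    using that crd_ge by (simp add: ops lmonom_mult_iff)
  show "x = y" if "x \<in> carrier ?M" "y \<in> carrier ?M"
    and eq: "\<And>s l. \<lbrakk>s \<in> S; l < n\<rbrakk> \<Longrightarrow> lmonom (- k) 1 * crd x s l = lmonom (- k) 1 * crd y s l"
  proof (rule crd_eqI)
    fix s l assume sl: "s \<in> S" "l < n"
    have "lmonom k 1 * (lmonom (- k) 1 * crd x s l) = lmonom k 1 * (lmonom (- k) 1 * crd y s l)"
      by (rule arg_cong[OF eq[OF sl]])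
    then show "crd x s l = crd y s l" by (simp only: lmonom_inverse)
  qed (use that in \<open>simp_all add: ops\<close>)
  show "\<exists>x\<in>carrier ?M. \<forall>s\<in>S. \<forall>l<n. lmonom (- k) 1 * crd x s l = f s l"
    if f: "\<And>s l. \<lbrakk>s \<in> S; l < n\<rbrakk> \<Longrightarrow> f s l \<in> order_ge (a s l - k)"
  proof -
    have "lmonom k 1 * f s l \<in> order_ge (a s l)" if "s \<in> S" "l < n" for s l
      using f[OF that] by (simp add: lmonom_mult_iff)
    from crd_surj[OF this] obtain x where "x \<in> carrier M" "\<forall>s\<in>S. \<forall>l<n. crd x s l = lmonom k 1 * f s l" by blast
    then show ?thesis by (intro bexI[of _ x]) (simp_all add: ops)
  qed
  show "\<zero>\<^bsub>?M\<^esub> \<in> carrier ?M" by (simp add: ops zero_in)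
  show "lmonom (- k) 1 * crd \<zero>\<^bsub>?M\<^esub> s l = 0" if "s \<in> S" "l < n" using that by (simp add: ops crd_zero)
  show "x \<oplus>\<^bsub>?M\<^esub> y \<in> carrier ?M" if "x \<in> carrier ?M" "y \<in> carrier ?M" using that by (simp add: ops add_in)
  show "lmonom (- k) 1 * crd (x \<oplus>\<^bsub>?M\<^esub> y) s l = lmonom (- k) 1 * crd x s l + lmonom (- k) 1 * crd y s l"
    if "x \<in> carrier ?M" "y \<in> carrier ?M" "s \<in> S" "l < n" using that by (simp add: ops crd_add distrib_left)
  show "ract ?M x b \<in> carrier ?M" if "x \<in> carrier ?M" "b \<in> tiled_order_carrier n d"
    using that by (simp add: ops ract_in)
  show "lmonom (- k) 1 * crd (ract ?M x b) s l = (\<Sum>m<n. lmonom (- k) 1 * crd x s m * b $$ (m, l))"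
    if "x \<in> carrier ?M" "b \<in> tiled_order_carrier n d" "s \<in> S" "l < n"
    using that by (simp add: ops crd_ract sum_distrib_left mult.assoc)
  have "(\<exists>c. crd x s m = lmonom (j + k) c) \<longleftrightarrow> (\<exists>c. lmonom (- k) 1 * crd x s m = lmonom j c)" for s m
    unfolding lmonom_eq_iff lookup_lmonom_mult by simp (metis add_diff_cancel_right' diff_add_cancel)
  then show "x \<in> mcomp ?M j \<longleftrightarrow> x \<in> carrier ?M \<and> (\<forall>s\<in>S. \<forall>m<n. \<exists>c. lmonom (- k) 1 * crd x s m = lmonom j c)"
    by (simp add: ops mcomp_iff)
qed

lemma (in coord_module) trunc_carrier:
  "carrier (trunc_nonneg M) = {x \<in> carrier M. \<forall>s\<in>S. \<forall>l<n. crd x s l \<in> order_ge 0}"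
proof (intro Set.set_eqI iffI)
  fix x assume "x \<in> carrier (trunc_nonneg M)"
  then obtain N f where f: "f \<in> (\<Pi> l\<in>{0..N}. mcomp M l)" and x: "x = (\<Oplus>\<^bsub>M\<^esub>l\<in>{0..N::int}. f l)"
    by (auto simp: trunc_nonneg_def)
  have fc: "f j \<in> carrier M" if "j \<in> {0..N}" for j using f that by (auto simp: mcomp_iff)
  then have "x \<in> carrier M" unfolding x by (intro M.finsum_closed) auto
  moreover have "crd x s l \<in> order_ge 0" if sl: "s \<in> S" "l < n" for s l
  proof -
    have "crd x s l = (\<Sum>j\<in>{0..N}. crd (f j) s l)" unfolding x by (rule crd_finsum[OF _ fc sl]) auto
    also have "\<dots> \<in> order_ge 0"
    proof (rule order_ge_sum)
      fix j assume j: "j \<in> {0..N}"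
      then obtain c where "crd (f j) s l = lmonom j c" using f sl unfolding Pi_def mcomp_iff by blast
      then show "crd (f j) s l \<in> order_ge 0" using j by simp
    qed
    finally show ?thesis .
  qed
  ultimately show "x \<in> {x \<in> carrier M. \<forall>s\<in>S. \<forall>l<n. crd x s l \<in> order_ge 0}" by simp
next
  fix x assume "x \<in> {x \<in> carrier M. \<forall>s\<in>S. \<forall>l<n. crd x s l \<in> order_ge 0}"
  then have x: "x \<in> carrier M" and ge: "\<And>s l. \<lbrakk>s \<in> S; l < n\<rbrakk> \<Longrightarrow> crd x s l \<in> order_ge 0" by auto
  define K where "K = (\<Union>s\<in>S. \<Union>k<n. Poly_Mapping.keys (crd x s k))"
  have finK: "finite K" using finS by (simp add: K_def)
  define N where "N = Max (insert 0 K)"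
  define g where "g j = mk (\<lambda>s k. lmonom j (lookup (crd x s k) j))" for j
  have g: "g j \<in> carrier M" "\<And>s k. \<lbrakk>s \<in> S; k < n\<rbrakk> \<Longrightarrow> crd (g j) s k = lmonom j (lookup (crd x s k) j)" for j
    unfolding g_def by (rule mk; use crd_ge[OF x] in \<open>force dest: order_geD\<close>)+
  have "x = (\<Oplus>\<^bsub>M\<^esub>j\<in>{0..N}. g j)"
  proof (rule crd_eqI[OF x])
    show "(\<Oplus>\<^bsub>M\<^esub>j\<in>{0..N}. g j) \<in> carrier M" using g by (intro M.finsum_closed) auto
    fix s k assume sk: "s \<in> S" "k < n"
    have "crd (\<Oplus>\<^bsub>M\<^esub>j\<in>{0..N}. g j) s k = (\<Sum>j\<in>{0..N}. lmonom j (lookup (crd x s k) j))"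
      by (subst crd_finsum) (simp_all add: g sk)
    moreover have "crd x s k = (\<Sum>j\<in>{0..N}. lmonom j (lookup (crd x s k) j))"
    proof (rule poly_mapping_eqI)
      fix t
      have "lookup (\<Sum>j\<in>{0..N}. lmonom j (lookup (crd x s k) j)) t = (\<Sum>j\<in>{0..N}. if j = t then lookup (crd x s k) t else 0)"
        unfolding lookup_sum by (intro sum.cong) (auto simp: lookup_single when_def)
      also have "\<dots> = lookup (crd x s k) t"
      proof (cases "lookup (crd x s k) t = 0")
        case False
        then have "0 \<le> t" using order_geD[OF ge[OF sk], of t] by force
        moreover have "t \<in> K" using False sk by (auto simp: K_def in_keys_iff)
        then have "t \<le> N" unfolding N_def using finK by (intro Max_ge) auto
        ultimately show ?thesis by simp
      qed (auto intro!: sum.neutral)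
      finally show "lookup (crd x s k) t = lookup (\<Sum>j\<in>{0..N}. lmonom j (lookup (crd x s k) j)) t" by simp
    qed
    ultimately show "crd x s k = crd (\<Oplus>\<^bsub>M\<^esub>j\<in>{0..N}. g j) s k" by simp
  qed
  moreover have "g \<in> (\<Pi> j\<in>{0..N}. mcomp M j)" using g by (auto simp: mcomp_iff)
  ultimately show "x \<in> carrier (trunc_nonneg M)" unfolding trunc_nonneg_def by auto
qed

text \<open>
  Truncation replaces the exponents by their nonnegative parts; these still form lattice vectors
  because the exponent matrix is nonnegative.
\<close>

lemma (in coord_module) coord_module_trunc:
  assumes nonneg: "\<And>i j. \<lbrakk>i < n; j < n\<rbrakk> \<Longrightarrow> 0 \<le> d i j"
  shows "coord_module n d (trunc_nonneg M) S (\<lambda>s l. max 0 (a s l)) crd"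
proof
  let ?M = "trunc_nonneg M"
  have ops: "zero ?M = zero M" "add ?M = add M" "ract ?M = ract M"
    "mcomp ?M = (\<lambda>j. if 0 \<le> j then mcomp M j else {\<zero>\<^bsub>M\<^esub>})" by (simp_all add: trunc_nonneg_def)
  have carD: "x \<in> carrier M" "\<And>s l. \<lbrakk>s \<in> S; l < n\<rbrakk> \<Longrightarrow> crd x s l \<in> order_ge 0" if "x \<in> carrier ?M" for x
    using that by (auto simp: trunc_carrier)
  have maxge: "f \<in> order_ge (max 0 e) \<longleftrightarrow> f \<in> order_ge 0 \<and> f \<in> order_ge e" for e and f :: "'k laurent"
    by (auto simp: order_ge_def)
  show "exponent_matrix n d" by (rule exp)
  show "finite S" by (rule finS)
  fix x y :: 'm and s :: 's and l :: nat and f :: "'s \<Rightarrow> nat \<Rightarrow> 'k laurent"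
    and b :: "'k laurent mat" and j :: int
  show "lattice_vec n d (\<lambda>l. max 0 (a s l))" if "s \<in> S"
    using lat[OF that] nonneg by (fastforce simp: lattice_vec_def)
  show "crd x s l \<in> order_ge (max 0 (a s l))" if "x \<in> carrier ?M" "s \<in> S" "l < n"
    using carD[OF that(1)] that crd_ge by (simp add: maxge)
  show "x = y" if "x \<in> carrier ?M" "y \<in> carrier ?M" "\<And>s l. \<lbrakk>s \<in> S; l < n\<rbrakk> \<Longrightarrow> crd x s l = crd y s l"
    by (rule crd_eqI[OF carD(1)[OF that(1)] carD(1)[OF that(2)] that(3)])
  show "\<exists>x\<in>carrier ?M. \<forall>s\<in>S. \<forall>l<n. crd x s l = f s l"
    if f: "\<And>s l. \<lbrakk>s \<in> S; l < n\<rbrakk> \<Longrightarrow> f s l \<in> order_ge (max 0 (a s l))"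
  proof -
    have "f s l \<in> order_ge (a s l)" if "s \<in> S" "l < n" for s l using f[OF that] by (simp add: maxge)
    from crd_surj[OF this] obtain x where "x \<in> carrier M" "\<forall>s\<in>S. \<forall>l<n. crd x s l = f s l" by blast
    then show ?thesis using f by (intro bexI[of _ x]) (simp_all add: trunc_carrier maxge)
  qed
  show "\<zero>\<^bsub>?M\<^esub> \<in> carrier ?M" by (simp add: ops trunc_carrier zero_in crd_zero)
  show "crd \<zero>\<^bsub>?M\<^esub> s l = 0" if "s \<in> S" "l < n" using that by (simp add: ops crd_zero)
  show "x \<oplus>\<^bsub>?M\<^esub> y \<in> carrier ?M" if "x \<in> carrier ?M" "y \<in> carrier ?M"
    using that by (simp add: ops trunc_carrier add_in crd_add order_ge_add)
  show "crd (x \<oplus>\<^bsub>?M\<^esub> y) s l = crd x s l + crd y s l"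
    if "x \<in> carrier ?M" "y \<in> carrier ?M" "s \<in> S" "l < n" using that carD by (simp add: ops crd_add)
  show "ract ?M x b \<in> carrier ?M" if x: "x \<in> carrier ?M" and b: "b \<in> tiled_order_carrier n d"
  proof -
    have "crd (ract M x b) s l \<in> order_ge 0" if sl: "s \<in> S" "l < n" for s l
      unfolding crd_ract[OF carD(1)[OF x] b sl]
    proof (rule order_ge_sum)
      fix m assume m: "m \<in> {..<n}"
      show "crd x s m * b $$ (m, l) \<in> order_ge 0"
        by (rule order_ge_mult_le[of _ 0 _ "d m l"]) (use carD(2)[OF x sl(1)] b m sl nonneg in \<open>auto simp: tiled_carrier_iff\<close>)
    qed
    then show ?thesis using carD(1)[OF x] b by (simp add: ops trunc_carrier ract_in)
  qed
  show "crd (ract ?M x b) s l = (\<Sum>m<n. crd x s m * b $$ (m, l))"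
    if "x \<in> carrier ?M" "b \<in> tiled_order_carrier n d" "s \<in> S" "l < n"
    using that carD by (simp add: ops crd_ract)
  show "x \<in> mcomp ?M j \<longleftrightarrow> x \<in> carrier ?M \<and> (\<forall>s\<in>S. \<forall>m<n. \<exists>c. crd x s m = lmonom j c)"
  proof (cases "0 \<le> j")
    case True
    have "crd x s m \<in> order_ge 0" if x: "\<forall>s\<in>S. \<forall>m<n. \<exists>c. crd x s m = lmonom j c" and "s \<in> S" "m < n" for s m
    proof -
      obtain c where "crd x s m = lmonom j c" using x \<open>s \<in> S\<close> \<open>m < n\<close> by blast
      then show ?thesis using True by simp
    qed
    then show ?thesis using True by (auto simp: ops mcomp_iff trunc_carrier)
  next
    case False
    have "x = \<zero>\<^bsub>M\<^esub>" if x: "x \<in> carrier ?M" and h: "\<forall>s\<in>S. \<forall>m<n. \<exists>c. crd x s m = lmonom j c"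
    proof (rule crd_eqI[OF carD(1)[OF x] zero_in])
      fix s m assume sm: "s \<in> S" "m < n"
      obtain c where c: "crd x s m = lmonom j c" using h sm by blast
      then have "c = 0" using carD(2)[OF x sm] False by simp
      then show "crd x s m = crd \<zero>\<^bsub>M\<^esub> s m" using c sm by (simp add: crd_zero)
    qed
    moreover have "\<zero>\<^bsub>M\<^esub> \<in> carrier ?M" "\<forall>s\<in>S. \<forall>m<n. \<exists>c. crd \<zero>\<^bsub>M\<^esub> s m = lmonom j c"
      by (auto simp: trunc_carrier zero_in crd_zero intro: exI[of _ 0])
    ultimately show ?thesis using False by (auto simp: ops)
  qed
qed

lemma (in coord_module) coord_module_reindex:
  fixes h :: "'u \<Rightarrow> 's"
  assumes h: "bij_betw h S' S"
  shows "coord_module n d M S' (\<lambda>s. a (h s)) (\<lambda>x s. crd x (h s))"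
proof
  have hS: "h s \<in> S" if "s \<in> S'" for s using h that by (auto simp: bij_betw_def)
  have inv: "\<exists>s'\<in>S'. s = h s'" if "s \<in> S" for s using h that by (auto simp: bij_betw_def)
  show "exponent_matrix n d" by (rule exp)
  show "finite S'" using h finS bij_betw_finite by blast
  fix x y :: 'm and s and l :: nat and f :: "'u \<Rightarrow> nat \<Rightarrow> 'k laurent"
    and b :: "'k laurent mat" and j :: int
  show "lattice_vec n d (a (h s))" if "s \<in> S'" using lat hS that by blast
  show "crd x (h s) l \<in> order_ge (a (h s) l)" if "x \<in> carrier M" "s \<in> S'" "l < n" using that crd_ge hS by blast
  show "x = y" if "x \<in> carrier M" "y \<in> carrier M" "\<And>s l. \<lbrakk>s \<in> S'; l < n\<rbrakk> \<Longrightarrow> crd x (h s) l = crd y (h s) l"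
    using crd_eqI[OF that(1,2)] that(3) inv by blast
  show "\<exists>x\<in>carrier M. \<forall>s\<in>S'. \<forall>l<n. crd x (h s) l = f s l"
    if f: "\<And>s l. \<lbrakk>s \<in> S'; l < n\<rbrakk> \<Longrightarrow> f s l \<in> order_ge (a (h s) l)"
  proof -
    let ?g = "inv_into S' h"
    have g: "?g s \<in> S'" "h (?g s) = s" if "s \<in> S" for s
      using that h inv_into_into[of s h S'] f_inv_into_f[of s h S'] by (auto simp: bij_betw_def)
    have gh: "?g (h s) = s" if "s \<in> S'" for s using that h by (simp add: bij_betw_def inv_into_f_f)
    have "f (?g s) l \<in> order_ge (a s l)" if "s \<in> S" "l < n" for s l using f[of "?g s" l] g that by simp
    from crd_surj[OF this] obtain x where "x \<in> carrier M" "\<forall>s\<in>S. \<forall>l<n. crd x s l = f (?g s) l" by blast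
    then show ?thesis using hS gh by (intro bexI[of _ x]) simp_all
  qed
  show "x \<in> mcomp M j \<longleftrightarrow> x \<in> carrier M \<and> (\<forall>s\<in>S'. \<forall>m<n. \<exists>c. crd x (h s) m = lmonom j c)"
    unfolding mcomp_iff using hS inv by metis
qed (use h in \<open>auto simp: zero_in crd_zero add_in crd_add ract_in crd_ract bij_betw_def\<close>)

lemma coord_module_dsum:
  fixes F :: "'i \<Rightarrow> ('k :: field laurent mat, 'm) graded_rmod" and S :: "'i \<Rightarrow> 't set"
  assumes ex: "exponent_matrix n d" and I: "finite I"
    and F: "\<And>i. i \<in> I \<Longrightarrow> coord_module n d (F i) (S i) (a i) (crd i)"
  shows "coord_module n d (graded_dsum I F) (Sigma I S) (\<lambda>p. a (fst p) (snd p)) (\<lambda>x p. crd (fst p) (x (fst p)) (snd p))"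
proof
  let ?M = "graded_dsum I F"
  have ops: "carrier ?M = (\<Pi>\<^sub>E i\<in>I. carrier (F i))" "zero ?M = (\<lambda>i\<in>I. \<zero>\<^bsub>F i\<^esub>)"
    "add ?M = (\<lambda>f g. \<lambda>i\<in>I. f i \<oplus>\<^bsub>F i\<^esub> g i)" "ract ?M = (\<lambda>f a. \<lambda>i\<in>I. ract (F i) (f i) a)"
    "mcomp ?M = (\<lambda>l. \<Pi>\<^sub>E i\<in>I. mcomp (F i) l)" by (simp_all add: graded_dsum_def)
  have I': "fst p \<in> I" "snd p \<in> S (fst p)" if "p \<in> Sigma I S" for p using that by auto
  have xc: "x i \<in> carrier (F i)" if "x \<in> carrier ?M" "i \<in> I" for x i using that by (auto simp: ops)
  show "exponent_matrix n d" by (rule ex)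
  show "finite (Sigma I S)" using I coord_module.finS[OF F] by blast
  fix x y :: "'i \<Rightarrow> 'm" and p :: "'i \<times> 't" and l :: nat and f :: "'i \<times> 't \<Rightarrow> nat \<Rightarrow> 'k laurent"
    and b :: "'k laurent mat" and j :: int
  show "lattice_vec n d (a (fst p) (snd p))" if "p \<in> Sigma I S"
    using coord_module.lat[OF F] I'[OF that] by blast
  show "crd (fst p) (x (fst p)) (snd p) l \<in> order_ge (a (fst p) (snd p) l)" if "x \<in> carrier ?M" "p \<in> Sigma I S" "l < n"
    using coord_module.crd_ge[OF F] I'[OF that(2)] xc that by blast
  show "x = y" if x: "x \<in> carrier ?M" and y: "y \<in> carrier ?M"
    and eq: "\<And>p l. \<lbrakk>p \<in> Sigma I S; l < n\<rbrakk> \<Longrightarrow> crd (fst p) (x (fst p)) (snd p) l = crd (fst p) (y (fst p)) (snd p) l"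
  proof (rule PiE_ext[of x I _ y])
    fix i assume i: "i \<in> I"
    show "x i = y i"
      by (rule coord_module.crd_eqI[OF F[OF i] xc[OF x i] xc[OF y i]]) (use eq i in force)
  qed (use x y in \<open>simp_all add: ops\<close>)
  show "\<exists>x\<in>carrier ?M. \<forall>p\<in>Sigma I S. \<forall>l<n. crd (fst p) (x (fst p)) (snd p) l = f p l"
    if f: "\<And>p l. \<lbrakk>p \<in> Sigma I S; l < n\<rbrakk> \<Longrightarrow> f p l \<in> order_ge (a (fst p) (snd p) l)"
  proof -
    have "\<exists>z\<in>carrier (F i). \<forall>s\<in>S i. \<forall>l<n. crd i z s l = f (i, s) l" if "i \<in> I" for i
      using coord_module.crd_surj[OF F[OF that], of "\<lambda>s. f (i, s)"] f[of "(i, _)"] that by force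
    then obtain z where z: "\<And>i. i \<in> I \<Longrightarrow> z i \<in> carrier (F i) \<and> (\<forall>s\<in>S i. \<forall>l<n. crd i (z i) s l = f (i, s) l)"
      by metis
    show ?thesis by (rule bexI[of _ "restrict z I"]) (use z in \<open>auto simp: ops\<close>)
  qed
  show "\<zero>\<^bsub>?M\<^esub> \<in> carrier ?M" using coord_module.zero_in[OF F] by (auto simp: ops)
  show "crd (fst p) (\<zero>\<^bsub>?M\<^esub> (fst p)) (snd p) l = 0" if "p \<in> Sigma I S" "l < n"
    using coord_module.crd_zero[OF F] I'[OF that(1)] that by (simp add: ops)
  show "x \<oplus>\<^bsub>?M\<^esub> y \<in> carrier ?M" if "x \<in> carrier ?M" "y \<in> carrier ?M"
    using coord_module.add_in[OF F] that by (auto simp: ops PiE_def Pi_def)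
  show "crd (fst p) ((x \<oplus>\<^bsub>?M\<^esub> y) (fst p)) (snd p) l = crd (fst p) (x (fst p)) (snd p) l + crd (fst p) (y (fst p)) (snd p) l"
    if "x \<in> carrier ?M" "y \<in> carrier ?M" "p \<in> Sigma I S" "l < n"
    using coord_module.crd_add[OF F] I'[OF that(3)] xc that by (simp add: ops)
  show "ract ?M x b \<in> carrier ?M" if "x \<in> carrier ?M" "b \<in> tiled_order_carrier n d"
    using coord_module.ract_in[OF F] that by (auto simp: ops PiE_def Pi_def)
  show "crd (fst p) (ract ?M x b (fst p)) (snd p) l = (\<Sum>m<n. crd (fst p) (x (fst p)) (snd p) m * b $$ (m, l))"
    if "x \<in> carrier ?M" "b \<in> tiled_order_carrier n d" "p \<in> Sigma I S" "l < n"
    using coord_module.crd_ract[OF F] I'[OF that(3)] xc that by (simp add: ops)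
  have "x \<in> mcomp ?M j \<longleftrightarrow> x \<in> carrier ?M \<and> (\<forall>i\<in>I. x i \<in> mcomp (F i) j)"
    using coord_module.mcomp_iff[OF F] by (auto simp: ops PiE_def Pi_def)
  also have "\<dots> \<longleftrightarrow> x \<in> carrier ?M \<and> (\<forall>i\<in>I. \<forall>s\<in>S i. \<forall>m<n. \<exists>c. crd i (x i) s m = lmonom j c)"
    using coord_module.mcomp_iff[OF F] xc[of x] by blast
  finally show "x \<in> mcomp ?M j \<longleftrightarrow> x \<in> carrier ?M \<and> (\<forall>p\<in>Sigma I S. \<forall>m<n. \<exists>c. crd (fst p) (x (fst p)) (snd p) m = lmonom j c)"
    by auto
qed

section \<open>Coordinates on V and on free modules\<close>

lemma lattice_vec_row: "exponent_matrix n d \<Longrightarrow> i < n \<Longrightarrow> lattice_vec n d (d i)"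
  by (simp add: exponent_matrix_def lattice_vec_def)

text \<open>
  The module \<open>e\<^sub>i A\<close> consists of the matrices supported in row \<open>i\<close>.
\<close>

lemma idem_module_carrier:
  assumes i: "i < n"
  shows "carrier (idem_module n d i :: ('k :: field laurent mat, _) graded_rmod) = {x \<in> carrier_mat n n. \<forall>r<n. \<forall>l<n.
        (r \<in> {i} \<longrightarrow> x $$ (r, l) \<in> order_ge (d i l)) \<and> (r \<notin> {i} \<longrightarrow> x $$ (r, l) = 0)}" (is "_ = ?C")
proof -
  have ind: "(mat_idem n i * a) $$ (r, l) = (if r = i then a $$ (i, l) else 0)"
    if "a \<in> carrier_mat n n" "r < n" "l < n" for a :: "'k laurent mat" and r l
  proof -
    have "(mat_idem n i * a) $$ (r, l) = (\<Sum>k<n. mat_idem n i $$ (r, k) * a $$ (k, l))"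
      using that by (intro mat_mult_index) (auto simp: mat_idem_def)
    also have "\<dots> = (\<Sum>k<n. if k = i then (if r = i then a $$ (i, l) else 0) else 0)"
      using that by (intro sum.cong) (auto simp: mat_idem_def)
    finally show ?thesis using i by simp
  qed
  show ?thesis
  proof (intro Set.set_eqI iffI)
    fix x :: "'k laurent mat" assume "x \<in> carrier (idem_module n d i)"
    then obtain a where a: "a \<in> tiled_order_carrier n d" "x = mat_idem n i * a" by (auto simp: idem_module_def mat_rmod_def)
    then have "x \<in> carrier_mat n n" by (auto simp: tiled_carrier_iff mat_idem_def)
    then show "x \<in> ?C" using a i by (auto simp: ind tiled_carrier_iff)
  next
    fix x :: "'k laurent mat" assume x: "x \<in> ?C"
    then have xm: "x \<in> carrier_mat n n" by simp
    have "x \<in> tiled_order_carrier n d"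
      unfolding tiled_carrier_iff
    proof (intro conjI allI impI)
      fix r l assume "r < n" "l < n"
      then show "x $$ (r, l) \<in> order_ge (d r l)" using x by (cases "r = i") auto
    qed (rule xm)
    moreover have "x = mat_idem n i * x"
      by (rule eq_matI) (use x xm ind[OF xm] in \<open>auto simp: mat_idem_def\<close>)
    ultimately show "x \<in> carrier (idem_module n d i)" by (auto simp: idem_module_def mat_rmod_def)
  qed
qed

lemma coord_module_idem:
  assumes "exponent_matrix n d" "i < n"
  shows "coord_module n d (idem_module n d i) {i} (\<lambda>r l. d i l) (\<lambda>x r l. x $$ (r, l))"
proof (rule coord_module_mat[where r = n])
  show "lattice_vec n d (d i)" for r using lattice_vec_row assms by blast
qed (use assms idem_module_carrier in \<open>simp_all add: idem_module_def mat_rmod_def\<close>)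

lemma coord_module_row:
  assumes "exponent_matrix n d" "\<And>i j. \<lbrakk>i < n; j < n\<rbrakk> \<Longrightarrow> 0 \<le> d i j"
  shows "coord_module n d (row_module n) {0} (\<lambda>r l. 0) (\<lambda>x r l. x $$ (r, l))"
  by (rule coord_module_mat[where r = 1])
    (use assms in \<open>auto simp: row_module_def mat_rmod_def lattice_vec_def poly_part_eq\<close>)

lemma coord_module_regular:
  assumes "exponent_matrix n d"
  shows "coord_module n d (graded_regular (tiled_order n d)) {..<n} d (\<lambda>x r l. x $$ (r, l))"
  by (rule coord_module_mat[where r = n])
    (use assms lattice_vec_row in \<open>auto simp: graded_regular_def tiled_carrier_iff\<close>)

definition V_row :: "nat \<Rightarrow> (nat \<Rightarrow> nat \<Rightarrow> int) \<Rightarrow> (nat \<times> int) option \<Rightarrow> nat"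
  where "V_row n d s = (case s of None \<Rightarrow> 0 | Some (i, j) \<Rightarrow> nakayama n d i)"

text \<open>
  The only nonzero row of an element of a summand, shifted so that its degrees become those of
  \<open>V\<close>.
\<close>

definition V_crd :: "nat \<Rightarrow> (nat \<Rightarrow> nat \<Rightarrow> int) \<Rightarrow> ((nat \<times> int) option \<Rightarrow> 'k :: field laurent mat) \<Rightarrow>
    (nat \<times> int) option \<Rightarrow> nat \<Rightarrow> 'k laurent"
  where "V_crd n d x s l = (case s of None \<Rightarrow> x s $$ (0, l)
    | Some (i, j) \<Rightarrow> lmonom (- j) 1 * x s $$ (nakayama n d i, l))"

lemma (in N_gorenstein_tiled) coord_module_V:
  "coord_module n d (V_module n d :: ('k :: field laurent mat, _) graded_rmod) (V_index n d) (V_exp n d) (V_crd n d)"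
proof -
  let ?F = "(\<lambda>s. case s of None \<Rightarrow> row_module n
         | Some (i, j) \<Rightarrow> trunc_nonneg (shift (idem_module n d (nakayama n d i)) j))
      :: _ \<Rightarrow> ('k laurent mat, 'k laurent mat) graded_rmod"
  let ?crd = "(\<lambda>s x r l. case s of None \<Rightarrow> x $$ (r, l) | Some (i, j) \<Rightarrow> lmonom (- j) 1 * x $$ (r, l))
      :: _ \<Rightarrow> 'k laurent mat \<Rightarrow> nat \<Rightarrow> nat \<Rightarrow> 'k laurent"
  have F: "coord_module n d (?F s) {V_row n d s} (\<lambda>r. V_exp n d s) (?crd s)" if s: "s \<in> V_index n d" for s
  proof (cases s)
    case None
    have "V_exp n d None = (\<lambda>l. 0)" by (rule ext) simp
    then show ?thesis using coord_module_row[OF exp nonneg] None by (simp add: V_row_def)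
  next
    case (Some p)
    obtain i j where p: "p = (i, j)" by (cases p)
    have i: "\<nu> i < n" using s by (simp add: Some p V_index_Some)
    interpret C1: coord_module n d "idem_module n d (\<nu> i) :: ('k laurent mat, _) graded_rmod" "{\<nu> i}" "\<lambda>r l. d (\<nu> i) l" "\<lambda>x r l. x $$ (r, l)"
      by (rule coord_module_idem[OF exp i])
    interpret C2: coord_module n d "shift (idem_module n d (\<nu> i) :: ('k laurent mat, _) graded_rmod) j" "{\<nu> i}"
      "\<lambda>r l. d (\<nu> i) l - j" "\<lambda>x r l. lmonom (- j) 1 * x $$ (r, l)"
      by (rule C1.coord_module_shift)
    have "V_exp n d (Some (i, j)) = (\<lambda>l. max 0 (d (\<nu> i) l - j))" by (rule ext) simp
    then show ?thesis using C2.coord_module_trunc[OF nonneg]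
      by (simp add: Some p V_row_def nakayama_eq)
  qed
  have V: "V_module n d = graded_dsum (V_index n d) ?F" by (simp add: V_module_def V_index_def)
  have D: "coord_module n d (V_module n d :: ('k laurent mat, _) graded_rmod) (SIGMA s:V_index n d. {V_row n d s})
     (\<lambda>p. V_exp n d (fst p)) (\<lambda>x p. ?crd (fst p) (x (fst p)) (snd p))"
    unfolding V by (rule coord_module_dsum[OF exp finite_V_index F])
  have h: "bij_betw (\<lambda>s. (s, V_row n d s)) (V_index n d) (SIGMA s:V_index n d. {V_row n d s})"
    by (auto simp: bij_betw_def inj_on_def)
  have e: "(\<lambda>x s. ?crd (fst (s, V_row n d s)) (x (fst (s, V_row n d s))) (snd (s, V_row n d s))) = (V_crd n d :: _ \<Rightarrow> _ \<Rightarrow> _ \<Rightarrow> 'k laurent)"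
    by (intro ext) (simp add: V_crd_def V_row_def split: option.split)
  show ?thesis using coord_module.coord_module_reindex[OF D h] unfolding e by simp
qed

lemma coord_module_free:
  assumes "exponent_matrix n d"
  shows "coord_module n d (graded_dsum {..<m :: nat} (\<lambda>i. shift (graded_regular (tiled_order n d)) (q i)))
    (SIGMA i:{..<m}. {..<n}) (\<lambda>p l. d (snd p) l - q (fst p))
    (\<lambda>x p l. lmonom (- q (fst p)) 1 * x (fst p) $$ (snd p, l))"
  by (rule coord_module_dsum[OF assms, of "{..<m}" _ "\<lambda>_. {..<n}" "\<lambda>i r l. d r l - q i" "\<lambda>i x r l. lmonom (- q i) 1 * x $$ (r, l)"])
    (use coord_module.coord_module_shift[OF coord_module_regular[OF assms]] in auto)

section \<open>Finite generation and freeness over the base\<close>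

lemma poly_ring_simps [simp]:
  "carrier poly_ring = poly_part" "monoid.mult poly_ring = (*)" "one poly_ring = 1" "zero poly_ring = 0"
  "add poly_ring = (+)"
  by (simp_all add: poly_ring_def)

lemma ring_poly_ring: "ring (poly_ring :: 'k :: field laurent ring)" (is "ring ?R")
proof (rule ringI)
  show "abelian_group ?R"
  proof (rule abelian_groupI)
    fix x assume "x \<in> carrier ?R"
    then show "\<exists>y\<in>carrier ?R. y \<oplus>\<^bsub>?R\<^esub> x = \<zero>\<^bsub>?R\<^esub>"
      by (intro bexI[of _ "- x"]) (auto simp: poly_part_eq intro: order_ge_uminus)
  qed (auto simp: poly_part_eq intro: order_ge_add)
  have "1 \<in> (order_ge 0 :: 'k laurent set)" using order_ge_lmonom[of 0 1 0] by simp
  then show "Group.monoid ?R"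
    by unfold_locales (auto simp: poly_part_eq mult.assoc intro: order_ge_mult_le)
qed (simp_all add: algebra_simps)

context coord_module begin

lemma basis_el_inj:
  assumes "s \<in> S" "s' \<in> S" "l < n" "l' < n" "basis_el s l (a s l) = basis_el s' l' (a s' l')"
  shows "s = s' \<and> l = l'"
proof -
  have "crd (basis_el s' l' (a s' l')) s l = lmonom (a s l) 1"
    unfolding assms(5)[symmetric] basis_el(2)[OF order_refl assms(1,3)] by simp
  moreover have "crd (basis_el s' l' (a s' l')) s l = (if s = s' \<and> l = l' then lmonom (a s' l') 1 else 0)"
    by (rule basis_el(2)[OF order_refl assms(1,3)])
  moreover have "lmonom (a s l) (1 :: 'k) \<noteq> 0" by (metis lookup_single_eq lookup_zero zero_neq_one)
  ultimately show ?thesis by (metis (full_types))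
qed

text \<open>
  One generator in the lowest degree for every row and column; they form a basis over \<open>R\<close>.
\<close>

definition gens :: "'m set" where "gens = (\<lambda>(s, l). basis_el s l (a s l)) ` (S \<times> {..<n})"

lemma finite_gens: "finite gens" using finS by (simp add: gens_def)

lemma gens_carrier: "gens \<subseteq> carrier M" by (auto simp: gens_def basis_el)

lemma inj_gens: "inj_on (\<lambda>(s, l). basis_el s l (a s l)) (S \<times> {..<n})"
  using basis_el_inj by (auto simp: inj_on_def)

definition gen_pos :: "'m \<Rightarrow> 's \<times> nat" where "gen_pos = inv_into (S \<times> {..<n}) (\<lambda>(s, l). basis_el s l (a s l))"

lemma gen_pos: "\<lbrakk>s \<in> S; l < n\<rbrakk> \<Longrightarrow> gen_pos (basis_el s l (a s l)) = (s, l)"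
  using inv_into_f_f[OF inj_gens, of "(s, l)"] by (simp add: gen_pos_def)

text \<open>
  The coordinate of \<open>x\<close> with respect to the generator in row \<open>s\<close> and column \<open>l\<close>.
\<close>

definition coeff_at :: "'m \<Rightarrow> 's \<Rightarrow> nat \<Rightarrow> 'k laurent"
  where "coeff_at x s l = lmonom (- a s l) 1 * crd x s l"

lemma coeff_at: "\<lbrakk>x \<in> carrier M; s \<in> S; l < n\<rbrakk> \<Longrightarrow> coeff_at x s l \<in> poly_part"
  using crd_ge by (simp add: coeff_at_def poly_part_eq lmonom_mult_iff)

lemma coeff_at_mult: "lmonom (a s l) 1 * coeff_at x s l = crd x s l"
  unfolding coeff_at_def by (rule lmonom_inverse)

lemma fin_gen_M: "fin_gen A M"
  unfolding fin_gen_def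
proof (intro exI[of _ gens] conjI ballI)
  show "finite gens" by (rule finite_gens)
  show "gens \<subseteq> carrier M" by (rule gens_carrier)
  fix x assume x: "x \<in> carrier M"
  define c where "c g = (case gen_pos g of (s, l) \<Rightarrow> unit_mat n (coeff_at x s l) l l)" for g
  have U: "unit_mat n (coeff_at x s l) l l \<in> tiled_order_carrier n d" if "s \<in> S" "l < n" for s l
    using coeff_at[OF x that] that by (intro unit_mat_in_tiled) (simp add: poly_part_eq)
  have c: "c \<in> gens \<rightarrow> carrier A" by (auto simp: c_def gens_def gen_pos U)
  have rc: "ract M g (c g) \<in> carrier M" if "g \<in> gens" for g
    using that c gens_carrier by (intro ract_in) auto
  have "x = (\<Oplus>\<^bsub>M\<^esub>g\<in>gens. ract M g (c g))"
  proof (rule crd_eqI[OF x])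
    show "(\<Oplus>\<^bsub>M\<^esub>g\<in>gens. ract M g (c g)) \<in> carrier M" using rc by (intro M.finsum_closed) auto
    fix s k assume sk: "s \<in> S" "k < n"
    have "crd (\<Oplus>\<^bsub>M\<^esub>g\<in>gens. ract M g (c g)) s k = (\<Sum>g\<in>gens. crd (ract M g (c g)) s k)"
      by (rule crd_finsum[OF finite_gens rc sk])
    also have "\<dots> = (\<Sum>p\<in>S \<times> {..<n}. crd (ract M (basis_el (fst p) (snd p) (a (fst p) (snd p)))
        (c (basis_el (fst p) (snd p) (a (fst p) (snd p))))) s k)"
      unfolding gens_def by (subst sum.reindex[OF inj_gens]) (simp add: comp_def case_prod_beta)
    also have "\<dots> = (\<Sum>p\<in>S \<times> {..<n}. if p = (s, k) then crd x s k else 0)"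
    proof (intro sum.cong refl)
      fix p assume "p \<in> S \<times> {..<n}"
      then have p: "fst p \<in> S" "snd p < n" by auto
      have g: "coeff_at x (fst p) (snd p) \<in> order_ge (d (snd p) (snd p))"
        using coeff_at[OF x p] p by (simp add: poly_part_eq)
      show "crd (ract M (basis_el (fst p) (snd p) (a (fst p) (snd p)))
        (c (basis_el (fst p) (snd p) (a (fst p) (snd p))))) s k = (if p = (s, k) then crd x s k else 0)"
        unfolding c_def gen_pos[OF p] case_prod_conv crd_ract_unit_mat[OF basis_el(1)[OF order_refl] g p(2) sk]
        using basis_el(2)[OF order_refl sk(1) p(2), of "fst p" "snd p"] by (cases p) (auto simp: coeff_at_mult)
    qed
    also have "\<dots> = crd x s k" using sk finS by (simp add: sum.delta)
    finally show "crd x s k = crd (\<Oplus>\<^bsub>M\<^esub>g\<in>gens. ract M g (c g)) s k" by simp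
  qed
  then show "\<exists>c\<in>gens \<rightarrow> carrier A. x = (\<Oplus>\<^bsub>M\<^esub>s\<in>gens. ract M s (c s))" using c by blast
qed

lemma scalar_mat: "r \<in> poly_part \<Longrightarrow> r \<cdot>\<^sub>m 1\<^sub>m n \<in> tiled_order_carrier n d"
  by (intro tiled_smult_closed tiled_one_closed exp) (simp add: poly_part_eq)

lemma crd_scalar:
  assumes "x \<in> carrier M" "r \<in> poly_part" "s \<in> S" "l < n"
  shows "crd (ract M x (r \<cdot>\<^sub>m 1\<^sub>m n)) s l = crd x s l * r"
proof -
  have "(\<Sum>m<n. crd x s m * (r \<cdot>\<^sub>m 1\<^sub>m n) $$ (m, l)) = (\<Sum>m<n. if m = l then crd x s m * r else 0)"
    using assms by (intro sum.cong) auto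
  then show ?thesis using assms by (simp add: crd_ract scalar_mat)
qed

lemma base_simps:
  "carrier (base_module n M) = carrier M" "zero (base_module n M) = zero M" "add (base_module n M) = add M"
  "ract (base_module n M) x r = ract M x (r \<cdot>\<^sub>m 1\<^sub>m n)"
  by (simp_all add: base_module_def)

lemma right_module_base: "right_module poly_ring (base_module n M)"
proof -
  interpret R: ring "poly_ring :: 'k laurent ring" by (rule ring_poly_ring)
  have "abelian_group (base_module n M)"
    by (rule abelian_groupI)
      (auto simp: base_simps M.a_ac M.l_neg intro!: bexI[of _ "\<ominus>\<^bsub>M\<^esub> _"])
  then interpret B: abelian_group "base_module n M" .
  show ?thesis
  proof
    fix m m' and b c :: "'k laurent"
    assume "m \<in> carrier (base_module n M)"
    then have m: "m \<in> carrier M" by (simp add: base_simps)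
    have one: "1 \<in> (poly_part :: 'k laurent set)" using R.one_closed by simp
    show "ract (base_module n M) m \<one>\<^bsub>poly_ring\<^esub> = m"
      unfolding base_simps poly_ring_simps
      by (rule crd_eqI[OF ract_in[OF m scalar_mat[OF one]] m]) (simp add: crd_scalar m one)
    assume "b \<in> carrier poly_ring"
    then have b: "b \<in> poly_part" by simp
    note in_m = ract_in[OF _ scalar_mat]
    show "ract (base_module n M) m b \<in> carrier (base_module n M)" using m b by (simp add: base_simps in_m)
    show "ract (base_module n M) (m \<oplus>\<^bsub>base_module n M\<^esub> m') b =
      ract (base_module n M) m b \<oplus>\<^bsub>base_module n M\<^esub> ract (base_module n M) m' b"
      if "m' \<in> carrier (base_module n M)"
      using that unfolding base_simps
      by (intro crd_eqI) (simp_all add: m b in_m add_in crd_add crd_scalar distrib_right)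
    assume "c \<in> carrier poly_ring"
    then have c: "c \<in> poly_part" by simp
    have bc: "b + c \<in> poly_part" "b * c \<in> poly_part" using R.a_closed[of b c] R.m_closed[of b c] b c by simp_all
    show "ract (base_module n M) m (b \<oplus>\<^bsub>poly_ring\<^esub> c) =
      ract (base_module n M) m b \<oplus>\<^bsub>base_module n M\<^esub> ract (base_module n M) m c"
      unfolding base_simps poly_ring_simps
      by (intro crd_eqI) (simp_all add: m b c bc in_m add_in crd_add crd_scalar distrib_left)
    show "ract (base_module n M) m (b \<otimes>\<^bsub>poly_ring\<^esub> c) = ract (base_module n M) (ract (base_module n M) m b) c"
      unfolding base_simps poly_ring_simps
      by (intro crd_eqI) (simp_all add: m b c bc in_m crd_scalar mult.assoc)
  qed
qed

lemma free_simps: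
  "carrier (free_rmod poly_ring gens) = {f \<in> gens \<rightarrow>\<^sub>E poly_part. finite {i \<in> gens. f i \<noteq> 0}}"
  "add (free_rmod poly_ring gens) = (\<lambda>f g. \<lambda>i\<in>gens. f i + g i)"
  "ract (free_rmod poly_ring gens) = (\<lambda>f a. \<lambda>i\<in>gens. f i * a)"
  by (simp_all add: free_rmod_def)

lemma projective_base: "projective_rmod poly_ring (base_module n M)"
proof -
  let ?F = "free_rmod (poly_ring :: 'k laurent ring) gens"
  let ?B = "base_module n M"
  define f where "f = (\<lambda>x\<in>carrier M. \<lambda>g\<in>gens. coeff_at x (fst (gen_pos g)) (snd (gen_pos g)))"
  define h where "h = (\<lambda>c\<in>carrier ?F. mk (\<lambda>s l. lmonom (a s l) 1 * c (basis_el s l (a s l))))"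
  have pos: "fst (gen_pos g) \<in> S" "snd (gen_pos g) < n" "basis_el (fst (gen_pos g)) (snd (gen_pos g)) (a (fst (gen_pos g)) (snd (gen_pos g))) = g"
    if "g \<in> gens" for g using that by (auto simp: gens_def gen_pos)
  have gin: "basis_el s l (a s l) \<in> gens" if "s \<in> S" "l < n" for s l using that by (auto simp: gens_def)
  have Fc: "carrier ?F = gens \<rightarrow>\<^sub>E poly_part" using finite_gens by (auto simp: free_simps)
  have h: "h c \<in> carrier M" "\<lbrakk>s \<in> S; l < n\<rbrakk> \<Longrightarrow> crd (h c) s l = lmonom (a s l) 1 * c (basis_el s l (a s l))"
    if c: "c \<in> gens \<rightarrow>\<^sub>E poly_part" for c s l
  proof -
    have "lmonom (a s l) 1 * c (basis_el s l (a s l)) \<in> order_ge (a s l)" if "s \<in> S" "l < n" for s l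
      using c gin[OF that] by (auto simp: lmonom_mult_iff poly_part_eq)
    note mk[of "\<lambda>s l. lmonom (a s l) 1 * c (basis_el s l (a s l))", OF this]
    then show "h c \<in> carrier M" "\<lbrakk>s \<in> S; l < n\<rbrakk> \<Longrightarrow> crd (h c) s l = lmonom (a s l) 1 * c (basis_el s l (a s l))"
      using c by (simp_all add: h_def Fc)
  qed
  have fin: "f x \<in> gens \<rightarrow>\<^sub>E poly_part" if "x \<in> carrier M" for x
    using that pos coeff_at[OF that] by (auto simp: f_def)
  have "f \<in> rmod_hom poly_ring ?B ?F"
    unfolding rmod_hom_def mem_Collect_eq base_simps Fc
  proof (intro conjI ballI)
    show "f \<in> carrier M \<rightarrow>\<^sub>E (gens \<rightarrow>\<^sub>E poly_part)" using fin by (auto simp: f_def)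
    fix x assume x: "x \<in> carrier M"
    show "f (x \<oplus>\<^bsub>M\<^esub> y) = f x \<oplus>\<^bsub>?F\<^esub> f y" if y: "y \<in> carrier M" for y
      unfolding free_simps by (rule ext) (simp add: f_def x y add_in coeff_at_def crd_add pos distrib_left)
    show "f (ract M x (r \<cdot>\<^sub>m 1\<^sub>m n)) = ract ?F (f x) r" if "r \<in> carrier poly_ring" for r
      using that unfolding free_simps
      by (intro ext) (simp add: f_def x ract_in scalar_mat coeff_at_def crd_scalar pos mult.assoc)
  qed
  moreover have "h \<in> rmod_hom poly_ring ?F ?B"
    unfolding rmod_hom_def mem_Collect_eq base_simps Fc
  proof (intro conjI ballI)
    show "h \<in> (gens \<rightarrow>\<^sub>E poly_part) \<rightarrow>\<^sub>E carrier M" using h(1) Fc by (auto simp: h_def)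
    fix x assume x: "x \<in> gens \<rightarrow>\<^sub>E (poly_part :: 'k laurent set)"
    show "h (x \<oplus>\<^bsub>?F\<^esub> y) = h x \<oplus>\<^bsub>M\<^esub> h y" if y: "y \<in> gens \<rightarrow>\<^sub>E poly_part" for y
    proof -
      have xy: "x \<oplus>\<^bsub>?F\<^esub> y \<in> gens \<rightarrow>\<^sub>E poly_part"
        using x y by (auto simp: free_simps poly_part_eq intro!: order_ge_add)
      show ?thesis
      proof (rule crd_eqI[OF h(1)[OF xy] add_in[OF h(1)[OF x] h(1)[OF y]]])
        fix s l assume sl: "s \<in> S" "l < n"
        have "(x \<oplus>\<^bsub>?F\<^esub> y) (basis_el s l (a s l)) = x (basis_el s l (a s l)) + y (basis_el s l (a s l))"
          using gin[OF sl] by (simp add: free_simps)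
        then show "crd (h (x \<oplus>\<^bsub>?F\<^esub> y)) s l = crd (h x \<oplus>\<^bsub>M\<^esub> h y) s l"
          unfolding crd_add[OF h(1)[OF x] h(1)[OF y] sl] h(2)[OF x sl] h(2)[OF y sl] h(2)[OF xy sl]
          by (simp only: distrib_left)
      qed
    qed
    show "h (ract ?F x r) = ract M (h x) (r \<cdot>\<^sub>m 1\<^sub>m n)" if "r \<in> carrier poly_ring" for r
    proof -
      have r: "r \<in> poly_part" using that by simp
      have xr: "ract ?F x r \<in> gens \<rightarrow>\<^sub>E poly_part"
        using x r by (auto simp: free_simps poly_part_eq intro!: order_ge_mult_le[of _ 0 _ 0])
      show ?thesis
      proof (rule crd_eqI[OF h(1)[OF xr] ract_in[OF h(1)[OF x] scalar_mat[OF r]]])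
        fix s l assume sl: "s \<in> S" "l < n"
        have "ract ?F x r (basis_el s l (a s l)) = x (basis_el s l (a s l)) * r"
          using gin[OF sl] by (simp add: free_simps)
        then show "crd (h (ract ?F x r)) s l = crd (ract M (h x) (r \<cdot>\<^sub>m 1\<^sub>m n)) s l"
          unfolding crd_scalar[OF h(1)[OF x] r sl] h(2)[OF x sl] h(2)[OF xr sl]
          by (simp only: mult.assoc)
      qed
    qed
  qed
  moreover have "h (f x) = x" if x: "x \<in> carrier M" for x
  proof (rule crd_eqI[OF h(1)[OF fin[OF x]] x])
    fix s l assume sl: "s \<in> S" "l < n"
    have "f x (basis_el s l (a s l)) = coeff_at x s l" using x gin[OF sl] gen_pos[OF sl] by (simp add: f_def)
    then show "crd (h (f x)) s l = crd x s l" unfolding h(2)[OF fin[OF x] sl] by (simp only: coeff_at_mult)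
  qed
  ultimately show ?thesis
    unfolding projective_rmod_def using right_module_base by (auto simp: base_simps)
qed

lemma graded_CM_M: "graded_CM n d M"
  unfolding graded_CM_def using graded_right_module_M fin_gen_M projective_base by blast

end

section \<open>Maps factoring through projectives\<close>

lemma (in coord_module) graded_hom_compose:
  assumes f: "f \<in> graded_hom A M L" and g: "g \<in> graded_hom A L N"
  shows "compose (carrier M) g f \<in> graded_hom A M N"
proof -
  have fc: "f x \<in> carrier L" if "x \<in> carrier M" for x using f that by (auto simp: graded_hom_def rmod_hom_def)
  have gc: "g y \<in> carrier N" if "y \<in> carrier L" for y using g that by (auto simp: graded_hom_def rmod_hom_def)
  have fh: "f (x \<oplus>\<^bsub>M\<^esub> y) = f x \<oplus>\<^bsub>L\<^esub> f y" "b \<in> carrier A \<Longrightarrow> f (ract M x b) = ract L (f x) b"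
    if "x \<in> carrier M" "y \<in> carrier M" for x y b using f that unfolding graded_hom_def rmod_hom_def by blast+
  have gh: "g (x \<oplus>\<^bsub>L\<^esub> y) = g x \<oplus>\<^bsub>N\<^esub> g y" "b \<in> carrier A \<Longrightarrow> g (ract L x b) = ract N (g x) b"
    if "x \<in> carrier L" "y \<in> carrier L" for x y b using g that unfolding graded_hom_def rmod_hom_def by blast+
  show ?thesis
    unfolding graded_hom_def rmod_hom_def mem_Collect_eq
  proof (intro conjI ballI allI)
    show "compose (carrier M) g f \<in> carrier M \<rightarrow>\<^sub>E carrier N" using fc gc by (simp add: compose_def)
    fix x assume x: "x \<in> carrier M"
    show "compose (carrier M) g f (x \<oplus>\<^bsub>M\<^esub> y) = compose (carrier M) g f x \<oplus>\<^bsub>N\<^esub> compose (carrier M) g f y"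
      if y: "y \<in> carrier M" for y
      using x y by (simp add: compose_eq add_in fh(1)[OF x y] gh(1)[OF fc[OF x] fc[OF y]])
    show "compose (carrier M) g f (ract M x b) = ract N (compose (carrier M) g f x) b" if b: "b \<in> carrier A" for b
      using x b ract_in[OF x, of b] by (simp add: compose_eq fh(2)[OF x x] gh(2)[OF fc[OF x] fc[OF x]])
  next
    fix j
    show "compose (carrier M) g f ` mcomp M j \<subseteq> mcomp N j"
    proof
      fix y assume "y \<in> compose (carrier M) g f ` mcomp M j"
      then obtain x where x: "x \<in> mcomp M j" "y = compose (carrier M) g f x" by blast
      then have "y = g (f x)" by (simp add: compose_eq mcomp_iff)
      moreover have "f x \<in> mcomp L j" using f x(1) unfolding graded_hom_def by blast
      ultimately show "y \<in> mcomp N j" using g unfolding graded_hom_def by blast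
    qed
  qed
qed

lemma free_graded_projective:
  assumes ex: "exponent_matrix n d"
  shows "graded_projective (tiled_order n d :: ('k :: field, _) graded_algebra)
    (graded_dsum {..<m :: nat} (\<lambda>i. shift (graded_regular (tiled_order n d)) (q i)))" (is "graded_projective ?A ?F")
proof -
  interpret F: coord_module n d ?F "SIGMA i:{..<m}. {..<n}" "\<lambda>p l. d (snd p) l - q (fst p)"
    "\<lambda>x p l. lmonom (- q (fst p)) 1 * x (fst p) $$ (snd p, l)" by (rule coord_module_free[OF ex])
  interpret E: coord_end n d ?F "SIGMA i:{..<m}. {..<n}" "\<lambda>p l. d (snd p) l - q (fst p)"
    "\<lambda>x p l. lmonom (- q (fst p)) 1 * x (fst p) $$ (snd p, l)" by unfold_locales
  have "(\<lambda>x\<in>carrier ?F. x) \<in> graded_hom ?A ?F ?F" using E.End_one(1) by (simp add: E.End_simps)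
  then show ?thesis
    unfolding graded_projective_def Let_def
    by (intro conjI F.graded_right_module_M exI[of _ m] exI[of _ q] bexI[of _ "\<lambda>x\<in>carrier ?F. x"]) auto
qed

context coord_end begin

text \<open>
  A map through a graded projective also factors through a finite sum of shifts of \<open>A\<close>, so through
  shifts of modules \<open>e\<^sub>m A\<close>. If an entry of the composite is nonzero, some term in the matrix product is,
  which puts such a module between the two lattices.
\<close>

lemma projective_maps_subset: "projective_maps n d M M \<subseteq> unstable"
proof
  fix f assume "f \<in> projective_maps n d M M"
  then obtain P :: "('k laurent mat, nat \<Rightarrow> 'k laurent mat) graded_rmod" and g h where
    f: "f \<in> graded_hom A M M" and P: "graded_projective A P" and g: "g \<in> graded_hom A M P" and
    h: "h \<in> graded_hom A P M" and fgh: "\<forall>x\<in>carrier M. f x = h (g x)"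
    by (auto simp: projective_maps_def Let_def)
  obtain m :: nat and q where "\<exists>i \<in> graded_hom A P (graded_dsum {..<m} (\<lambda>i. shift (graded_regular A) (q i))).
     \<exists>p \<in> graded_hom A (graded_dsum {..<m} (\<lambda>i. shift (graded_regular A) (q i))) P. \<forall>x\<in>carrier P. p (i x) = x"
    using P unfolding graded_projective_def Let_def by blast
  then obtain i p where i: "i \<in> graded_hom A P (graded_dsum {..<m} (\<lambda>i. shift (graded_regular A) (q i)))"
    and p: "p \<in> graded_hom A (graded_dsum {..<m} (\<lambda>i. shift (graded_regular A) (q i))) P"
    and pi: "\<forall>x\<in>carrier P. p (i x) = x" by blast
  define F where "F = graded_dsum {..<m} (\<lambda>i. shift (graded_regular A) (q i))"
  let ?S = "SIGMA i:{..<m}. {..<n}" and ?a = "\<lambda>p l. d (snd p) l - q (fst p)"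
    and ?c = "\<lambda>x p l. lmonom (- q (fst p)) (1 :: 'k) * x (fst p) $$ (snd p, l)"
  interpret F: coord_module n d F ?S ?a ?c unfolding F_def by (rule coord_module_free[OF E.M.exp])
  interpret MF: coord_pair n d M S a crd F ?S ?a ?c by unfold_locales
  interpret FM: coord_pair n d F ?S ?a ?c M S a crd by unfold_locales
  have ig: "compose (carrier M) i g \<in> graded_hom A M F"
    using E.M.graded_hom_compose[OF g i] unfolding F_def .
  have hp: "compose (carrier F) h p \<in> graded_hom A F M"
    by (rule F.graded_hom_compose[OF p[folded F_def] h])
  have eq: "f x = compose (carrier F) h p (compose (carrier M) i g x)" if x: "x \<in> carrier M" for x
  proof -
    have gx: "g x \<in> carrier P" using g x by (auto simp: graded_hom_def rmod_hom_def)
    then have "i (g x) \<in> carrier F" using i by (auto simp: graded_hom_def rmod_hom_def F_def)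
    then show ?thesis using x gx fgh pi by (simp add: compose_def)
  qed
  show "f \<in> unstable"
    unfolding unstable_def
  proof (intro CollectI conjI ballI impI)
    show "f \<in> carrier End" using f by (simp add: End_simps)
    fix s t assume st: "s \<in> S" "t \<in> S" and stable: "stable_hom n d (a s) (a t)"
    have "coef f s t = (\<Sum>u\<in>?S. MF.coef (compose (carrier M) i g) s u * FM.coef (compose (carrier F) h p) u t)"
      by (rule coef_comp[of n d M S a crd F ?S ?a ?c M S a crd, OF MF.coord_pair_axioms FM.coord_pair_axioms E.coord_pair_axioms ig hp eq st])
    also have "\<dots> = 0"
    proof (rule sum.neutral, rule ballI, rule ccontr)
      fix u assume u: "u \<in> ?S" and ne: "MF.coef (compose (carrier M) i g) s u * FM.coef (compose (carrier F) h p) u t \<noteq> 0"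
      then have ne: "MF.coef (compose (carrier M) i g) s u \<noteq> 0" "FM.coef (compose (carrier F) h p) u t \<noteq> 0" by auto
      have 1: "\<forall>l<n. ?a u l \<le> a s l"
        using MF.coef_admissible[OF ig, unfolded MF.admissible_def, rule_format, OF st(1) u ne(1)] by blast
      have 2: "\<forall>l<n. a t l \<le> ?a u l"
        using FM.coef_admissible[OF hp, unfolded FM.admissible_def, rule_format, OF u st(2) ne(2)] by blast
      have un: "snd u < n" using u by auto
      have "through_proj n d (a s) (a t)"
        unfolding through_proj_def
      proof (intro exI[of _ "snd u"] conjI allI impI)
        fix l assume l: "l < n"
        have "a t (snd u) \<le> - q (fst u)" using 2[rule_format, OF un] un by simp
        moreover have "d (snd u) l - q (fst u) \<le> a s l" using 1[rule_format, OF l] by simp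
        ultimately show "d (snd u) l + a t (snd u) \<le> a s l" by simp
      qed (rule un)
      then show False using stable by (simp add: stable_hom_def)
    qed
    finally show "coef f s t = 0" .
  qed
qed

text \<open>
  For each nonzero entry choose a projective \<open>e\<^sub>m A\<close>, shifted, between the two lattices. The direct sum over
  all these entries of the corresponding shifts of \<open>A\<close> is a free module through which \<open>f\<close> factors.
\<close>

lemma unstable_subset: "unstable \<subseteq> projective_maps n d M M"
proof
  fix f assume "f \<in> unstable"
  then have fE: "f \<in> carrier End" and z: "\<And>s t. \<lbrakk>s \<in> S; t \<in> S; stable_hom n d (a s) (a t)\<rbrakk> \<Longrightarrow> coef f s t = 0"
    by (auto simp: unstable_def)
  have f: "f \<in> graded_hom A M M" using fE by (simp add: End_simps)
  define T where "T = {(s, t). s \<in> S \<and> t \<in> S \<and> coef f s t \<noteq> 0}"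
  have finT: "finite T" by (rule finite_subset[of _ "S \<times> S"]) (auto simp: T_def E.M.finS)
  define m where "m = card T"
  obtain \<beta> where \<beta>: "bij_betw \<beta> {..<m} T" unfolding m_def using ex_bij_betw_nat_finite[OF finT] by (auto simp: lessThan_atLeast0)
  have tp: "\<exists>r<n. \<forall>l<n. d r l + a t r \<le> a s l" if "(s, t) \<in> T" for s t
  proof -
    have st: "s \<in> S" "t \<in> S" "coef f s t \<noteq> 0" using that by (auto simp: T_def)
    then have "\<forall>l<n. a t l \<le> a s l" using coef_nonzero_le[OF fE] by blast
    moreover have "\<not> stable_hom n d (a s) (a t)" using z st by blast
    ultimately show ?thesis by (simp add: stable_hom_def through_proj_def)
  qed
  define row where "row p = (SOME r. r < n \<and> (\<forall>l<n. d r l + a (snd p) r \<le> a (fst p) l))" for p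
  have row: "row p < n" "\<And>l. l < n \<Longrightarrow> d (row p) l + a (snd p) (row p) \<le> a (fst p) l" if "p \<in> T" for p
  proof -
    have "\<exists>r. r < n \<and> (\<forall>l<n. d r l + a (snd p) r \<le> a (fst p) l)" using tp[of "fst p" "snd p"] that by auto
    then have "row p < n \<and> (\<forall>l<n. d (row p) l + a (snd p) (row p) \<le> a (fst p) l)" unfolding row_def by (rule someI_ex)
    then show "row p < n" "\<And>l. l < n \<Longrightarrow> d (row p) l + a (snd p) (row p) \<le> a (fst p) l" by auto
  qed
  define q where "q i = - a (snd (\<beta> i)) (row (\<beta> i))" for i
  define F where "F = graded_dsum {..<m} (\<lambda>i. shift (graded_regular A) (q i))"
  let ?S = "SIGMA i:{..<m}. {..<n}" and ?a = "\<lambda>p l. d (snd p) l - q (fst p)"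
    and ?c = "\<lambda>x p l. lmonom (- q (fst p)) (1 :: 'k) * x (fst p) $$ (snd p, l)"
  interpret F: coord_module n d F ?S ?a ?c unfolding F_def by (rule coord_module_free[OF E.M.exp])
  interpret MF: coord_pair n d M S a crd F ?S ?a ?c by unfold_locales
  interpret FM: coord_pair n d F ?S ?a ?c M S a crd by unfold_locales
  (* c1 sends row s to the chosen row in the copies of A that belong to entries starting at s;
     c2 sends the chosen row of each copy to the target of its entry. *)
  define c1 where "c1 s u = (if snd u = row (\<beta> (fst u)) \<and> fst (\<beta> (fst u)) = s then coef f s (snd (\<beta> (fst u))) else 0)" for s and u :: "nat \<times> nat"
  define c2 where "c2 u t = (if snd u = row (\<beta> (fst u)) \<and> snd (\<beta> (fst u)) = t then 1 else 0 :: 'k)" for t and u :: "nat \<times> nat"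
  have \<beta>T: "\<beta> i \<in> T" if "i < m" for i using \<beta> that by (auto simp: bij_betw_def)
  have adm1: "MF.admissible c1"
    unfolding MF.admissible_def
  proof (intro ballI impI allI)
    fix s u l assume u: "u \<in> ?S" and ne: "c1 s u \<noteq> 0" and l: "l < n"
    then have e: "snd u = row (\<beta> (fst u))" "fst (\<beta> (fst u)) = s" by (auto simp: c1_def split: if_splits)
    have "fst u < m" using u by auto
    from row(2)[OF \<beta>T[OF this] l] show "?a u l \<le> a s l" unfolding e(1) q_def e(2) by linarith
  qed
  have adm2: "FM.admissible c2"
    unfolding FM.admissible_def
  proof (intro ballI impI allI)
    fix u t l assume u: "u \<in> ?S" and t: "t \<in> S" and ne: "c2 u t \<noteq> 0" and l: "l < n"
    then have e: "snd u = row (\<beta> (fst u))" "snd (\<beta> (fst u)) = t" by (auto simp: c2_def split: if_splits)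
    have um: "fst u < m" using u by auto
    have "a t l \<le> a t (row (\<beta> (fst u))) + d (row (\<beta> (fst u))) l"
      using E.M.lat[OF t] row(1)[OF \<beta>T[OF um]] l by (simp add: lattice_vec_def)
    then show "a t l \<le> ?a u l" unfolding e(1) q_def e(2) by linarith
  qed
  have h1: "MF.lin c1 \<in> graded_hom A M F" by (rule MF.lin_graded_hom[OF adm1])
  have h2: "FM.lin c2 \<in> graded_hom A F M" by (rule FM.lin_graded_hom[OF adm2])
  have comp: "compose (carrier M) (FM.lin c2) (MF.lin c1) \<in> graded_hom A M M"
    by (rule E.M.graded_hom_compose[OF h1 h2])
  have feq: "f = compose (carrier M) (FM.lin c2) (MF.lin c1)"
  proof (rule E.hom_eqI[OF f comp])
    fix s t assume st: "s \<in> S" "t \<in> S"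
    have "coef (compose (carrier M) (FM.lin c2) (MF.lin c1)) s t = (\<Sum>u\<in>?S. MF.coef (MF.lin c1) s u * FM.coef (FM.lin c2) u t)"
      by (rule coef_comp[of n d M S a crd F ?S ?a ?c M S a crd, OF MF.coord_pair_axioms FM.coord_pair_axioms E.coord_pair_axioms h1 h2 _ st]) (simp add: compose_def)
    also have "\<dots> = (\<Sum>u\<in>?S. c1 s u * c2 u t)"
      using MF.coef_lin[OF adm1 st(1)] FM.coef_lin[OF adm2 _ st(2)] by (intro sum.cong refl) simp
    also have "\<dots> = (\<Sum>i<m. \<Sum>r<n. c1 s (i, r) * c2 (i, r) t)"
      by (simp add: sum.Sigma case_prod_beta)
    also have "\<dots> = (\<Sum>i<m. if \<beta> i = (s, t) then coef f s t else 0)"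
    proof (intro sum.cong refl)
      fix i assume "i \<in> {..<m}"
      then have i: "i < m" by simp
      have "(\<Sum>r<n. c1 s (i, r) * c2 (i, r) t) = (\<Sum>r<n. if r = row (\<beta> i) then (if \<beta> i = (s, t) then coef f s t else 0) else 0)"
        by (intro sum.cong refl) (auto simp: c1_def c2_def prod_eq_iff)
      then show "(\<Sum>r<n. c1 s (i, r) * c2 (i, r) t) = (if \<beta> i = (s, t) then coef f s t else 0)"
        using row(1)[OF \<beta>T[OF i]] by simp
    qed
    also have "\<dots> = (\<Sum>p\<in>T. if p = (s, t) then coef f s t else 0)"
      by (rule sum.reindex_bij_betw[OF \<beta>])
    also have "\<dots> = coef f s t" using finT st by (auto simp: T_def)
    finally show "coef f s t = coef (compose (carrier M) (FM.lin c2) (MF.lin c1)) s t" by simp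
  qed
  have eq: "\<forall>x\<in>carrier M. f x = FM.lin c2 (MF.lin c1 x)"
  proof
    fix x assume "x \<in> carrier M"
    then show "f x = FM.lin c2 (MF.lin c1 x)" by (rule trans[OF fun_cong[OF feq] compose_eq])
  qed
  have CM: "graded_CM n d F" by (rule F.graded_CM_M)
  have GP: "graded_projective A F" unfolding F_def by (rule free_graded_projective[OF E.M.exp])
  show "f \<in> projective_maps n d M M"
    unfolding projective_maps_def Let_def
    by (intro CollectI conjI f exI[of _ F] CM GP bexI[OF _ h1] bexI[OF _ h2]) (rule eq)
qed

lemma projective_maps_eq: "projective_maps n d M M = unstable"
  using projective_maps_subset unstable_subset by blast

end

section \<open>The path algebras of types A1 and A2\<close>

text \<open>
  The vertex \<open>1\<close> of a quiver should not be rewritten to \<open>Suc 0\<close>, as the other vertices are numerals.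
\<close>

declare One_nat_def [simp del]

abbreviation path_A1 :: "('k :: field, nat \<times> nat list \<Rightarrow> 'k) module" where "path_A1 \<equiv> path_algebra (quiver_A 1)"
abbreviation path_A2 :: "('k :: field, nat \<times> nat list \<Rightarrow> 'k) module" where "path_A2 \<equiv> path_algebra (quiver_A 2)"

definition elt_A1 :: "'k :: field \<Rightarrow> nat \<times> nat list \<Rightarrow> 'k"
  where "elt_A1 a = (\<lambda>w. if w = (1, []) then a else 0)"

text \<open>
  The element \<open>a e\<^sub>1 + b e\<^sub>2 + c \<alpha>\<close>, where \<open>\<alpha>\<close> is the arrow from \<open>1\<close> to \<open>2\<close>.
\<close>

definition elt_A2 :: "'k :: field \<Rightarrow> 'k \<Rightarrow> 'k \<Rightarrow> nat \<times> nat list \<Rightarrow> 'k"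
  where "elt_A2 a b c = (\<lambda>w. if w = (1, []) then a else if w = (2, []) then b else if w = (1, [1]) then c else 0)"

lemma quiver_A_simps [simp]:
  "verts (quiver_A m) = {1..m}" "arcs (quiver_A m) = {1..<m}" "tail (quiver_A m) = id" "head (quiver_A m) = Suc"
  by (simp_all add: quiver_A_def)

lemma paths_A1: "quiver_paths (quiver_A 1) = {(1, [])}"
  by (auto simp: quiver_paths_def pre_digraph.awalk_def pre_digraph.cas.simps)

lemma paths_A2: "quiver_paths (quiver_A 2) = {(1, []), (2, []), (1, [1])}"
proof -
  have "(\<exists>v. pre_digraph.awalk (quiver_A 2) u p v) \<longleftrightarrow> (u, p) \<in> {(1, []), (2, []), (1, [1])}" for u p
  proof (cases p)
    case Nil
    then show ?thesis by (auto simp: pre_digraph.awalk_def pre_digraph.cas.simps)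
  next
    case (Cons e q)
    then show ?thesis by (cases q) (auto simp: pre_digraph.awalk_def pre_digraph.cas.simps)
  qed
  then show ?thesis unfolding quiver_paths_def by blast
qed

lemma carrier_A1: "carrier path_A1 = range elt_A1"
proof (intro Set.set_eqI iffI)
  fix f :: "nat \<times> nat list \<Rightarrow> 'k :: field" assume "f \<in> carrier path_A1"
  then have "f w = 0" if "w \<noteq> (1, [])" for w using that paths_A1 by (force simp: path_algebra_def)
  then have "f = elt_A1 (f (1, []))" by (auto simp: elt_A1_def)
  then show "f \<in> range elt_A1" by blast
next
  fix f :: "nat \<times> nat list \<Rightarrow> 'k :: field" assume "f \<in> range elt_A1"
  then obtain a where f: "f = elt_A1 a" by blast
  have "{w. f w \<noteq> 0} \<subseteq> {(1, [])}" unfolding f elt_A1_def by auto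
  then show "f \<in> carrier path_A1" using paths_A1 finite_subset by (auto simp: path_algebra_def)
qed

lemma carrier_A2: "carrier path_A2 = {elt_A2 a b c | a b c. True}"
proof (intro Set.set_eqI iffI)
  fix f :: "nat \<times> nat list \<Rightarrow> 'k :: field" assume "f \<in> carrier path_A2"
  then have "f w = 0" if "w \<notin> {(1, []), (2, []), (1, [1])}" for w using that paths_A2 by (force simp: path_algebra_def)
  then have "f = elt_A2 (f (1, [])) (f (2, [])) (f (1, [1]))" by (auto simp: elt_A2_def)
  then show "f \<in> {elt_A2 a b c | a b c. True}" by blast
next
  fix f :: "nat \<times> nat list \<Rightarrow> 'k :: field" assume "f \<in> {elt_A2 a b c | a b c. True}"
  then obtain a b c where f: "f = elt_A2 a b c" by blast
  have "{w. f w \<noteq> 0} \<subseteq> {(1, []), (2, []), (1, [1])}" unfolding f elt_A2_def by auto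
  moreover from this have "finite {w. f w \<noteq> 0}" by (rule finite_subset) simp
  ultimately show "f \<in> carrier path_A2" using paths_A2 by (auto simp: path_algebra_def)
qed

lemma elt_A1_inject [simp]: "elt_A1 a = elt_A1 b \<longleftrightarrow> a = b"
  by (metis elt_A1_def)

lemma elt_A2_inject [simp]: "elt_A2 a b c = elt_A2 a' b' c' \<longleftrightarrow> a = a' \<and> b = b' \<and> c = c'"
proof
  assume e: "elt_A2 a b c = elt_A2 a' b' c'"
  from fun_cong[OF e, of "(1, [])"] fun_cong[OF e, of "(2, [])"] fun_cong[OF e, of "(1, [1])"]
  show "a = a' \<and> b = b' \<and> c = c'" by (simp add: elt_A2_def)
qed simp

lemma ops_A1:
  "one path_A1 = elt_A1 1" "zero path_A1 = elt_A1 0" "add path_A1 (elt_A1 a) (elt_A1 b) = elt_A1 (a + b)"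
  "module.smult path_A1 e (elt_A1 a) = elt_A1 (e * a)"
  by (auto simp: path_algebra_def elt_A1_def)

lemma mult_A1: "monoid.mult path_A1 (elt_A1 a) (elt_A1 b) = elt_A1 (a * b)"
proof
  fix w :: "nat \<times> nat list"
  obtain u p where w: "w = (u, p)" by (cases w)
  have "(\<Sum>i\<le>length p. elt_A1 a (u, take i p) * elt_A1 b (pre_digraph.awlast (quiver_A 1) u (take i p), drop i p)) = elt_A1 (a * b) (u, p)"
  proof (cases "p = []")
    case False
    have "elt_A1 a (u, take i p) * elt_A1 b (pre_digraph.awlast (quiver_A 1) u (take i p), drop i p) = 0" for i
      using False by (auto simp: elt_A1_def)
    then show ?thesis using False by (simp only: sum.neutral_const) (simp add: elt_A1_def)
  qed (auto simp: elt_A1_def pre_digraph.awalk_verts.simps)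
  then show "monoid.mult path_A1 (elt_A1 a) (elt_A1 b) w = elt_A1 (a * b) w" by (simp add: path_algebra_def w)
qed

lemma elt_A2_nonzero: "elt_A2 a b c w \<noteq> 0 \<Longrightarrow> w \<in> {(1, []), (2, []), (1, [1])}"
  by (auto simp: elt_A2_def split: if_splits)

lemma awlast_A2: "pre_digraph.awlast (quiver_A 2) u [] = u" "pre_digraph.awlast (quiver_A 2) 1 [1] = 2"
  by (simp_all add: pre_digraph.awalk_verts.simps)

lemma ops_A2:
  "one path_A2 = elt_A2 1 1 0" "zero path_A2 = elt_A2 0 0 0" "add path_A2 (elt_A2 a b c) (elt_A2 a' b' c') = elt_A2 (a + a') (b + b') (c + c')"
  "module.smult path_A2 e (elt_A2 a b c) = elt_A2 (e * a) (e * b) (e * c)"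
  by (auto simp: path_algebra_def elt_A2_def intro!: ext)

lemma mult_A2: "monoid.mult path_A2 (elt_A2 a b c) (elt_A2 a' b' c') = elt_A2 (a * a') (b * b') (a * c' + c * b')"
proof
  fix w :: "nat \<times> nat list"
  obtain u p where w: "w = (u, p)" by (cases w)
  let ?t = "\<lambda>i. elt_A2 a b c (u, take i p) * elt_A2 a' b' c' (pre_digraph.awlast (quiver_A 2) u (take i p), drop i p)"
  have "(\<Sum>i\<le>length p. ?t i) = elt_A2 (a * a') (b * b') (a * c' + c * b') (u, p)"
  proof (cases "p = [] \<or> (u, p) = (1, [1])")
    case True
    then show ?thesis by (auto simp: elt_A2_def pre_digraph.awalk_verts.simps)
  next
    case False
    have "?t i = 0" for i
    proof (rule ccontr)
      assume ne: "?t i \<noteq> 0"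
      have p: "p = take i p @ drop i p" by simp
      from ne have 1: "(u, take i p) \<in> {(1, []), (2, []), (1, [1])}"
        by (intro elt_A2_nonzero[of a b c]) (metis mult_zero_left)
      from ne have 2: "(pre_digraph.awlast (quiver_A 2) u (take i p), drop i p) \<in> {(1, []), (2, []), (1, [1])}"
        by (intro elt_A2_nonzero[of a' b' c']) (metis mult_zero_right)
      have "(u, take i p) = (1, []) \<or> (u, take i p) = (2, []) \<or> (u, take i p) = (1, [1])" using 1 by blast
      then have "p = [] \<or> (u, p) = (1, [1])"
      proof (elim disjE)
        assume e: "(u, take i p) = (1, [])"
        then have "drop i p = p" using p by (metis append_Nil prod.inject)
        then have "(1 :: nat, p) \<in> {(1, []), (2, []), (1, [1])}" using 2 e awlast_A2(1)[of 1] by (metis prod.inject)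
        then show ?thesis using e by simp
      next
        assume e: "(u, take i p) = (2, [])"
        then have "drop i p = p" using p by (metis append_Nil prod.inject)
        then have "(2 :: nat, p) \<in> {(1, []), (2, []), (1, [1])}" using 2 e awlast_A2(1)[of 2] by (metis prod.inject)
        then show ?thesis by simp
      next
        assume e: "(u, take i p) = (1, [1])"
        then have "(2 :: nat, drop i p) \<in> {(1, []), (2, []), (1, [1])}" using 2 awlast_A2(2) by (metis prod.inject)
        then have "drop i p = []" by simp
        then show ?thesis using p e by (metis append_Nil2 prod.inject)
      qed
      then show False using False by blast
    qed
    then show ?thesis using False by (simp only: sum.neutral_const) (auto simp: elt_A2_def)
  qed
  then show "monoid.mult path_A2 (elt_A2 a b c) (elt_A2 a' b' c') w = elt_A2 (a * a') (b * b') (a * c' + c * b') w"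
    by (simp add: path_algebra_def w)
qed

lemma ring_A1: "ring (path_A1 :: ('k :: field, _) module)" (is "ring ?B")
proof (rule ringI)
  have el: "\<exists>a. x = elt_A1 a" if "x \<in> carrier ?B" for x using that unfolding carrier_A1 by blast
  have elc: "elt_A1 a \<in> carrier ?B" for a unfolding carrier_A1 by blast
  show "abelian_group ?B"
  proof (rule abelian_groupI)
    fix x assume "x \<in> carrier ?B"
    then obtain a where x: "x = elt_A1 a" using el by blast
    have "elt_A1 (- a) \<oplus>\<^bsub>?B\<^esub> x = \<zero>\<^bsub>?B\<^esub>" by (simp only: x ops_A1 add.left_inverse)
    then show "\<exists>y\<in>carrier ?B. y \<oplus>\<^bsub>?B\<^esub> x = \<zero>\<^bsub>?B\<^esub>" using elc by blast
    show "\<zero>\<^bsub>?B\<^esub> \<oplus>\<^bsub>?B\<^esub> x = x" by (simp only: x ops_A1 add_0)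
  next
    fix x y z assume "x \<in> carrier ?B" "y \<in> carrier ?B" "z \<in> carrier ?B"
    then obtain a b c where x: "x = elt_A1 a" "y = elt_A1 b" "z = elt_A1 c" using el by blast
    show "x \<oplus>\<^bsub>?B\<^esub> y \<oplus>\<^bsub>?B\<^esub> z = x \<oplus>\<^bsub>?B\<^esub> (y \<oplus>\<^bsub>?B\<^esub> z)" by (simp only: x ops_A1 add.assoc)
  next
    fix x y assume "x \<in> carrier ?B" "y \<in> carrier ?B"
    then obtain a b where x: "x = elt_A1 a" "y = elt_A1 b" using el by blast
    show "x \<oplus>\<^bsub>?B\<^esub> y \<in> carrier ?B" by (simp only: x ops_A1 elc)
    show "x \<oplus>\<^bsub>?B\<^esub> y = y \<oplus>\<^bsub>?B\<^esub> x" by (simp only: x ops_A1 add.commute)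
  qed (simp only: ops_A1 elc)
  show "Group.monoid ?B"
  proof (rule monoidI)
    fix x y z assume "x \<in> carrier ?B" "y \<in> carrier ?B" "z \<in> carrier ?B"
    then obtain a b c where x: "x = elt_A1 a" "y = elt_A1 b" "z = elt_A1 c" using el by blast
    show "x \<otimes>\<^bsub>?B\<^esub> y \<otimes>\<^bsub>?B\<^esub> z = x \<otimes>\<^bsub>?B\<^esub> (y \<otimes>\<^bsub>?B\<^esub> z)" by (simp only: x mult_A1 mult.assoc)
  next
    fix x y assume "x \<in> carrier ?B" "y \<in> carrier ?B"
    then obtain a b where x: "x = elt_A1 a" "y = elt_A1 b" using el by blast
    show "x \<otimes>\<^bsub>?B\<^esub> y \<in> carrier ?B" by (simp only: x mult_A1 elc)
  next
    fix x assume "x \<in> carrier ?B"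
    then obtain a where x: "x = elt_A1 a" using el by blast
    show "\<one>\<^bsub>?B\<^esub> \<otimes>\<^bsub>?B\<^esub> x = x" "x \<otimes>\<^bsub>?B\<^esub> \<one>\<^bsub>?B\<^esub> = x" by (simp_all only: x mult_A1 ops_A1 mult_1_left mult_1_right)
  qed (simp only: ops_A1 elc)
  fix x y z assume "x \<in> carrier ?B" "y \<in> carrier ?B" "z \<in> carrier ?B"
  then obtain a b c where x: "x = elt_A1 a" "y = elt_A1 b" "z = elt_A1 c" using el by blast
  show "(x \<oplus>\<^bsub>?B\<^esub> y) \<otimes>\<^bsub>?B\<^esub> z = x \<otimes>\<^bsub>?B\<^esub> z \<oplus>\<^bsub>?B\<^esub> y \<otimes>\<^bsub>?B\<^esub> z"
    by (simp only: x mult_A1 ops_A1 distrib_right)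
  show "z \<otimes>\<^bsub>?B\<^esub> (x \<oplus>\<^bsub>?B\<^esub> y) = z \<otimes>\<^bsub>?B\<^esub> x \<oplus>\<^bsub>?B\<^esub> z \<otimes>\<^bsub>?B\<^esub> y"
    by (simp only: x mult_A1 ops_A1 distrib_left)
qed

lemma ring_A2: "ring (path_A2 :: ('k :: field, _) module)" (is "ring ?B")
proof (rule ringI)
  have el: "\<exists>a b c. x = elt_A2 a b c" if "x \<in> carrier ?B" for x using that unfolding carrier_A2 by blast
  have elc: "elt_A2 a b c \<in> carrier ?B" for a b c unfolding carrier_A2 by blast
  show "abelian_group ?B"
  proof (rule abelian_groupI)
    fix x assume "x \<in> carrier ?B"
    then obtain a b c where x: "x = elt_A2 a b c" using el by blast
    have "elt_A2 (- a) (- b) (- c) \<oplus>\<^bsub>?B\<^esub> x = \<zero>\<^bsub>?B\<^esub>" by (simp only: x ops_A2 add.left_inverse)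
    then show "\<exists>y\<in>carrier ?B. y \<oplus>\<^bsub>?B\<^esub> x = \<zero>\<^bsub>?B\<^esub>" using elc by blast
    show "\<zero>\<^bsub>?B\<^esub> \<oplus>\<^bsub>?B\<^esub> x = x" by (simp only: x ops_A2 add_0)
  next
    fix x y z assume "x \<in> carrier ?B" "y \<in> carrier ?B" "z \<in> carrier ?B"
    then obtain a b c a' b' c' a'' b'' c'' where x: "x = elt_A2 a b c" "y = elt_A2 a' b' c'" "z = elt_A2 a'' b'' c''" using el by metis
    show "x \<oplus>\<^bsub>?B\<^esub> y \<oplus>\<^bsub>?B\<^esub> z = x \<oplus>\<^bsub>?B\<^esub> (y \<oplus>\<^bsub>?B\<^esub> z)" by (simp only: x ops_A2 add.assoc)
  next
    fix x y assume "x \<in> carrier ?B" "y \<in> carrier ?B"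
    then obtain a b c a' b' c' where x: "x = elt_A2 a b c" "y = elt_A2 a' b' c'" using el by metis
    show "x \<oplus>\<^bsub>?B\<^esub> y \<in> carrier ?B" by (simp only: x ops_A2 elc)
    show "x \<oplus>\<^bsub>?B\<^esub> y = y \<oplus>\<^bsub>?B\<^esub> x" by (simp only: x ops_A2 elt_A2_inject) (simp add: add.commute)
  qed (simp only: ops_A2 elc)
  show "Group.monoid ?B"
  proof (rule monoidI)
    fix x y z assume "x \<in> carrier ?B" "y \<in> carrier ?B" "z \<in> carrier ?B"
    then obtain a b c a' b' c' a'' b'' c'' where x: "x = elt_A2 a b c" "y = elt_A2 a' b' c'" "z = elt_A2 a'' b'' c''" using el by metis
    show "x \<otimes>\<^bsub>?B\<^esub> y \<otimes>\<^bsub>?B\<^esub> z = x \<otimes>\<^bsub>?B\<^esub> (y \<otimes>\<^bsub>?B\<^esub> z)"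
      by (simp only: x mult_A2 elt_A2_inject) (simp add: algebra_simps)
  next
    fix x y assume "x \<in> carrier ?B" "y \<in> carrier ?B"
    then obtain a b c a' b' c' where x: "x = elt_A2 a b c" "y = elt_A2 a' b' c'" using el by metis
    show "x \<otimes>\<^bsub>?B\<^esub> y \<in> carrier ?B" by (simp only: x mult_A2 elc)
  next
    fix x assume "x \<in> carrier ?B"
    then obtain a b c where x: "x = elt_A2 a b c" using el by blast
    show "\<one>\<^bsub>?B\<^esub> \<otimes>\<^bsub>?B\<^esub> x = x" "x \<otimes>\<^bsub>?B\<^esub> \<one>\<^bsub>?B\<^esub> = x"
      by (simp_all only: x mult_A2 ops_A2 elt_A2_inject) simp_all
  qed (simp only: ops_A2 elc)
  fix x y z assume "x \<in> carrier ?B" "y \<in> carrier ?B" "z \<in> carrier ?B"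
  then obtain a b c a' b' c' a'' b'' c'' where x: "x = elt_A2 a b c" "y = elt_A2 a' b' c'" "z = elt_A2 a'' b'' c''" using el by metis
  show "(x \<oplus>\<^bsub>?B\<^esub> y) \<otimes>\<^bsub>?B\<^esub> z = x \<otimes>\<^bsub>?B\<^esub> z \<oplus>\<^bsub>?B\<^esub> y \<otimes>\<^bsub>?B\<^esub> z"
    by (simp only: x mult_A2 ops_A2 elt_A2_inject) (simp add: algebra_simps)
  show "z \<otimes>\<^bsub>?B\<^esub> (x \<oplus>\<^bsub>?B\<^esub> y) = z \<otimes>\<^bsub>?B\<^esub> x \<oplus>\<^bsub>?B\<^esub> z \<otimes>\<^bsub>?B\<^esub> y"
    by (simp only: x mult_A2 ops_A2 elt_A2_inject) (simp add: algebra_simps)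
qed

section \<open>The stable endomorphism ring\<close>

lemma quot_algebra_simps:
  "carrier (quot_algebra E I) = carrier (E Quot I)" "zero (quot_algebra E I) = zero (E Quot I)"
  "ring_iso (quot_algebra E I) B = ring_iso (E Quot I) B"
proof -
  have "carrier (quot_algebra E I) = carrier (E Quot I)" "monoid.mult (quot_algebra E I) = monoid.mult (E Quot I)"
    "add (quot_algebra E I) = add (E Quot I)" "one (quot_algebra E I) = one (E Quot I)"
    by (simp_all add: quot_algebra_def)
  then show "ring_iso (quot_algebra E I) B = ring_iso (E Quot I) B" "carrier (quot_algebra E I) = carrier (E Quot I)"
    unfolding ring_iso_def Ring.ring_hom_def by (simp_all only:)
  show "zero (quot_algebra E I) = zero (E Quot I)" by (simp add: quot_algebra_def)
qed

text \<open>
  An isomorphism from the quotient is used through the surjection from the ring itself, whose kernel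
  is the ideal.
\<close>

lemma algebra_iso_quot_hom:
  assumes E: "ring E" and B: "ring B" and I: "ideal I E" and iso: "algebra_iso (quot_algebra E I) B"
  shows "\<exists>g. ring_hom_ring E B g \<and> g ` carrier E = carrier B \<and> (\<forall>x\<in>carrier E. g x = \<zero>\<^bsub>B\<^esub> \<longleftrightarrow> x \<in> I)"
proof -
  interpret I: ideal I E by (rule I)
  obtain h where "h \<in> ring_iso (quot_algebra E I) B" using iso unfolding algebra_iso_def by blast
  then have h: "h \<in> ring_iso (E Quot I) B" unfolding quot_algebra_simps .
  interpret Q: ring "E Quot I" by (rule I.quotient_is_ring)
  have hh: "h \<in> Ring.ring_hom (E Quot I) B" and hb: "bij_betw h (carrier (E Quot I)) (carrier B)"
    using h by (auto simp: ring_iso_def)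
  interpret h: ring_hom_ring "E Quot I" B h using Q.ring_axioms B hh by (rule ring_hom_ringI2)
  have car: "carrier (E Quot I) = (\<lambda>x. I +>\<^bsub>E\<^esub> x) ` carrier E"
    by (auto simp: FactRing_def A_RCOSETS_def')
  have zero: "\<zero>\<^bsub>E Quot I\<^esub> = I" by (simp add: FactRing_def)
  let ?g = "\<lambda>x. h (I +>\<^bsub>E\<^esub> x)"
  have "?g \<in> Ring.ring_hom E B"
    using ring_hom_trans[OF I.rcos_ring_hom hh] by (simp add: comp_def)
  then have "ring_hom_ring E B ?g" using E B by (intro ring_hom_ringI2)
  moreover have "?g ` carrier E = carrier B"
    using bij_betw_imp_surj_on[OF hb] unfolding car by (simp add: image_image)
  moreover have "?g x = \<zero>\<^bsub>B\<^esub> \<longleftrightarrow> x \<in> I" if x: "x \<in> carrier E" for x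
  proof -
    have "?g x = \<zero>\<^bsub>B\<^esub> \<longleftrightarrow> h (I +>\<^bsub>E\<^esub> x) = h \<zero>\<^bsub>E Quot I\<^esub>" by simp
    also have "\<dots> \<longleftrightarrow> I +>\<^bsub>E\<^esub> x = \<zero>\<^bsub>E Quot I\<^esub>"
    proof (rule inj_on_eq_iff[OF bij_betw_imp_inj_on[OF hb]])
      show "I +>\<^bsub>E\<^esub> x \<in> carrier (E Quot I)" unfolding car using x by blast
    qed (rule Q.zero_closed)
    also have "\<dots> \<longleftrightarrow> x \<in> I"
      unfolding zero using x I.a_rcos_const I.a_rcos_self by metis
    finally show ?thesis .
  qed
  ultimately show ?thesis by (intro exI[of _ ?g]) blast
qed

context coord_end begin

definition nonproj :: "'s set" where "nonproj = {s \<in> S. \<not> through_proj n d (a s) (a s)}"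

lemma nonproj_iff: "s \<in> nonproj \<longleftrightarrow> s \<in> S \<and> stable_hom n d (a s) (a s)"
  by (simp add: nonproj_def stable_hom_def)

lemma stable_hom_nonproj:
  assumes "s \<in> S" "t \<in> S" "stable_hom n d (a s) (a t)" shows "s \<in> nonproj" "t \<in> nonproj"
  using stable_hom_middle(3)[OF E.M.lat[OF assms(1)] assms(3)] stable_hom_middle(3)[OF E.M.lat[OF assms(2)] assms(3)] assms
  by (auto simp: nonproj_def stable_hom_def)

text \<open>
  A path between stably related summands cannot pass through a projective summand.
\<close>

lemma coef_mult_stable:
  assumes f: "f \<in> carrier End" and g: "g \<in> carrier End" and st: "s \<in> S" "t \<in> S" "stable_hom n d (a s) (a t)"
  shows "coef (f \<otimes>\<^bsub>End\<^esub> g) s t = (\<Sum>u\<in>nonproj. coef g s u * coef f u t)"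
  unfolding End_mult(2)[OF f g st(1,2)]
proof (rule sum.mono_neutral_right)
  show "\<forall>u\<in>S - nonproj. coef g s u * coef f u t = 0"
    using stable_term(3)[OF f g st(1,2) _ st(3)] by (auto simp: nonproj_def)
qed (auto simp: nonproj_def E.M.finS)

abbreviation stEnd :: "('k, ('m \<Rightarrow> 'm) set) module" where "stEnd \<equiv> quot_algebra End unstable"

lemma stable_End_eq: "stable_End n d M = stEnd"
  by (simp add: stable_End_def projective_maps_eq)

definition summand_pr :: "'s \<Rightarrow> 'm \<Rightarrow> 'm" where "summand_pr s = E.lin (\<lambda>t u. if t = s \<and> u = s then 1 else 0)"

lemma summand_pr: "summand_pr s \<in> carrier End" "\<lbrakk>t \<in> S; u \<in> S\<rbrakk> \<Longrightarrow> coef (summand_pr s) t u = (if t = s \<and> u = s then 1 else 0)"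
proof -
  have adm: "E.admissible (\<lambda>t u. if t = s \<and> u = s then 1 else 0)" by (auto simp: E.admissible_def)
  show "summand_pr s \<in> carrier End" unfolding summand_pr_def by (rule End_lin[OF adm])
  show "\<lbrakk>t \<in> S; u \<in> S\<rbrakk> \<Longrightarrow> coef (summand_pr s) t u = (if t = s \<and> u = s then 1 else 0)"
    unfolding summand_pr_def by (rule E.coef_lin[OF adm])
qed

lemma summand_pr_mult: assumes s: "s \<in> S" and t: "t \<in> S" shows "summand_pr s \<otimes>\<^bsub>End\<^esub> summand_pr t = (if s = t then summand_pr s else \<zero>\<^bsub>End\<^esub>)"
proof (rule End_eqI)
  show "(if s = t then summand_pr s else \<zero>\<^bsub>End\<^esub>) \<in> carrier End" using summand_pr(1) End_zero(1) by simp
  fix x y assume xy: "x \<in> S" "y \<in> S"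
  have "coef (summand_pr s \<otimes>\<^bsub>End\<^esub> summand_pr t) x y = (\<Sum>u\<in>S. if u = s then (if x = t \<and> s = t \<and> y = s then 1 else 0) else 0)"
    unfolding End_mult(2)[OF summand_pr(1) summand_pr(1) xy] using xy by (intro sum.cong refl) (auto simp: summand_pr)
  then show "coef (summand_pr s \<otimes>\<^bsub>End\<^esub> summand_pr t) x y = coef (if s = t then summand_pr s else \<zero>\<^bsub>End\<^esub>) x y"
    using s E.M.finS xy by (auto simp: summand_pr End_zero)
qed (rule End_mult(1)[OF summand_pr(1) summand_pr(1)])

lemma summand_pr_unstable: "s \<in> S \<Longrightarrow> summand_pr s \<in> unstable \<longleftrightarrow> s \<notin> nonproj"
  using summand_pr by (auto simp: unstable_def nonproj_iff)

lemma stEnd_trivial: "carrier stEnd = {\<zero>\<^bsub>stEnd\<^esub>} \<longleftrightarrow> nonproj = {}"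
proof -
  interpret R: ring End by (rule ring_End)
  interpret I: ideal unstable End by (rule ideal_unstable)
  have zero: "\<zero>\<^bsub>stEnd\<^esub> = unstable" unfolding quot_algebra_simps by (simp add: FactRing_def)
  have car: "carrier stEnd = (\<lambda>x. unstable +>\<^bsub>End\<^esub> x) ` carrier End"
    unfolding quot_algebra_simps by (auto simp: FactRing_def A_RCOSETS_def')
  show ?thesis
  proof
    assume triv: "carrier stEnd = {\<zero>\<^bsub>stEnd\<^esub>}"
    show "nonproj = {}"
    proof (rule ccontr)
      assume "nonproj \<noteq> {}"
      then obtain s where s: "s \<in> nonproj" by blast
      then have sS: "s \<in> S" by (simp add: nonproj_def)
      have "unstable +>\<^bsub>End\<^esub> summand_pr s = unstable" using triv summand_pr(1) unfolding car zero by blast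
      then have "summand_pr s \<in> unstable" using I.a_rcos_self[OF summand_pr(1)[of s]] by (simp only:)
      then show False using summand_pr_unstable[OF sS] s by blast
    qed
  next
    assume e: "nonproj = {}"
    have "x \<in> unstable" if "x \<in> carrier End" for x
      unfolding unstable_def using that stable_hom_nonproj(1) e by blast
    then have "unstable +>\<^bsub>End\<^esub> x = unstable" if "x \<in> carrier End" for x using that I.a_rcos_const by blast
    then show "carrier stEnd = {\<zero>\<^bsub>stEnd\<^esub>}" unfolding car zero using R.one_closed by blast
  qed
qed

text \<open>
  Two nonprojective summands would give two orthogonal nonzero idempotents, which a field does not
  have.
\<close>

lemma stEnd_A1_imp: assumes iso: "algebra_iso stEnd (path_A1 :: ('k, _) module)" shows "card nonproj = 1"
proof -
  obtain g where g: "ring_hom_ring End (path_A1 :: ('k, _) module) g" "g ` carrier End = carrier path_A1"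
    "\<forall>x\<in>carrier End. g x = \<zero>\<^bsub>path_A1\<^esub> \<longleftrightarrow> x \<in> unstable"
    using algebra_iso_quot_hom[OF ring_End ring_A1 ideal_unstable iso] by blast
  interpret g: ring_hom_ring End path_A1 g by (rule g(1))
  have el: "\<exists>a. g x = elt_A1 a" if "x \<in> carrier End" for x using that g(2) carrier_A1 by blast
  have ne: "nonproj \<noteq> {}"
  proof
    assume e: "nonproj = {}"
    have "\<one>\<^bsub>End\<^esub> \<in> unstable" unfolding unstable_def using stable_hom_nonproj(1) e End_one(1) by blast
    then have "g \<one>\<^bsub>End\<^esub> = \<zero>\<^bsub>path_A1\<^esub>" using g(3) End_one(1) by blast
    then show False unfolding g.hom_one ops_A1 by simp
  qed
  have "s = t" if s: "s \<in> nonproj" and t: "t \<in> nonproj" for s t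
  proof (rule ccontr)
    assume st: "s \<noteq> t"
    have sS: "s \<in> S" "t \<in> S" using s t by (auto simp: nonproj_def)
    obtain x y where xy: "g (summand_pr s) = elt_A1 x" "g (summand_pr t) = elt_A1 y" using el summand_pr(1) by metis
    have "elt_A1 x \<noteq> elt_A1 0" "elt_A1 y \<noteq> elt_A1 0"
      using g(3) summand_pr(1) summand_pr_unstable sS s t unfolding xy[symmetric] ops_A1(2)[symmetric] by blast+
    moreover have "elt_A1 (x * y) = elt_A1 (0 :: 'k)"
      using g.hom_mult[OF summand_pr(1) summand_pr(1), of s t] summand_pr_mult[OF sS] st g.hom_zero unfolding xy mult_A1 ops_A1 by simp
    ultimately show False by simp
  qed
  then obtain s where "nonproj = {s}" using ne by blast
  then show ?thesis by simp
qed

text \<open>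
  With a single nonprojective summand the stable endomorphism ring is generated by scalars, so it is commutative.
\<close>

lemma commutator_unstable:
  assumes np: "nonproj \<subseteq> {s}" and x: "x \<in> carrier End" and y: "y \<in> carrier End"
  shows "x \<otimes>\<^bsub>End\<^esub> y \<ominus>\<^bsub>End\<^esub> y \<otimes>\<^bsub>End\<^esub> x \<in> unstable"
proof -
  interpret R: ring End by (rule ring_End)
  have xy: "x \<otimes>\<^bsub>End\<^esub> y \<in> carrier End" "y \<otimes>\<^bsub>End\<^esub> x \<in> carrier End" using x y by simp_all
  have z: "x \<otimes>\<^bsub>End\<^esub> y \<ominus>\<^bsub>End\<^esub> y \<otimes>\<^bsub>End\<^esub> x \<in> carrier End" using xy by simp
  have "coef (x \<otimes>\<^bsub>End\<^esub> y \<ominus>\<^bsub>End\<^esub> y \<otimes>\<^bsub>End\<^esub> x) t u = 0" if tu: "t \<in> S" "u \<in> S" "stable_hom n d (a t) (a u)" for t u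
  proof -
    have e: "nonproj = {s}" "t = s" "u = s" using np stable_hom_nonproj[OF tu] by auto
    have "coef (x \<otimes>\<^bsub>End\<^esub> y) t u = coef (y \<otimes>\<^bsub>End\<^esub> x) t u"
      unfolding coef_mult_stable[OF x y tu] coef_mult_stable[OF y x tu] by (simp add: e mult.commute)
    moreover have "x \<otimes>\<^bsub>End\<^esub> y = (x \<otimes>\<^bsub>End\<^esub> y \<ominus>\<^bsub>End\<^esub> y \<otimes>\<^bsub>End\<^esub> x) \<oplus>\<^bsub>End\<^esub> y \<otimes>\<^bsub>End\<^esub> x"
      using xy by (simp add: R.minus_eq R.a_assoc R.l_neg)
    ultimately show ?thesis using End_add(2)[OF z xy(2) tu(1,2)] by simp
  qed
  then show ?thesis using z by (simp add: unstable_def)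
qed

text \<open>
  With at most one nonprojective summand the ring is commutative, but \<open>e\<^sub>1 \<alpha> \<noteq> \<alpha> e\<^sub>1\<close>. With three there are
  three orthogonal nonzero idempotents; a nonzero idempotent of \<open>kA\<^sub>2\<close> has a nonzero coefficient at one
  of the two vertices, and orthogonal idempotents do not share a vertex.
\<close>

lemma stEnd_A2_imp: assumes iso: "algebra_iso stEnd (path_A2 :: ('k, _) module)" shows "card nonproj = 2"
proof -
  interpret R: ring End by (rule ring_End)
  obtain g where g: "ring_hom_ring End (path_A2 :: ('k, _) module) g" "g ` carrier End = carrier path_A2"
    "\<forall>x\<in>carrier End. g x = \<zero>\<^bsub>path_A2\<^esub> \<longleftrightarrow> x \<in> unstable"
    using algebra_iso_quot_hom[OF ring_End ring_A2 ideal_unstable iso] by blast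
  interpret g: ring_hom_ring End path_A2 g by (rule g(1))
  have fin: "finite nonproj" using E.M.finS by (simp add: nonproj_def)
  have "\<not> nonproj \<subseteq> {s}" for s
  proof
    assume np: "nonproj \<subseteq> {s}"
    have comm: "g x \<otimes>\<^bsub>path_A2\<^esub> g y = g y \<otimes>\<^bsub>path_A2\<^esub> g x" if x: "x \<in> carrier End" and y: "y \<in> carrier End" for x y
    proof -
      have "g (x \<otimes>\<^bsub>End\<^esub> y \<ominus>\<^bsub>End\<^esub> y \<otimes>\<^bsub>End\<^esub> x) = \<zero>\<^bsub>path_A2\<^esub>"
        using commutator_unstable[OF np x y] g(3) x y by simp
      moreover have "x \<otimes>\<^bsub>End\<^esub> y = (x \<otimes>\<^bsub>End\<^esub> y \<ominus>\<^bsub>End\<^esub> y \<otimes>\<^bsub>End\<^esub> x) \<oplus>\<^bsub>End\<^esub> y \<otimes>\<^bsub>End\<^esub> x"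
        using x y by (simp add: R.minus_eq R.a_assoc R.l_neg)
      then have "g (x \<otimes>\<^bsub>End\<^esub> y) = g (x \<otimes>\<^bsub>End\<^esub> y \<ominus>\<^bsub>End\<^esub> y \<otimes>\<^bsub>End\<^esub> x) \<oplus>\<^bsub>path_A2\<^esub> g (y \<otimes>\<^bsub>End\<^esub> x)"
        using x y g.hom_add[of "x \<otimes>\<^bsub>End\<^esub> y \<ominus>\<^bsub>End\<^esub> y \<otimes>\<^bsub>End\<^esub> x" "y \<otimes>\<^bsub>End\<^esub> x"] by simp
      ultimately have "g (x \<otimes>\<^bsub>End\<^esub> y) = g (y \<otimes>\<^bsub>End\<^esub> x)" using x y by simp
      then show ?thesis using x y by simp
    qed
    have im: "elt_A2 u v w \<in> g ` carrier End" for u v w :: 'k unfolding g(2) carrier_A2 by blast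
    obtain x where x: "elt_A2 1 0 0 = g x" "x \<in> carrier End" using im by (rule imageE)
    obtain y where y: "elt_A2 0 0 1 = g y" "y \<in> carrier End" using im by (rule imageE)
    have "elt_A2 1 0 0 \<otimes>\<^bsub>path_A2\<^esub> elt_A2 0 0 1 = elt_A2 0 0 1 \<otimes>\<^bsub>path_A2\<^esub> (elt_A2 1 0 0 :: _ \<Rightarrow> 'k)"
      unfolding x(1) y(1) by (rule comm[OF x(2) y(2)])
    then show False unfolding mult_A2 by simp
  qed
  then have "nonproj \<noteq> {}" "\<And>s. nonproj \<noteq> {s}" by blast+
  then have ge: "card nonproj \<ge> 2" using fin by (metis One_nat_def Suc_1 card_1_singletonE card_gt_0_iff less_Suc_eq not_less_eq_eq not_le)
  have "\<not> card nonproj \<ge> 3"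
  proof
    assume "card nonproj \<ge> 3"
    then obtain T where "T \<subseteq> nonproj" "card T = 3" by (meson obtain_subset_with_card_n)
    then obtain s t u where stu: "s \<in> nonproj" "t \<in> nonproj" "u \<in> nonproj" "s \<noteq> t" "s \<noteq> u" "t \<noteq> u"
      by (auto simp: card_3_iff)
    have S: "s \<in> S" "t \<in> S" "u \<in> S" using stu by (auto simp: nonproj_def)
    have el: "\<exists>x y z. g f = elt_A2 x y z" if "f \<in> carrier End" for f using that g(2) carrier_A2 by blast
    obtain x1 y1 z1 x2 y2 z2 x3 y3 z3 where e: "g (summand_pr s) = elt_A2 x1 y1 z1" "g (summand_pr t) = elt_A2 x2 y2 z2" "g (summand_pr u) = elt_A2 x3 y3 z3"
      using el summand_pr(1) by metis
    have nz: "x \<noteq> 0 \<or> y \<noteq> 0" if v: "v \<in> nonproj" and gv: "g (summand_pr v) = elt_A2 x y z" for v x y z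
    proof (rule ccontr)
      assume z: "\<not> (x \<noteq> 0 \<or> y \<noteq> 0)"
      have vS: "v \<in> S" using v by (simp add: nonproj_def)
      have "elt_A2 (x * x) (y * y) (x * z + z * y) = g (summand_pr v \<otimes>\<^bsub>End\<^esub> summand_pr v)"
        unfolding g.hom_mult[OF summand_pr(1) summand_pr(1)] gv mult_A2 ..
      also have "\<dots> = elt_A2 x y z" unfolding summand_pr_mult[OF vS vS] using gv by simp
      finally have "elt_A2 (x * x) (y * y) (x * z + z * y) = elt_A2 x y z" .
      then have "g (summand_pr v) = \<zero>\<^bsub>path_A2\<^esub>" unfolding gv ops_A2 using z by simp
      then show False using g(3) summand_pr(1) summand_pr_unstable[OF vS] v by blast
    qed
    have orth: "x * x' = 0 \<and> y * y' = 0" if "v \<in> S" "w \<in> S" "v \<noteq> w" "g (summand_pr v) = elt_A2 x y z" "g (summand_pr w) = elt_A2 x' y' z'" for v w x y z x' y' z'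
      using g.hom_mult[OF summand_pr(1) summand_pr(1), of v w] summand_pr_mult[OF that(1,2)] that(3) g.hom_zero unfolding that(4,5) mult_A2 ops_A2 by simp
    show False
      using nz[OF stu(1) e(1)] nz[OF stu(2) e(2)] nz[OF stu(3) e(3)]
        orth[OF S(1,2) stu(4) e(1,2)] orth[OF S(1,3) stu(5) e(1,3)] orth[OF S(2,3) stu(6) e(2,3)] by auto
  qed
  then show ?thesis using ge by simp
qed

lemma stEnd_A1: assumes np: "card nonproj = 1" shows "algebra_iso stEnd (path_A1 :: ('k, _) module)"
proof -
  obtain s where s: "nonproj = {s}" using np by (rule card_1_singletonE)
  have sS: "s \<in> S" and ss: "stable_hom n d (a s) (a s)" using s nonproj_iff by auto
  have only: "t = s \<and> u = s" if "t \<in> S" "u \<in> S" "stable_hom n d (a t) (a u)" for t u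
    using stable_hom_nonproj[OF that] s by auto
  let ?h = "\<lambda>f. elt_A1 (coef f s s)"
  show ?thesis
  proof (rule algebra_iso_quot[OF ring_End ring_A1])
    show "?h \<in> Ring.ring_hom End path_A1"
    proof (rule ring_hom_memI)
      fix x y assume x: "x \<in> carrier End" and y: "y \<in> carrier End"
      show "?h x \<in> carrier path_A1" unfolding carrier_A1 by blast
      show "?h (x \<otimes>\<^bsub>End\<^esub> y) = ?h x \<otimes>\<^bsub>path_A1\<^esub> ?h y"
        unfolding mult_A1 coef_mult_stable[OF x y sS sS ss] by (simp add: s mult.commute)
      show "?h (x \<oplus>\<^bsub>End\<^esub> y) = ?h x \<oplus>\<^bsub>path_A1\<^esub> ?h y" unfolding ops_A1 End_add(2)[OF x y sS sS] ..
    qed (simp only: ops_A1 End_one(2)[OF sS sS], simp)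
    show "?h ` carrier End = carrier path_A1"
    proof
      show "carrier path_A1 \<subseteq> ?h ` carrier End"
      proof
        fix z :: "nat \<times> nat list \<Rightarrow> 'k" assume "z \<in> carrier path_A1"
        then obtain x where z: "z = elt_A1 x" unfolding carrier_A1 by blast
        have "coef (x \<odot>\<^bsub>End\<^esub> summand_pr s) s s = x" using End_smult(2)[OF summand_pr(1) sS sS] summand_pr(2)[OF sS sS] by simp
        then show "z \<in> ?h ` carrier End" unfolding z using End_smult(1)[OF summand_pr(1)] by (intro image_eqI[of _ _ "x \<odot>\<^bsub>End\<^esub> summand_pr s"]) simp_all
      qed
    qed (unfold carrier_A1, blast)
    show "unstable = {x \<in> carrier End. ?h x = \<zero>\<^bsub>path_A1\<^esub>}"
    proof -
      have "(\<forall>t\<in>S. \<forall>u\<in>S. stable_hom n d (a t) (a u) \<longrightarrow> coef f t u = 0) \<longleftrightarrow> coef f s s = 0" for f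
      proof
        assume z: "coef f s s = 0"
        show "\<forall>t\<in>S. \<forall>u\<in>S. stable_hom n d (a t) (a u) \<longrightarrow> coef f t u = 0"
        proof (intro ballI impI)
          fix t u assume "t \<in> S" "u \<in> S" "stable_hom n d (a t) (a u)"
          then have "t = s" "u = s" using only by blast+
          then show "coef f t u = 0" using z by simp
        qed
      qed (use sS ss in blast)
      then show ?thesis unfolding ops_A1 unstable_def elt_A1_inject by simp
    qed
    show "c \<odot>\<^bsub>End\<^esub> x \<in> carrier End" "?h (c \<odot>\<^bsub>End\<^esub> x) = c \<odot>\<^bsub>path_A1\<^esub> ?h x" if "x \<in> carrier End" for c x
      using End_smult[OF that] sS by (simp_all only: ops_A1)
  qed
qed

text \<open>
  The only surviving entries are the two diagonal ones and that from \<open>s\<close> to \<open>t\<close>. Endomorphisms compose from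
  right to left and paths from left to right, so vertex \<open>1\<close> corresponds to \<open>t\<close>.
\<close>

lemma stEnd_A2:
  assumes np: "nonproj = {s, t}" "s \<noteq> t" and st: "stable_hom n d (a s) (a t)" "\<not> stable_hom n d (a t) (a s)"
  shows "algebra_iso stEnd (path_A2 :: ('k, _) module)"
proof -
  have S: "s \<in> S" "t \<in> S" and ss: "stable_hom n d (a s) (a s)" "stable_hom n d (a t) (a t)"
    using np nonproj_iff by auto
  have only: "x = s \<and> y = s \<or> x = t \<and> y = t \<or> x = s \<and> y = t" if "x \<in> S" "y \<in> S" "stable_hom n d (a x) (a y)" for x y
    using stable_hom_nonproj[OF that] np st(2) that(3) by auto
  have ts: "coef g t s = 0 \<or> coef f s t = 0" if "f \<in> carrier End" "g \<in> carrier End" for f g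
  proof (rule ccontr)
    assume "\<not> ?thesis"
    then have "\<forall>l<n. a t l \<le> a s l" "\<forall>l<n. a s l \<le> a t l" using coef_nonzero_le that S by blast+
    then show False using stable_hom_middle(2)[OF E.M.lat[OF S(2)] ss(1)] st(2) by blast
  qed
  let ?h = "\<lambda>f. elt_A2 (coef f t t) (coef f s s) (coef f s t)"
  show ?thesis
  proof (rule algebra_iso_quot[OF ring_End ring_A2])
    show "?h \<in> Ring.ring_hom End path_A2"
    proof (rule ring_hom_memI)
      fix x y assume x: "x \<in> carrier End" and y: "y \<in> carrier End"
      show "?h x \<in> carrier path_A2" unfolding carrier_A2 by blast
      have "coef y t s * coef x s t = 0" "coef y s t * coef x t s = 0" using ts[OF x y] ts[OF y x] by auto
      then show "?h (x \<otimes>\<^bsub>End\<^esub> y) = ?h x \<otimes>\<^bsub>path_A2\<^esub> ?h y"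
        unfolding mult_A2 coef_mult_stable[OF x y S(1,1) ss(1)] coef_mult_stable[OF x y S(2,2) ss(2)] coef_mult_stable[OF x y S st(1)]
        using np by (simp add: mult.commute)
      show "?h (x \<oplus>\<^bsub>End\<^esub> y) = ?h x \<oplus>\<^bsub>path_A2\<^esub> ?h y" by (simp only: ops_A2 End_add(2)[OF x y] S)
    qed (use np(2) S in \<open>simp add: ops_A2 End_one(2)\<close>)
    show "?h ` carrier End = carrier path_A2"
    proof
      show "carrier path_A2 \<subseteq> ?h ` carrier End"
      proof
        fix w :: "nat \<times> nat list \<Rightarrow> 'k" assume "w \<in> carrier path_A2"
        then obtain x y z where w: "w = elt_A2 x y z" unfolding carrier_A2 by blast
        define c where "c p q = (if p = t \<and> q = t then x else if p = s \<and> q = s then y else if p = s \<and> q = t then z else 0)" for p q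
        have adm: "E.admissible c" using st(1) by (auto simp: E.admissible_def c_def stable_hom_def)
        have "?h (E.lin c) = w" using E.coef_lin[OF adm] S np(2) by (simp add: w c_def)
        then show "w \<in> ?h ` carrier End" using End_lin[OF adm] by blast
      qed
    qed (unfold carrier_A2, blast)
    show "unstable = {x \<in> carrier End. ?h x = \<zero>\<^bsub>path_A2\<^esub>}"
    proof -
      have "(\<forall>x\<in>S. \<forall>y\<in>S. stable_hom n d (a x) (a y) \<longrightarrow> coef f x y = 0) \<longleftrightarrow>
          coef f t t = 0 \<and> coef f s s = 0 \<and> coef f s t = 0" for f
      proof
        assume z: "coef f t t = 0 \<and> coef f s s = 0 \<and> coef f s t = 0"
        show "\<forall>x\<in>S. \<forall>y\<in>S. stable_hom n d (a x) (a y) \<longrightarrow> coef f x y = 0"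
        proof (intro ballI impI)
          fix x y assume "x \<in> S" "y \<in> S" "stable_hom n d (a x) (a y)"
          from only[OF this] show "coef f x y = 0" using z by (elim disjE conjE) simp_all
        qed
      qed (use S ss st(1) in blast)
      then show ?thesis unfolding ops_A2 unstable_def elt_A2_inject by simp
    qed
    show "c \<odot>\<^bsub>End\<^esub> x \<in> carrier End" "?h (c \<odot>\<^bsub>End\<^esub> x) = c \<odot>\<^bsub>path_A2\<^esub> ?h x" if "x \<in> carrier End" for c x
      using End_smult[OF that] S by (simp_all only: ops_A2)
  qed
qed

end

section \<open>The algebra Gamma and the Nakayama sum\<close>

context N_gorenstein_tiled begin

text \<open>
  By \<open>card_V_nonproj\<close> these are the cases of zero, one and two nonprojective summands. Two summands always
  have stable maps in exactly one direction (\<open>V_nonproj_excess_two\<close>), so the number of summands decides.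
\<close>

lemma Gamma_by_nak_sum:
  fixes G :: "('k :: field, (((nat \<times> int) option \<Rightarrow> 'k laurent mat) \<Rightarrow> ((nat \<times> int) option \<Rightarrow> 'k laurent mat)) set) module"
  assumes G: "G = Gamma n d"
  shows "carrier G = {\<zero>\<^bsub>G\<^esub>} \<longleftrightarrow> nak_sum = int n - 1"
    "algebra_iso G (path_A1 :: ('k, _) module) \<longleftrightarrow> nak_sum = int n"
    "algebra_iso G (path_A2 :: ('k, _) module) \<longleftrightarrow> nak_sum = int n + 1"
proof -
  interpret V: coord_module n d "V_module n d :: ('k laurent mat, _) graded_rmod" "V_index n d" "V_exp n d" "V_crd n d"
    by (rule coord_module_V)
  interpret VE: coord_end n d "V_module n d :: ('k laurent mat, _) graded_rmod" "V_index n d" "V_exp n d" "V_crd n d"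
    by unfold_locales
  have G: "G = VE.stEnd" unfolding G Gamma_def VE.stable_End_eq ..
  have np: "VE.nonproj = V_nonproj n d" by (simp add: VE.nonproj_def V_nonproj_def)
  show "carrier G = {\<zero>\<^bsub>G\<^esub>} \<longleftrightarrow> nak_sum = int n - 1"
    unfolding G VE.stEnd_trivial np using card_V_nonproj by (metis add.commute card_0_eq diff_add_cancel eq_iff_diff_eq_0 finite_V_nonproj of_nat_0 of_nat_eq_0_iff add_diff_eq diff_diff_eq2)
  show "algebra_iso G (path_A1 :: ('k, _) module) \<longleftrightarrow> nak_sum = int n"
    unfolding G using VE.stEnd_A1 VE.stEnd_A1_imp card_V_nonproj unfolding np by auto
  show "algebra_iso G (path_A2 :: ('k, _) module) \<longleftrightarrow> nak_sum = int n + 1"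
  proof
    assume "algebra_iso G (path_A2 :: ('k, _) module)"
    then show "nak_sum = int n + 1" unfolding G using VE.stEnd_A2_imp card_V_nonproj unfolding np by simp
  next
    assume "nak_sum = int n + 1"
    then obtain s t where "s \<noteq> t" "V_nonproj n d = {s, t}" "stable_hom n d (V_exp n d s) (V_exp n d t)"
      "\<not> stable_hom n d (V_exp n d t) (V_exp n d s)" using V_nonproj_excess_two by blast
    then show "algebra_iso G (path_A2 :: ('k, _) module)" unfolding G using VE.stEnd_A2 np by blast
  qed
qed

end

section \<open>Dual bases of right ideals\<close>

definition functional :: "('a, 'c) ring_scheme \<Rightarrow> 'a set \<Rightarrow> ('a \<Rightarrow> 'a) \<Rightarrow> bool"
  where "functional A J \<psi> \<longleftrightarrow> (\<forall>x\<in>J. \<psi> x \<in> carrier A) \<and>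
    (\<forall>x\<in>J. \<forall>y\<in>J. \<psi> (x \<oplus>\<^bsub>A\<^esub> y) = \<psi> x \<oplus>\<^bsub>A\<^esub> \<psi> y) \<and>
    (\<forall>x\<in>J. \<forall>r\<in>carrier A. \<psi> (x \<otimes>\<^bsub>A\<^esub> r) = \<psi> x \<otimes>\<^bsub>A\<^esub> r)"

text \<open>
  The dual basis criterion for \<open>J\<close> to be finitely generated projective. It mentions only elements and
  functionals of \<open>J\<close>, which suits an induction over a filtration of \<open>J\<close>.
\<close>

definition dual_basis :: "('a, 'c) ring_scheme \<Rightarrow> 'a set \<Rightarrow> bool"
  where "dual_basis A J \<longleftrightarrow> (\<exists>B \<phi>. finite B \<and> B \<subseteq> J \<and> (\<forall>b\<in>B. functional A J (\<phi> b)) \<and>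
    (\<forall>x\<in>J. x = (\<Oplus>\<^bsub>A\<^esub>b\<in>B. b \<otimes>\<^bsub>A\<^esub> \<phi> b x)))"

context ring begin

lemma right_ideal_facts:
  assumes "right_ideal R J"
  shows "J \<subseteq> carrier R" "\<zero> \<in> J" "\<lbrakk>x \<in> J; y \<in> J\<rbrakk> \<Longrightarrow> x \<oplus> y \<in> J" "x \<in> J \<Longrightarrow> \<ominus> x \<in> J"
    "\<lbrakk>x \<in> J; r \<in> carrier R\<rbrakk> \<Longrightarrow> x \<otimes> r \<in> J"
proof -
  interpret S: additive_subgroup J R using assms by (intro additive_subgroup.intro) (simp add: right_ideal_def)
  show "J \<subseteq> carrier R" by (rule S.a_subset)
  show "\<zero> \<in> J" by simp
  show "\<lbrakk>x \<in> J; y \<in> J\<rbrakk> \<Longrightarrow> x \<oplus> y \<in> J" by simp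
  show "x \<in> J \<Longrightarrow> \<ominus> x \<in> J" by simp
  show "\<lbrakk>x \<in> J; r \<in> carrier R\<rbrakk> \<Longrightarrow> x \<otimes> r \<in> J" using assms by (simp add: right_ideal_def)
qed

lemma right_ideal_finsum:
  assumes J: "right_ideal R J" and "finite I" "\<And>i. i \<in> I \<Longrightarrow> x i \<in> J"
  shows "(\<Oplus>i\<in>I. x i) \<in> J"
  using assms(2,3)
proof (induction I rule: finite_induct)
  case (insert i I)
  then have "x i \<in> carrier R" "x \<in> I \<rightarrow> carrier R" using right_ideal_facts(1)[OF J] by auto
  then show ?case using insert right_ideal_facts(3)[OF J] by simp
qed (simp add: right_ideal_facts(2)[OF J])

lemma projective_of_dual_basis:
  assumes J: "right_ideal R J" and db: "dual_basis R J"
  shows "projective_rmod R ((regular_rmod R)\<lparr>carrier := J\<rparr>)"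
proof -
  note JF = right_ideal_facts[OF J]
  have JR: "x \<in> J \<Longrightarrow> x \<in> carrier R" for x using JF(1) by blast
  let ?M = "(regular_rmod R)\<lparr>carrier := J\<rparr>"
  have M: "carrier ?M = J" "zero ?M = \<zero>" "add ?M = add R" "ract ?M = monoid.mult R" by (simp_all add: regular_rmod_def)
  obtain B \<phi> where B: "finite B" "B \<subseteq> J" and \<phi>: "\<And>b. b \<in> B \<Longrightarrow> functional R J (\<phi> b)"
    and sum: "\<And>x. x \<in> J \<Longrightarrow> x = (\<Oplus>b\<in>B. b \<otimes> \<phi> b x)" using db unfolding dual_basis_def by blast
  have BR: "b \<in> carrier R" if "b \<in> B" for b using that B JR by blast
  let ?F = "free_rmod R B"
  have F: "carrier ?F = B \<rightarrow>\<^sub>E carrier R" "add ?F = (\<lambda>f g. \<lambda>i\<in>B. f i \<oplus> g i)" "ract ?F = (\<lambda>f a. \<lambda>i\<in>B. f i \<otimes> a)"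
    using B(1) by (auto simp: free_rmod_def)
  have "abelian_group ?M"
  proof (rule abelian_groupI)
    fix x assume "x \<in> carrier ?M"
    then show "\<exists>y\<in>carrier ?M. y \<oplus>\<^bsub>?M\<^esub> x = \<zero>\<^bsub>?M\<^esub>"
      using JR JF(4) by (intro bexI[of _ "\<ominus> x"]) (auto simp: M l_neg)
  qed (use JF(2,3) JR in \<open>auto simp: M a_ac\<close>)
  then interpret M: abelian_group ?M .
  have rm: "right_module R ?M"
    by unfold_locales (use JF JR in \<open>auto simp: M l_distr r_distr m_assoc\<close>)
  define f where "f = (\<lambda>x\<in>J. \<lambda>b\<in>B. \<phi> b x)"
  define g where "g = (\<lambda>c\<in>carrier ?F. \<Oplus>b\<in>B. b \<otimes> c b)"
  have fB: "f x \<in> B \<rightarrow>\<^sub>E carrier R" if "x \<in> J" for x using that \<phi> by (auto simp: f_def functional_def)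
  have "f \<in> rmod_hom R ?M ?F"
    unfolding rmod_hom_def mem_Collect_eq M F
  proof (intro conjI ballI)
    show "f \<in> J \<rightarrow>\<^sub>E (B \<rightarrow>\<^sub>E carrier R)" using fB by (auto simp: f_def)
    fix x assume x: "x \<in> J"
    show "f (x \<oplus> y) = (\<lambda>i\<in>B. f x i \<oplus> f y i)" if y: "y \<in> J" for y
      using x y JF(3) \<phi> by (intro ext) (auto simp: f_def functional_def)
    show "f (x \<otimes> r) = (\<lambda>i\<in>B. f x i \<otimes> r)" if r: "r \<in> carrier R" for r
      using x r JF(5) \<phi> by (intro ext) (auto simp: f_def functional_def)
  qed
  moreover have "g \<in> rmod_hom R ?F ?M"
    unfolding rmod_hom_def mem_Collect_eq M F
  proof (intro conjI ballI)
    have cl: "b \<otimes> c b \<in> J" if "c \<in> B \<rightarrow>\<^sub>E carrier R" "b \<in> B" for c b using that B JF(5) by blast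
    show "g \<in> (B \<rightarrow>\<^sub>E carrier R) \<rightarrow>\<^sub>E J"
      using right_ideal_finsum[OF J B(1) cl] by (auto simp: g_def F)
    fix c assume c: "c \<in> B \<rightarrow>\<^sub>E carrier R"
    have cR: "c b \<in> carrier R" if "b \<in> B" for b using c that by blast
    show "g (\<lambda>i\<in>B. c i \<oplus> e i) = g c \<oplus> g e" if e: "e \<in> B \<rightarrow>\<^sub>E carrier R" for e
    proof -
      have eR: "e b \<in> carrier R" if "b \<in> B" for b using e that by blast
      have "(\<lambda>i\<in>B. c i \<oplus> e i) \<in> B \<rightarrow>\<^sub>E carrier R" using cR eR by auto
      then have "g (\<lambda>i\<in>B. c i \<oplus> e i) = (\<Oplus>b\<in>B. b \<otimes> (\<lambda>i\<in>B. c i \<oplus> e i) b)" by (simp add: g_def F)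
      also have "\<dots> = (\<Oplus>b\<in>B. b \<otimes> c b \<oplus> b \<otimes> e b)"
        by (rule finsum_cong') (use BR cR eR in \<open>auto simp: r_distr\<close>)
      also have "\<dots> = g c \<oplus> g e" using c e BR cR eR by (subst finsum_addf) (auto simp: g_def F)
      finally show ?thesis .
    qed
    show "g (\<lambda>i\<in>B. c i \<otimes> r) = g c \<otimes> r" if r: "r \<in> carrier R" for r
    proof -
      have "(\<lambda>i\<in>B. c i \<otimes> r) \<in> B \<rightarrow>\<^sub>E carrier R" using cR r by auto
      then have "g (\<lambda>i\<in>B. c i \<otimes> r) = (\<Oplus>b\<in>B. b \<otimes> (\<lambda>i\<in>B. c i \<otimes> r) b)" by (simp add: g_def F)
      also have "\<dots> = (\<Oplus>b\<in>B. b \<otimes> c b \<otimes> r)"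
        by (rule finsum_cong') (use BR cR r in \<open>auto simp: m_assoc\<close>)
      also have "\<dots> = g c \<otimes> r" using c BR cR r B(1) by (subst finsum_ldistr[symmetric]) (auto simp: g_def F)
      finally show ?thesis .
    qed
  qed
  moreover have "g (f x) = x" if x: "x \<in> J" for x
  proof -
    have "g (f x) = (\<Oplus>b\<in>B. b \<otimes> f x b)" using fB[OF x] by (simp add: g_def F)
    also have "\<dots> = (\<Oplus>b\<in>B. b \<otimes> \<phi> b x)"
      by (rule finsum_cong') (use x BR \<phi> in \<open>auto simp: f_def functional_def\<close>)
    finally show ?thesis using sum[OF x] by simp
  qed
  ultimately show ?thesis unfolding projective_rmod_def M using rm by blast
qed

text \<open>
  The map \<open>x \<mapsto> x - b \<psi>(x)\<close> retracts \<open>J\<close> to \<open>J'\<close>. Compose the functionals of \<open>J'\<close> with it and add the pair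
  \<open>(b, \<psi>)\<close>.
\<close>

lemma dual_basis_extend:
  assumes J: "right_ideal R J" and sub: "J' \<subseteq> J" and db: "dual_basis R J'"
    and b: "b \<in> J" "b \<notin> J'" and \<psi>: "functional R J \<psi>" and rest: "\<And>x. x \<in> J \<Longrightarrow> x \<ominus> b \<otimes> \<psi> x \<in> J'"
  shows "dual_basis R J"
proof -
  note JF = right_ideal_facts[OF J]
  have JR: "x \<in> J \<Longrightarrow> x \<in> carrier R" for x using JF(1) by blast
  have \<psi>R: "\<psi> x \<in> carrier R" and \<psi>a: "y \<in> J \<Longrightarrow> \<psi> (x \<oplus> y) = \<psi> x \<oplus> \<psi> y"
    and \<psi>m: "r \<in> carrier R \<Longrightarrow> \<psi> (x \<otimes> r) = \<psi> x \<otimes> r" if "x \<in> J" for x y r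
    using \<psi> that by (auto simp: functional_def)
  have bR: "b \<in> carrier R" using b JR by blast
  define \<rho> where "\<rho> x = x \<ominus> b \<otimes> \<psi> x" for x
  have \<rho>J: "\<rho> x \<in> J'" if "x \<in> J" for x using rest[OF that] by (simp add: \<rho>_def)
  have \<rho>a: "\<rho> (x \<oplus> y) = \<rho> x \<oplus> \<rho> y" if "x \<in> J" "y \<in> J" for x y
    using JR[OF that(1)] JR[OF that(2)] \<psi>R[OF that(1)] \<psi>R[OF that(2)] bR
    by (simp add: \<rho>_def \<psi>a that minus_eq r_distr minus_add a_ac)
  have \<rho>m: "\<rho> (x \<otimes> r) = \<rho> x \<otimes> r" if "x \<in> J" "r \<in> carrier R" for x r
    using JR[OF that(1)] that(2) \<psi>R[OF that(1)] bR
    by (simp add: \<rho>_def \<psi>m that minus_eq l_distr l_minus m_assoc)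
  obtain B \<phi> where B: "finite B" "B \<subseteq> J'" and \<phi>: "\<And>c. c \<in> B \<Longrightarrow> functional R J' (\<phi> c)"
    and sum: "\<And>x. x \<in> J' \<Longrightarrow> x = (\<Oplus>c\<in>B. c \<otimes> \<phi> c x)" using db unfolding dual_basis_def by blast
  have bB: "b \<notin> B" using B b by blast
  define \<theta> where "\<theta> c = (if c = b then \<psi> else \<phi> c \<circ> \<rho>)" for c
  have \<theta>: "functional R J (\<theta> c)" if c: "c \<in> insert b B" for c
  proof (cases "c = b")
    case False
    then have f: "functional R J' (\<phi> c)" using c \<phi> by blast
    have "functional R J (\<phi> c \<circ> \<rho>)"
      unfolding functional_def comp_def
    proof (intro conjI ballI)
      fix x assume x: "x \<in> J"
      show "\<phi> c (\<rho> x) \<in> carrier R" using f \<rho>J[OF x] unfolding functional_def by blast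
      show "\<phi> c (\<rho> (x \<oplus> y)) = \<phi> c (\<rho> x) \<oplus> \<phi> c (\<rho> y)" if y: "y \<in> J" for y
        using f \<rho>J[OF x] \<rho>J[OF y] unfolding functional_def \<rho>a[OF x y] by blast
      show "\<phi> c (\<rho> (x \<otimes> r)) = \<phi> c (\<rho> x) \<otimes> r" if r: "r \<in> carrier R" for r
        using f \<rho>J[OF x] r unfolding functional_def \<rho>m[OF x r] by blast
    qed
    then show ?thesis using False by (simp add: \<theta>_def)
  qed (simp add: \<theta>_def \<psi>)
  have "x = (\<Oplus>c\<in>insert b B. c \<otimes> \<theta> c x)" if x: "x \<in> J" for x
  proof -
    have cl: "c \<otimes> \<theta> c x \<in> carrier R" if "c \<in> insert b B" for c
      using \<theta>[OF that] x that bR B sub JR unfolding functional_def by blast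
    have "(\<Oplus>c\<in>insert b B. c \<otimes> \<theta> c x) = b \<otimes> \<theta> b x \<oplus> (\<Oplus>c\<in>B. c \<otimes> \<theta> c x)"
      by (rule finsum_insert[OF B(1) bB]) (use cl in auto)
    also have "(\<Oplus>c\<in>B. c \<otimes> \<theta> c x) = (\<Oplus>c\<in>B. c \<otimes> \<phi> c (\<rho> x))"
    proof (rule finsum_cong'[OF refl])
      have B2: "\<theta> c x = \<phi> c (\<rho> x)" if "c \<in> B" for c using that bB by (auto simp: \<theta>_def)
      show "(\<lambda>c. c \<otimes> \<phi> c (\<rho> x)) \<in> B \<rightarrow> carrier R" using cl B2 by fastforce
      show "c \<otimes> \<theta> c x = c \<otimes> \<phi> c (\<rho> x)" if "c \<in> B" for c using B2[OF that] by simp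
    qed
    also have "\<dots> = \<rho> x" using sum[OF \<rho>J[OF x]] by simp
    also have "b \<otimes> \<theta> b x \<oplus> \<rho> x = x" using JR[OF x] \<psi>R[OF x] bR
      by (simp add: \<theta>_def \<rho>_def minus_eq a_lcomm r_neg)
    finally show ?thesis by simp
  qed
  then show ?thesis unfolding dual_basis_def
    using B b(1) sub \<theta> by (intro exI[of _ "insert b B"] exI[of _ \<theta>]) blast
qed

lemma dual_basis_zero: "dual_basis R {\<zero>}"
  unfolding dual_basis_def by (intro exI[of _ "{}"]) auto

end

lemma dual_basis_transport:
  assumes R: "ring R" and S: "ring S" and h: "h \<in> ring_iso R S" and J: "right_ideal R J" and db: "dual_basis R J"
  shows "dual_basis S (h ` J)"
proof -
  interpret R: ring R by (rule R)
  interpret S: ring S by (rule S)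
  have hb: "bij_betw h (carrier R) (carrier S)" and hh: "h \<in> Ring.ring_hom R S" using h by (auto simp: ring_iso_def)
  interpret h: ring_hom_ring R S h using R S hh by (rule ring_hom_ringI2)
  note JF = R.right_ideal_facts[OF J]
  have JR: "x \<in> J \<Longrightarrow> x \<in> carrier R" for x using JF(1) by blast
  have inj: "inj_on h (carrier R)" using hb by (simp add: bij_betw_def)
  define k where "k = inv_into (carrier R) h"
  have kh: "k (h x) = x" if "x \<in> carrier R" for x using inj that by (simp add: k_def)
  have hk: "h (k y) = y" "k y \<in> carrier R" if "y \<in> carrier S" for y
    using that hb f_inv_into_f[of y h "carrier R"] inv_into_into[of y h "carrier R"] by (auto simp: k_def bij_betw_def)
  obtain B \<phi> where B: "finite B" "B \<subseteq> J" and \<phi>: "\<And>c. c \<in> B \<Longrightarrow> functional R J (\<phi> c)"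
    and sum: "\<And>x. x \<in> J \<Longrightarrow> x = (\<Oplus>\<^bsub>R\<^esub>c\<in>B. c \<otimes>\<^bsub>R\<^esub> \<phi> c x)" using db unfolding dual_basis_def by blast
  have \<phi>R: "\<phi> c x \<in> carrier R" and \<phi>a: "y \<in> J \<Longrightarrow> \<phi> c (x \<oplus>\<^bsub>R\<^esub> y) = \<phi> c x \<oplus>\<^bsub>R\<^esub> \<phi> c y"
    and \<phi>m: "r \<in> carrier R \<Longrightarrow> \<phi> c (x \<otimes>\<^bsub>R\<^esub> r) = \<phi> c x \<otimes>\<^bsub>R\<^esub> r" if "c \<in> B" "x \<in> J" for c x y r
    using \<phi> that by (auto simp: functional_def)
  define \<theta> where "\<theta> c x = h (\<phi> (k c) (k x))" for c x
  have "functional S (h ` J) (\<theta> c)" if c: "c \<in> h ` B" for c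
  proof -
    obtain b where b: "b \<in> B" "c = h b" using c by blast
    have kb: "k c = b" using b B JR kh by auto
    show ?thesis
      unfolding functional_def
    proof (intro conjI ballI)
      fix x' assume "x' \<in> h ` J"
      then obtain x where x: "x \<in> J" "x' = h x" by blast
      show "\<theta> c x' \<in> carrier S" using \<phi>R[OF b(1) x(1)] by (simp add: \<theta>_def kb x(2) kh JR[OF x(1)])
      show "\<theta> c (x' \<oplus>\<^bsub>S\<^esub> y') = \<theta> c x' \<oplus>\<^bsub>S\<^esub> \<theta> c y'" if "y' \<in> h ` J" for y'
      proof -
        obtain y where y: "y \<in> J" "y' = h y" using \<open>y' \<in> h ` J\<close> by blast
        have "x' \<oplus>\<^bsub>S\<^esub> y' = h (x \<oplus>\<^bsub>R\<^esub> y)" using x y JR by simp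
        then show ?thesis
          using \<phi>R[OF b(1) x(1)] \<phi>R[OF b(1) y(1)] \<phi>a[OF b(1) x(1) y(1)] JR[OF x(1)] JR[OF y(1)]
          by (simp add: \<theta>_def kb x(2) y(2) kh del: h.hom_add) (simp)
      qed
      show "\<theta> c (x' \<otimes>\<^bsub>S\<^esub> r') = \<theta> c x' \<otimes>\<^bsub>S\<^esub> r'" if r': "r' \<in> carrier S" for r'
      proof -
        have r: "k r' \<in> carrier R" "h (k r') = r'" using hk[OF r'] by auto
        have "x' \<otimes>\<^bsub>S\<^esub> r' = h (x \<otimes>\<^bsub>R\<^esub> k r')" using x r JR by simp
        then have "\<theta> c (x' \<otimes>\<^bsub>S\<^esub> r') = h (\<phi> b (x \<otimes>\<^bsub>R\<^esub> k r'))" using JR[OF x(1)] r(1) kh by (simp only: \<theta>_def kb R.m_closed)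
        also have "\<dots> = h (\<phi> b x) \<otimes>\<^bsub>S\<^esub> r'" unfolding \<phi>m[OF b(1) x(1) r(1)] using \<phi>R[OF b(1) x(1)] r by simp
        finally show ?thesis using JR[OF x(1)] by (simp add: \<theta>_def kb x(2) kh)
      qed
    qed
  qed
  moreover have "x' = (\<Oplus>\<^bsub>S\<^esub>c\<in>h ` B. c \<otimes>\<^bsub>S\<^esub> \<theta> c x')" if x': "x' \<in> h ` J" for x'
  proof -
    obtain x where x: "x \<in> J" "x' = h x" using x' by blast
    have cl: "b \<otimes>\<^bsub>R\<^esub> \<phi> b x \<in> carrier R" if "b \<in> B" for b using that B JR \<phi>R x by blast
    have "h (\<Oplus>\<^bsub>R\<^esub>c\<in>I. c \<otimes>\<^bsub>R\<^esub> \<phi> c x) = (\<Oplus>\<^bsub>S\<^esub>c\<in>h ` I. c \<otimes>\<^bsub>S\<^esub> \<theta> c x')" if "finite I" "I \<subseteq> B" for I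
      using that
    proof (induction I rule: finite_induct)
      case (insert b I)
      have bI: "b \<in> carrier R" "I \<subseteq> carrier R" using insert B JR by auto
      have "h b \<notin> h ` I" using insert(2) bI inj_on_image_mem_iff[OF inj] by blast
      moreover have th: "h c \<otimes>\<^bsub>S\<^esub> \<theta> (h c) x' = h (c \<otimes>\<^bsub>R\<^esub> \<phi> c x)" if "c \<in> B" for c
      proof -
        have "c \<in> carrier R" using that B JR by blast
        then show ?thesis using \<phi>R[OF that x(1)] JR[OF x(1)] by (simp add: \<theta>_def kh x(2))
      qed
      moreover have "(\<lambda>c. c \<otimes>\<^bsub>S\<^esub> \<theta> c x') \<in> h ` I \<rightarrow> carrier S"
      proof
        fix c assume "c \<in> h ` I"
        then obtain c' where c': "c' \<in> B" "c = h c'" using insert(4) by blast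
        show "c \<otimes>\<^bsub>S\<^esub> \<theta> c x' \<in> carrier S" unfolding c'(2) th[OF c'(1)] using cl[OF c'(1)] by simp
      qed
      moreover have "h b \<otimes>\<^bsub>S\<^esub> \<theta> (h b) x' \<in> carrier S" using th[of b] cl[of b] insert(4) by simp
      ultimately have "(\<Oplus>\<^bsub>S\<^esub>c\<in>h ` insert b I. c \<otimes>\<^bsub>S\<^esub> \<theta> c x') = h b \<otimes>\<^bsub>S\<^esub> \<theta> (h b) x' \<oplus>\<^bsub>S\<^esub> (\<Oplus>\<^bsub>S\<^esub>c\<in>h ` I. c \<otimes>\<^bsub>S\<^esub> \<theta> c x')"
        using insert(1) by simp
      also have "\<dots> = h (b \<otimes>\<^bsub>R\<^esub> \<phi> b x) \<oplus>\<^bsub>S\<^esub> h (\<Oplus>\<^bsub>R\<^esub>c\<in>I. c \<otimes>\<^bsub>R\<^esub> \<phi> c x)" using th[of b] insert by simp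
      also have "\<dots> = h (b \<otimes>\<^bsub>R\<^esub> \<phi> b x \<oplus>\<^bsub>R\<^esub> (\<Oplus>\<^bsub>R\<^esub>c\<in>I. c \<otimes>\<^bsub>R\<^esub> \<phi> c x))"
        by (rule h.hom_add[symmetric]) (use cl insert(4) in \<open>auto intro!: R.finsum_closed\<close>)
      also have "b \<otimes>\<^bsub>R\<^esub> \<phi> b x \<oplus>\<^bsub>R\<^esub> (\<Oplus>\<^bsub>R\<^esub>c\<in>I. c \<otimes>\<^bsub>R\<^esub> \<phi> c x) = (\<Oplus>\<^bsub>R\<^esub>c\<in>insert b I. c \<otimes>\<^bsub>R\<^esub> \<phi> c x)"
        by (rule R.finsum_insert[symmetric]) (use insert cl in auto)
      finally show ?case by simp
    qed simp
    from this[OF B(1) order_refl] show ?thesis using sum[OF x(1)] x(2) by simp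
  qed
  ultimately show ?thesis unfolding dual_basis_def using B
    by (intro exI[of _ "h ` B"] exI[of _ \<theta>]) auto
qed

section \<open>Submodules of the Laurent polynomials\<close>

definition window :: "int \<Rightarrow> nat \<Rightarrow> 'k :: field laurent set"
  where "window v w = {g. Poly_Mapping.keys g \<subseteq> {v..v + int w}}"

text \<open>
  Euclid's algorithm in \<open>K\<close>: a nonzero element of \<open>W\<close> with the shortest range of degrees divides
  all others, since subtracting a multiple that cancels the lowest term shortens the range.
\<close>

lemma laurent_principal:
  fixes W :: "'k :: field laurent set"
  assumes sub: "\<And>g f c i. \<lbrakk>g \<in> W; f \<in> W\<rbrakk> \<Longrightarrow> g - lmonom i c * f \<in> W" and g0: "g0 \<in> W" "g0 \<noteq> 0"
  obtains f where "f \<in> W" "f \<in> order_ge 0" "lookup f 0 \<noteq> 0" "\<And>g. g \<in> W \<Longrightarrow> \<exists>h. g = f * h"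
proof -
  have zero: "0 \<in> W" using sub[OF g0(1) g0(1), of 0 1] by simp
  have mon: "lmonom i c * f \<in> W" if "f \<in> W" for f i c using sub[OF zero that, of i "- c"] by (simp add: single_uminus)
  define P where "P w = (\<exists>g\<in>W. g \<noteq> 0 \<and> (\<exists>v. g \<in> window v w))" for w
  have "\<exists>w. P w"
  proof -
    let ?K = "Poly_Mapping.keys g0"
    have K: "finite ?K" "?K \<noteq> {}" using g0 by auto
    have "?K \<subseteq> {Min ?K..Min ?K + int (nat (Max ?K - Min ?K))}" using K Min_le_iff[OF K] by auto
    then show ?thesis unfolding P_def window_def using g0 by blast
  qed
  define w where "w = (LEAST w. P w)"
  have Pw: "P w" unfolding w_def using \<open>\<exists>w. P w\<close> by (rule LeastI_ex)
  have least: "\<not> P w'" if "w' < w" for w' using that not_less_Least unfolding w_def by blast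
  obtain f0 v where f0: "f0 \<in> W" "f0 \<noteq> 0" "f0 \<in> window v w" using Pw unfolding P_def by blast
  have lv: "lookup f0 v \<noteq> 0"
  proof
    assume z: "lookup f0 v = 0"
    have sb: "Poly_Mapping.keys f0 \<subseteq> {v + 1..v + int w}"
    proof
      fix i assume i: "i \<in> Poly_Mapping.keys f0"
      then have "i \<noteq> v" using z by (auto simp: in_keys_iff)
      then show "i \<in> {v + 1..v + int w}" using i f0(3) by (force simp: window_def)
    qed
    have "Poly_Mapping.keys f0 \<noteq> {}" using f0(2) by simp
    then have "w > 0" using sb by (cases w) auto
    then have "f0 \<in> window (v + 1) (w - 1)" using sb by (simp add: window_def of_nat_diff)
    then have "P (w - 1)" unfolding P_def using f0 by blast
    then show False using least[of "w - 1"] \<open>w > 0\<close> by simp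
  qed
  define f where "f = lmonom (- v) 1 * f0"
  have lf: "lookup f i = lookup f0 (i + v)" for i by (simp add: f_def lookup_lmonom_mult)
  have fW: "f \<in> W" unfolding f_def by (rule mon[OF f0(1)])
  have fk: "0 \<le> i \<and> i \<le> int w" if "lookup f i \<noteq> 0" for i
    using that f0(3) unfolding lf window_def by (force simp: in_keys_iff)
  have ford: "f \<in> order_ge 0" using fk by (auto simp: order_ge_def)
  have f00: "lookup f 0 \<noteq> 0" using lv by (simp add: lf)
  have div: "\<exists>h. g = f * h" if "g \<in> W" "g \<in> window u w'" for g u w'
    using that
  proof (induction w' arbitrary: g u)
    case 0
    show ?case
    proof (cases "g = 0")
      case False
      then have "P 0" unfolding P_def using 0 by blast
      then have w0: "w = 0" using least[of 0] by blast
      have "f = lmonom 0 (lookup f 0)"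
        by (rule poly_mapping_eqI) (use fk w0 in \<open>force simp: lookup_single when_def\<close>)
      then obtain e where e: "f = lmonom 0 e" "e \<noteq> 0" using f00 by metis
      have "f * (lmonom 0 (1 / e) * g) = g"
        unfolding e(1) using e(2) by (simp add: mult.assoc[symmetric] mult_single)
      then show ?thesis by metis
    qed (auto intro: exI[of _ 0])
  next
    case (Suc w')
    define c where "c = lookup g u / lookup f 0"
    define g' where "g' = g - lmonom u c * f"
    have g'W: "g' \<in> W" unfolding g'_def by (rule sub[OF Suc.prems(1) fW])
    show ?case
    proof (cases "Suc w' < w")
      case True
      then have "g = 0" using least Suc.prems unfolding P_def by blast
      then show ?thesis by (intro exI[of _ 0]) simp
    next
      case False
      have "g' \<in> window (u + 1) w'"
        unfolding window_def
      proof (intro CollectI subsetI)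
        fix i assume "i \<in> Poly_Mapping.keys g'"
        then have i: "lookup g i - c * lookup f (i - u) \<noteq> 0"
          by (simp add: in_keys_iff g'_def lookup_minus lookup_lmonom_mult)
        have "i \<noteq> u" using i f00 by (auto simp: c_def)
        moreover have "u \<le> i \<and> i \<le> u + int (Suc w')"
        proof (cases "lookup g i = 0")
          case True
          then have "lookup f (i - u) \<noteq> 0" using i by auto
          then show ?thesis using fk[of "i - u"] False by auto
        next
          case False
          then show ?thesis using Suc.prems(2) by (auto simp: window_def in_keys_iff)
        qed
        ultimately show "i \<in> {u + 1..u + 1 + int w'}" by auto
      qed
      then obtain h where "g' = f * h" using Suc.IH[OF g'W] by blast
      then have "g = f * (h + lmonom u c)" by (simp add: g'_def algebra_simps)
      then show ?thesis by blast
    qed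
  qed
  have "\<exists>h. g = f * h" if g: "g \<in> W" for g
  proof (cases "g = 0")
    case False
    let ?K = "Poly_Mapping.keys g"
    have K: "finite ?K" "?K \<noteq> {}" using False by auto
    have "?K \<subseteq> {Min ?K..Min ?K + int (nat (Max ?K - Min ?K))}" using K Min_le_iff[OF K] by auto
    then show ?thesis using div[OF g] unfolding window_def by blast
  qed (auto intro: exI[of _ 0])
  then show ?thesis using that fW ford f00 by blast
qed

section \<open>Right ideals of a tiled order\<close>

lemma tiled_a_inv:
  assumes ex: "exponent_matrix n d" and x: "x \<in> tiled_order_carrier n d"
  shows "\<ominus>\<^bsub>tiled_order n d\<^esub> x = - x"
proof -
  interpret A: ring "tiled_order n d" by (rule ring_tiled_order[OF ex])
  show ?thesis
    using A.minus_equality[of "- x" x] x tiled_uminus_closed[OF x] uminus_l_inv_mat[OF tiled_carrier_mat[OF x]] by simp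
qed

text \<open>
  The entries in row \<open>k\<close> and column \<open>l\<close> of elements of \<open>J\<close> form an \<open>R\<close>-submodule \<open>S l\<close> of \<open>K\<close>. All of them span the same
  ideal of \<open>K\<close>, generated by \<open>f\<close>, and \<open>S l = f x\<^bsup>a l\<^esup> R\<close> for a lattice vector \<open>a\<close>. As all lattices of rank
  one are projective, row \<open>k\<close> of \<open>J\<close> is a multiple of some \<open>e\<^sub>m A\<close>.
\<close>

lemma row_generator:
  fixes J :: "'k :: field laurent mat set"
  assumes ex: "exponent_matrix n d" and ap: "all_projective n d"
    and J: "right_ideal (tiled_order n d) J" and k: "k < n" and nz: "x1 \<in> J" "l1 < n" "x1 $$ (k, l1) \<noteq> 0"
  shows "\<exists>f m b. f \<noteq> 0 \<and> m < n \<and> b \<in> J \<and> (\<forall>l<n. b $$ (k, l) = (if l = m then f else 0)) \<and>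
    (\<forall>x\<in>J. \<forall>l<n. \<exists>y\<in>order_ge (d m l). x $$ (k, l) = f * y)"
proof -
  let ?A = "tiled_order n d :: ('k, 'k laurent mat) graded_algebra"
  interpret A: ring ?A by (rule ring_tiled_order[OF ex])
  note JF = A.right_ideal_facts[OF J, unfolded tiled_order_simps]
  have n0: "0 < n" using k by simp
  have d0: "d i i = 0" if "i < n" for i using ex that by (simp add: exponent_matrix_def)
  have xm: "x \<in> carrier_mat n n" if "x \<in> J" for x using JF(1) that tiled_carrier_mat by blast
  define S where "S l = {x $$ (k, l) | x. x \<in> J}" for l
  have S_add: "s + t \<in> S l" if s: "s \<in> S l" and t: "t \<in> S l" and l: "l < n" for s t l
  proof -
    obtain x y where xy: "x \<in> J" "y \<in> J" "s = x $$ (k, l)" "t = y $$ (k, l)" using s t by (auto simp: S_def)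
    then have "s + t = (x + y) $$ (k, l)" using xm[of x] xm[of y] k l by simp
    then show ?thesis using JF(3)[OF xy(1,2)] by (auto simp: S_def)
  qed
  have S_mult: "s * g \<in> S j" if s: "s \<in> S i" and g: "g \<in> order_ge (d i j)" and ij: "i < n" "j < n" for s g i j
  proof -
    obtain x where x: "x \<in> J" "s = x $$ (k, i)" using s by (auto simp: S_def)
    have u: "unit_mat n g i j \<in> tiled_order_carrier n d" by (rule unit_mat_in_tiled[of _ d i j, OF g])
    have "(x * unit_mat n g i j) $$ (k, j) = s * g"
      unfolding mat_mult_index[OF xm[OF x(1)] unit_mat_carrier k ij(2)] sum_unit_mat[OF ij] x(2) by simp
    then show ?thesis using JF(5)[OF x(1) u] unfolding S_def by (metis (mono_tags, lifting) mem_Collect_eq)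
  qed
  define W where "W = {w. \<exists>N :: nat. lmonom (int N) 1 * w \<in> S 0}"
  have W_sub: "g - lmonom i c * f \<in> W" if g: "g \<in> W" and f: "f \<in> W" for g f i c
  proof -
    obtain N1 N2 :: nat where N: "lmonom (int N1) 1 * g \<in> S 0" "lmonom (int N2) 1 * f \<in> S 0" using g f by (auto simp: W_def)
    define N where "N = N1 + N2 + nat (- i)"
    have "lmonom (int N1) 1 * g * lmonom (int N - int N1) 1 \<in> S 0"
      by (rule S_mult[OF N(1) _ n0 n0]) (simp add: d0[OF n0] N_def)
    moreover have "lmonom (int N2) 1 * f * lmonom (int N - int N2 + i) (- c) \<in> S 0"
      by (rule S_mult[OF N(2) _ n0 n0]) (simp add: d0[OF n0] N_def)
    ultimately have "lmonom (int N1) 1 * g * lmonom (int N - int N1) 1 + lmonom (int N2) 1 * f * lmonom (int N - int N2 + i) (- c) \<in> S 0"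
      using S_add n0 by blast
    also have "lmonom (int N1) 1 * g * lmonom (int N - int N1) 1 + lmonom (int N2) 1 * f * lmonom (int N - int N2 + i) (- c)
        = (lmonom (int N1) 1 * lmonom (int N - int N1) 1) * g + (lmonom (int N2) 1 * lmonom (int N - int N2 + i) (- c)) * f"
      by (simp only: ac_simps)
    also have "\<dots> = lmonom (int N) 1 * g + lmonom (int N + i) (- c) * f" by (simp add: mult_single)
    also have "\<dots> = lmonom (int N) 1 * (g - lmonom i c * f)"
      by (simp add: right_diff_distrib mult.assoc[symmetric] mult_single single_uminus)
    finally show ?thesis unfolding W_def by blast
  qed
  have SW: "s \<in> W" if s: "s \<in> S l" and l: "l < n" for s l
  proof -
    have "s * lmonom (int (nat (d l 0))) 1 \<in> S 0" by (rule S_mult[OF s _ l n0]) simp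
    then have "lmonom (int (nat (d l 0))) 1 * s \<in> S 0" by (simp only: mult.commute)
    then show ?thesis unfolding W_def by blast
  qed
  have inS: "x $$ (k, l) \<in> S l" if "x \<in> J" for x l using that by (auto simp: S_def)
  obtain f where f: "f \<in> W" "f \<in> order_ge 0" "lookup f 0 \<noteq> 0" and fdiv: "\<And>g. g \<in> W \<Longrightarrow> \<exists>h. g = f * h"
    using laurent_principal[OF W_sub SW[OF inS[OF nz(1)] nz(2)] nz(3)] by blast
  (* a l will be the least exponent e with H l e. *)
  define H where "H l e \<longleftrightarrow> f * lmonom e 1 \<in> S l" for l e
  have H_ex: "\<exists>e. H l e" if l: "l < n" for l
  proof -
    obtain N :: nat where N: "lmonom (int N) 1 * f \<in> S 0" using f(1) by (auto simp: W_def)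
    have "lmonom (int N) 1 * f * lmonom (d 0 l) 1 \<in> S l" by (rule S_mult[OF N _ n0 l]) simp
    also have "lmonom (int N) 1 * f * lmonom (d 0 l) 1 = f * (lmonom (int N) 1 * lmonom (d 0 l) 1)" by (simp only: ac_simps)
    finally show ?thesis unfolding H_def mult_single by auto
  qed
  have H_ge: "d k l \<le> e" if H: "H l e" and l: "l < n" for l e
  proof (rule ccontr)
    assume "\<not> d k l \<le> e"
    obtain x where x: "x \<in> J" "f * lmonom e 1 = x $$ (k, l)" using H by (auto simp: H_def S_def)
    then have "f * lmonom e 1 \<in> order_ge (d k l)" using JF(1) k l by (auto simp: tiled_carrier_iff)
    then have "lookup (f * lmonom e 1) e = 0" using \<open>\<not> d k l \<le> e\<close> by (intro order_geD[of _ "d k l"]) auto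
    then show False using f(3) by (simp add: mult.commute[of f] lookup_lmonom_mult)
  qed
  have "\<exists>e. H l e \<and> (\<forall>e'. H l e' \<longrightarrow> e \<le> e')" if l: "l < n" for l
  proof -
    obtain e where e: "H l e" using H_ex[OF l] by blast
    define j where "j = (LEAST j. H l (d k l + int j))"
    have "H l (d k l + int (nat (e - d k l)))" using e H_ge[OF e l] by simp
    then have j: "H l (d k l + int j)" unfolding j_def by (rule LeastI)
    have "d k l + int j \<le> e'" if e': "H l e'" for e'
    proof -
      have "H l (d k l + int (nat (e' - d k l)))" using e' H_ge[OF e' l] by simp
      then have "j \<le> nat (e' - d k l)" unfolding j_def by (rule Least_le)
      then show ?thesis using H_ge[OF e' l] by linarith
    qed
    then show ?thesis using j by blast
  qed
  then obtain a where a: "\<And>l. l < n \<Longrightarrow> H l (a l)" "\<And>l e. l < n \<Longrightarrow> H l e \<Longrightarrow> a l \<le> e" by metis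
  have lat: "lattice_vec n d a"
    unfolding lattice_vec_def
  proof (intro allI impI)
    fix i j assume ij: "i < n" "j < n"
    have "f * lmonom (a i) 1 * lmonom (d i j) 1 \<in> S j" by (rule S_mult[OF a(1)[OF ij(1), unfolded H_def] _ ij]) simp
    then have "H j (a i + d i j)" by (simp add: H_def mult.assoc mult_single)
    then show "a j \<le> a i + d i j" by (rule a(2)[OF ij(2)])
  qed
  have quot: "h \<in> order_ge (a l)" if s: "f * h \<in> S l" and l: "l < n" for h l
  proof (rule ccontr)
    assume nh: "h \<notin> order_ge (a l)"
    let ?K = "Poly_Mapping.keys h"
    define e where "e = Min ?K"
    obtain i where i: "lookup h i \<noteq> 0" "i < a l" using nh by (auto simp: order_ge_def)
    have K: "finite ?K" "i \<in> ?K" using i by (auto simp: in_keys_iff)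
    then have "?K \<noteq> {}" by blast
    then have ei: "e \<le> i" "e \<in> ?K" unfolding e_def using Min_le[OF K] Min_in[OF K(1)] by blast+
    have he: "lookup h e \<noteq> 0" using ei by (simp add: in_keys_iff)
    have hge: "h \<in> order_ge e" unfolding order_ge_def e_def using K(1) by (auto simp: in_keys_iff)
    (* If h had a term below a l, multiply by a power of x to move its lowest term to degree a l - 1.
       The other terms are already multiples of x^(a l), so f x^(a l - 1) would lie in S l. *)
    define h' where "h' = h * lmonom (a l - 1 - e) 1"
    have h': "lookup h' t = lookup h (t - (a l - 1 - e))" for t
      by (simp add: h'_def mult.commute[of h] lookup_lmonom_mult)
    define h2 where "h2 = h' - lmonom (a l - 1) (lookup h e)"
    have h2: "h2 \<in> order_ge (a l)"
      unfolding order_ge_def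
    proof (intro CollectI allI impI)
      fix t assume t: "lookup h2 t \<noteq> 0"
      then have "t \<noteq> a l - 1" by (auto simp: h2_def lookup_minus h')
      then have "lookup h' t \<noteq> 0" using t by (simp add: h2_def lookup_minus lookup_single when_def)
      then have "e \<le> t - (a l - 1 - e)" using hge unfolding h' order_ge_def by blast
      then show "a l \<le> t" using \<open>t \<noteq> a l - 1\<close> by linarith
    qed
    have s1: "f * h' \<in> S l"
      unfolding h'_def mult.assoc[symmetric] by (rule S_mult[OF s _ l l]) (use ei i l in \<open>simp add: d0\<close>)
    have "f * lmonom (a l) 1 * (lmonom (- a l) (- 1) * h2) \<in> S l"
    proof (rule S_mult[OF a(1)[OF l, unfolded H_def] _ l l])
      have "lmonom (- a l) 1 * h2 \<in> order_ge 0" using h2 by (simp add: lmonom_mult_iff)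
      then have "- (lmonom (- a l) 1 * h2) \<in> order_ge 0" by (rule order_ge_uminus)
      then show "lmonom (- a l) (- 1) * h2 \<in> order_ge (d l l)" by (simp add: d0 l single_uminus)
    qed
    also have "f * lmonom (a l) 1 * (lmonom (- a l) (- 1) * h2) = - (f * h2)"
      by (simp add: single_uminus mult.assoc)
    finally have "f * h' + - (f * h2) \<in> S l" using S_add[OF s1] l by blast
    also have "f * h' + - (f * h2) = f * lmonom (a l - 1) (lookup h e)"
      by (simp add: h2_def algebra_simps)
    finally have "f * lmonom (a l - 1) (lookup h e) * lmonom 0 (1 / lookup h e) \<in> S l"
      by (rule S_mult[OF _ _ l l]) (simp add: d0 l)
    then have "H l (a l - 1)" using he by (simp add: H_def mult.assoc mult_single)
    then show False using a(2)[OF l] by force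
  qed
  obtain m where m: "m < n" and ml: "\<And>l. l < n \<Longrightarrow> d m l + a m \<le> a l"
    using ap lat unfolding all_projective_def through_proj_def by blast
  define F where "F = f * lmonom (a m) 1"
  have Fne: "F \<noteq> 0"
  proof
    assume "F = 0"
    then have "lookup F (a m) = 0" by simp
    then show False using f(3) by (simp add: F_def mult.commute[of f] lookup_lmonom_mult)
  qed
  obtain x0 where x0: "x0 \<in> J" "x0 $$ (k, m) = F" using a(1)[OF m] by (auto simp: H_def S_def F_def)
  have one: "1 \<in> (order_ge (d m m) :: 'k laurent set)" using order_ge_lmonom[of 0 1 0] d0[OF m] by simp
  have um: "unit_mat n (1 :: 'k laurent) m m \<in> tiled_order_carrier n d" by (rule unit_mat_in_tiled[of _ d m m, OF one])
  have "(x0 * unit_mat n 1 m m) $$ (k, l) = (if l = m then F else 0)" if "l < n" for l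
    unfolding mat_mult_index[OF xm[OF x0(1)] unit_mat_carrier k that] sum_unit_mat[OF m that] x0(2) by simp
  moreover have "x0 * unit_mat n 1 m m \<in> J" by (rule JF(5)[OF x0(1) um])
  moreover have "\<exists>y\<in>order_ge (d m l). x $$ (k, l) = F * y" if x: "x \<in> J" and l: "l < n" for x l
  proof -
    obtain h where h: "x $$ (k, l) = f * h" using fdiv[OF SW[OF inS[OF x] l]] by blast
    have hl: "h \<in> order_ge (a l)" using quot[OF _ l] inS[OF x, of l] unfolding h by blast
    have "lmonom (- a m) 1 * h \<in> order_ge (a l - a m)" using hl by (simp add: lmonom_mult_iff)
    then have "lmonom (- a m) 1 * h \<in> order_ge (d m l)" by (rule order_ge_mono) (use ml[OF l] in simp)
    moreover have "x $$ (k, l) = F * (lmonom (- a m) 1 * h)" unfolding h F_def mult.assoc lmonom_inverse ..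
    ultimately show ?thesis by blast
  qed
  ultimately show ?thesis using Fne m by blast
qed

text \<open>
  Filter \<open>J\<close> by the number of leading zero rows. By \<open>row_generator\<close> every step of the filtration has a
  projective quotient, so it splits off one member of a dual basis.
\<close>

lemma dual_basis_of_all_projective:
  fixes J :: "'k :: field laurent mat set"
  assumes ex: "exponent_matrix n d" and ap: "all_projective n d"
    and J: "right_ideal (tiled_order n d) J"
  shows "dual_basis (tiled_order n d) J"
proof -
  let ?A = "tiled_order n d :: ('k, 'k laurent mat) graded_algebra"
  interpret A: ring ?A by (rule ring_tiled_order[OF ex])
  note JF = A.right_ideal_facts[OF J, unfolded tiled_order_simps]
  have xm: "x \<in> carrier_mat n n" if "x \<in> J" for x using JF(1) that tiled_carrier_mat by blast
  define L where "L k = {x \<in> J. \<forall>i<k. \<forall>l<n. x $$ (i, l) = 0}" for k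
  have L: "right_ideal ?A (L k)" if k: "k \<le> n" for k
    unfolding right_ideal_def
  proof (intro conjI ballI)
    show "subgroup (L k) (add_monoid ?A)"
    proof (rule A.add.subgroupI)
      show "L k \<subseteq> carrier ?A" using JF(1) by (auto simp: L_def)
      have "0\<^sub>m n n \<in> L k" using JF(2) k by (auto simp: L_def)
      then show "L k \<noteq> {}" by blast
      fix x assume x: "x \<in> L k"
      then have xJ: "x \<in> J" by (simp add: L_def)
      have xc: "x \<in> tiled_order_carrier n d" using xJ JF(1) by blast
      have "- x \<in> J" using JF(4)[OF xJ] tiled_a_inv[OF ex xc] by simp
      then show "\<ominus>\<^bsub>?A\<^esub> x \<in> L k" unfolding tiled_a_inv[OF ex xc] using x xm[OF xJ] k by (auto simp: L_def)
      show "x \<oplus>\<^bsub>?A\<^esub> y \<in> L k" if y: "y \<in> L k" for y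
      proof -
        have yJ: "y \<in> J" using y by (simp add: L_def)
        have "(x + y) $$ (i, l) = 0" if "i < k" "l < n" for i l
          using x y xm[OF yJ] that k by (simp add: L_def)
        then show ?thesis using JF(3)[OF xJ yJ] by (simp add: L_def)
      qed
    qed
    fix x r assume x: "x \<in> L k" and r: "r \<in> carrier ?A"
    have xJ: "x \<in> J" using x by (simp add: L_def)
    have rc: "r \<in> tiled_order_carrier n d" using r by simp
    have "(x * r) $$ (i, l) = 0" if "i < k" "l < n" for i l
      using x that k mat_mult_index[OF xm[OF xJ] tiled_carrier_mat[OF rc], of i l] by (auto simp: L_def)
    then show "x \<otimes>\<^bsub>?A\<^esub> r \<in> L k" using JF(5)[OF xJ rc] by (simp add: L_def)
  qed
  have step: "dual_basis ?A (L k)" if k: "k < n" and db: "dual_basis ?A (L (Suc k))" for k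
  proof (cases "\<exists>x\<in>L k. \<exists>l<n. x $$ (k, l) \<noteq> 0")
    case False
    then have "L (Suc k) = L k" unfolding L_def by (auto simp: less_Suc_eq)
    then show ?thesis using db by simp
  next
    case True
    then obtain x1 l1 where "x1 \<in> L k" "l1 < n" "x1 $$ (k, l1) \<noteq> 0" by blast
    from row_generator[OF ex ap L[OF less_imp_le[OF k]] k this]
    obtain f m b where f: "f \<noteq> 0" and m: "m < n" and b: "b \<in> L k" and bk: "\<And>l. l < n \<Longrightarrow> b $$ (k, l) = (if l = m then f else 0)"
      and div: "\<And>x l. \<lbrakk>x \<in> L k; l < n\<rbrakk> \<Longrightarrow> \<exists>y\<in>order_ge (d m l). x $$ (k, l) = f * y" by blast
    note LF = A.right_ideal_facts[OF L[OF less_imp_le[OF k]], unfolded tiled_order_simps]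
    have Lm: "x \<in> carrier_mat n n" if "x \<in> L k" for x using xm that by (simp add: L_def)
    define q where "q x l = (THE y. x $$ (k, l) = f * y)" for x l
    have qI: "q x l = y" if "x $$ (k, l) = f * y" for x l y
      unfolding q_def using that f by (intro the_equality) auto
    have q: "q x l \<in> order_ge (d m l)" "x $$ (k, l) = f * q x l" if x: "x \<in> L k" "l < n" for x l
    proof -
      obtain y where y: "y \<in> order_ge (d m l)" "x $$ (k, l) = f * y" using div[OF x] by blast
      then show "q x l \<in> order_ge (d m l)" "x $$ (k, l) = f * q x l" using qI[OF y(2)] by auto
    qed
    define \<psi> where "\<psi> x = mat n n (\<lambda>(i, l). if i = m then q x l else 0)" for x
    have \<psi>m: "\<psi> x \<in> carrier_mat n n" for x by (simp add: \<psi>_def)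
    have \<psi>: "\<psi> x \<in> tiled_order_carrier n d" if "x \<in> L k" for x
      using q(1)[OF that] by (auto simp: tiled_carrier_iff \<psi>_def)
    have "functional ?A (L k) \<psi>"
      unfolding functional_def
    proof (intro conjI ballI)
      fix x assume x: "x \<in> L k"
      show "\<psi> x \<in> carrier ?A" using \<psi>[OF x] by simp
      show "\<psi> (x \<oplus>\<^bsub>?A\<^esub> y) = \<psi> x \<oplus>\<^bsub>?A\<^esub> \<psi> y" if y: "y \<in> L k" for y
      proof -
        have "q (x + y) l = q x l + q y l" if l: "l < n" for l
          by (rule qI) (use q(2)[OF x l] q(2)[OF y l] Lm[OF x] Lm[OF y] k l in \<open>simp add: distrib_left\<close>)
        then show ?thesis by (intro eq_matI) (auto simp: \<psi>_def)
      qed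
      show "\<psi> (x \<otimes>\<^bsub>?A\<^esub> r) = \<psi> x \<otimes>\<^bsub>?A\<^esub> r" if r: "r \<in> carrier ?A" for r
      proof -
        have rm: "r \<in> carrier_mat n n" using r by (simp add: tiled_carrier_iff)
        have qr: "q (x * r) l = (\<Sum>j<n. q x j * r $$ (j, l))" if l: "l < n" for l
          by (rule qI) (use q(2)[OF x] in \<open>simp add: mat_mult_index[OF Lm[OF x] rm k l] sum_distrib_left mult.assoc\<close>)
        show ?thesis
        proof (rule eq_matI)
          fix i l assume "i < dim_row (\<psi> x \<otimes>\<^bsub>?A\<^esub> r)" "l < dim_col (\<psi> x \<otimes>\<^bsub>?A\<^esub> r)"
          then have il: "i < n" "l < n" using rm by (auto simp: \<psi>_def)
          have "(\<psi> x * r) $$ (i, l) = (\<Sum>j<n. \<psi> x $$ (i, j) * r $$ (j, l))" by (rule mat_mult_index[OF \<psi>m rm il])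
          then show "\<psi> (x \<otimes>\<^bsub>?A\<^esub> r) $$ (i, l) = (\<psi> x \<otimes>\<^bsub>?A\<^esub> r) $$ (i, l)"
            using il qr[OF il(2)] by (simp add: \<psi>_def)
        qed (use rm in \<open>auto simp: \<psi>_def\<close>)
      qed
    qed
    moreover have "x \<ominus>\<^bsub>?A\<^esub> b \<otimes>\<^bsub>?A\<^esub> \<psi> x \<in> L (Suc k)" if x: "x \<in> L k" for x
    proof -
      have bp: "b * \<psi> x \<in> L k" by (rule LF(5)[OF b \<psi>[OF x]])
      have bpc: "b * \<psi> x \<in> tiled_order_carrier n d" using bp LF(1) by blast
      have "x + - (b * \<psi> x) \<in> L k" using LF(3)[OF x LF(4)[OF bp]] unfolding tiled_a_inv[OF ex bpc] .
      moreover have "(x + - (b * \<psi> x)) $$ (k, l) = 0" if l: "l < n" for l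
      proof -
        have "(b * \<psi> x) $$ (k, l) = (\<Sum>j<n. if j = m then f * q x l else 0)"
          unfolding mat_mult_index[OF Lm[OF b] \<psi>m k l] using l bk by (intro sum.cong refl) (auto simp: \<psi>_def)
        then show ?thesis using m q(2)[OF x l] Lm[OF x] Lm[OF b] \<psi>m[of x] k l by simp
      qed
      ultimately have "x + - (b * \<psi> x) \<in> L (Suc k)" by (auto simp: L_def less_Suc_eq)
      then show ?thesis by (simp add: A.minus_eq tiled_a_inv[OF ex bpc])
    qed
    moreover have "L (Suc k) \<subseteq> L k" by (auto simp: L_def)
    moreover have "b \<notin> L (Suc k)" using bk[OF m] f m by (auto simp: L_def)
    ultimately show ?thesis using A.dual_basis_extend[OF L[OF less_imp_le[OF k]] _ db b] by blast
  qed
  have "L n = {0\<^sub>m n n}"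
  proof
    show "L n \<subseteq> {0\<^sub>m n n}"
    proof
      fix x assume x: "x \<in> L n"
      then have "x = 0\<^sub>m n n" using xm[of x] by (intro eq_matI) (auto simp: L_def)
      then show "x \<in> {0\<^sub>m n n}" by simp
    qed
  qed (use JF(2) in \<open>auto simp: L_def\<close>)
  then have base: "dual_basis ?A (L n)" using A.dual_basis_zero by simp
  have "dual_basis ?A (L k)" if "k \<le> n" for k
    using that by (induction k rule: inc_induct) (auto intro: base step)
  from this[of 0] show ?thesis by (simp add: L_def)
qed

lemma right_hereditary_of_all_projective:
  assumes "exponent_matrix n d" "all_projective n d"
  shows "right_hereditary (tiled_order n d :: ('k :: field, 'k laurent mat) graded_algebra)"
  unfolding right_hereditary_def
  using ring.projective_of_dual_basis[OF ring_tiled_order[OF assms(1)]] dual_basis_of_all_projective[OF assms] by blast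

lemma opposite_simps [simp]:
  "carrier (opposite_ring A) = carrier A" "zero (opposite_ring A) = zero A" "one (opposite_ring A) = one A"
  "add (opposite_ring A) = add A" "monoid.mult (opposite_ring A) a b = monoid.mult A b a"
  by (simp_all add: opposite_ring_def)

lemma (in ring) ring_opposite: "ring (opposite_ring R)"
proof (rule ringI)
  show "abelian_group (opposite_ring R)"
    by (rule abelian_groupI) (auto simp: a_ac l_neg intro!: bexI[of _ "\<ominus> _"])
  show "Group.monoid (opposite_ring R)" by (rule monoidI) (auto simp: m_assoc)
qed (auto simp: l_distr r_distr)

lemma transpose_tiled:
  "transpose_mat a \<in> tiled_order_carrier n d \<longleftrightarrow> a \<in> tiled_order_carrier n (\<lambda>i j. d j i)"
  by (auto simp: tiled_carrier_iff)

lemma transpose_ring_iso: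
  "transpose_mat \<in> ring_iso (tiled_order n (\<lambda>i j. d j i) :: ('k :: field, 'k laurent mat) graded_algebra)
     (opposite_ring (tiled_order n d :: ('k, 'k laurent mat) graded_algebra))"
proof -
  have "bij_betw transpose_mat (tiled_order_carrier n (\<lambda>i j. d j i) :: 'k laurent mat set) (tiled_order_carrier n d)"
    by (rule bij_betw_byWitness[of _ transpose_mat]) (auto simp: transpose_tiled)
  moreover have "transpose_mat (x * y) = transpose_mat y * transpose_mat x"
    if "x \<in> tiled_order_carrier n (\<lambda>i j. d j i)" "y \<in> tiled_order_carrier n (\<lambda>i j. d j i)" for x y :: "'k laurent mat"
    by (rule transpose_mult[OF tiled_carrier_mat[OF that(1)] tiled_carrier_mat[OF that(2)]])
  moreover have "transpose_mat (x + y) = transpose_mat x + transpose_mat y"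
    if "x \<in> tiled_order_carrier n (\<lambda>i j. d j i)" "y \<in> tiled_order_carrier n (\<lambda>i j. d j i)" for x y :: "'k laurent mat"
    by (rule transpose_add[OF tiled_carrier_mat[OF that(1)] tiled_carrier_mat[OF that(2)]])
  ultimately show ?thesis
    by (auto simp: ring_iso_def Ring.ring_hom_def transpose_tiled)
qed

text \<open>
  Transposition identifies the opposite ring with the order of the transposed exponent matrix.
\<close>

lemma left_hereditary_of_all_projective:
  assumes ex: "exponent_matrix n d" and ap: "all_projective n (\<lambda>i j. d j i)"
  shows "right_hereditary (opposite_ring (tiled_order n d :: ('k :: field, 'k laurent mat) graded_algebra))"
  unfolding right_hereditary_def
proof (intro allI impI)
  let ?A = "tiled_order n d :: ('k, 'k laurent mat) graded_algebra"
  let ?T = "tiled_order n (\<lambda>i j. d j i) :: ('k, 'k laurent mat) graded_algebra"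
  note exT = exponent_matrix_transpose[OF ex]
  interpret A: ring ?A by (rule ring_tiled_order[OF ex])
  interpret T: ring ?T by (rule ring_tiled_order[OF exT])
  interpret O: ring "opposite_ring ?A" by (rule A.ring_opposite)
  fix J assume J: "right_ideal (opposite_ring ?A) J"
  note JF = O.right_ideal_facts[OF J, unfolded opposite_simps tiled_order_simps]
  have Jc: "x \<in> tiled_order_carrier n d" if "x \<in> J" for x using that JF(1) by blast
  have tc: "transpose_mat x \<in> tiled_order_carrier n (\<lambda>i j. d j i)" if "x \<in> J" for x
    using transpose_tiled[of "transpose_mat x" n d] Jc[OF that] by simp
  define J' where "J' = transpose_mat ` J"
  have J': "right_ideal ?T J'"
    unfolding right_ideal_def
  proof (intro conjI ballI)
    show "subgroup J' (add_monoid ?T)"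
    proof (rule T.add.subgroupI)
      show "J' \<subseteq> carrier ?T" using tc by (auto simp: J'_def)
      show "J' \<noteq> {}" using JF(2) by (auto simp: J'_def)
      fix x' assume "x' \<in> J'"
      then obtain x where x: "x \<in> J" "x' = transpose_mat x" by (auto simp: J'_def)
      have mx: "- x \<in> J"
      proof -
        have "- x = \<ominus>\<^bsub>opposite_ring ?A\<^esub> x"
          using O.minus_equality[of "- x" x] Jc[OF x(1)] tiled_uminus_closed[OF Jc[OF x(1)]]
            uminus_l_inv_mat[OF tiled_carrier_mat[OF Jc[OF x(1)]]] by simp
        then show ?thesis using JF(4)[OF x(1)] by simp
      qed
      have "\<ominus>\<^bsub>?T\<^esub> x' = transpose_mat (- x)"
        unfolding x(2) tiled_a_inv[OF exT tc[OF x(1)]] by (auto simp: transpose_mat_def)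
      then show "\<ominus>\<^bsub>?T\<^esub> x' \<in> J'" using mx by (auto simp: J'_def)
      show "x' \<oplus>\<^bsub>?T\<^esub> y' \<in> J'" if "y' \<in> J'" for y'
      proof -
        obtain y where y: "y \<in> J" "y' = transpose_mat y" using \<open>y' \<in> J'\<close> by (auto simp: J'_def)
        have "x' + y' = transpose_mat (x + y)"
          unfolding x(2) y(2) by (rule transpose_add[OF tiled_carrier_mat[OF Jc[OF x(1)]] tiled_carrier_mat[OF Jc[OF y(1)]], symmetric])
        then show ?thesis using JF(3)[OF x(1) y(1)] by (auto simp: J'_def)
      qed
    qed
    fix x' r assume "x' \<in> J'" and r: "r \<in> carrier ?T"
    then obtain x where x: "x \<in> J" "x' = transpose_mat x" by (auto simp: J'_def)
    have rc: "r \<in> tiled_order_carrier n (\<lambda>i j. d j i)" using r by simp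
    have rt: "transpose_mat r \<in> tiled_order_carrier n d" using rc transpose_tiled by blast
    have "x' * r = transpose_mat (transpose_mat r * x)"
      using transpose_mult[OF tiled_carrier_mat[OF rt] tiled_carrier_mat[OF Jc[OF x(1)]]] x(2) by simp
    then show "x' \<otimes>\<^bsub>?T\<^esub> r \<in> J'" using JF(5)[OF x(1) rt] by (auto simp: J'_def)
  qed
  have "dual_basis (opposite_ring ?A) (transpose_mat ` J')"
    by (rule dual_basis_transport[OF T.ring_axioms O.ring_axioms transpose_ring_iso J' dual_basis_of_all_projective[OF exT ap J']])
  moreover have "transpose_mat ` J' = J" by (simp add: J'_def image_image)
  ultimately show "projective_rmod (opposite_ring ?A) ((regular_rmod (opposite_ring ?A))\<lparr>carrier := J\<rparr>)"
    using O.projective_of_dual_basis[OF J] by simp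
qed

section \<open>Hereditary orders have only projective lattices\<close>

text \<open>
  A shift of \<open>L(a0)\<close> is a right ideal \<open>J\<close> concentrated in row \<open>0\<close>. A splitting of \<open>J\<close> from a free module,
  applied to one element and read at one entry, writes a monomial as a finite sum of products
  \<open>g(\<delta>\<^sub>i)\<^sub>l f(v)\<^sub>i\<^sub>,\<^sub>l\<close>. One product contains this monomial, and then \<open>L(a0) \<rightarrow> e\<^sub>l A \<rightarrow> L(a0)\<close> is nonzero
  in degree \<open>0\<close> up to a shift, which makes \<open>L(a0)\<close> projective.
\<close>

lemma all_projective_of_right_hereditary:
  assumes ex: "exponent_matrix n d"
    and her: "right_hereditary (tiled_order n d :: ('k :: field, 'k laurent mat) graded_algebra)"
  shows "all_projective n d"
  unfolding all_projective_def
proof (intro allI impI)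
  fix a0 assume lat0: "lattice_vec n d a0"
  let ?A = "tiled_order n d :: ('k, 'k laurent mat) graded_algebra"
  interpret A: ring ?A by (rule ring_tiled_order[OF ex])
  have n0: "0 < n" and d0: "\<And>i. i < n \<Longrightarrow> d i i = 0" using ex by (auto simp: exponent_matrix_def)
  define N where "N = Max ((\<lambda>l. d 0 l - a0 l) ` {..<n})"
  define a where "a l = a0 l + N" for l
  have aN: "d 0 l \<le> a l" if "l < n" for l
  proof -
    have "d 0 l - a0 l \<le> N" unfolding N_def using that by (intro Max_ge) auto
    then show ?thesis by (simp add: a_def)
  qed
  have lat: "lattice_vec n d a" using lat0 by (simp add: lattice_vec_def a_def)
  define J where "J = {x \<in> carrier_mat n n. \<forall>i<n. \<forall>l<n.
        (i \<in> {0} \<longrightarrow> x $$ (i, l) \<in> order_ge (a l)) \<and> (i \<notin> {0} \<longrightarrow> x $$ (i, l) = (0 :: 'k laurent))}"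
  interpret C: coord_module n d "mat_rmod n n J" "{0}" "\<lambda>i. a" "\<lambda>x i l. x $$ (i, l)"
    by (rule coord_module_mat[where r = n]) (use ex n0 lat in \<open>simp_all add: mat_rmod_def J_def\<close>)
  have Jm: "x \<in> carrier_mat n n" if "x \<in> J" for x using that by (simp add: J_def)
  have J0: "x $$ (0, l) \<in> order_ge (a l)" if "x \<in> J" "l < n" for x l using that n0 unfolding J_def by blast
  have JA: "J \<subseteq> tiled_order_carrier n d"
  proof
    fix x assume x: "x \<in> J"
    have "x $$ (i, l) \<in> order_ge (d i l)" if "i < n" "l < n" for i l
      using order_ge_mono[OF J0[OF x that(2)] aN[OF that(2)]] x that by (cases "i = 0") (auto simp: J_def)
    then show "x \<in> tiled_order_carrier n d" using Jm[OF x] by (simp add: tiled_carrier_iff)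
  qed
  have Jadd: "x + y \<in> J" if "x \<in> J" "y \<in> J" for x y using C.add_in[of x y] that by (simp add: mat_rmod_def)
  have Jmul: "x * r \<in> J" if "x \<in> J" "r \<in> tiled_order_carrier n d" for x r
    using C.ract_in[of x r] that by (simp add: mat_rmod_def)
  have J: "right_ideal ?A J"
    unfolding right_ideal_def
  proof (intro conjI ballI)
    show "subgroup J (add_monoid ?A)"
    proof (rule A.add.subgroupI)
      show "J \<subseteq> carrier ?A" using JA by simp
      show "J \<noteq> {}" using C.zero_in by (auto simp: mat_rmod_def)
      fix x assume x: "x \<in> J"
      have xA: "x \<in> tiled_order_carrier n d" using x JA by blast
      have "- x \<in> J"
        unfolding J_def
      proof (intro CollectI conjI allI impI)
        show "- x \<in> carrier_mat n n" using Jm[OF x] by simp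
        fix i l assume il: "i < n" "l < n"
        show "(- x) $$ (i, l) \<in> order_ge (a l)" if "i \<in> {0}"
          using order_ge_uminus[OF J0[OF x il(2)]] Jm[OF x] il that by simp
        show "(- x) $$ (i, l) = 0" if "i \<notin> {0}" using x Jm[OF x] il that by (simp add: J_def)
      qed
      then show "\<ominus>\<^bsub>?A\<^esub> x \<in> J" unfolding tiled_a_inv[OF ex xA] .
      show "x \<oplus>\<^bsub>?A\<^esub> y \<in> J" if "y \<in> J" for y using Jadd[OF x that] by simp
    qed
  qed (use Jmul in simp)
  let ?M = "(regular_rmod ?A)\<lparr>carrier := J\<rparr>"
  have M: "carrier ?M = J" "add ?M = (+)" "ract ?M = (*)" by (simp_all add: regular_rmod_def)
  have "projective_rmod ?A ?M" using her J unfolding right_hereditary_def by blast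
  then obtain I :: "'k laurent mat set" and f g where f: "f \<in> rmod_hom ?A ?M (free_rmod ?A I)"
    and g: "g \<in> rmod_hom ?A (free_rmod ?A I) ?M" and gf: "\<And>x. x \<in> J \<Longrightarrow> g (f x) = x"
    unfolding projective_rmod_def M by blast
  let ?F = "free_rmod ?A I"
  have F: "carrier ?F = {c \<in> I \<rightarrow>\<^sub>E tiled_order_carrier n d. finite {i \<in> I. c i \<noteq> 0\<^sub>m n n}}"
    "add ?F = (\<lambda>f g. \<lambda>i\<in>I. f i + g i)" "ract ?F = (\<lambda>f a. \<lambda>i\<in>I. f i * a)"
    by (simp_all add: free_rmod_def)
  have fF: "f x \<in> carrier ?F" if "x \<in> J" for x using f that by (auto simp: rmod_hom_def M)
  have fm: "f (x * r) = (\<lambda>i\<in>I. f x i * r)" if "x \<in> J" "r \<in> tiled_order_carrier n d" for x r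
    using f that by (auto simp: rmod_hom_def M F(3))
  have gJ: "g c \<in> J" if "c \<in> carrier ?F" for c using g that by (auto simp: rmod_hom_def M)
  have ga: "g (\<lambda>i\<in>I. c i + e i) = g c + g e" if "c \<in> carrier ?F" "e \<in> carrier ?F" for c e
    using g that by (auto simp: rmod_hom_def M F(2))
  have gm: "g (\<lambda>i\<in>I. c i * r) = g c * r" if "c \<in> carrier ?F" "r \<in> tiled_order_carrier n d" for c r
    using g that by (auto simp: rmod_hom_def M F(3))
  (* The standard basis of the free module, and restriction of an element to a finite set of coordinates. *)
  define dl where "dl i = (\<lambda>j\<in>I. if j = i then 1\<^sub>m n else (0\<^sub>m n n :: 'k laurent mat))" for i
  have zA: "0\<^sub>m n n \<in> (tiled_order_carrier n d :: 'k laurent mat set)" using A.zero_closed by simp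
  have dlF: "dl i \<in> carrier ?F" for i
  proof -
    have "{j \<in> I. dl i j \<noteq> 0\<^sub>m n n} \<subseteq> {i}" by (auto simp: dl_def)
    then have "finite {j \<in> I. dl i j \<noteq> 0\<^sub>m n n}" by (rule finite_subset) simp
    then show ?thesis using tiled_one_closed[OF ex] zA by (auto simp: F dl_def)
  qed
  define cut where "cut K c = (\<lambda>i\<in>I. if i \<in> K then c i else (0\<^sub>m n n :: 'k laurent mat))" for K c
  have cutF: "cut K c \<in> carrier ?F" if c: "c \<in> carrier ?F" for K c
  proof -
    have "{i \<in> I. cut K c i \<noteq> 0\<^sub>m n n} \<subseteq> {i \<in> I. c i \<noteq> 0\<^sub>m n n}" by (auto simp: cut_def)
    then have "finite {i \<in> I. cut K c i \<noteq> 0\<^sub>m n n}" using c finite_subset by (auto simp: F)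
    then show ?thesis using c zA by (auto simp: F cut_def)
  qed
  have gsum: "g (cut K c) $$ (0, m) = (\<Sum>i\<in>K. (g (dl i) * c i) $$ (0, m))"
    if c: "c \<in> carrier ?F" and K: "finite K" "K \<subseteq> I" and m: "m < n" for c K m
    using K
  proof (induction K rule: finite_induct)
    case empty
    have "cut {} c = (\<lambda>i\<in>I. cut {} c i + cut {} c i)" by (auto simp: cut_def)
    then have "g (cut {} c) = g (cut {} c) + g (cut {} c)" using ga[OF cutF[OF c] cutF[OF c], of "{}" "{}"] by simp
    then have "g (cut {} c) $$ (0, m) = (g (cut {} c) + g (cut {} c)) $$ (0, m)" by (rule arg_cong)
    also have "\<dots> = g (cut {} c) $$ (0, m) + g (cut {} c) $$ (0, m)" using Jm[OF gJ[OF cutF[OF c]], of "{}"] n0 m by simp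
    finally show ?case by (simp only: add_cancel_right_right sum.empty)
  next
    case (insert i K)
    have ci: "c i \<in> tiled_order_carrier n d" using insert c by (auto simp: F)
    have cm: "c j \<in> carrier_mat n n" if "j \<in> I" for j using c that by (auto simp: F intro!: tiled_carrier_mat)
    have e1: "(\<lambda>j\<in>I. dl i j * c i) \<in> carrier ?F"
    proof -
      have "{j \<in> I. (\<lambda>j\<in>I. dl i j * c i) j \<noteq> 0\<^sub>m n n} \<subseteq> {i}" using tiled_carrier_mat[OF ci] by (auto simp: dl_def)
      then have "finite {j \<in> I. (\<lambda>j\<in>I. dl i j * c i) j \<noteq> 0\<^sub>m n n}" by (rule finite_subset) simp
      moreover have "dl i j * c i \<in> tiled_order_carrier n d" if "j \<in> I" for j
        using dlF[of i] that ci by (intro tiled_mult_closed[OF ex]) (auto simp: F)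
      ultimately show ?thesis by (auto simp: F)
    qed
    have "cut (insert i K) c = (\<lambda>j\<in>I. cut K c j + (\<lambda>j\<in>I. dl i j * c i) j)"
    proof
      fix j show "cut (insert i K) c j = (\<lambda>j\<in>I. cut K c j + (\<lambda>j\<in>I. dl i j * c i) j) j"
        using cm[of j] cm[of i] insert by (cases "j \<in> I"; cases "j = i"; cases "j \<in> K") (auto simp: cut_def dl_def)
    qed
    then have "g (cut (insert i K) c) = g (cut K c) + g (dl i) * c i"
      using ga[OF cutF[OF c] e1, of K] gm[OF dlF ci, of i] by simp
    then have "g (cut (insert i K) c) $$ (0, m) = g (cut K c) $$ (0, m) + (g (dl i) * c i) $$ (0, m)"
      using n0 m Jm[OF gJ[OF dlF, of i]] tiled_carrier_mat[OF ci] by simp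
    then show ?case using insert by simp
  qed
  define v where "v m u = unit_mat n (lmonom u (1 :: 'k)) 0 m" for m u
  have v: "v m u \<in> J" if "a m \<le> u" "m < n" for m u using that n0 by (auto simp: v_def J_def)
  have vmul: "v m u * unit_mat n (lmonom p 1) m m' = v m' (u + p)" if "m < n" "m' < n" for m m' u p
  proof (rule eq_matI)
    fix i l assume "i < dim_row (v m' (u + p))" "l < dim_col (v m' (u + p))"
    then have il: "i < n" "l < n" by (auto simp: v_def unit_mat_def)
    show "(v m u * unit_mat n (lmonom p 1) m m') $$ (i, l) = v m' (u + p) $$ (i, l)"
      unfolding v_def mat_mult_index[OF unit_mat_carrier unit_mat_carrier il] sum_unit_mat[OF that(1) il(2)]
      using il that by (auto simp: mult_single)
  qed (auto simp: v_def unit_mat_def)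
  have fshift: "f (v m' (u + p)) i $$ (l, m') = f (v m u) i $$ (l, m) * lmonom p 1"
    if "m < n" "m' < n" "a m \<le> u" "d m m' \<le> p" "i \<in> I" "l < n" for m m' u p i l
  proof -
    have un: "unit_mat n (lmonom p 1) m m' \<in> tiled_order_carrier n d"
      by (rule unit_mat_in_tiled[of _ d m m']) (use that in simp)
    have fc: "f (v m u) i \<in> carrier_mat n n" using fF[OF v[OF that(3,1)]] that(5) by (auto simp: F intro!: tiled_carrier_mat)
    have "f (v m' (u + p)) i = f (v m u) i * unit_mat n (lmonom p 1) m m'"
      unfolding vmul[OF that(1,2), symmetric] fm[OF v[OF that(3,1)] un] using that(5) by simp
    then show ?thesis
      by (simp only: mat_mult_index[OF fc unit_mat_carrier that(6,2)] sum_unit_mat[OF that(1,2)] simp_thms if_True)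
  qed
  let ?w = "f (v 0 (a 0))"
  have w: "?w \<in> carrier ?F" by (rule fF[OF v[OF order_refl n0]])
  define K where "K = {i \<in> I. ?w i \<noteq> 0\<^sub>m n n}"
  have K: "finite K" "K \<subseteq> I" using w by (auto simp: F K_def)
  have "cut K ?w = ?w"
  proof
    fix j show "cut K ?w j = ?w j" using w by (cases "j \<in> I") (auto simp: cut_def K_def F)
  qed
  then have "lmonom (a 0) 1 = g (cut K ?w) $$ (0, 0)" using gf[OF v[OF order_refl n0]] n0 by (simp add: v_def)
  also have "\<dots> = (\<Sum>i\<in>K. \<Sum>l<n. g (dl i) $$ (0, l) * ?w i $$ (l, 0))"
    unfolding gsum[OF w K n0]
  proof (intro sum.cong refl)
    fix i assume "i \<in> K"
    then have "?w i \<in> carrier_mat n n" using w K(2) by (auto simp: F intro!: tiled_carrier_mat)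
    then show "(g (dl i) * ?w i) $$ (0, 0) = (\<Sum>l<n. g (dl i) $$ (0, l) * ?w i $$ (l, 0))"
      by (rule mat_mult_index[OF Jm[OF gJ[OF dlF]] _ n0 n0])
  qed
  finally have one: "lmonom (a 0) 1 = (\<Sum>i\<in>K. \<Sum>l<n. g (dl i) $$ (0, l) * ?w i $$ (l, 0))" .
  have "\<exists>i\<in>K. \<exists>l<n. lookup (g (dl i) $$ (0, l) * ?w i $$ (l, 0)) (a 0) \<noteq> 0"
  proof (rule ccontr)
    assume z: "\<not> ?thesis"
    have "lookup (lmonom (a 0) (1 :: 'k)) (a 0) = 0"
      unfolding one lookup_sum using z by (intro sum.neutral ballI) auto
    then show False by simp
  qed
  then obtain i l where il: "i \<in> I" "l < n" and ne: "lookup (g (dl i) $$ (0, l) * ?w i $$ (l, 0)) (a 0) \<noteq> 0" using K(2) by blast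
  then have "a 0 \<in> Poly_Mapping.keys (g (dl i) $$ (0, l) * ?w i $$ (l, 0))" by (simp add: in_keys_iff)
  then obtain e1 e2 where e: "e1 \<in> Poly_Mapping.keys (g (dl i) $$ (0, l))" "e2 \<in> Poly_Mapping.keys (?w i $$ (l, 0))" "a 0 = e1 + e2"
    using keys_mult by blast
  have e1: "a l \<le> e1" using J0[OF gJ[OF dlF] il(2), of i] e(1) by (auto simp: order_ge_def in_keys_iff)
  have "d l m + a l \<le> a m" if m: "m < n" for m
  proof -
    (* Both a 0 and a m are compared in column 0 in a common large degree. *)
    define P where "P = max 0 (a m + d m 0 - a 0)"
    have "f (v 0 (a 0 + P)) i $$ (l, 0) = ?w i $$ (l, 0) * lmonom P 1"
      by (rule fshift[OF n0 n0 order_refl _ il]) (simp add: P_def d0 n0)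
    moreover have "f (v 0 (a m + (a 0 + P - a m))) i $$ (l, 0) = f (v m (a m)) i $$ (l, m) * lmonom (a 0 + P - a m) 1"
      by (rule fshift[OF m n0 order_refl _ il]) (simp add: P_def)
    ultimately have "?w i $$ (l, 0) * lmonom P 1 = f (v m (a m)) i $$ (l, m) * lmonom (a 0 + P - a m) 1" by simp
    then have "lookup (lmonom P 1 * ?w i $$ (l, 0)) (e2 + P) = lookup (lmonom (a 0 + P - a m) 1 * f (v m (a m)) i $$ (l, m)) (e2 + P)"
      by (simp only: mult.commute)
    then have "lookup (f (v m (a m)) i $$ (l, m)) (e2 + a m - a 0) \<noteq> 0"
      using e(2) by (simp add: lookup_lmonom_mult in_keys_iff algebra_simps)
    moreover have "f (v m (a m)) i \<in> tiled_order_carrier n d"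
      using fF[OF v[OF order_refl m]] il(1) unfolding F by blast
    then have "f (v m (a m)) i $$ (l, m) \<in> order_ge (d l m)" using il(2) m by (simp add: tiled_carrier_iff)
    ultimately have "d l m \<le> e2 + a m - a 0" by (auto simp: order_ge_def)
    then show ?thesis using e(3) e1 by linarith
  qed
  then show "through_proj n d a0 a0"
    unfolding through_proj_def using il(2) by (intro exI[of _ l]) (simp add: a_def)
qed

section \<open>The classification\<close>

theorem theorem5p1:
  fixes n :: nat and d :: "nat \<Rightarrow> nat \<Rightarrow> int"
    and A :: "('k :: field, 'k laurent mat) graded_algebra"
    and \<Gamma> :: "('k, (((nat \<times> int) option \<Rightarrow> 'k laurent mat) \<Rightarrow>
                    ((nat \<times> int) option \<Rightarrow> 'k laurent mat)) set) module"
  assumes "exponent_matrix n d"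
    and A_eq: "A = tiled_order n d"
    and "basic_order n d" and "N_graded A" and "gorenstein_order n d"
    and \<Gamma>_eq: "\<Gamma> = Gamma n d"
  shows "((carrier \<Gamma> = {\<zero>\<^bsub>\<Gamma>\<^esub>} \<longleftrightarrow> hereditary A) \<and>
          (hereditary A \<longleftrightarrow> (\<exists>m\<ge>1. conjugate_orders n d m exp_hereditary))) \<and>
         (algebra_iso \<Gamma> (path_algebra (quiver_A 1) :: ('k, _) module) \<longleftrightarrow>
          (\<exists>m\<ge>2. even m \<and> conjugate_orders n d m exp_A1)) \<and>
         (algebra_iso \<Gamma> (path_algebra (quiver_A 2) :: ('k, _) module) \<longleftrightarrow>
          (\<exists>m\<ge>2. conjugate_orders n d m (exp_A2 m)))"
proof -
  note ex = \<open>exponent_matrix n d\<close>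
  obtain \<nu> where nu: "is_nakayama n d \<nu>" using \<open>gorenstein_order n d\<close> by (auto simp: gorenstein_order_def)
  have nonneg: "0 \<le> d i j" if ij: "i < n" "j < n" for i j
  proof (rule ccontr)
    assume neg: "\<not> 0 \<le> d i j"
    let ?u = "unit_mat n (lmonom (d i j) (1 :: 'k)) i j"
    have "?u \<in> tiled_order_carrier n d" by (rule unit_mat_in_tiled[of _ d i j]) simp
    moreover have "homogeneous_mat (d i j) ?u"
      by (auto simp: homogeneous_mat_def unit_mat_def intro: exI[of _ 0])
    ultimately have "?u \<in> acomp A (d i j)" by (simp add: A_eq)
    also have "acomp A (d i j) = {\<zero>\<^bsub>A\<^esub>}" using \<open>N_graded A\<close> neg unfolding N_graded_def by simp
    finally have "?u = 0\<^sub>m n n" by (simp add: A_eq)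
    then have "?u $$ (i, j) = 0" using ij by simp
    then have "lookup (lmonom (d i j) (1 :: 'k)) (d i j) = 0" using ij by simp
    then show False by simp
  qed
  interpret N_gorenstein_tiled n d \<nu> using ex \<open>basic_order n d\<close> nu nonneg by unfold_locales
  have n: "n \<ge> 1" by (rule n_pos)
  have m_eq: "m = n" if "conjugate_orders n d m e" for m e using that by (simp add: conjugate_orders_def)
  have 1: "\<exists>m\<ge>1. conjugate_orders n d m exp_hereditary" if "nak_sum = int n - 1"
    using nak_sum_hereditary[OF that] n by blast
  have 2: "hereditary A" if c: "\<exists>m\<ge>1. conjugate_orders n d m exp_hereditary"
  proof -
    have c: "conjugate_orders n d n exp_hereditary" using c m_eq by blast
    have ap: "all_projective n d" by (rule all_projective_hereditary[OF ex c])
    have ap': "all_projective n (\<lambda>i j. d j i)"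
      by (rule all_projective_hereditary[OF exponent_matrix_transpose[OF ex] conjugate_hereditary_transpose[OF c]])
    show ?thesis unfolding hereditary_def A_eq
      using right_hereditary_of_all_projective[OF ex ap] left_hereditary_of_all_projective[OF ex ap'] by blast
  qed
  have 3: "nak_sum = int n - 1" if "hereditary A"
  proof -
    have ap: "all_projective n d"
      using that all_projective_of_right_hereditary[OF ex] unfolding hereditary_def A_eq by blast
    then have "V_nonproj n d = {}"
      unfolding V_nonproj_def all_projective_def using lattice_V_exp by blast
    then show ?thesis using card_V_nonproj by simp
  qed
  have a: "carrier \<Gamma> = {\<zero>\<^bsub>\<Gamma>\<^esub>} \<longleftrightarrow> nak_sum = int n - 1" by (rule Gamma_by_nak_sum(1)[OF \<Gamma>_eq])
  have "algebra_iso \<Gamma> (path_A1 :: ('k, _) module) \<longleftrightarrow> (\<exists>m\<ge>2. even m \<and> conjugate_orders n d m exp_A1)"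
    unfolding Gamma_by_nak_sum(2)[OF \<Gamma>_eq]
  proof
    assume "nak_sum = int n"
    then show "\<exists>m\<ge>2. even m \<and> conjugate_orders n d m exp_A1" using nak_sum_A1 by blast
  next
    assume "\<exists>m\<ge>2. even m \<and> conjugate_orders n d m exp_A1"
    then have c: "even n" "conjugate_orders n d n exp_A1" using m_eq by blast+
    have "int n * nak_sum = int n * int n" using nak_sum_of_conj[OF c(2)] sum_exp_A1[OF c(1)] by linarith
    then show "nak_sum = int n" using n by simp
  qed
  moreover have "algebra_iso \<Gamma> (path_A2 :: ('k, _) module) \<longleftrightarrow> (\<exists>m\<ge>2. conjugate_orders n d m (exp_A2 m))"
    unfolding Gamma_by_nak_sum(3)[OF \<Gamma>_eq]
  proof
    assume "nak_sum = int n + 1"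
    then show "\<exists>m\<ge>2. conjugate_orders n d m (exp_A2 m)" using nak_sum_A2 by blast
  next
    assume "\<exists>m\<ge>2. conjugate_orders n d m (exp_A2 m)"
    then have c: "n \<ge> 2" "conjugate_orders n d n (exp_A2 n)" using m_eq by blast+
    have "int n * nak_sum = int n * (int n + 1)" using nak_sum_of_conj[OF c(2)] sum_exp_A2[OF c(1)] by linarith
    then show "nak_sum = int n + 1" using n by simp
  qed
  ultimately show ?thesis using 1 2 3 a by blast
qed

end
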